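(* Let $(g,X)$ be a radial Kähler–Ricci soliton with solitonic constant $\lambda$ on a complex manifold $M$ of complex dimension $n\ge 2$. If the metric $g$ is $c$-stable projectively induced for some $c>0$, then its Kähler potential $f(r)$ is defined at the origin; hence, $\mu\ne0$ and $\nu$ denoting the parameters of the soliton, $\nu=\dfrac{n!\,(\mu-\lambda)}{\mu^{n+1}}$.
   Context: Radial metrics. A Kähler metric $g$ on a connected complex manifold $M$ of complex dimension $n$, with complex coordinates $z_1,\dots,z_n$, is radial if its Kähler form is $\omega=\frac{i}{2}\partial\bar\partial f(r)$, $r=|z|^2=|z_1|^2+\cdots+|z_n|^2$, for a smooth function $f:(r_{\inf},r_{\sup})\to\mathbb{R}$, $0\le r_{\inf}<r_{\sup}\le\infty$, where $(r_{\inf},r_{\sup})$ is the maximal domain where $f$ is defined. Components are defined by $\omega_{i\bar j}=\partial_{z_i}\partial_{\bar z_j}f$. The potential is defined at the origin if $r_{\inf}=0$ and $f$ extends smoothly to $[0,r_{\sup})$, defining the metric there. Put $y(r)=rf'(r)$ and $\psi(r)=r\,y'(r)$. Since $g$ is a metric, $y>0$ and $\psi>0$ on $(r_{\inf},r_{\sup})$, so $r\mapsto y(r)$ can be inverted and $\psi$ regarded as a function $\psi(y)$ of $y$. Solitons. A Kähler–Ricci soliton (KRS) is a pair $(g,X)$ of a Kähler metric $g$ and a (real) holomorphic vector field $X$ such that $\rho=\lambda\omega+L_X\omega$ for some $\lambda\in\mathbb{R}$ (the solitonic constant), where $\rho$ is the Ricci form, with the convention $\rho_{i\bar j}=-\partial_{z_i}\partial_{\bar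 z_j}\log\det(\omega_{k\bar l})$. It is radial if $g$ is radial. Parameters. For a radial KRS with solitonic constant $\lambda$ and $n\ge2$ there is $\mu\in\mathbb{R}$ with $\frac{d\psi}{dy}=\left(\mu-\frac{n-1}{y}\right)\psi(y)+n-\lambda y$; if $\mu=0$ then $g$ is Kähler–Einstein, and if $\mu\ne0$ then for some $\nu\in\mathbb{R}$ $$\psi(y)=\frac{\nu e^{\mu y}}{y^{n-1}}+\frac{\lambda}{\mu}y+\frac{\lambda-\mu}{\mu^{n+1}}\sum_{j=0}^{n-1}\frac{n!}{j!}\mu^j y^{j+1-n}.$$ In the latter case $\mu,\nu$ are the parameters of the soliton. $c$-stability. For $c>0$ let $g^\infty_c$ be the metric on $\mathbb{C}\mathrm{P}^\infty$ with Kähler form $\omega_c=\frac{i}{2c}\partial\bar\partial\log\sum_{j\ge0}|Z_j|^2$ in homogeneous coordinates. A metric $h$ on $M$ is induced by $(\mathbb{C}\mathrm{P}^\infty,g^\infty_c)$ if there is a holomorphic map $\varphi:M\to\mathbb{C}\mathrm{P}^\infty$ with $\varphi^*g^\infty_c=h$. A Kähler metric $g$ is $c$-stable projectively induced if there is $\epsilon>0$ such that $\alpha g$ is induced by $(\mathbb{C}\mathrm{P}^\infty,g^\infty_c)$ for all $\alpha\in(1-\epsilon,1+\epsilon)$. *)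

theory Defs
  imports "HOL-Analysis.Analysis"
begin

section \<open>Calculus on open subsets of complex n-space\<close>

text \<open>
  The type \<^typ>\<open>complex^'n\<close> is complex Euclidean space of dimension \<open>n = CARD('n)\<close>, regarded by
  the library as a real Euclidean space; \<^const>\<open>frechet_derivative\<close> is the real derivative.
  Complex multiples of vectors are written \<open>c *s v\<close>.
\<close>

primrec C_k_on :: "nat \<Rightarrow> 'a::real_normed_vector set \<Rightarrow> ('a \<Rightarrow> 'b::real_normed_vector) \<Rightarrow> bool" where
  "C_k_on 0 S u \<longleftrightarrow> continuous_on S u"
| "C_k_on (Suc k) S u \<longleftrightarrow>
     u differentiable_on S \<and> (\<forall>h. C_k_on k S (\<lambda>x. frechet_derivative u (at x) h))"

text \<open>Only meant for open \<open>S\<close>.\<close>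

definition smooth_on :: "'a::real_normed_vector set \<Rightarrow> ('a \<Rightarrow> 'b::real_normed_vector) \<Rightarrow> bool" where
  "smooth_on S u \<longleftrightarrow> (\<forall>k. C_k_on k S u)"

definition holomorphic_map_on :: "(complex^'n) set \<Rightarrow> (complex^'n \<Rightarrow> complex^'m) \<Rightarrow> bool" where
  "holomorphic_map_on S F \<longleftrightarrow>
     (\<forall>x\<in>S. \<exists>D. (F has_derivative D) (at x) \<and> (\<forall>a v. D (a *s v) = a *s D v))"

text \<open>The Wirtinger operators, from \<open>\<partial>/\<partial>x\<^sub>i\<close> (direction \<open>axis i 1\<close>) and \<open>\<partial>/\<partial>y\<^sub>i\<close>
  (direction \<open>axis i \<i>\<close>).\<close>

definition d_z :: "'n \<Rightarrow> (complex^'n \<Rightarrow> complex) \<Rightarrow> complex^'n \<Rightarrow> complex" where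
  "d_z i u x =
     (frechet_derivative u (at x) (axis i 1) - \<i> * frechet_derivative u (at x) (axis i \<i>)) / 2"

definition d_zbar :: "'n \<Rightarrow> (complex^'n \<Rightarrow> complex) \<Rightarrow> complex^'n \<Rightarrow> complex" where
  "d_zbar i u x =
     (frechet_derivative u (at x) (axis i 1) + \<i> * frechet_derivative u (at x) (axis i \<i>)) / 2"

definition complex_hessian :: "(complex^'n \<Rightarrow> real) \<Rightarrow> complex^'n \<Rightarrow> complex^'n^'n" where
  "complex_hessian u x = (\<chi> i j. d_z i (d_zbar j (\<lambda>y. complex_of_real (u y))) x)"


section \<open>Kaehler metrics and solitons in coordinates\<close>

text \<open>
  A real (1,1)-form \<open>\<i>/2 \<Sum> G\<^sub>i\<^sub>j dz\<^sub>i \<and> d(cnj z\<^sub>j)\<close> on a coordinate domain \<open>S\<close> is given by its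
  component matrix, \<open>G x $ i $ j\<close> being the component with indices \<open>i\<close> and \<open>j-bar\<close>. A Kaehler
  metric is identified with its Kaehler form. By the Hermitian symmetry, the last clause says
  that the form is closed.
\<close>

definition kaehler_on :: "(complex^'n) set \<Rightarrow> (complex^'n \<Rightarrow> complex^'n^'n) \<Rightarrow> bool" where
  "kaehler_on S G \<longleftrightarrow>
     (\<forall>i j. smooth_on S (\<lambda>x. G x $ i $ j)) \<and>
     (\<forall>x\<in>S. \<forall>i j. G x $ j $ i = cnj (G x $ i $ j)) \<and>
     (\<forall>x\<in>S. \<forall>v. v \<noteq> 0 \<longrightarrow> 0 < Re (\<Sum>i\<in>UNIV. \<Sum>j\<in>UNIV. G x $ i $ j * v $ i * cnj (v $ j))) \<and>
     (\<forall>x\<in>S. \<forall>i j k. d_z k (\<lambda>y. G y $ i $ j) x = d_z i (\<lambda>y. G y $ k $ j) x)"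

text \<open>For a Kaehler metric the determinant is a positive real number, so \<^const>\<open>Re\<close> only changes
  its type.\<close>

definition ricci_form :: "(complex^'n \<Rightarrow> complex^'n^'n) \<Rightarrow> complex^'n \<Rightarrow> complex^'n^'n" where
  "ricci_form G x = - complex_hessian (\<lambda>y. ln (Re (det (G y)))) x"

text \<open>
  A real vector field is a map \<open>V\<close> into \<^typ>\<open>complex^'n\<close>, the real tangent space; it stands for
  \<open>\<Sum> V\<^sub>m \<partial>/\<partial>z\<^sub>m + cnj V\<^sub>m \<partial>/\<partial>(cnj z\<^sub>m)\<close> and is a real holomorphic field iff \<open>V\<close> is a holomorphic map.
  The flow of such a field is holomorphic, so the Lie derivative of a (1,1)-form is again of type
  (1,1). Its components follow from \<open>L\<^sub>V dz\<^sub>m = dV\<^sub>m = \<Sum> (\<partial>V\<^sub>m/\<partial>z\<^sub>i) dz\<^sub>i\<close> and the Leibniz rule.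
\<close>

definition lie_derivative ::
    "(complex^'n \<Rightarrow> complex^'n) \<Rightarrow> (complex^'n \<Rightarrow> complex^'n^'n) \<Rightarrow> complex^'n \<Rightarrow> complex^'n^'n" where
  "lie_derivative V G x = (\<chi> i j.
      frechet_derivative (\<lambda>y. G y $ i $ j) (at x) (V x)
      + (\<Sum>m\<in>UNIV. G x $ m $ j * d_z i (\<lambda>y. V y $ m) x)
      + (\<Sum>m\<in>UNIV. G x $ i $ m * cnj (d_z j (\<lambda>y. V y $ m) x)))"

definition krs_on ::
    "(complex^'n) set \<Rightarrow> (complex^'n \<Rightarrow> complex^'n^'n) \<Rightarrow> (complex^'n \<Rightarrow> complex^'n) \<Rightarrow> real \<Rightarrow> bool" where
  "krs_on S G V lam \<longleftrightarrow>
     kaehler_on S G \<and> holomorphic_map_on S V \<and>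
     (\<forall>x\<in>S. ricci_form G x = lam *\<^sub>R G x + lie_derivative V G x)"


section \<open>Complex manifolds\<close>

text \<open>The underlying space of the manifold is a type. A chart is a domain together with a
  coordinate map, whose values outside the domain are irrelevant.\<close>

type_synonym ('m, 'n) chart = "'m set \<times> ('m \<Rightarrow> complex^'n)"

definition is_chart :: "('m::topological_space, 'n::finite) chart \<Rightarrow> bool" where
  "is_chart C \<longleftrightarrow> (case C of (U, z) \<Rightarrow>
     open U \<and> open (z ` U) \<and> homeomorphism U (z ` U) z (inv_into U z))"

definition transition :: "('m, 'n::finite) chart \<Rightarrow> ('m, 'n) chart \<Rightarrow> complex^'n \<Rightarrow> complex^'n" where
  "transition C D = snd D \<circ> inv_into (fst C) (snd C)"

definition overlap :: "('m, 'n::finite) chart \<Rightarrow> ('m, 'n) chart \<Rightarrow> (complex^'n) set" where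
  "overlap C D = snd C ` (fst C \<inter> fst D)"

definition compatible :: "('m, 'n::finite) chart \<Rightarrow> ('m, 'n) chart \<Rightarrow> bool" where
  "compatible C D \<longleftrightarrow>
     holomorphic_map_on (overlap C D) (transition C D) \<and>
     holomorphic_map_on (overlap D C) (transition D C)"

text \<open>\<open>A\<close> is the maximal holomorphic atlas of a complex manifold.\<close>

definition complex_manifold ::
    "('m::{t2_space,second_countable_topology}, 'n::finite) chart set \<Rightarrow> bool" where
  "complex_manifold A \<longleftrightarrow>
     (\<forall>C\<in>A. is_chart C) \<and> (\<Union>C\<in>A. fst C) = UNIV \<and>
     (\<forall>C\<in>A. \<forall>D\<in>A. compatible C D) \<and>
     (\<forall>C. is_chart C \<and> (\<forall>D\<in>A. compatible C D) \<longrightarrow> C \<in> A)"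

text \<open>Tensor fields on the manifold are families of components, one for each chart of the
  maximal atlas, obeying the respective transformation law.\<close>

type_synonym ('m, 'n) form11 = "('m, 'n) chart \<Rightarrow> complex^'n \<Rightarrow> complex^'n^'n"
type_synonym ('m, 'n) vector_field = "('m, 'n) chart \<Rightarrow> complex^'n \<Rightarrow> complex^'n"

definition is_form11 :: "('m, 'n::finite) chart set \<Rightarrow> ('m, 'n) form11 \<Rightarrow> bool" where
  "is_form11 A g \<longleftrightarrow> (\<forall>C\<in>A. \<forall>D\<in>A. \<forall>x\<in>overlap C D. \<forall>i j.
     g C x $ i $ j =
       (\<Sum>k\<in>UNIV. \<Sum>l\<in>UNIV.
          d_z i (\<lambda>y. transition C D y $ k) x * cnj (d_z j (\<lambda>y. transition C D y $ l) x) *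
          g D (transition C D x) $ k $ l))"

definition is_vector_field :: "('m, 'n::finite) chart set \<Rightarrow> ('m, 'n) vector_field \<Rightarrow> bool" where
  "is_vector_field A X \<longleftrightarrow> (\<forall>C\<in>A. \<forall>D\<in>A. \<forall>x\<in>overlap C D.
     X D (transition C D x) = frechet_derivative (transition C D) (at x) (X C x))"

definition kaehler_ricci_soliton ::
    "('m, 'n::finite) chart set \<Rightarrow> ('m, 'n) form11 \<Rightarrow> ('m, 'n) vector_field \<Rightarrow> real \<Rightarrow> bool" where
  "kaehler_ricci_soliton A g X lam \<longleftrightarrow>
     is_form11 A g \<and> is_vector_field A X \<and>
     (\<forall>C\<in>A. krs_on (snd C ` fst C) (g C) (X C) lam)"


section \<open>Radial solitons\<close>

definition radial_form :: "(real \<Rightarrow> real) \<Rightarrow> complex^'n \<Rightarrow> complex^'n^'n" where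
  "radial_form f = complex_hessian (\<lambda>x. f ((norm x)\<^sup>2))"

definition shell :: "ereal \<Rightarrow> ereal \<Rightarrow> (complex^'n) set" where
  "shell a b = {x. (norm x)\<^sup>2 \<in> einterval a b}"

definition krs_potential ::
    "'n::finite itself \<Rightarrow> real \<Rightarrow> (real \<Rightarrow> real) \<Rightarrow> ereal \<Rightarrow> ereal \<Rightarrow> bool" where
  "krs_potential TYPE('n) lam f a b \<longleftrightarrow>
     0 \<le> a \<and> a < b \<and> smooth_on (einterval a b) f \<and>
     (\<exists>V :: complex^'n \<Rightarrow> complex^'n. krs_on (shell a b) (radial_form f) V lam)"

text \<open>
  \<open>(a, b)\<close> is the maximal domain where \<open>f\<close> is defined, as a radial soliton potential. Solitons are
  real analytic and \<open>f\<close> is determined by its restriction to any subinterval, so the maximal domain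
  depends on the metric only; it can exceed the range of \<open>|z|\<^sup>2\<close> on a given manifold (a flat
  metric on \<open>{1 < |z|\<^sup>2 < 2}\<close> has \<open>f r = r\<close>, with maximal domain \<open>(0, \<infinity>)\<close>).
\<close>

definition maximal_krs_potential ::
    "'n::finite itself \<Rightarrow> real \<Rightarrow> (real \<Rightarrow> real) \<Rightarrow> ereal \<Rightarrow> ereal \<Rightarrow> bool" where
  "maximal_krs_potential TYPE('n) lam f a b \<longleftrightarrow>
     krs_potential TYPE('n) lam f a b \<and>
     (\<forall>F a' b'. a' \<le> a \<and> b \<le> b' \<and> krs_potential TYPE('n) lam F a' b' \<and>
                (\<forall>r\<in>einterval a b. F r = f r) \<longrightarrow> a' = a \<and> b' = b)"

text \<open>As on projective space, the coordinates in which the metric is radial need not cover the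
  manifold. They may be taken to avoid the origin, where \<open>f\<close> need not be defined.\<close>

definition radial_krs ::
    "('m, 'n::finite) chart set \<Rightarrow> ('m, 'n) form11 \<Rightarrow> ('m, 'n) vector_field \<Rightarrow> real \<Rightarrow>
     (real \<Rightarrow> real) \<Rightarrow> ereal \<Rightarrow> ereal \<Rightarrow> bool" where
  "radial_krs A g X lam f rinf rsup \<longleftrightarrow>
     kaehler_ricci_soliton A g X lam \<and>
     maximal_krs_potential TYPE('n) lam f rinf rsup \<and>
     (\<exists>(U, z)\<in>A. U \<noteq> {} \<and> z ` U \<subseteq> shell rinf rsup \<and> (\<forall>x\<in>z ` U. g (U, z) x = radial_form f x))"

text \<open>Smoothness on \<open>[0, rsup)\<close> means the existence of a smooth extension past \<open>0\<close>.\<close>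

definition defined_at_origin ::
    "'n::finite itself \<Rightarrow> (real \<Rightarrow> real) \<Rightarrow> ereal \<Rightarrow> ereal \<Rightarrow> bool" where
  "defined_at_origin TYPE('n) f rinf rsup \<longleftrightarrow>
     rinf = 0 \<and>
     (\<exists>F \<delta>. 0 < \<delta> \<and> smooth_on (einterval (ereal (-\<delta>)) rsup) F \<and>
        (\<forall>r\<in>einterval rinf rsup. F r = f r) \<and>
        kaehler_on {x :: complex^'n. ereal ((norm x)\<^sup>2) < rsup} (radial_form F))"

definition y_of :: "(real \<Rightarrow> real) \<Rightarrow> real \<Rightarrow> real" where
  "y_of f r = r * deriv f r"

definition psi_of :: "(real \<Rightarrow> real) \<Rightarrow> real \<Rightarrow> real" where
  "psi_of f r = r * deriv (y_of f) r"

text \<open>\<open>\<psi>\<close> as a function of \<open>y\<close>; \<open>y\<close> is strictly increasing on \<open>I\<close> since \<open>\<psi> > 0\<close>.\<close>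

definition psi_of_y :: "(real \<Rightarrow> real) \<Rightarrow> real set \<Rightarrow> real \<Rightarrow> real" where
  "psi_of_y f I t = psi_of f (the_inv_into I (y_of f) t)"

text \<open>The sum has negative integer powers of \<open>y\<close>, hence \<open>powi\<close>.\<close>

definition soliton_parameters ::
    "nat \<Rightarrow> real \<Rightarrow> (real \<Rightarrow> real) \<Rightarrow> real set \<Rightarrow> real \<Rightarrow> real \<Rightarrow> bool" where
  "soliton_parameters n lam f I \<mu> \<nu> \<longleftrightarrow>
     \<mu> \<noteq> 0 \<and>
     (\<forall>t\<in>y_of f ` I.
        (psi_of_y f I has_real_derivative
           (\<mu> - (real n - 1) / t) * psi_of_y f I t + real n - lam * t) (at t)) \<and>
     (\<forall>t\<in>y_of f ` I.
        psi_of_y f I t =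
          \<nu> * exp (\<mu> * t) / t ^ (n - 1) + lam / \<mu> * t
          + (lam - \<mu>) / \<mu> ^ (n + 1) *
              (\<Sum>j<n. fact n / fact j * \<mu> ^ j * t powi (int j + 1 - int n)))"


section \<open>Infinite dimensional complex projective space\<close>

definition ell2 :: "(nat \<Rightarrow> complex) set" where
  "ell2 = {Z. summable (\<lambda>j. (cmod (Z j))\<^sup>2)}"

definition ell2_norm :: "(nat \<Rightarrow> complex) \<Rightarrow> real" where
  "ell2_norm Z = sqrt (\<Sum>j. (cmod (Z j))\<^sup>2)"

text \<open>The point with homogeneous coordinates \<open>Z\<close>, as a punctured complex line.\<close>

definition proj_point :: "(nat \<Rightarrow> complex) \<Rightarrow> (nat \<Rightarrow> complex) set" where
  "proj_point Z = {(\<lambda>j. c * Z j) | c. c \<noteq> 0}"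

definition CP_infinity :: "(nat \<Rightarrow> complex) set set" where
  "CP_infinity = proj_point ` (ell2 - {\<lambda>j. 0})"

text \<open>Complex differentiability (in the sense of Frechet, for the norm of \<open>\<ell>\<^sup>2\<close>) at each point
  of an open set.\<close>

definition ell2_holomorphic_on :: "(complex^'n) set \<Rightarrow> (complex^'n \<Rightarrow> nat \<Rightarrow> complex) \<Rightarrow> bool" where
  "ell2_holomorphic_on S s \<longleftrightarrow>
     (\<forall>x\<in>S. s x \<in> ell2) \<and>
     (\<forall>x\<in>S. \<exists>D. (\<forall>v. D v \<in> ell2) \<and>
        (\<forall>v w. D (v + w) = (\<lambda>j. D v j + D w j)) \<and>
        (\<forall>a v. D (a *s v) = (\<lambda>j. a * D v j)) \<and>
        ((\<lambda>h. ell2_norm (\<lambda>j. s (x + h) j - s x j - D h j) / norm h) \<longlongrightarrow> 0) (at 0))"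

text \<open>\<open>s\<close> expresses the map in homogeneous coordinates on the domain of the chart.\<close>

definition homogeneous_lift ::
    "('m \<Rightarrow> (nat \<Rightarrow> complex) set) \<Rightarrow> ('m, 'n::finite) chart \<Rightarrow> (complex^'n \<Rightarrow> nat \<Rightarrow> complex) \<Rightarrow> bool" where
  "homogeneous_lift \<phi> C s \<longleftrightarrow>
     ell2_holomorphic_on (snd C ` fst C) s \<and>
     (\<forall>x\<in>snd C ` fst C. s x \<noteq> (\<lambda>j. 0)) \<and>
     (\<forall>p\<in>fst C. \<phi> p = proj_point (s (snd C p)))"

definition holomorphic_to_CP_infinity ::
    "('m, 'n::finite) chart set \<Rightarrow> ('m \<Rightarrow> (nat \<Rightarrow> complex) set) \<Rightarrow> bool" where
  "holomorphic_to_CP_infinity A \<phi> \<longleftrightarrow>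
     range \<phi> \<subseteq> CP_infinity \<and> (\<forall>p. \<exists>C\<in>A. \<exists>s. p \<in> fst C \<and> homogeneous_lift \<phi> C s)"

text \<open>
  The pullback of the Kaehler form \<open>\<i>/(2 c) \<partial> \<partial>-bar log (\<Sum> |Z\<^sub>j|\<^sup>2)\<close> by a holomorphic map is obtained
  by substituting the map, written in homogeneous coordinates, in the potential; the choice of
  the homogeneous coordinates is immaterial.
\<close>

definition fubini_study_pullback ::
    "real \<Rightarrow> (complex^'n \<Rightarrow> nat \<Rightarrow> complex) \<Rightarrow> complex^'n \<Rightarrow> complex^'n^'n" where
  "fubini_study_pullback c s = complex_hessian (\<lambda>x. 1 / c * ln (\<Sum>j. (cmod (s x j))\<^sup>2))"

definition induced_by_CP_infinity ::
    "('m, 'n::finite) chart set \<Rightarrow> real \<Rightarrow> ('m, 'n) form11 \<Rightarrow> bool" where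
  "induced_by_CP_infinity A c h \<longleftrightarrow>
     (\<exists>\<phi>. holomorphic_to_CP_infinity A \<phi> \<and>
        (\<forall>C\<in>A. \<forall>s. homogeneous_lift \<phi> C s \<longrightarrow>
           (\<forall>x\<in>snd C ` fst C. h C x = fubini_study_pullback c s x)))"

definition c_stable_projectively_induced ::
    "('m, 'n::finite) chart set \<Rightarrow> real \<Rightarrow> ('m, 'n) form11 \<Rightarrow> bool" where
  "c_stable_projectively_induced A c g \<longleftrightarrow>
     (\<exists>\<epsilon>>0. \<forall>\<alpha>\<in>{1 - \<epsilon><..<1 + \<epsilon>}. induced_by_CP_infinity A c (\<lambda>C x. \<alpha> *\<^sub>R g C x))"

end

theory Submission
  imports Defs "HOL-Complex_Analysis.Complex_Analysis"
begin

text \<open>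
  Let \<open>\<alpha> g\<close> be induced by the map with homogeneous coordinates \<open>s\<close>, and put \<open>F = exp (c \<alpha> f)\<close>. Then
  \<open>log F(|x|\<^sup>2) - log |s|\<^sup>2\<close> is pluriharmonic, so its exponential is a weight with a flat Chern
  connection, and weighted norms of iterated covariant derivatives of \<open>s\<close> depend on \<open>F\<close> only. Those
  in the radial direction and in a direction orthogonal to it show that \<open>p \<mapsto> p(r d/dr) F\<close> is
  non-negative on the polynomials \<open>R\<^sup>2 X (X - 1) \<dots> (X - m + 1)\<close>. This property propagates to smaller
  \<open>r\<close>, where it makes \<open>F\<close> absolutely monotone; by Bernstein's theorem \<open>F\<close> is a power series
  with non-negative coefficients.

  Let \<open>k\<close> be the leading exponent of that series for \<open>\<alpha> = 1\<close>. For \<open>\<alpha> = 1 + \<eta>\<close> it is \<open>(1 + \<eta>) k\<close>,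
  which by stability is an integer for all small \<open>\<eta>\<close>, so \<open>k = 0\<close> and \<open>log F / c\<close> is an analytic
  function near \<open>0\<close>. The soliton equation reduces to an ordinary differential equation for \<open>f\<close>: after
  averaging over circles, \<open>X\<close> acts as a multiple of the Euler field. By the identity theorem
  \<open>log F / c\<close> solves it up to the origin, hence continues \<open>f\<close> there, and maximality of the domain
  gives \<open>rinf = 0\<close>. The value of \<open>\<nu>\<close> follows by letting \<open>y\<close> tend to \<open>0\<close> in the formula for \<open>\<psi>\<close>.
\<close>

text \<open>The metric is known only on a shell, so there is no origin at which Calabi's criterion
  could be applied. Non-negative derivatives of F in r at one radius are not enough either: they do
  not pass to smaller r, where the Taylor series alternates. In the variable log r, however, a shift
  by y is exp (y D) with D = r d/dr, a limit of even powers of 1 + y D / M, hence of squares, and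
  these can be absorbed into R. This is why the inequality is carried for all squares, and why two
  directions occur: radial derivatives supply R^2, the orthogonal ones supply X (X - 1) ... (X - m +
  1), that is, r^m times the m-th derivative, which is what Bernstein's theorem wants. Covariant
  derivatives replace a local choice of s with |s|^2 = F, which would require a primitive of the
  flat connection; the connection form is holomorphic, so they stay among the square summable
  holomorphic families. A leading exponent k > 0 would mean a term k log r in c f. A single inducing
  map allows it, since k is then just some natural number; rescaling by real factors near 1 does
  not.\<close>

section \<open>Smooth functions on open sets\<close>

lemma C_k_on_cong:
  assumes "open S" "\<And>x. x \<in> S \<Longrightarrow> u x = w x"
  shows "C_k_on k S u \<longleftrightarrow> C_k_on k S w"
  using assms(2)
proof (induction k arbitrary: u w)
  case 0
  then show ?case by (simp cong: continuous_on_cong)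
next
  case (Suc k)
  have *: "(u has_derivative D) (at x) \<longleftrightarrow> (w has_derivative D) (at x)" if "x \<in> S" for x D
    using Suc.prems that assms(1) has_derivative_transform_within_open[of u D x UNIV S w]
      has_derivative_transform_within_open[of w D x UNIV S u] by auto
  have "u differentiable_on S \<longleftrightarrow> w differentiable_on S"
    using * by (simp add: differentiable_on_eq_differentiable_at[OF assms(1)] differentiable_def)
  moreover have "frechet_derivative u (at x) h = frechet_derivative w (at x) h" if "x \<in> S" for x h
    using * that by (simp add: frechet_derivative_def)
  ultimately show ?case using Suc.IH by (metis (no_types, lifting) C_k_on.simps(2))
qed

lemma smooth_on_cong:
  assumes "open S" "\<And>x. x \<in> S \<Longrightarrow> u x = w x"
  shows "smooth_on S u \<longleftrightarrow> smooth_on S w"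
  using C_k_on_cong[OF assms] by (simp add: smooth_on_def)

lemma C_k_on_Union:
  assumes "\<And>T. T \<in> \<T> \<Longrightarrow> open T \<and> C_k_on k T u"
  shows "C_k_on k (\<Union>\<T>) u"
  using assms
proof (induction k arbitrary: u)
  case 0
  then show ?case by (auto intro!: continuous_on_open_Union)
next
  case (Suc k)
  have "u differentiable at x" if "x \<in> \<Union>\<T>" for x
    using Suc.prems that differentiable_on_eq_differentiable_at by (metis C_k_on.simps(2) Union_iff)
  then have "u differentiable_on \<Union>\<T>" by (rule differentiable_at_imp_differentiable_on)
  then show ?case using Suc by simp
qed

lemma smooth_on_Un:
  assumes "open S" "open T" "smooth_on S u" "smooth_on T u"
  shows "smooth_on (S \<union> T) u"
  using assms C_k_on_Union[of "{S, T}" _ u] by (auto simp: smooth_on_def)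

lemma smooth_on_subset:
  assumes "smooth_on S u" "open S" "open T" "T \<subseteq> S"
  shows "smooth_on T u"
proof -
  have "C_k_on k S u \<Longrightarrow> C_k_on k T u" for k
    using assms(4)
    by (induction k arbitrary: u) (auto intro: continuous_on_subset differentiable_on_subset)
  then show ?thesis using assms(1) by (simp add: smooth_on_def)
qed

text \<open>Induction on the order: directional derivatives of a member of \<open>K\<close> agree on
  \<open>S\<close> with members of \<open>K\<close>. Smoothness of explicit functions is thereby
  reduced to a syntactic closure property, which the classes \<open>radial_class\<close>,
  \<open>exp_class\<close> and \<open>ln_class\<close> are built to have.\<close>

lemma smooth_on_closed_class:
  assumes S: "open S" and uK: "u \<in> K"
    and K: "\<And>u. u \<in> K \<Longrightarrow> \<exists>D. (\<forall>x\<in>S. (u has_derivative D x) (at x)) \<and> (\<forall>h. \<exists>w\<in>K. \<forall>x\<in>S. D x h = w x)"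
  shows "smooth_on S u"
proof -
  have "C_k_on k S u" if "u \<in> K" for k u
    using that
  proof (induction k arbitrary: u)
    case 0
    then obtain D where D: "\<forall>x\<in>S. (u has_derivative D x) (at x)" using K by meson
    have "continuous_on S u"
    proof (rule continuous_at_imp_continuous_on, rule ballI)
      fix x assume "x \<in> S"
      then have "(u has_derivative D x) (at x)" using D by blast
      then show "isCont u x" by (rule has_derivative_continuous)
    qed
    then show ?case by simp
  next
    case (Suc k)
    from K[OF this(2)] obtain D where D: "\<forall>x\<in>S. (u has_derivative D x) (at x)" "\<forall>h. \<exists>w\<in>K. \<forall>x\<in>S. D x h = w x"
      by (elim exE conjE)
    have "u differentiable_on S"
    proof (rule differentiable_at_imp_differentiable_on)
      fix x assume "x \<in> S"
      then have "(u has_derivative D x) (at x)" using D(1) by blast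
      then show "u differentiable at x" by (rule differentiableI)
    qed
    moreover have "C_k_on k S (\<lambda>x. frechet_derivative u (at x) h)" for h
    proof -
      obtain w where w: "w \<in> K" "\<forall>x\<in>S. D x h = w x" using D(2) by blast
      have "frechet_derivative u (at x) h = w x" if "x \<in> S" for x
      proof -
        have "(u has_derivative D x) (at x)" using D(1) that by blast
        then have "D x = frechet_derivative u (at x)" by (rule frechet_derivative_at)
        moreover have "D x h = w x" using w(2) that by blast
        ultimately show ?thesis by simp
      qed
      then show ?thesis using C_k_on_cong[OF S, of "\<lambda>x. frechet_derivative u (at x) h" w] Suc.IH[OF w(1)] by simp
    qed
    ultimately show ?case by simp
  qed
  then show ?thesis using uK by (simp add: smooth_on_def)
qed

lemma frechet_derivative_real:
  assumes "f differentiable at (x::real)"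
  shows "frechet_derivative f (at x) h = h * deriv f x" "(f has_real_derivative deriv f x) (at x)"
proof -
  show *: "(f has_real_derivative deriv f x) (at x)"
    using assms DERIV_deriv_iff_real_differentiable by blast
  then have "(f has_derivative (*) (deriv f x)) (at x)" by (simp add: has_field_derivative_def)
  from frechet_derivative_at[OF this, symmetric]
  show "frechet_derivative f (at x) h = h * deriv f x" by simp
qed

lemma smooth_on_deriv:
  fixes f :: "real \<Rightarrow> real"
  assumes "open S" "smooth_on S f"
  shows "smooth_on S (deriv f)" and "x \<in> S \<Longrightarrow> (f has_real_derivative deriv f x) (at x)"
proof -
  have C: "C_k_on (Suc k) S f" for k using assms(2) unfolding smooth_on_def by blast
  have d: "f differentiable at x" if "x \<in> S" for x
    using C[of 0] that by (simp add: differentiable_on_eq_differentiable_at[OF assms(1)])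
  have "C_k_on k S (\<lambda>x. frechet_derivative f (at x) 1)" for k using C[of k] by simp
  then show "smooth_on S (deriv f)"
    unfolding smooth_on_def using C_k_on_cong[OF assms(1)] frechet_derivative_real(1)[OF d]
    by (metis (no_types, lifting) mult_1)
  show "x \<in> S \<Longrightarrow> (f has_real_derivative deriv f x) (at x)"
    using frechet_derivative_real(2)[OF d] .
qed

lemma smooth_on_higher_deriv:
  fixes f :: "real \<Rightarrow> real"
  assumes "open S" "smooth_on S f"
  shows "smooth_on S ((deriv ^^ k) f)"
    and "x \<in> S \<Longrightarrow> ((deriv ^^ k) f has_real_derivative (deriv ^^ Suc k) f x) (at x)"
proof -
  show *: "smooth_on S ((deriv ^^ k) f)"
    using assms smooth_on_deriv(1) by (induction k) auto
  show "x \<in> S \<Longrightarrow> ((deriv ^^ k) f has_real_derivative (deriv ^^ Suc k) f x) (at x)"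
    using smooth_on_deriv(2)[OF assms(1) *] by simp
qed

section \<open>Radial forms\<close>

lemma d_z_eqI: "(u has_derivative D) (at x) \<Longrightarrow> d_z i u x = (D (axis i 1) - \<i> * D (axis i \<i>)) / 2"
  using frechet_derivative_at[of u D x] by (simp add: d_z_def)

lemma d_zbar_eqI: "(u has_derivative D) (at x) \<Longrightarrow> d_zbar i u x = (D (axis i 1) + \<i> * D (axis i \<i>)) / 2"
  using frechet_derivative_at[of u D x] by (simp add: d_zbar_def)

lemma has_derivative_norm_sq:
  "((\<lambda>x::'a::real_inner. (norm x)\<^sup>2) has_derivative (\<lambda>h. 2 * (x \<bullet> h))) (at x)"
  unfolding power2_norm_eq_inner
  by (rule has_derivative_eq_rhs, rule has_derivative_inner[OF has_derivative_ident has_derivative_ident])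
     (simp add: fun_eq_iff inner_commute)

lemma has_derivative_radial:
  fixes x :: "'a::real_inner"
  assumes "(\<phi> has_real_derivative \<phi>') (at ((norm x)\<^sup>2))"
  shows "((\<lambda>x. complex_of_real (\<phi> ((norm x)\<^sup>2))) has_derivative (\<lambda>h. of_real (\<phi>' * (2 * (x \<bullet> h))))) (at x)"
proof -
  have "((\<lambda>x. \<phi> ((norm x)\<^sup>2)) has_derivative (\<lambda>h. \<phi>' * (2 * (x \<bullet> h)))) (at x)"
    using has_derivative_compose[OF has_derivative_norm_sq assms[unfolded has_field_derivative_def]] by simp
  then show ?thesis by (rule has_derivative_of_real)
qed

lemma has_derivative_vec_nth [derivative_intros]:
  "((\<lambda>x::complex^'n. x $ j) has_derivative (\<lambda>h. h $ j)) (at x)"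
  by (rule bounded_linear_imp_has_derivative) (rule bounded_linear_vec_nth)

definition herm :: "complex^'n \<Rightarrow> complex^'n \<Rightarrow> complex" where
  "herm x y = (\<Sum>i\<in>UNIV. x $ i * cnj (y $ i))"

lemma herm_self: "herm x x = of_real ((norm x)\<^sup>2)"
proof -
  have "(norm x)\<^sup>2 = (\<Sum>i\<in>UNIV. (cmod (x $ i))\<^sup>2)" by (simp add: norm_vec_def L2_set_def sum_nonneg)
  then show ?thesis by (simp only: herm_def of_real_sum complex_norm_square)
qed

lemma herm_add_left: "herm (x + y) z = herm x z + herm y z"
  and herm_add_right: "herm x (y + z) = herm x y + herm x z"
  and herm_scale_left: "herm (a *s x) y = a * herm x y"
  and herm_scale_right: "herm x (a *s y) = cnj a * herm x y"
  by (simp_all add: herm_def algebra_simps sum.distrib sum_distrib_left)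

lemma herm_commute: "cnj (herm x y) = herm y x"
  by (simp add: herm_def mult.commute)

lemma inner_herm: "x \<bullet> y = Re (herm x y)"
  by (simp add: inner_vec_def herm_def inner_complex_def)

lemma inner_axis_1: "x \<bullet> axis i 1 = Re (x $ i)" and inner_axis_i: "x \<bullet> axis i \<i> = Im (x $ i)"
  by (simp_all add: inner_axis inner_complex_def)

lemma two_inner_herm: "complex_of_real (2 * (x \<bullet> h)) = herm h x + herm x h"
  by (simp add: inner_herm complex_eq_iff flip: herm_commute[of x h])

lemma has_derivative_radial_mult:
  fixes x :: "complex^'n"
  assumes "(\<phi> has_real_derivative \<phi>') (at ((norm x)\<^sup>2))"
  shows "((\<lambda>x. of_real (\<phi> ((norm x)\<^sup>2)) * x $ j) has_derivative
      (\<lambda>h. of_real (\<phi> ((norm x)\<^sup>2)) * h $ j + of_real (\<phi>' * (2 * (x \<bullet> h))) * x $ j)) (at x)"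
  by (rule has_derivative_mult[OF has_derivative_radial[OF assms] has_derivative_vec_nth])

lemma d_zbar_radial:
  fixes x :: "complex^'n"
  assumes "(\<phi> has_real_derivative \<phi>') (at ((norm x)\<^sup>2))"
  shows "d_zbar j (\<lambda>x. complex_of_real (\<phi> ((norm x)\<^sup>2))) x = of_real \<phi>' * x $ j"
  unfolding d_zbar_eqI[OF has_derivative_radial[OF assms]] inner_axis_1 inner_axis_i
  by (auto simp: complex_eq_iff)

lemma open_shell_preimage: "open I \<Longrightarrow> open {y::'a::real_inner. (norm y)\<^sup>2 \<in> I}"
  using open_vimage[of I "\<lambda>y::'a. (norm y)\<^sup>2"] by (simp add: vimage_def continuous_intros)

lemma has_derivative_d_zbar_radial:
  fixes x :: "complex^'n"
  assumes "open I" "(norm x)\<^sup>2 \<in> I" "\<And>r. r \<in> I \<Longrightarrow> (\<phi> has_real_derivative \<phi>1 r) (at r)"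
    and "(\<phi>1 has_real_derivative \<phi>2) (at ((norm x)\<^sup>2))"
  shows "(d_zbar j (\<lambda>x. complex_of_real (\<phi> ((norm x)\<^sup>2))) has_derivative
      (\<lambda>h. of_real (\<phi>1 ((norm x)\<^sup>2)) * h $ j + of_real (\<phi>2 * (2 * (x \<bullet> h))) * x $ j)) (at x)"
proof (rule has_derivative_transform_within_open[OF has_derivative_radial_mult[OF assms(4)] open_shell_preimage[OF assms(1)]])
  fix y :: "complex^'n" assume "y \<in> {y. (norm y)\<^sup>2 \<in> I}"
  then show "of_real (\<phi>1 ((norm y)\<^sup>2)) * y $ j = d_zbar j (\<lambda>x. complex_of_real (\<phi> ((norm x)\<^sup>2))) y"
    using d_zbar_radial[OF assms(3), of y j] by simp
qed (use assms in auto)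

text \<open>The derivatives of the profile are arguments instead of \<open>deriv\<close> terms, so
  that the formula serves both for the potential and for the logarithm of a determinant whose
  derivatives are computed by hand.\<close>

lemma complex_hessian_radial:
  fixes x :: "complex^'n"
  assumes "open I" "(norm x)\<^sup>2 \<in> I" "\<And>r. r \<in> I \<Longrightarrow> (\<phi> has_real_derivative \<phi>1 r) (at r)"
    and "(\<phi>1 has_real_derivative \<phi>2) (at ((norm x)\<^sup>2))"
  shows "complex_hessian (\<lambda>x. \<phi> ((norm x)\<^sup>2)) x =
    (\<chi> i j. of_real (\<phi>1 ((norm x)\<^sup>2)) * (if i = j then 1 else 0) + of_real \<phi>2 * cnj (x $ i) * x $ j)"
proof -
  have ax: "axis i a $ j = (if i = j then a else 0)" for i j :: 'n and a :: complex
    by (simp add: axis_def)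
  have D: "(d_zbar j (\<lambda>x. complex_of_real (\<phi> ((norm x)\<^sup>2))) has_derivative
      (\<lambda>h. of_real (\<phi>1 ((norm x)\<^sup>2)) * h $ j + of_real (\<phi>2 * (2 * (x \<bullet> h))) * x $ j)) (at x)" for j
    by (rule has_derivative_d_zbar_radial[OF assms(1,2) _ assms(4)]) (rule assms(3))
  have "d_z i (d_zbar j (\<lambda>x. complex_of_real (\<phi> ((norm x)\<^sup>2)))) x =
     of_real (\<phi>1 ((norm x)\<^sup>2)) * (if i = j then 1 else 0) + of_real \<phi>2 * cnj (x $ i) * x $ j" for i j
    unfolding d_z_eqI[OF D] inner_axis_1 inner_axis_i ax
    by (auto simp: complex_eq_iff field_simps)
  then show ?thesis by (simp add: complex_hessian_def vec_eq_iff)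
qed

lemma complex_hessian_cong:
  assumes "open S" "x \<in> S" "\<And>y. y \<in> S \<Longrightarrow> u y = w y"
  shows "complex_hessian u x = complex_hessian w x"
proof -
  have fd: "frechet_derivative u' (at y) h = frechet_derivative w' (at y) h"
    if "y \<in> S" "\<And>y. y \<in> S \<Longrightarrow> u' y = w' y" for y h and u' w' :: "complex^'a \<Rightarrow> complex"
  proof -
    have "(u' has_derivative D) (at y) \<longleftrightarrow> (w' has_derivative D) (at y)" for D
      using that assms(1) has_derivative_transform_within_open[of u' D y UNIV S w']
        has_derivative_transform_within_open[of w' D y UNIV S u'] by auto
    then show ?thesis by (simp add: frechet_derivative_def)
  qed
  have "d_zbar j (\<lambda>y. complex_of_real (u y)) y = d_zbar j (\<lambda>y. complex_of_real (w y)) y" if "y \<in> S" for y j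
    unfolding d_zbar_def using fd[OF that, of "\<lambda>y. complex_of_real (u y)" "\<lambda>y. complex_of_real (w y)"] assms(3) by simp
  then show ?thesis
    unfolding complex_hessian_def d_z_def
    using fd[OF assms(2), of "d_zbar _ (\<lambda>y. complex_of_real (u y))" "d_zbar _ (\<lambda>y. complex_of_real (w y))"] by simp
qed

text \<open>The rows \<open>axis i a\<close> are changed into the full rows one at a time. By
  linearity in the changed row each change adds \<open>b * u $ k\<close> times the determinant of
  \<open>E k T\<close>, whose row \<open>k\<close> is \<open>v\<close> itself; multiples of that row
  clear \<open>v\<close> from all other rows, so \<open>E k T\<close> has the same determinant as
  \<open>E k {}\<close>.\<close>

lemma det_scalar_plus_rank_one:
  fixes a b :: complex and u v :: "complex^'n"
  shows "det (\<chi> i j. a * (if i = j then 1 else 0) + b * u $ i * v $ j) =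
     a ^ (CARD('n) - 1) * (a + b * (\<Sum>i\<in>UNIV. u $ i * v $ i))"
proof -
  define M :: "'n set \<Rightarrow> complex^'n^'n" where
    "M T = (\<chi> i. if i \<in> T then axis i a + (b * u $ i) *s v else axis i a)" for T
  define E :: "'n \<Rightarrow> 'n set \<Rightarrow> complex^'n^'n" where
    "E k T = (\<chi> i. if i = k then v else if i \<in> T then axis i a + (b * u $ i) *s v else axis i a)" for k T
  have prodE: "(\<Prod>i\<in>UNIV. if i = k then c else a) = a ^ (CARD('n) - 1) * c" for k :: 'n and c
    by (subst prod.remove[of _ k]) (auto simp: prod_constant card_Diff_singleton cong: prod.cong_simp)
  have E0: "det (E k {}) = a ^ (CARD('n) - 1) * v $ k" for k
  proof -
    have "det (E k {}) = det (\<chi> i. if i = k then v $ k *s axis k 1 else axis i a)"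
    proof -
      have 1: "v = v $ k *s axis k 1 + (\<Sum>j\<in>UNIV - {k}. v $ j *s axis j 1)"
        using basis_expansion[of v] by (subst (asm) sum.remove[of _ k]) auto
      show ?thesis
      \<comment> \<open>For \<open>a \<noteq> 0\<close> the other rows span the remaining
        coordinates, which can be subtracted from row \<open>k\<close>. For \<open>a = 0\<close>
        they vanish: a second row then makes both determinants zero, and in dimension one
        \<open>v\<close> already equals its \<open>k\<close>-component.\<close>
      proof (cases "a = 0")
        case True
        show ?thesis
        proof (cases "\<exists>i. i \<noteq> k")
          case True
          then obtain i where i: "i \<noteq> k" by blast
          have "det (E k {}) = 0" by (rule det_zero_row(1)[where i=i]) (use i \<open>a = 0\<close> in \<open>auto simp: E_def row_def vec_eq_iff axis_def\<close>)
          moreover have "det (\<chi> i. if i = k then v $ k *s axis k 1 else axis i a) = 0"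
            by (rule det_zero_row(1)[where i=i]) (use i \<open>a = 0\<close> in \<open>auto simp: row_def vec_eq_iff axis_def\<close>)
          ultimately show ?thesis by simp
        next
          case False
          then have "UNIV - {k} = {}" by auto
          obtain w where w: "w = v $ k *s axis k 1" by blast
          with \<open>UNIV - {k} = {}\<close> have "v = w" using 1 by (metis (no_types) add.right_neutral sum.empty)
          then have "E k {} = (\<chi> i. if i = k then w else axis i a)" by (simp add: E_def cong: if_cong)
          then show ?thesis unfolding w by (rule arg_cong)
        qed
      next
        case False
        define A :: "complex^'n^'n" where "A = (\<chi> i. if i = k then v $ k *s axis k 1 else axis i a)"
        have sp: "(\<Sum>j\<in>UNIV - {k}. v $ j *s axis j 1) \<in> vec.span {row j A |j. j \<noteq> k}"
        proof (rule vec.span_sum)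
          fix j assume "j \<in> UNIV - {k}"
          then have "row j A = a *s axis j 1" by (auto simp: row_def A_def vec_eq_iff axis_def)
          then have "axis j 1 = (1/a) *s row j A" using False by (simp add: vector_smult_assoc)
          moreover have "row j A \<in> vec.span {row j A |j. j \<noteq> k}" using \<open>j \<in> UNIV - {k}\<close>
            by (intro vec.span_base) auto
          ultimately show "v $ j *s axis j 1 \<in> vec.span {row j A |j. j \<noteq> k}"
            by (simp add: vec.span_scale)
        qed
        obtain R where R: "R = (\<Sum>j\<in>UNIV - {k}. v $ j *s axis j 1)" by blast
        obtain w where w: "w = v $ k *s axis k 1" by blast
        have vw: "v = w + R" unfolding R w by (rule 1)
        have rows: "row l A = (if l = k then w else axis l a)" for l
          unfolding w by (simp add: row_def A_def vec_eq_iff)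
        have "det (\<chi> l. if l = k then row k A + R else row l A) = det A"
          unfolding R by (rule det_row_span[OF sp])
        moreover have "(\<chi> l. if l = k then row k A + R else row l A) = E k {}"
        proof (subst vec_eq_iff, rule allI)
          show "(\<chi> l. if l = k then row k A + R else row l A) $ l = E k {} $ l" for l
            by (cases "l = k") (simp_all add: E_def rows vw)
        qed
        ultimately show ?thesis by (simp add: A_def)
      qed
    qed
    also have "\<dots> = (\<Prod>i\<in>UNIV. if i = k then v $ k else a)"
      by (subst det_diagonal) (auto simp: axis_def intro!: prod.cong)
    also have "\<dots> = a ^ (CARD('n) - 1) * v $ k" by (rule prodE)
    finally show ?thesis .
  qed
  have E: "det (E k T) = a ^ (CARD('n) - 1) * v $ k" if "k \<notin> T" for k T
    using finite[of T] that
  proof (induction T rule: finite_induct)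
    case (insert l T)
    then have "l \<noteq> k" by auto
    have "det (\<chi> i. if i = l then row l (E k T) + (b * u $ l) *s row k (E k T) else row i (E k T)) = det (E k T)"
      by (rule det_row_operation[OF \<open>l \<noteq> k\<close>])
    moreover have "(\<chi> i. if i = l then row l (E k T) + (b * u $ l) *s row k (E k T) else row i (E k T)) = E k (insert l T)"
      using insert.hyps \<open>l \<noteq> k\<close> by (auto simp: E_def row_def vec_eq_iff)
    ultimately show ?case using insert by simp
  qed (rule E0)
  have "det (M T) = a ^ CARD('n) + a ^ (CARD('n) - 1) * b * (\<Sum>i\<in>T. u $ i * v $ i)" for T
    using finite[of T]
  proof (induction T rule: finite_induct)
    case empty
    have "det (M {}) = (\<Prod>i\<in>(UNIV::'n set). a)"
      unfolding M_def by (subst det_diagonal) (auto simp: axis_def)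
    then show ?case by simp
  next
    case (insert k T)
    have "M (insert k T) = (\<chi> i. if i = k then axis i a + (b * u $ i) *s v else M T $ i)"
      using insert.hyps by (auto simp: M_def vec_eq_iff)
    also have "det \<dots> = det (\<chi> i. if i = k then axis i a else M T $ i) + det (\<chi> i. if i = k then (b * u $ i) *s v else M T $ i)"
      by (rule det_row_add)
    also have "(\<chi> i. if i = k then axis i a else M T $ i) = M T"
      using insert.hyps by (auto simp: M_def vec_eq_iff)
    also have "(\<chi> i. if i = k then (b * u $ i) *s v else M T $ i) = (\<chi> i. if i = k then (b * u $ k) *s v else M T $ i)"
      by (auto simp: vec_eq_iff)
    also have "det \<dots> = b * u $ k * det (\<chi> i. if i = k then v else M T $ i)"
      by (rule det_row_mul)
    also have "(\<chi> i. if i = k then v else M T $ i) = E k T"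
      by (auto simp: M_def E_def vec_eq_iff)
    finally show ?case using E[OF insert.hyps(2)] insert by (simp add: algebra_simps)
  qed
  from this[of UNIV]
  have "det (M UNIV) = a ^ (CARD('n) - 1) * (a + b * (\<Sum>i\<in>UNIV. u $ i * v $ i))"
    using power_minus_mult[of "CARD('n)" a] by (simp add: algebra_simps)
  moreover have "M UNIV = (\<chi> i j. a * (if i = j then 1 else 0) + b * u $ i * v $ j)"
    by (auto simp: M_def vec_eq_iff axis_def)
  ultimately show ?thesis by simp
qed

text \<open>Closed under directional derivatives as soon as \<open>\<phi> (Suc k)\<close> is the
  derivative of \<open>\<phi> k\<close>: the inner product that comes from differentiating the
  squared norm is a sum of coordinates and conjugate coordinates with constant factors.\<close>

inductive radial_class :: "(nat \<Rightarrow> real \<Rightarrow> real) \<Rightarrow> (complex^'n \<Rightarrow> complex) \<Rightarrow> bool" for \<phi> where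
  const: "radial_class \<phi> (\<lambda>x. c)"
| nth: "radial_class \<phi> (\<lambda>x. x $ i)"
| cnj_nth: "radial_class \<phi> (\<lambda>x. cnj (x $ i))"
| radial: "radial_class \<phi> (\<lambda>x. of_real (\<phi> k ((norm x)\<^sup>2)))"
| add: "radial_class \<phi> u \<Longrightarrow> radial_class \<phi> v \<Longrightarrow> radial_class \<phi> (\<lambda>x. u x + v x)"
| mult: "radial_class \<phi> u \<Longrightarrow> radial_class \<phi> v \<Longrightarrow> radial_class \<phi> (\<lambda>x. u x * v x)"

lemma radial_class_sum:
  assumes "\<And>i. i \<in> A \<Longrightarrow> radial_class \<phi> (u i)"
  shows "radial_class \<phi> (\<lambda>x. \<Sum>i\<in>A. u i x)"
  using assms by (induction A rule: infinite_finite_induct) (auto intro: radial_class.intros)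

lemma radial_class_derivative:
  fixes u :: "complex^'n \<Rightarrow> complex"
  assumes "radial_class \<phi> u"
    and \<phi>: "\<And>k r. r \<in> I \<Longrightarrow> (\<phi> k has_real_derivative \<phi> (Suc k) r) (at r)"
  shows "\<exists>D. (\<forall>x. (norm x)\<^sup>2 \<in> I \<longrightarrow> (u has_derivative D x) (at x)) \<and> (\<forall>h. radial_class \<phi> (\<lambda>x. D x h))"
  using assms(1)
proof induction
  case (const c)
  then show ?case by (intro exI[of _ "\<lambda>x h. 0"]) (auto intro: radial_class.intros)
next
  case (nth i)
  then show ?case
    by (intro exI[of _ "\<lambda>x h. h $ i"]) (auto intro: radial_class.intros has_derivative_vec_nth)
next
  case (cnj_nth i)
  then show ?case
    by (intro exI[of _ "\<lambda>x h. cnj (h $ i)"])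
       (auto intro: radial_class.intros has_derivative_cnj has_derivative_vec_nth)
next
  case (radial k)
  have "radial_class \<phi> (\<lambda>x. complex_of_real (\<phi> (Suc k) ((norm x)\<^sup>2) * (2 * (x \<bullet> h))))" for h :: "complex^'n"
    unfolding of_real_mult[of "\<phi> (Suc k) _"] two_inner_herm herm_def
    by (intro radial_class.intros radial_class_sum)
  then show ?case
    by (intro exI[of _ "\<lambda>x h. of_real (\<phi> (Suc k) ((norm x)\<^sup>2) * (2 * (x \<bullet> h)))"] conjI allI impI
          has_derivative_radial \<phi>)
next
  case (add u v)
  then obtain D E where DE: "\<forall>x. (norm x)\<^sup>2 \<in> I \<longrightarrow> (u has_derivative D x) (at x)" "\<And>h. radial_class \<phi> (\<lambda>x. D x h)"
    "\<forall>x. (norm x)\<^sup>2 \<in> I \<longrightarrow> (v has_derivative E x) (at x)" "\<And>h. radial_class \<phi> (\<lambda>x. E x h)" by blast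
  have "radial_class \<phi> (\<lambda>x. D x h + E x h)" for h
    by (rule radial_class.add[OF DE(2) DE(4)])
  then show ?case
    using DE(1,3) by (intro exI[of _ "\<lambda>x h. D x h + E x h"]) (auto intro: has_derivative_add)
next
  case (mult u v)
  then obtain D E where DE: "\<forall>x. (norm x)\<^sup>2 \<in> I \<longrightarrow> (u has_derivative D x) (at x)" "\<And>h. radial_class \<phi> (\<lambda>x. D x h)"
    "\<forall>x. (norm x)\<^sup>2 \<in> I \<longrightarrow> (v has_derivative E x) (at x)" "\<And>h. radial_class \<phi> (\<lambda>x. E x h)" by blast
  have "radial_class \<phi> (\<lambda>x. u x * E x h + D x h * v x)" for h
    by (rule radial_class.add[OF radial_class.mult[OF mult.hyps(1) DE(4)] radial_class.mult[OF DE(2) mult.hyps(2)]])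
  then show ?case
    using DE(1,3) by (intro exI[of _ "\<lambda>x h. u x * E x h + D x h * v x"]) (auto intro: has_derivative_mult)
qed

lemma radial_class_smooth:
  fixes u :: "complex^'n \<Rightarrow> complex"
  assumes "radial_class \<phi> u" "open I"
    and \<phi>: "\<And>k r. r \<in> I \<Longrightarrow> (\<phi> k has_real_derivative \<phi> (Suc k) r) (at r)"
  shows "smooth_on {x. (norm x)\<^sup>2 \<in> I} u"
proof (rule smooth_on_closed_class[where K="Collect (radial_class \<phi>)"])
  show "open {x :: complex^'n. (norm x)\<^sup>2 \<in> I}" by (rule open_shell_preimage[OF assms(2)])
  show "u \<in> Collect (radial_class \<phi>)" using assms by simp
  fix w :: "complex^'n \<Rightarrow> complex" assume "w \<in> Collect (radial_class \<phi>)"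
  then obtain D where "\<forall>x. (norm x)\<^sup>2 \<in> I \<longrightarrow> (w has_derivative D x) (at x)" "\<forall>h. radial_class \<phi> (\<lambda>x. D x h)"
    using radial_class_derivative[where u=w and \<phi>=\<phi> and I=I] \<phi> by auto
  then show "\<exists>D. (\<forall>x\<in>{x. (norm x)\<^sup>2 \<in> I}. (w has_derivative D x) (at x)) \<and>
      (\<forall>h. \<exists>w\<in>Collect (radial_class \<phi>). \<forall>x\<in>{x. (norm x)\<^sup>2 \<in> I}. D x h = w x)"
    by (intro exI[of _ D]) auto
qed

section \<open>Kaehler, Ricci and soliton conditions for radial forms\<close>

abbreviation kd :: "'n \<Rightarrow> 'n \<Rightarrow> complex" where "kd i j \<equiv> (if i = j then 1 else 0)"

context
  fixes I :: "real set" and F :: "real \<Rightarrow> real" and F1 F2 F3 :: "real \<Rightarrow> real"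
  assumes I: "open I" and smF: "smooth_on I F"
  defines "F1 \<equiv> deriv F" and "F2 \<equiv> deriv (deriv F)" and "F3 \<equiv> deriv (deriv (deriv F))"
begin

lemma F_deriv:
  assumes "r \<in> I"
  shows "(F has_real_derivative F1 r) (at r)" "(F1 has_real_derivative F2 r) (at r)"
    "(F2 has_real_derivative F3 r) (at r)"
  using smooth_on_higher_deriv(2)[OF I smF assms, of 0] smooth_on_higher_deriv(2)[OF I smF assms, of 1]
    smooth_on_higher_deriv(2)[OF I smF assms, of 2]
  by (simp_all add: F1_def F2_def F3_def numeral_2_eq_2)

lemma radial_form_eq:
  fixes x :: "complex^'n"
  assumes "(norm x)\<^sup>2 \<in> I"
  shows "radial_form F x $ i $ j = of_real (F1 ((norm x)\<^sup>2)) * kd i j + of_real (F2 ((norm x)\<^sup>2)) * cnj (x $ i) * x $ j"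
  unfolding radial_form_def
  by (subst complex_hessian_radial[OF I assms, of F F1 "F2 ((norm x)\<^sup>2)"]) (use assms F_deriv in auto)

lemma radial_form_has_derivative:
  fixes x :: "complex^'n"
  assumes x: "(norm x)\<^sup>2 \<in> I"
  shows "((\<lambda>x. radial_form F x $ i $ j) has_derivative
     (\<lambda>h. of_real (F2 ((norm x)\<^sup>2) * (2 * (x \<bullet> h))) * kd i j + of_real (F3 ((norm x)\<^sup>2) * (2 * (x \<bullet> h))) * cnj (x $ i) * x $ j
        + of_real (F2 ((norm x)\<^sup>2)) * (cnj (h $ i) * x $ j + cnj (x $ i) * h $ j))) (at x)"
proof (rule has_derivative_transform_within_open[OF _ open_shell_preimage[OF I]])
  show "x \<in> {x. (norm x)\<^sup>2 \<in> I}" using x by simp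
  show "of_real (F1 ((norm y)\<^sup>2)) * kd i j + of_real (F2 ((norm y)\<^sup>2)) * (cnj (y $ i) * y $ j)
      = radial_form F y $ i $ j" if "y \<in> {x. (norm x)\<^sup>2 \<in> I}" for y
    using radial_form_eq[of y i j] that by (simp add: mult.assoc)
  show "((\<lambda>y. of_real (F1 ((norm y)\<^sup>2)) * kd i j + of_real (F2 ((norm y)\<^sup>2)) * (cnj (y $ i) * y $ j)) has_derivative
     (\<lambda>h. of_real (F2 ((norm x)\<^sup>2) * (2 * (x \<bullet> h))) * kd i j + of_real (F3 ((norm x)\<^sup>2) * (2 * (x \<bullet> h))) * cnj (x $ i) * x $ j
        + of_real (F2 ((norm x)\<^sup>2)) * (cnj (h $ i) * x $ j + cnj (x $ i) * h $ j))) (at x)"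
    by (rule has_derivative_eq_rhs, (rule has_derivative_add has_derivative_mult_left has_derivative_mult
          has_derivative_radial has_derivative_cnj has_derivative_vec_nth F_deriv x)+)
       (simp add: fun_eq_iff algebra_simps)
qed

lemma radial_form_pairing:
  fixes x v :: "complex^'n"
  assumes "(norm x)\<^sup>2 \<in> I"
  shows "(\<Sum>i\<in>UNIV. \<Sum>j\<in>UNIV. radial_form F x $ i $ j * v $ i * cnj (w $ j)) =
     of_real (F1 ((norm x)\<^sup>2)) * herm v w + of_real (F2 ((norm x)\<^sup>2)) * herm v x * herm x w"
proof -
  have "(\<Sum>i\<in>UNIV. \<Sum>j\<in>UNIV. radial_form F x $ i $ j * v $ i * cnj (w $ j)) =
    (\<Sum>i\<in>UNIV. \<Sum>j\<in>UNIV. (if i = j then of_real (F1 ((norm x)\<^sup>2)) * (v $ i * cnj (w $ i)) else 0)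
      + of_real (F2 ((norm x)\<^sup>2)) * ((v $ i * cnj (x $ i)) * (x $ j * cnj (w $ j))))"
    by (intro sum.cong refl) (simp add: radial_form_eq[OF assms] algebra_simps)
  also have "\<dots> = of_real (F1 ((norm x)\<^sup>2)) * herm v w + of_real (F2 ((norm x)\<^sup>2)) * (herm v x * herm x w)"
    unfolding herm_def sum_product by (simp add: sum.distrib sum_distrib_left)
  finally show ?thesis by (simp add: mult.assoc)
qed

lemma cmod_herm_le: "(cmod (herm x y))\<^sup>2 \<le> (norm x)\<^sup>2 * (norm y)\<^sup>2"
proof -
  have "cmod (herm x y) \<le> (\<Sum>i\<in>UNIV. \<bar>cmod (x $ i)\<bar> * \<bar>cmod (y $ i)\<bar>)"
    unfolding herm_def by (rule order_trans[OF norm_sum]) (simp add: norm_mult)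
  also have "\<dots> \<le> norm x * norm y"
    unfolding norm_vec_def by (rule L2_set_mult_ineq)
  finally show ?thesis by (metis norm_ge_zero power_mono power_mult_distrib)
qed

text \<open>\<open>F1\<close> and \<open>F1 + |x|^2 F2\<close> are the eigenvalues of the form on
  the orthogonal complement of \<open>x\<close> and on the complex line of \<open>x\<close>. At
  \<open>x = 0\<close> both equal \<open>F1 0\<close>, so the origin is covered.\<close>

lemma kaehler_on_radial_form:
  fixes S :: "(complex^'n) set"
  assumes S: "S = {x. (norm x)\<^sup>2 \<in> I}"
    and pos: "\<And>x. x \<in> S \<Longrightarrow> 0 < F1 ((norm x)\<^sup>2) \<and> 0 < F1 ((norm x)\<^sup>2) + (norm x)\<^sup>2 * F2 ((norm x)\<^sup>2)"
  shows "kaehler_on S (radial_form F)"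
  unfolding kaehler_on_def
proof (intro conjI allI ballI impI)
  have opS: "open S" unfolding S by (rule open_shell_preimage[OF I])
  have d2: "(deriv ^^ 2) F = deriv (deriv F)" by (simp add: numeral_2_eq_2)
  show "smooth_on S (\<lambda>x. radial_form F x $ i $ j)" for i j
  proof -
    have "smooth_on S (\<lambda>x. of_real ((deriv ^^ 1) F ((norm x)\<^sup>2)) * kd i j
        + of_real ((deriv ^^ 2) F ((norm x)\<^sup>2)) * (cnj (x $ i) * x $ j))"
      unfolding S
      by (rule radial_class_smooth[where \<phi>="\<lambda>k. (deriv ^^ k) F"])
         (auto intro!: radial_class.intros I smooth_on_higher_deriv(2)[OF I smF] simp del: funpow.simps if_split)
    then show ?thesis
      by (rule smooth_on_cong[OF opS, THEN iffD1, rotated])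
         (simp add: S radial_form_eq F1_def F2_def d2 mult.assoc)
  qed
  fix x assume "x \<in> S"
  then have x: "(norm x)\<^sup>2 \<in> I" by (simp add: S)
  show "radial_form F x $ j $ i = cnj (radial_form F x $ i $ j)" for i j
    by (simp add: radial_form_eq[OF x])
  show "0 < Re (\<Sum>i\<in>UNIV. \<Sum>j\<in>UNIV. radial_form F x $ i $ j * v $ i * cnj (v $ j))" if "v \<noteq> 0" for v
  proof -
    define q where "q = (norm x)\<^sup>2"
    have "herm v x * herm x v = of_real ((cmod (herm v x))\<^sup>2)"
      by (simp only: complex_norm_square herm_commute)
    then have "Re (\<Sum>i\<in>UNIV. \<Sum>j\<in>UNIV. radial_form F x $ i $ j * v $ i * cnj (v $ j))
       = F1 q * (norm v)\<^sup>2 + F2 q * (cmod (herm v x))\<^sup>2"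
      unfolding radial_form_pairing[OF x] unfolding herm_self q_def mult.assoc by (simp del: of_real_power)
    moreover have "0 < F1 q * (norm v)\<^sup>2 + F2 q * (cmod (herm v x))\<^sup>2"
    \<comment> \<open>If the radial term is negative, Cauchy-Schwarz reduces the worst case to the
      eigenvalue in the direction of \<open>x\<close>.\<close>
    proof (cases "F2 q \<ge> 0")
      case True
      then show ?thesis using pos[OF \<open>x \<in> S\<close>] that by (intro add_pos_nonneg) (auto simp: q_def)
    next
      case False
      have "0 < (F1 q + q * F2 q) * (norm v)\<^sup>2" using pos[OF \<open>x \<in> S\<close>] that by (simp add: q_def)
      also have "\<dots> = F1 q * (norm v)\<^sup>2 + F2 q * ((norm v)\<^sup>2 * (norm x)\<^sup>2)" by (simp add: q_def algebra_simps)
      also have "\<dots> \<le> F1 q * (norm v)\<^sup>2 + F2 q * (cmod (herm v x))\<^sup>2"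
        using False by (intro add_left_mono mult_left_mono_neg cmod_herm_le) auto
      finally show ?thesis .
    qed
    ultimately show ?thesis by simp
  qed
  show "d_z k (\<lambda>y. radial_form F y $ i $ j) x = d_z i (\<lambda>y. radial_form F y $ k $ j) x" for i j k
    unfolding d_z_eqI[OF radial_form_has_derivative[OF x]] inner_axis_1 inner_axis_i
    by (auto simp: axis_def complex_eq_iff field_simps)
qed

text \<open>The form is tested on \<open>x\<close> and on a unit vector orthogonal to it, which
  exists because the dimension is at least two. That vector is part of the conclusion since the
  positivity argument differentiates along it.\<close>

lemma radial_kaehler_imp_pos:
  fixes x :: "complex^'n"
  assumes K: "kaehler_on S (radial_form F)" and x: "x \<in> S" "(norm x)\<^sup>2 \<in> I" "x \<noteq> 0"
    and n: "CARD('n) \<ge> 2"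
  shows "0 < F1 ((norm x)\<^sup>2)" "0 < F1 ((norm x)\<^sup>2) + (norm x)\<^sup>2 * F2 ((norm x)\<^sup>2)"
    "\<exists>e :: complex^'n. norm e = 1 \<and> herm e x = 0"
proof -
  define q where "q = (norm x)\<^sup>2"
  have q: "q > 0" using x by (simp add: q_def)
  have pos: "0 < Re (of_real (F1 q) * herm v v + of_real (F2 q) * herm v x * herm x v)" if "v \<noteq> 0" for v
  proof -
    have "0 < Re (\<Sum>i\<in>UNIV. \<Sum>j\<in>UNIV. radial_form F x $ i $ j * v $ i * cnj (v $ j))"
      using K x(1) that unfolding kaehler_on_def by blast
    then show ?thesis unfolding radial_form_pairing[OF x(2)] q_def .
  qed
  have "0 < F1 q * q + F2 q * q * q" using pos[OF x(3)] by (simp add: herm_self q_def del: of_real_power)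
  also have "\<dots> = q * (F1 q + q * F2 q)" by (simp add: algebra_simps)
  finally show "0 < F1 q + q * F2 q" using q by (simp add: zero_less_mult_iff)
  obtain k :: 'n where k: "x $ k \<noteq> 0" using x(3) by (metis vec_eq_iff zero_index)
  have "\<exists>l. l \<noteq> k"
  proof (rule ccontr)
    assume "\<nexists>l. l \<noteq> k"
    then have "UNIV = {k}" by auto
    then have "CARD('n) = 1" by (metis is_singletonI is_singleton_altdef)
    then show False using n by simp
  qed
  then obtain l where l: "l \<noteq> k" by blast
  define v :: "complex^'n" where "v = (\<chi> i. if i = l then cnj (x $ k) else if i = k then - cnj (x $ l) else 0)"
  have "herm v x = (\<Sum>i\<in>{k, l}. v $ i * cnj (x $ i))"
    unfolding herm_def by (rule sum.mono_neutral_right) (auto simp: v_def)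
  then have vx: "herm v x = 0" using l by (simp add: v_def)
  have "v $ l \<noteq> 0" using k by (simp add: v_def)
  then have v0: "v \<noteq> 0" by auto
  define e where "e = complex_of_real (1 / norm v) *s v"
  have he: "herm e x = 0" by (simp add: e_def herm_scale_left vx)
  have "of_real ((norm e)\<^sup>2) = (1 :: complex)"
    using v0 unfolding herm_self[symmetric] e_def herm_scale_left herm_scale_right
    by (simp add: herm_self power2_eq_square)
  then have "(norm e)\<^sup>2 = 1" by (simp only: of_real_eq_1_iff)
  then have "norm e = 1" using norm_ge_zero[of e] by (auto simp: power2_eq_1_iff)
  then show "\<exists>e :: complex^'n. norm e = 1 \<and> herm e x = 0" using he by blast
  have "e \<noteq> 0" using \<open>norm e = 1\<close> by auto
  then show "0 < F1 q" using pos[of e] \<open>norm e = 1\<close> he by (simp add: herm_self)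
qed

lemma radial_det:
  fixes x :: "complex^'n"
  assumes "(norm x)\<^sup>2 \<in> I"
  shows "det (radial_form F x) = of_real (F1 ((norm x)\<^sup>2) ^ (CARD('n) - 1) * (F1 ((norm x)\<^sup>2) + (norm x)\<^sup>2 * F2 ((norm x)\<^sup>2)))"
proof -
  have "radial_form F x = (\<chi> i j. of_real (F1 ((norm x)\<^sup>2)) * kd i j + of_real (F2 ((norm x)\<^sup>2)) * (\<chi> i. cnj (x $ i)) $ i * x $ j)"
    by (simp add: vec_eq_iff radial_form_eq[OF assms])
  then have "det (radial_form F x) = of_real (F1 ((norm x)\<^sup>2)) ^ (CARD('n) - 1) *
     (of_real (F1 ((norm x)\<^sup>2)) + of_real (F2 ((norm x)\<^sup>2)) * (\<Sum>i\<in>UNIV. (\<chi> i. cnj (x $ i)) $ i * x $ i))"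
    by (simp only: det_scalar_plus_rank_one)
  also have "(\<Sum>i\<in>UNIV. (\<chi> i. cnj (x $ i)) $ i * x $ i) = of_real ((norm x)\<^sup>2)"
    unfolding herm_self[symmetric] herm_def by (simp add: mult.commute)
  finally show ?thesis by (simp add: mult.commute)
qed

text \<open>\<open>H\<close> only has to agree with the logarithm of the determinant on
  \<open>I\<close>. A caller that knows the soliton equation can insert the expression it yields,
  whose second derivative involves \<open>F\<close> only up to third order.\<close>

lemma ricci_form_radial:
  fixes x :: "complex^'n"
  assumes x: "(norm x)\<^sup>2 \<in> I"
    and H: "\<And>r. r \<in> I \<Longrightarrow> ln (F1 r ^ (CARD('n) - 1) * (F1 r + r * F2 r)) = H r"
    and H1: "\<And>r. r \<in> I \<Longrightarrow> (H has_real_derivative H1 r) (at r)"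
    and H2: "(H1 has_real_derivative H2) (at ((norm x)\<^sup>2))"
  shows "ricci_form (radial_form F) x $ i $ j = - (of_real (H1 ((norm x)\<^sup>2)) * kd i j + of_real H2 * cnj (x $ i) * x $ j)"
proof -
  have "complex_hessian (\<lambda>y. ln (Re (det (radial_form F y)))) x = complex_hessian (\<lambda>y. H ((norm y)\<^sup>2)) x"
    by (rule complex_hessian_cong[OF open_shell_preimage[OF I]])
       (use x H in \<open>auto simp: radial_det simp del: of_real_mult of_real_add of_real_power\<close>)
  then show ?thesis
    unfolding ricci_form_def
    by (subst (asm) complex_hessian_radial[OF I x, of H H1 H2]) (use H1 H2 in auto)
qed

text \<open>The Lie derivative of the form along \<open>\<kappa>\<close> times the Euler field is
  the complex Hessian of \<open>2 * \<kappa> * r * F1 r\<close> with \<open>r = |x|^2\<close>. So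
  the soliton equation says that the complex Hessian of the left-hand side of \<open>ode\<close>
  vanishes, and that side is constant.\<close>

lemma krs_on_radial:
  fixes S :: "(complex^'n) set"
  assumes S: "S = {x. (norm x)\<^sup>2 \<in> I}" and I0: "I \<subseteq> {0<..}"
    and pos: "\<And>r. r \<in> I \<Longrightarrow> 0 < F1 r \<and> 0 < F1 r + r * F2 r"
    and ode: "\<And>r. r \<in> I \<Longrightarrow> ln (F1 r ^ (CARD('n) - 1) * (F1 r + r * F2 r)) + lam * F r + 2 * \<kappa> * r * F1 r = B"
  shows "krs_on S (radial_form F) (\<lambda>x. of_real \<kappa> *s x) lam"
  unfolding krs_on_def
proof (intro conjI ballI)
  show "kaehler_on S (radial_form F)" using pos by (intro kaehler_on_radial_form[OF S]) (auto simp: S)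
  have V: "((\<lambda>x :: complex^'n. of_real \<kappa> *s x) has_derivative (\<lambda>h. of_real \<kappa> *s h)) (at x)" for x
  proof -
    have "(\<lambda>x :: complex^'n. of_real \<kappa> *s x) = (\<lambda>x. \<kappa> *\<^sub>R x)"
      by (auto simp: vec_eq_iff scaleR_conv_of_real[where 'a=complex] fun_eq_iff)
    then show ?thesis by (metis bounded_linear_imp_has_derivative bounded_linear_scaleR_right)
  qed
  show "holomorphic_map_on S (\<lambda>x. of_real \<kappa> *s x)"
    unfolding holomorphic_map_on_def
    by (intro ballI exI[of _ "\<lambda>h. of_real \<kappa> *s h"] conjI V) (simp add: vec_eq_iff)
  fix x assume "x \<in> S"
  then have x: "(norm x)\<^sup>2 \<in> I" by (simp add: S)
  define q where "q = (norm x)\<^sup>2"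
  define H where "H r = B - lam * F r - 2 * \<kappa> * r * F1 r" for r
  define H1 where "H1 r = - lam * F1 r - 2 * \<kappa> * (F1 r + r * F2 r)" for r
  define H2 where "H2 = - lam * F2 q - 2 * \<kappa> * (2 * F2 q + q * F3 q)"
  have Hd: "(H has_real_derivative H1 r) (at r)" if "r \<in> I" for r
    unfolding H_def H1_def by (auto intro!: derivative_eq_intros F_deriv[OF that] simp: algebra_simps)
  have H1d: "(H1 has_real_derivative H2) (at q)"
    unfolding H2_def H1_def[abs_def] using x
    by (auto intro!: derivative_eq_intros F_deriv simp: q_def algebra_simps)
  have ric: "ricci_form (radial_form F) x $ i $ j = - (of_real (H1 q) * kd i j + of_real H2 * cnj (x $ i) * x $ j)" for i j
    unfolding q_def
  proof (rule ricci_form_radial[OF x _ Hd])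
    show "ln (F1 r ^ (CARD('n) - 1) * (F1 r + r * F2 r)) = H r" if "r \<in> I" for r
      using ode[OF that] by (simp add: H_def)
    show "(H1 has_real_derivative H2) (at ((norm x)\<^sup>2))" using H1d by (simp add: q_def)
  qed
  have dV: "d_z i (\<lambda>y. (of_real \<kappa> *s y) $ m) x = of_real \<kappa> * kd i m" for i m
  proof -
    have "((\<lambda>y. (of_real \<kappa> *s y) $ m) has_derivative (\<lambda>h. of_real \<kappa> * h $ m)) (at x)"
      using has_derivative_mult_right[OF has_derivative_vec_nth, of "of_real \<kappa>" m x] by simp
    note D = this
    show ?thesis unfolding d_z_eqI[OF D] by (simp add: axis_def complex_eq_iff)
  qed
  have xV: "x \<bullet> (of_real \<kappa> *s x) = \<kappa> * q"
    by (simp add: inner_herm herm_scale_right herm_self q_def del: of_real_power)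
  have "lie_derivative (\<lambda>x. of_real \<kappa> *s x) (radial_form F) x $ i $ j =
     of_real (2 * \<kappa> * (F1 q + q * F2 q)) * kd i j + of_real (2 * \<kappa> * (2 * F2 q + q * F3 q)) * cnj (x $ i) * x $ j" for i j
  proof -
    have fd: "frechet_derivative (\<lambda>y. radial_form F y $ i $ j) (at x) h =
      of_real (F2 ((norm x)\<^sup>2) * (2 * (x \<bullet> h))) * kd i j + of_real (F3 ((norm x)\<^sup>2) * (2 * (x \<bullet> h))) * cnj (x $ i) * x $ j
        + of_real (F2 ((norm x)\<^sup>2)) * (cnj (h $ i) * x $ j + cnj (x $ i) * h $ j)" for h
      by (simp add: frechet_derivative_at[OF radial_form_has_derivative[OF x], symmetric])
    have 1: "(\<Sum>m\<in>UNIV. radial_form F x $ m $ j * (of_real \<kappa> * kd i m)) = of_real \<kappa> * radial_form F x $ i $ j"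
      by (simp add: mult_ac if_distrib[of "\<lambda>u. _ * u"] cong: if_cong)
    have 2: "(\<Sum>m\<in>UNIV. radial_form F x $ i $ m * cnj (of_real \<kappa> * kd j m)) = of_real \<kappa> * radial_form F x $ i $ j"
      by (simp add: mult_ac if_distrib[of "\<lambda>u. _ * u"] if_distrib[of cnj] cong: if_cong)
    show ?thesis
      unfolding lie_derivative_def dV
      by (simp only: vec_lambda_beta fd 1 2 xV, simp only: radial_form_eq[OF x] flip: q_def)
         (simp add: algebra_simps)
  qed
  note L = this
  show "ricci_form (radial_form F) x = lam *\<^sub>R radial_form F x + lie_derivative (\<lambda>x. of_real \<kappa> *s x) (radial_form F) x"
    unfolding vec_eq_iff
  proof (intro allI)
    show "ricci_form (radial_form F) x $ i $ j =
       (lam *\<^sub>R radial_form F x + lie_derivative (\<lambda>x. of_real \<kappa> *s x) (radial_form F) x) $ i $ j" for i j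
      unfolding vector_add_component vector_scaleR_component ric L radial_form_eq[OF x] H1_def H2_def
      by (simp add: scaleR_conv_of_real[where 'a=complex] flip: q_def) (simp add: algebra_simps)
  qed
qed

end

section \<open>Locally bounded families of holomorphic functions\<close>

abbreviation dird :: "('a::real_normed_vector \<Rightarrow> 'b::real_normed_vector) \<Rightarrow> 'a \<Rightarrow> 'a \<Rightarrow> 'b" where
  "dird g v x \<equiv> frechet_derivative g (at x) v"

lemma dirdI:
  assumes "(g has_derivative D) (at x)"
  shows "dird g v x = D v"
  by (simp add: frechet_derivative_at[OF assms, symmetric])

lemma ball_subset_ballI:
  fixes x :: "'a::metric_space"
  assumes "dist x y + r \<le> s"
  shows "ball y r \<subseteq> ball x s"
proof
  fix z assume "z \<in> ball y r"
  then show "z \<in> ball x s" using assms dist_triangle[of x z y] by simp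
qed

text \<open>The pairing of two families of functions is handled as a holomorphic function on the product space
  with the second factor conjugated, hence the abstract complex structure \<open>sc\<close>.\<close>

locale complex_scaling =
  fixes sc :: "complex \<Rightarrow> 'a::real_normed_vector \<Rightarrow> 'a"
  assumes sc_add_left: "sc (a + b) v = sc a v + sc b v"
    and sc_add_right: "sc a (v + w) = sc a v + sc a w"
    and sc_sc: "sc a (sc b v) = sc (a * b) v"
    and sc_real: "sc (complex_of_real r) v = r *\<^sub>R v"
    and norm_sc: "norm (sc a v) = cmod a * norm v"
begin

definition hol :: "'a set \<Rightarrow> ('a \<Rightarrow> complex) \<Rightarrow> bool" where
  "hol S g \<longleftrightarrow> (\<forall>x\<in>S. \<exists>D. (g has_derivative D) (at x) \<and> (\<forall>a v. D (sc a v) = a * D v))"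

lemma sc_1: "sc 1 v = v"
  using sc_real[of 1 v] by simp

lemma sc_0: "sc 0 v = 0"
  using sc_real[of 0 v] by simp

lemma bounded_linear_sc_left: "bounded_linear (\<lambda>a. sc a v)"
proof (rule bounded_linear_intro[where K="norm v"])
  show "sc (r *\<^sub>R a) v = r *\<^sub>R sc a v" for r a
    by (metis scaleR_conv_of_real sc_real sc_sc)
qed (auto simp: sc_add_left norm_sc)

lemma holD:
  assumes "hol S g" "x \<in> S"
  shows "(g has_derivative frechet_derivative g (at x)) (at x)"
    and "dird g (sc a v) x = a * dird g v x"
proof -
  from assms obtain D where D: "(g has_derivative D) (at x)" "\<forall>a v. D (sc a v) = a * D v"
    unfolding hol_def by blast
  then have "D = frechet_derivative g (at x)" by (simp add: frechet_derivative_at)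
  with D show "(g has_derivative frechet_derivative g (at x)) (at x)"
    and "dird g (sc a v) x = a * dird g v x" by auto
qed

lemma holI:
  assumes "\<And>x. x \<in> S \<Longrightarrow> (g has_derivative D x) (at x)"
    and "\<And>x a v. x \<in> S \<Longrightarrow> D x (sc a v) = a * D x v"
  shows "hol S g"
  unfolding hol_def using assms by blast

lemma hol_subset: "hol S g \<Longrightarrow> T \<subseteq> S \<Longrightarrow> hol T g"
  unfolding hol_def by blast

lemma hol_local:
  assumes "\<And>x. x \<in> S \<Longrightarrow> \<exists>T. x \<in> T \<and> hol T g"
  shows "hol S g"
  using assms unfolding hol_def by blast

lemma dird_linear:
  assumes "hol S g" "x \<in> S"
  shows "linear (frechet_derivative g (at x))"
  using holD(1)[OF assms] has_derivative_linear by blast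

lemma hol_line:
  assumes "hol S g" "x + sc z v \<in> S"
  shows "((\<lambda>z. g (x + sc z v)) has_field_derivative dird g v (x + sc z v)) (at z)"
proof -
  have 1: "((\<lambda>z. x + sc z v) has_derivative (\<lambda>a. sc a v)) (at z)"
    using bounded_linear_imp_has_derivative[OF bounded_linear_sc_left, of v "at z"]
    by (auto intro!: derivative_eq_intros)
  have "((\<lambda>z. g (x + sc z v)) has_derivative (\<lambda>a. dird g (sc a v) (x + sc z v))) (at z)"
    using has_derivative_compose[OF 1] holD(1)[OF assms] by blast
  then show ?thesis
    unfolding has_field_derivative_def holD(2)[OF assms]
    by (rule has_derivative_eq_rhs) (simp add: fun_eq_iff mult.commute)
qed

lemma hol_line_deriv:
  assumes "hol S g" "x \<in> S"
  shows "deriv (\<lambda>z. g (x + sc z v)) 0 = dird g v x"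
  using hol_line[of S g x 0 v] assms by (simp add: sc_0 DERIV_imp_deriv)

lemma cauchy_first:
  assumes "hol S g" "ball x \<rho> \<subseteq> S" "\<rho> > 0" "\<And>y. y \<in> ball x \<rho> \<Longrightarrow> cmod (g y) \<le> M"
  shows "cmod (dird g v x) \<le> 2 * M * norm v / \<rho>"
proof (cases "v = 0")
  case True
  have "x \<in> S" using assms by auto
  then show ?thesis using True dird_linear[OF assms(1)] by (simp add: linear_0)
next
  case False
  \<comment> \<open>Half the parameter at which the complex line leaves the ball, so that the closed
    disc stays inside; this is the factor 2 in the bound.\<close>
  define r where "r = \<rho> / (2 * norm v)"
  have r: "r > 0" using False assms by (simp add: r_def)
  have xS: "x \<in> S" using assms by auto
  have mem: "x + sc z v \<in> ball x \<rho>" if "z \<in> cball 0 r" for z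
  proof -
    have "cmod z * norm v \<le> r * norm v" using that by (intro mult_right_mono) auto
    also have "\<dots> = \<rho>/2" using False by (simp add: r_def)
    also have "\<dots> < \<rho>" using assms by simp
    finally show ?thesis by (simp add: dist_norm norm_sc)
  qed
  have d: "((\<lambda>z. g (x + sc z v)) has_field_derivative dird g v (x + sc z v)) (at z)"
    if "z \<in> cball 0 r" for z
    using hol_line[OF assms(1)] mem[OF that] assms(2) by blast
  have "cmod ((deriv ^^ 1) (\<lambda>z. g (x + sc z v)) 0) \<le> fact 1 * M / r ^ 1"
  proof (rule Cauchy_inequality)
    show "(\<lambda>z. g (x + sc z v)) holomorphic_on ball 0 r"
      unfolding holomorphic_on_open[OF open_ball] using d by (meson ball_subset_cball subsetD)
    show "continuous_on (cball 0 r) (\<lambda>z. g (x + sc z v))"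
      by (rule DERIV_continuous_on[OF DERIV_subset[OF d]]) auto
    show "cmod (g (x + sc z v)) \<le> M" if "cmod (0 - z) = r" for z
      using assms(4) mem that by auto
  qed (rule r)
  then show ?thesis using False by (simp add: hol_line_deriv[OF assms(1) xS] r_def field_simps)
qed

text \<open>Taylor's formula on the complex line through \<open>x\<close> and \<open>x + h\<close>,
  with \<open>x + h\<close> at parameter 1. The line stays in the ball for parameters below
  \<open>R = \<rho> / norm h\<close>, and \<open>R \<ge> 4\<close> leaves room for discs of radius
  \<open>R / 2\<close> around all points of the unit disc; Cauchy's inequality there gives the
  constant \<open>8 = fact 2 * 4\<close>. The bound depends on \<open>g\<close> only through
  \<open>M\<close>, so it is uniform in a bounded family.\<close>

lemma cauchy_second:
  assumes "hol S g" "ball x \<rho> \<subseteq> S" "\<rho> > 0" "\<And>y. y \<in> ball x \<rho> \<Longrightarrow> cmod (g y) \<le> M"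
    and h: "norm h \<le> \<rho> / 4"
  shows "cmod (g (x + h) - g x - dird g h x) \<le> 8 * M / \<rho>\<^sup>2 * (norm h)\<^sup>2"
proof (cases "h = 0")
  case True
  have "x \<in> S" using assms by auto
  then show ?thesis using True dird_linear[OF assms(1)] by (simp add: linear_0)
next
  case False
  define R where "R = \<rho> / norm h"
  define \<phi> where "\<phi> = (\<lambda>z. g (x + sc z h))"
  have R: "R \<ge> 4" using False h assms(3) by (simp add: R_def field_simps)
  have xS: "x \<in> S" using assms by auto
  have mem: "x + sc z h \<in> ball x \<rho>" if "z \<in> ball 0 R" for z
  proof -
    have "cmod z * norm h < R * norm h" using that False by (intro mult_strict_right_mono) auto
    also have "\<dots> = \<rho>" using False by (simp add: R_def)
    finally show ?thesis by (simp add: dist_norm norm_sc)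
  qed
  have d: "(\<phi> has_field_derivative dird g h (x + sc z h)) (at z)" if "z \<in> ball 0 R" for z
    using hol_line[OF assms(1)] mem[OF that] assms(2) unfolding \<phi>_def by blast
  have hol\<phi>: "\<phi> holomorphic_on ball 0 R"
    unfolding holomorphic_on_open[OF open_ball] using d by blast
  have b2: "cmod ((deriv ^^ 2) \<phi> w) \<le> fact 2 * M / (R/2) ^ 2" if w: "w \<in> cball 0 1" for w
  proof (rule Cauchy_inequality)
    have sub: "cball w (R/2) \<subseteq> ball 0 R"
    proof
      fix z assume "z \<in> cball w (R/2)"
      then have "norm (z - w) \<le> R/2" by (simp add: dist_norm norm_minus_commute)
      then have "norm z \<le> 1 + R/2" using w norm_triangle_ineq[of "z-w" w] by simp
      then show "z \<in> ball 0 R" using R by simp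
    qed
    show "\<phi> holomorphic_on ball w (R/2)"
      using hol\<phi> sub by (meson ball_subset_cball holomorphic_on_subset order_trans)
    show "continuous_on (cball w (R/2)) \<phi>"
      using hol\<phi> sub by (meson holomorphic_on_imp_continuous_on continuous_on_subset)
    show "cmod (\<phi> z) \<le> M" if "cmod (w - z) = R/2" for z
      using sub that mem[of z] assms(4) by (auto simp: \<phi>_def dist_norm)
    show "0 < R/2" using R by simp
  qed
  have "cmod ((deriv ^^ 0) \<phi> 1 - (\<Sum>i\<le>1. (deriv ^^ i) \<phi> 0 * (1 - 0) ^ i / fact i))
        \<le> (fact 2 * M / (R/2) ^ 2) * cmod (1 - 0) ^ Suc 1 / fact 1"
  proof (rule complex_Taylor[where S="cball 0 1" and f="\<lambda>i. (deriv ^^ i) \<phi>"])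
    show "((deriv ^^ i) \<phi> has_field_derivative (deriv ^^ Suc i) \<phi> z) (at z within cball 0 1)"
      if "z \<in> cball 0 1" for i z
    proof -
      have "(deriv ^^ i) \<phi> holomorphic_on ball 0 R"
        using hol\<phi> by (simp add: holomorphic_higher_deriv)
      moreover have "z \<in> ball 0 R" using that R by simp
      ultimately show ?thesis
        using holomorphic_derivI[of "(deriv ^^ i) \<phi>" "ball 0 R" z "cball 0 1"] by simp
    qed
    show "cmod ((deriv ^^ Suc 1) \<phi> w) \<le> fact 2 * M / (R/2) ^ 2" if "w \<in> cball 0 1" for w
      using b2[OF that] by (simp add: numeral_2_eq_2)
  qed auto
  moreover have "deriv \<phi> 0 = dird g h x" unfolding \<phi>_def by (rule hol_line_deriv[OF assms(1) xS])
  moreover have "fact 2 * M / (R/2)^2 = 8 * M / \<rho>\<^sup>2 * (norm h)\<^sup>2"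
    using False assms(3) by (simp add: R_def field_simps power2_eq_square)
  ultimately show ?thesis by (simp add: \<phi>_def sc_1 sc_0 diff_diff_eq)
qed

text \<open>By \<open>cauchy_second\<close> the difference quotient of \<open>g J\<close> at a fixed
  step differs from the derivative by an amount bounded independently of \<open>J\<close>. So
  pointwise convergence of the functions forces convergence of the derivatives, and the same
  quadratic bound passes to the limit and gives differentiability.\<close>

lemma hol_limit:
  assumes "open S" and hg: "\<And>J::nat. hol S (g J)"
    and bd: "\<And>x. x \<in> S \<Longrightarrow> \<exists>\<rho>>0. \<exists>M. \<forall>J. \<forall>y\<in>ball x \<rho>. cmod (g J y) \<le> M"
    and lim: "\<And>x. x \<in> S \<Longrightarrow> (\<lambda>J. g J x) \<longlonglongrightarrow> G x"
  shows "hol S G" and "\<And>x v. x \<in> S \<Longrightarrow> (\<lambda>J. dird (g J) v x) \<longlonglongrightarrow> dird G v x"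
proof -
  have main: "\<exists>D. (G has_derivative D) (at x) \<and> (\<forall>a v. D (sc a v) = a * D v) \<and>
       (\<forall>v. (\<lambda>J. dird (g J) v x) \<longlonglongrightarrow> D v)" if xS: "x \<in> S" for x
  proof -
    obtain \<rho>1 M where \<rho>1: "\<rho>1 > 0" "\<And>J y. y \<in> ball x \<rho>1 \<Longrightarrow> cmod (g J y) \<le> M"
      using bd[OF xS] by blast
    obtain \<rho>2 where \<rho>2: "\<rho>2 > 0" "ball x \<rho>2 \<subseteq> S" using \<open>open S\<close> xS by (meson open_contains_ball)
    define \<rho> where "\<rho> = min \<rho>1 \<rho>2"
    have \<rho>: "\<rho> > 0" "ball x \<rho> \<subseteq> S" "\<And>J y. y \<in> ball x \<rho> \<Longrightarrow> cmod (g J y) \<le> M"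
      using \<rho>1 \<rho>2 by (auto simp: \<rho>_def)
    have "M \<ge> 0" using \<rho>(3)[of x 0] \<rho>(1) norm_ge_zero order_trans by (metis centre_in_ball)
    define C where "C = 8 * M / \<rho>\<^sup>2"
    have C: "C \<ge> 0" using \<open>M \<ge> 0\<close> by (simp add: C_def)
    have E: "cmod (g J (x + h) - g J x - dird (g J) h x) \<le> C * (norm h)\<^sup>2" if "norm h \<le> \<rho>/4" for J h
      unfolding C_def using cauchy_second[OF hg \<rho>(2,1) \<rho>(3) that] by blast
    have inS: "x + h \<in> S" if "norm h \<le> \<rho>/4" for h
      using that \<rho>(1,2) by (intro subsetD[OF \<rho>(2)]) (auto simp: dist_norm)
    have Cau: "Cauchy (\<lambda>J. dird (g J) v x)" for v
    proof (rule CauchyI)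
      fix e :: real assume e: "e > 0"
      \<comment> \<open>The first bound keeps \<open>x + t *\<^sub>R v\<close> in the range of the
        quadratic estimate, the second makes its error, divided by \<open>t\<close>, at most
        \<open>e / 4\<close>; the added ones avoid division by zero.\<close>
      define t where "t = min (\<rho> / (4 * (norm v + 1))) (e / (4 * (C + 1) * ((norm v)\<^sup>2 + 1)))"
      have "norm v + 1 > 0" "C + 1 > 0" "(norm v)\<^sup>2 + 1 > 0"
        using C by (auto intro: add_nonneg_pos)
      then have t: "t > 0" using \<rho>(1) e by (simp add: t_def)
      have t1: "norm (t *\<^sub>R v) \<le> \<rho>/4"
      proof -
        have "norm (t *\<^sub>R v) = t * norm v" using t by simp
        also have "\<dots> \<le> \<rho> / (4 * (norm v + 1)) * norm v"
          by (rule mult_right_mono) (simp_all add: t_def)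
        also have "\<dots> \<le> \<rho> / (4 * (norm v + 1)) * (norm v + 1)" using \<rho>(1)
          by (intro mult_left_mono) auto
        also have "\<dots> = \<rho>/4" using norm_ge_zero[of v]
          by (simp add: field_simps add_nonneg_eq_0_iff)
        finally show ?thesis .
      qed
      have t2: "C * t * (norm v)\<^sup>2 \<le> e/4"
      proof -
        have p: "0 < (C + 1) * ((norm v)\<^sup>2 + 1)" using C by (intro mult_pos_pos) (auto intro: add_nonneg_pos)
        have "C * t * (norm v)\<^sup>2 = t * (C * (norm v)\<^sup>2)" by simp
        also have "\<dots> \<le> t * ((C + 1) * ((norm v)\<^sup>2 + 1))" using t C
          by (intro mult_left_mono mult_mono) auto
        also have "\<dots> \<le> e / (4 * (C + 1) * ((norm v)\<^sup>2 + 1)) * ((C + 1) * ((norm v)\<^sup>2 + 1))"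
          using p by (intro mult_right_mono) (auto simp: t_def)
        also have "\<dots> = e/4" using p by (simp add: field_simps)
        finally show ?thesis .
      qed
      have "Cauchy (\<lambda>J. g J (x + t *\<^sub>R v) - g J x)"
        by (intro LIMSEQ_imp_Cauchy[OF tendsto_diff[OF lim[OF inS[OF t1]] lim[OF xS]]])
      then obtain N where N: "\<And>m n. m \<ge> N \<Longrightarrow> n \<ge> N \<Longrightarrow>
          cmod ((g m (x + t *\<^sub>R v) - g m x) - (g n (x + t *\<^sub>R v) - g n x)) < t * (e/4)"
        using t e unfolding Cauchy_iff by (meson mult_pos_pos zero_less_divide_iff zero_less_numeral)
      have "cmod (dird (g m) v x - dird (g n) v x) < e" if "m \<ge> N" "n \<ge> N" for m n
      proof -
        define a where "a J = g J (x + t *\<^sub>R v) - g J x" for J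
        have lin: "dird (g J) (t *\<^sub>R v) x = t *\<^sub>R dird (g J) v x" for J
          using dird_linear[OF hg xS] by (simp add: linear_scale)
        have b: "cmod (a J - t *\<^sub>R dird (g J) v x) \<le> t * (e/4)" for J
        proof -
          have "cmod (a J - t *\<^sub>R dird (g J) v x) \<le> C * (norm (t *\<^sub>R v))\<^sup>2"
            using E[OF t1, of J] by (simp add: a_def lin)
          also have "\<dots> = t * (C * t * (norm v)\<^sup>2)" by (simp add: power2_eq_square)
          also have "\<dots> \<le> t * (e/4)" using t2 t by (intro mult_left_mono) auto
          finally show ?thesis .
        qed
        have "t * cmod (dird (g m) v x - dird (g n) v x) = cmod (t *\<^sub>R (dird (g m) v x - dird (g n) v x))"
          using t by simp
        also have "t *\<^sub>R (dird (g m) v x - dird (g n) v x)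
          = (a m - a n) - (a m - t *\<^sub>R dird (g m) v x) + (a n - t *\<^sub>R dird (g n) v x)"
          by (simp add: algebra_simps)
        also have "cmod \<dots> \<le> cmod (a m - a n) + cmod (a m - t *\<^sub>R dird (g m) v x) + cmod (a n - t *\<^sub>R dird (g n) v x)"
          by (meson norm_triangle_ineq norm_triangle_ineq4 order_trans add_mono order_refl)
        also have "\<dots> < t * (e/4) + t * (e/4) + t * (e/4)"
          using N[OF that, folded a_def] b[of m] b[of n] by linarith
        also have "\<dots> \<le> t * e" using t e by (simp add: field_simps)
        finally show ?thesis using t by simp
      qed
      then show "\<exists>N. \<forall>m\<ge>N. \<forall>n\<ge>N. cmod (dird (g m) v x - dird (g n) v x) < e" by blast
    qed
    define D where "D v = lim (\<lambda>J. dird (g J) v x)" for v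
    have D: "(\<lambda>J. dird (g J) v x) \<longlonglongrightarrow> D v" for v
      unfolding D_def using Cau Cauchy_convergent convergent_LIMSEQ_iff by blast
    have Dsc: "D (sc a v) = a * D v" for a v
    proof -
      have "(\<lambda>J. dird (g J) (sc a v) x) \<longlonglongrightarrow> a * D v"
        unfolding holD(2)[OF hg xS] by (intro tendsto_intros D)
      then show ?thesis using D LIMSEQ_unique by blast
    qed
    have bl: "bounded_linear D"
    proof (rule bounded_linear_intro)
      show "D (v + w) = D v + D w" for v w
      proof -
        have "(\<lambda>J. dird (g J) (v + w) x) \<longlonglongrightarrow> D v + D w"
          unfolding linear_add[OF dird_linear[OF hg xS]] by (intro tendsto_intros D)
        then show ?thesis using D LIMSEQ_unique by blast
      qed
      show "D (r *\<^sub>R v) = r *\<^sub>R D v" for r v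
        using Dsc[of "complex_of_real r" v] by (simp add: sc_real scaleR_conv_of_real)
      show "cmod (D v) \<le> norm v * (2 * M / \<rho>)" for v
      proof (rule tendsto_upperbound[OF tendsto_norm[OF D]])
        show "\<forall>\<^sub>F J in sequentially. cmod (dird (g J) v x) \<le> norm v * (2 * M / \<rho>)"
          using cauchy_first[OF hg \<rho>(2,1) \<rho>(3), of _ v] by (simp add: mult.commute mult.left_commute)
      qed simp
    qed
    have EG: "cmod (G (x + h) - G x - D h) \<le> C * (norm h)\<^sup>2" if "norm h \<le> \<rho>/4" for h
    proof (rule tendsto_upperbound)
      show "(\<lambda>J. cmod (g J (x + h) - g J x - dird (g J) h x)) \<longlonglongrightarrow> cmod (G (x + h) - G x - D h)"
        by (intro tendsto_intros lim D inS xS that)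
    qed (use E[OF that] in auto)
    have "(G has_derivative D) (at x)"
    proof (rule has_derivativeI_sandwich[where e="\<rho>/4" and H="\<lambda>y. C * norm (y - x)"])
      show "cmod (G y - G x - D (y - x)) / norm (y - x) \<le> C * norm (y - x)"
        if "y \<noteq> x" "dist y x < \<rho>/4" for y
        using EG[of "y - x"] that by (simp add: dist_norm field_simps power2_eq_square)
      show "((\<lambda>y. C * norm (y - x)) \<longlongrightarrow> 0) (at x)"
        by (rule tendsto_eq_intros refl | simp)+
    qed (use \<rho> bl in auto)
    then show ?thesis using D Dsc by blast
  qed
  show "hol S G" unfolding hol_def using main by blast
  fix x v assume "x \<in> S"
  from main[OF this] show "(\<lambda>J. dird (g J) v x) \<longlonglongrightarrow> dird G v x"
    by (metis frechet_derivative_at)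
qed

lemma hol_const [intro]: "hol S (\<lambda>x. c)"
  by (rule holI) (auto intro: derivative_eq_intros)

lemma hol_add:
  assumes "hol S f" "hol S g"
  shows "hol S (\<lambda>x. f x + g x)"
    and "x \<in> S \<Longrightarrow> dird (\<lambda>x. f x + g x) v x = dird f v x + dird g v x"
proof -
  have d: "((\<lambda>x. f x + g x) has_derivative (\<lambda>v. dird f v x + dird g v x)) (at x)" if "x \<in> S" for x
    by (intro has_derivative_add holD(1)[OF _ that] assms)
  show "hol S (\<lambda>x. f x + g x)"
    by (rule holI[OF d]) (auto simp: holD(2)[OF assms(1)] holD(2)[OF assms(2)] algebra_simps)
  show "x \<in> S \<Longrightarrow> dird (\<lambda>x. f x + g x) v x = dird f v x + dird g v x"
    by (rule dirdI[OF d])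
qed

lemma hol_mult:
  assumes "hol S f" "hol S g"
  shows "hol S (\<lambda>x. f x * g x)"
    and "x \<in> S \<Longrightarrow> dird (\<lambda>x. f x * g x) v x = f x * dird g v x + dird f v x * g x"
proof -
  have d: "((\<lambda>x. f x * g x) has_derivative (\<lambda>v. f x * dird g v x + dird f v x * g x)) (at x)" if "x \<in> S" for x
    by (intro has_derivative_mult holD(1)[OF _ that] assms)
  show "hol S (\<lambda>x. f x * g x)"
    by (rule holI[OF d]) (auto simp: holD(2)[OF assms(1)] holD(2)[OF assms(2)] algebra_simps)
  show "x \<in> S \<Longrightarrow> dird (\<lambda>x. f x * g x) v x = f x * dird g v x + dird f v x * g x"
    by (rule dirdI[OF d])
qed

lemma hol_sum:
  assumes "\<And>j. j \<in> I \<Longrightarrow> hol S (f j)"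
  shows "hol S (\<lambda>x. \<Sum>j\<in>I. f j x)"
    and "x \<in> S \<Longrightarrow> dird (\<lambda>x. \<Sum>j\<in>I. f j x) v x = (\<Sum>j\<in>I. dird (f j) v x)"
proof -
  have d: "((\<lambda>x. \<Sum>j\<in>I. f j x) has_derivative (\<lambda>v. \<Sum>j\<in>I. dird (f j) v x)) (at x)" if "x \<in> S" for x
    by (intro has_derivative_sum holD(1)[OF _ that] assms)
  show "hol S (\<lambda>x. \<Sum>j\<in>I. f j x)"
    by (rule holI[OF d]) (auto simp: holD(2)[OF assms] sum_distrib_left)
  show "x \<in> S \<Longrightarrow> dird (\<lambda>x. \<Sum>j\<in>I. f j x) v x = (\<Sum>j\<in>I. dird (f j) v x)"
    by (rule dirdI[OF d])
qed

lemma hol_locally_bounded: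
  assumes "hol S g" "x \<in> S"
  obtains \<rho> M where "\<rho> > 0" "M \<ge> 0" "\<And>y. y \<in> ball x \<rho> \<Longrightarrow> cmod (g y) \<le> M"
proof -
  have "isCont g x" using holD(1)[OF assms] by (rule has_derivative_continuous)
  then obtain \<rho> where \<rho>: "\<rho> > 0" "\<And>y. dist y x < \<rho> \<Longrightarrow> dist (g y) (g x) < 1"
    unfolding continuous_at_eps_delta by (meson zero_less_one)
  show ?thesis
  proof (rule that[of \<rho> "cmod (g x) + 1"])
    fix y assume "y \<in> ball x \<rho>"
    then have "cmod (g y - g x) < 1" using \<rho>(2)[of y] by (simp add: dist_commute[of x y] flip: dist_norm)
    then show "cmod (g y) \<le> cmod (g x) + 1" using norm_triangle_ineq2[of "g y" "g x"] by simp
  qed (use \<rho> in auto)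
qed

lemma hol_translate:
  assumes "hol T g" "\<And>y. y \<in> S \<Longrightarrow> y + w \<in> T"
  shows "hol S (\<lambda>y. g (y + w))"
proof (rule holI)
  fix x assume x: "x \<in> S"
  have "((\<lambda>y. y + w) has_derivative (\<lambda>v. v)) (at x)"
    by (auto intro!: derivative_eq_intros)
  from has_derivative_compose[OF this holD(1)[OF assms(1) assms(2)[OF x]]]
  show "((\<lambda>y. g (y + w)) has_derivative frechet_derivative g (at (x + w))) (at x)" .
  show "dird g (sc a v) (x + w) = a * dird g v (x + w)" for a v
    using holD(2)[OF assms(1) assms(2)[OF x]] .
qed

text \<open>Difference quotients with real steps are holomorphic by translation. By
  \<open>cauchy_second\<close> they converge to the directional derivative with an error
  proportional to the step, so \<open>hol_limit\<close> applies.\<close>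

lemma hol_dird:
  assumes g: "hol S g" and S: "open S"
  shows "hol S (dird g v)"
proof (rule hol_local)
  fix x assume xS: "x \<in> S"
  obtain \<rho>1 M where \<rho>1: "\<rho>1 > 0" "M \<ge> 0" "\<And>y. y \<in> ball x \<rho>1 \<Longrightarrow> cmod (g y) \<le> M"
    using hol_locally_bounded[OF g xS] by blast
  obtain \<rho>2 where \<rho>2: "\<rho>2 > 0" "ball x \<rho>2 \<subseteq> S" using S xS by (meson open_contains_ball)
  define \<rho> where "\<rho> = min \<rho>1 \<rho>2 / 2"
  have \<rho>: "\<rho> > 0" "ball x (2 * \<rho>) \<subseteq> S" "\<And>y. y \<in> ball x (2 * \<rho>) \<Longrightarrow> cmod (g y) \<le> M"
    using \<rho>1 \<rho>2 by (auto simp: \<rho>_def)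
  have bsub: "ball y \<rho> \<subseteq> ball x (2 * \<rho>)" if "y \<in> ball x \<rho>" for y
    using that by (intro ball_subset_ballI) auto
  define \<tau> where "\<tau> = \<rho> / (4 * (norm v + 1))"
  have nv: "norm v + 1 > 0" by (simp add: add_nonneg_pos)
  have \<tau>: "\<tau> > 0" using \<rho> nv by (simp add: \<tau>_def)
  define t where "t J = \<tau> / real (Suc J)" for J
  have t: "t J > 0" "t J \<le> \<tau>" for J using \<tau> by (auto simp: t_def field_simps)
  have tv: "norm (t J *\<^sub>R v) \<le> \<rho> / 4" for J
  proof -
    have "norm (t J *\<^sub>R v) = t J * norm v" using t(1)[of J] by simp
    also have "\<dots> \<le> \<tau> * (norm v + 1)" using t[of J] \<tau> by (intro mult_mono) auto
    also have "\<dots> = \<rho>/4" using nv by (simp add: \<tau>_def field_simps)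
    finally show ?thesis .
  qed
  define q where "q J y = (g (y + t J *\<^sub>R v) - g y) / of_real (t J)" for J y
  define C where "C = 8 * M / \<rho>\<^sup>2 * (norm v)\<^sup>2"
  have C: "C \<ge> 0" using \<rho>1(2) by (simp add: C_def)
  have key: "cmod (q J y - dird g v y) \<le> C * t J" if y: "y \<in> ball x \<rho>" for J y
  proof -
    have yS: "y \<in> S" using bsub[OF y] \<rho> by (meson centre_in_ball subsetD)
    have "cmod (g (y + t J *\<^sub>R v) - g y - dird g (t J *\<^sub>R v) y) \<le> 8 * M / \<rho>\<^sup>2 * (norm (t J *\<^sub>R v))\<^sup>2"
      by (rule cauchy_second[OF g order_trans[OF bsub[OF y] \<rho>(2)] \<rho>(1) _ tv]) (use bsub[OF y] \<rho>(3) in auto)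
    also have "\<dots> = t J * (C * t J)" by (simp add: C_def power_mult_distrib power2_eq_square)
    finally have 1: "cmod (g (y + t J *\<^sub>R v) - g y - dird g (t J *\<^sub>R v) y) \<le> t J * (C * t J)" .
    have "g (y + t J *\<^sub>R v) - g y - dird g (t J *\<^sub>R v) y = of_real (t J) * (q J y - dird g v y)"
      using t(1)[of J] by (simp add: q_def linear_scale[OF dird_linear[OF g yS]] scaleR_conv_of_real field_simps)
    then have "t J * cmod (q J y - dird g v y) \<le> t J * (C * t J)"
      using 1 t(1)[of J] by (simp add: norm_mult)
    then show ?thesis using t(1)[of J] by (simp only: mult_le_cancel_left_pos)
  qed
  have "hol (ball x \<rho>) (dird g v)"
  proof (rule hol_limit(1)[where g=q])
    fix J
    have "hol (ball x \<rho>) (\<lambda>y. g (y + t J *\<^sub>R v))"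
    proof (rule hol_translate[OF g])
      fix y assume y: "y \<in> ball x \<rho>"
      have "y + t J *\<^sub>R v \<in> ball y \<rho>" using tv[of J] \<rho>(1) by (simp add: dist_norm)
      then show "y + t J *\<^sub>R v \<in> S" using bsub[OF y] \<rho>(2) by blast
    qed
    moreover have "hol (ball x \<rho>) g"
      using g by (rule hol_subset) (use bsub[of x] \<rho> in auto)
    ultimately have "hol (ball x \<rho>) (\<lambda>y. (g (y + t J *\<^sub>R v) + (-1) * g y) * (1 / of_real (t J)))"
      by (intro hol_mult(1) hol_add(1) hol_const)
    then show "hol (ball x \<rho>) (q J)" by (simp add: q_def[abs_def])
  next
    fix y assume y: "y \<in> ball x \<rho>"
    define r where "r = \<rho> - dist x y"
    have r: "r > 0" using y by (simp add: r_def)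
    have "cmod (q J w) \<le> 2 * M * norm v / \<rho> + C * \<tau>" if "w \<in> ball y r" for J w
    proof -
      have w: "w \<in> ball x \<rho>" using that dist_triangle[of x w y] by (simp add: r_def)
      have "cmod (dird g v w) \<le> 2 * M * norm v / \<rho>"
        by (rule cauchy_first[OF g order_trans[OF bsub[OF w] \<rho>(2)] \<rho>(1)]) (use bsub[OF w] \<rho>(3) in auto)
      moreover have "C * t J \<le> C * \<tau>" using C t by (intro mult_left_mono) auto
      ultimately show ?thesis using key[OF w, of J] norm_triangle_sub[of "q J w" "dird g v w"] by simp
    qed
    then show "\<exists>\<rho>>0. \<exists>M. \<forall>J. \<forall>w\<in>ball y \<rho>. cmod (q J w) \<le> M" using r by blast
    have t0: "t \<longlonglongrightarrow> 0"
      unfolding t_def using LIMSEQ_Suc[OF lim_const_over_n[of \<tau>]] by simp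
    have "(\<lambda>J. q J y - dird g v y) \<longlonglongrightarrow> 0"
    proof (rule tendsto_norm_zero_cancel, rule tendsto_sandwich[where f="\<lambda>_. 0"])
      show "(\<lambda>J. C * t J) \<longlonglongrightarrow> 0" using tendsto_mult_right_zero[OF t0] .
    qed (use key[OF y] in auto)
    then show "(\<lambda>J. q J y) \<longlonglongrightarrow> dird g v y" by (rule LIM_zero_cancel)
  qed simp
  then show "\<exists>T. x \<in> T \<and> hol T (dird g v)" using \<rho>(1) by (meson centre_in_ball)
qed

text \<open>The bounds on the partial sums make \<open>s\<close> a holomorphic map into \<open>\<ell>\<^sup>2\<close>.\<close>

definition lb :: "'a set \<Rightarrow> (nat \<Rightarrow> 'a \<Rightarrow> complex) \<Rightarrow> bool" where
  "lb S s \<longleftrightarrow> (\<forall>j. hol S (s j)) \<and>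
     (\<forall>x\<in>S. \<exists>\<rho>>0. \<exists>M. \<forall>y\<in>ball x \<rho>. \<forall>J. (\<Sum>j<J. (cmod (s j y))\<^sup>2) \<le> M)"

lemma lb_hol: "lb S s \<Longrightarrow> hol S (s j)"
  by (simp add: lb_def)

lemma lb_bound:
  assumes "lb S s" "open S" "x \<in> S"
  obtains \<rho> M where "\<rho> > 0" "M \<ge> 0" "ball x \<rho> \<subseteq> S"
    "\<And>y J. y \<in> ball x \<rho> \<Longrightarrow> (\<Sum>j<J. (cmod (s j y))\<^sup>2) \<le> M"
proof -
  obtain \<rho>1 M where 1: "\<rho>1 > 0" "\<And>y J. y \<in> ball x \<rho>1 \<Longrightarrow> (\<Sum>j<J. (cmod (s j y))\<^sup>2) \<le> M"
    using assms unfolding lb_def by blast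
  obtain \<rho>2 where 2: "\<rho>2 > 0" "ball x \<rho>2 \<subseteq> S" using assms by (meson open_contains_ball)
  have "M \<ge> 0" using 1(2)[of x 0] 1(1) by simp
  then show ?thesis using 1 2 by (intro that[of "min \<rho>1 \<rho>2" M]) auto
qed

lemma lb_summable:
  assumes "lb S s" "x \<in> S"
  shows "summable (\<lambda>j. (cmod (s j x))\<^sup>2)"
proof -
  obtain \<rho> M where "\<rho> > 0" "\<And>y J. y \<in> ball x \<rho> \<Longrightarrow> (\<Sum>j<J. (cmod (s j y))\<^sup>2) \<le> M"
    using assms unfolding lb_def by blast
  then show ?thesis by (intro summableI_nonneg_bounded[where x=M]) auto
qed

lemma lb_add:
  assumes "lb S s" "lb S t" "open S"
  shows "lb S (\<lambda>j x. s j x + t j x)"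
  unfolding lb_def
proof (intro conjI allI ballI)
  show "hol S (\<lambda>x. s j x + t j x)" for j
    by (intro hol_add lb_hol assms)
  fix x assume "x \<in> S"
  obtain \<rho>1 M1 where 1: "\<rho>1 > 0" "\<And>y J. y \<in> ball x \<rho>1 \<Longrightarrow> (\<Sum>j<J. (cmod (s j y))\<^sup>2) \<le> M1"
    using lb_bound[OF assms(1,3) \<open>x \<in> S\<close>] by metis
  obtain \<rho>2 M2 where 2: "\<rho>2 > 0" "\<And>y J. y \<in> ball x \<rho>2 \<Longrightarrow> (\<Sum>j<J. (cmod (t j y))\<^sup>2) \<le> M2"
    using lb_bound[OF assms(2,3) \<open>x \<in> S\<close>] by metis
  have sq: "(cmod (a + b))\<^sup>2 \<le> 2 * (cmod a)\<^sup>2 + 2 * (cmod b)\<^sup>2" for a b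
  proof -
    have "(cmod (a + b))\<^sup>2 \<le> (cmod a + cmod b)\<^sup>2" by (intro power_mono norm_triangle_ineq) auto
    also have "\<dots> \<le> 2 * (cmod a)\<^sup>2 + 2 * (cmod b)\<^sup>2" using sum_squares_bound[of "cmod a" "cmod b"]
      by (simp add: power2_sum)
    finally show ?thesis .
  qed
  have "(\<Sum>j<J. (cmod (s j y + t j y))\<^sup>2) \<le> 2 * M1 + 2 * M2" if "y \<in> ball x (min \<rho>1 \<rho>2)" for y J
  proof -
    have "(\<Sum>j<J. (cmod (s j y + t j y))\<^sup>2) \<le> (\<Sum>j<J. 2 * (cmod (s j y))\<^sup>2 + 2 * (cmod (t j y))\<^sup>2)"
      by (intro sum_mono sq)
    also have "\<dots> = 2 * (\<Sum>j<J. (cmod (s j y))\<^sup>2) + 2 * (\<Sum>j<J. (cmod (t j y))\<^sup>2)"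
      by (simp add: sum.distrib sum_distrib_left)
    also have "\<dots> \<le> 2 * M1 + 2 * M2" using 1(2)[of y J] 2(2)[of y J] that by auto
    finally show ?thesis .
  qed
  then show "\<exists>\<rho>>0. \<exists>M. \<forall>y\<in>ball x \<rho>. \<forall>J. (\<Sum>j<J. (cmod (s j y + t j y))\<^sup>2) \<le> M"
    using 1(1) 2(1) by (meson min_less_iff_conj)
qed

lemma lb_mult:
  assumes "hol S a" "lb S s" "open S"
  shows "lb S (\<lambda>j x. a x * s j x)"
  unfolding lb_def
proof (intro conjI allI ballI)
  show "hol S (\<lambda>x. a x * s j x)" for j
    by (intro hol_mult lb_hol assms)
  fix x assume "x \<in> S"
  obtain \<rho>1 M1 where 1: "\<rho>1 > 0" "M1 \<ge> 0" "\<And>y. y \<in> ball x \<rho>1 \<Longrightarrow> cmod (a y) \<le> M1"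
    using hol_locally_bounded[OF assms(1) \<open>x \<in> S\<close>] by metis
  obtain \<rho>2 M2 where 2: "\<rho>2 > 0" "\<And>y J. y \<in> ball x \<rho>2 \<Longrightarrow> (\<Sum>j<J. (cmod (s j y))\<^sup>2) \<le> M2"
    using lb_bound[OF assms(2,3) \<open>x \<in> S\<close>] by metis
  have "(\<Sum>j<J. (cmod (a y * s j y))\<^sup>2) \<le> M1\<^sup>2 * M2" if "y \<in> ball x (min \<rho>1 \<rho>2)" for y J
  proof -
    have "(\<Sum>j<J. (cmod (a y * s j y))\<^sup>2) = (cmod (a y))\<^sup>2 * (\<Sum>j<J. (cmod (s j y))\<^sup>2)"
      by (simp add: norm_mult power_mult_distrib sum_distrib_left)
    also have "\<dots> \<le> M1\<^sup>2 * M2" using 1(2) 1(3)[of y] 2(2)[of y J] that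
      by (intro mult_mono power_mono) (auto intro: sum_nonneg)
    finally show ?thesis .
  qed
  then show "\<exists>\<rho>>0. \<exists>M. \<forall>y\<in>ball x \<rho>. \<forall>J. (\<Sum>j<J. (cmod (a y * s j y))\<^sup>2) \<le> M"
    using 1(1) 2(1) by (meson min_less_iff_conj)
qed

lemma lb_sum:
  assumes "finite I" "\<And>i. i \<in> I \<Longrightarrow> lb S (s i)" "open S"
  shows "lb S (\<lambda>j x. \<Sum>i\<in>I. s i j x)"
  using assms(1,2)
proof (induction I rule: finite_induct)
  case empty
  show ?case unfolding lb_def by (auto intro!: exI[of _ "1::real"])
next
  case (insert i I)
  then show ?case by (simp add: lb_add[OF _ _ assms(3)])
qed

lemma cmod_sum_mult_le:
  "cmod (\<Sum>j\<in>I. a j * b j) \<le> sqrt (\<Sum>j\<in>I. (cmod (a j))\<^sup>2) * sqrt (\<Sum>j\<in>I. (cmod (b j))\<^sup>2)"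
proof -
  have "cmod (\<Sum>j\<in>I. a j * b j) \<le> (\<Sum>j\<in>I. \<bar>cmod (a j)\<bar> * \<bar>cmod (b j)\<bar>)"
    by (rule order_trans[OF norm_sum]) (simp add: norm_mult)
  also have "\<dots> \<le> L2_set (\<lambda>j. cmod (a j)) I * L2_set (\<lambda>j. cmod (b j)) I"
    by (rule L2_set_mult_ineq)
  finally show ?thesis by (simp add: L2_set_def)
qed

text \<open>The derivatives of the family are bounded by duality: Cauchy's inequality is applied to the
  scalar function obtained by pairing the family with its derivatives at the given point.\<close>

lemma lb_dird:
  assumes "lb S s" "open S"
  shows "lb S (\<lambda>j. dird (s j) v)"
  unfolding lb_def
proof (intro conjI allI ballI)
  show "hol S (dird (s j) v)" for j
    by (intro hol_dird lb_hol assms)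
  fix x assume "x \<in> S"
  obtain \<rho>0 M where 0: "\<rho>0 > 0" "M \<ge> 0" "ball x \<rho>0 \<subseteq> S"
      "\<And>y J. y \<in> ball x \<rho>0 \<Longrightarrow> (\<Sum>j<J. (cmod (s j y))\<^sup>2) \<le> M"
    using lb_bound[OF assms \<open>x \<in> S\<close>] by metis
  define \<rho> where "\<rho> = \<rho>0 / 2"
  have \<rho>: "\<rho> > 0" using 0 by (simp add: \<rho>_def)
  have "(\<Sum>j<J. (cmod (dird (s j) v y))\<^sup>2) \<le> (2 * sqrt M * norm v / \<rho>)\<^sup>2" if y: "y \<in> ball x \<rho>" for y J
  proof -
    have bsub: "ball y \<rho> \<subseteq> ball x \<rho>0"
      using y by (intro ball_subset_ballI) (auto simp: \<rho>_def)
    have yS: "y \<in> S" using bsub \<rho> 0(3) by (meson centre_in_ball subsetD)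
    define c where "c j = dird (s j) v y" for j
    define T where "T = (\<Sum>j<J. (cmod (c j))\<^sup>2)"
    have T0: "T \<ge> 0" by (simp add: T_def sum_nonneg)
    define G where "G = (\<lambda>z. \<Sum>j<J. cnj (c j) * s j z)"
    have holG: "hol S G" unfolding G_def by (intro hol_sum hol_mult hol_const lb_hol assms)
    have c0: "dird (\<lambda>z. cnj (c j)) v y = 0" for j by (simp add: frechet_derivative_const)
    have "dird G v y = (\<Sum>j<J. cnj (c j) * c j)"
      unfolding G_def
      by (subst hol_sum(2)[OF _ yS], intro hol_mult hol_const lb_hol assms)
         (simp add: hol_mult(2)[OF hol_const lb_hol[OF assms(1)] yS] c0 c_def)
    also have "\<dots> = of_real T" unfolding T_def of_real_sum by (intro sum.cong refl) (simp only: complex_norm_square mult.commute)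
    finally have dG: "dird G v y = of_real T" .
    have "cmod (dird G v y) \<le> 2 * (sqrt T * sqrt M) * norm v / \<rho>"
    proof (rule cauchy_first[OF holG order_trans[OF bsub 0(3)] \<rho>])
      fix z assume z: "z \<in> ball y \<rho>"
      have "cmod (G z) \<le> sqrt (\<Sum>j<J. (cmod (cnj (c j)))\<^sup>2) * sqrt (\<Sum>j<J. (cmod (s j z))\<^sup>2)"
        unfolding G_def by (rule cmod_sum_mult_le)
      also have "\<dots> \<le> sqrt T * sqrt M"
        using 0(4)[of z J] z bsub by (intro mult_mono) (auto simp: T_def sum_nonneg)
      finally show "cmod (G z) \<le> sqrt T * sqrt M" .
    qed
    then have "sqrt T * sqrt T \<le> sqrt T * (2 * sqrt M * norm v / \<rho>)"
      using T0 by (simp add: dG ac_simps)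
    then have "sqrt T \<le> 2 * sqrt M * norm v / \<rho>"
    proof (cases "T = 0")
      case False
      with T0 have "0 < sqrt T" by simp
      then show ?thesis
        using \<open>sqrt T * sqrt T \<le> sqrt T * (2 * sqrt M * norm v / \<rho>)\<close> by (simp only: mult_le_cancel_left_pos)
    qed (use \<rho> 0(2) in simp)
    then have "(sqrt T)\<^sup>2 \<le> (2 * sqrt M * norm v / \<rho>)\<^sup>2" using T0 by (intro power_mono) auto
    then show ?thesis using T0 by (simp add: T_def c_def)
  qed
  then show "\<exists>\<rho>>0. \<exists>M. \<forall>y\<in>ball x \<rho>. \<forall>J. (\<Sum>j<J. (cmod (dird (s j) v y))\<^sup>2) \<le> M"
    using \<rho> by blast
qed

definition pair :: "(nat \<Rightarrow> 'a \<Rightarrow> complex) \<Rightarrow> (nat \<Rightarrow> 'a \<Rightarrow> complex) \<Rightarrow> 'a \<Rightarrow> complex" where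
  "pair s t x = (\<Sum>j. s j x * cnj (t j x))"

lemma summable_pair2:
  assumes "lb S s" "lb S t" "x \<in> S" "y \<in> S"
  shows "summable (\<lambda>j. s j x * cnj (t j y))"
proof (rule summable_comparison_test)
  show "summable (\<lambda>j. (cmod (s j x))\<^sup>2 + (cmod (t j y))\<^sup>2)"
    using assms by (intro summable_add lb_summable)
  have "cmod (s j x * cnj (t j y)) \<le> (cmod (s j x))\<^sup>2 + (cmod (t j y))\<^sup>2" for j
    using sum_squares_bound[of "cmod (s j x)" "cmod (t j y)"] mult_nonneg_nonneg[OF norm_ge_zero[of "s j x"] norm_ge_zero[of "t j y"]]
    by (simp only: norm_mult complex_mod_cnj)
  then show "\<exists>N. \<forall>j\<ge>N. norm (s j x * cnj (t j y)) \<le> (cmod (s j x))\<^sup>2 + (cmod (t j y))\<^sup>2" by blast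
qed

lemma pair_linear:
  assumes "lb S s" "lb S t" "lb S u" "x \<in> S"
  shows "pair (\<lambda>j x. s j x + t j x) u x = pair s u x + pair t u x"
    and "pair u (\<lambda>j x. s j x + t j x) x = pair u s x + pair u t x"
    and "pair (\<lambda>j x. a x * s j x) u x = a x * pair s u x"
    and "pair u (\<lambda>j x. a x * s j x) x = cnj (a x) * pair u s x"
  unfolding pair_def
  using suminf_add[OF summable_pair2[OF assms(1,3,4,4)] summable_pair2[OF assms(2,3,4,4)]]
    suminf_add[OF summable_pair2[OF assms(3,1,4,4)] summable_pair2[OF assms(3,2,4,4)]]
    suminf_mult[OF summable_pair2[OF assms(1,3,4,4)], of "a x"]
    suminf_mult[OF summable_pair2[OF assms(3,1,4,4)], of "cnj (a x)"]
  by (simp_all add: algebra_simps)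

text \<open>\<open>B\<close> extends the pairing to independent arguments. For the structure
  \<open>sc2\<close>, conjugated in the second factor, it is a locally bounded limit of holomorphic
  partial sums, so \<open>hol_limit\<close> differentiates it term by term; the product rule is the
  restriction of its differential to the diagonal.\<close>

lemma pair_has_derivative:
  assumes s: "lb S s" and t: "lb S t" and S: "open S" and xS: "x \<in> S"
  shows "(pair s t has_derivative (\<lambda>v. pair (\<lambda>j. dird (s j) v) t x + pair s (\<lambda>j. dird (t j) v) x)) (at x)"
proof -
  define sc2 :: "complex \<Rightarrow> 'a \<times> 'a \<Rightarrow> 'a \<times> 'a" where "sc2 a p = (sc a (fst p), sc (cnj a) (snd p))" for a p
  interpret P: complex_scaling sc2
  proof
    show "norm (sc2 a v) = cmod a * norm v" for a v
    proof -
      have "norm (sc2 a v) = sqrt ((cmod a)\<^sup>2 * ((norm (fst v))\<^sup>2 + (norm (snd v))\<^sup>2))"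
        by (simp add: sc2_def norm_prod_def norm_sc power_mult_distrib algebra_simps)
      then show ?thesis by (simp add: real_sqrt_mult norm_prod_def)
    qed
  qed (auto simp: sc2_def sc_add_left sc_add_right sc_sc sc_real prod_eq_iff)
  define A where "A J p = (\<Sum>j<J. s j (fst p) * cnj (t j (snd p)))" for J and p :: "'a \<times> 'a"
  define B where "B p = (\<Sum>j. s j (fst p) * cnj (t j (snd p)))" for p :: "'a \<times> 'a"
  have dA: "(A J has_derivative (\<lambda>v. \<Sum>j<J. s j (fst p) * cnj (dird (t j) (snd v) (snd p))
              + dird (s j) (fst v) (fst p) * cnj (t j (snd p)))) (at p)"
    if p: "p \<in> S \<times> S" for J p
  proof -
    have 1: "((\<lambda>p. s j (fst p)) has_derivative (\<lambda>v. dird (s j) (fst v) (fst p))) (at p)" for j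
      by (rule has_derivative_compose[OF has_derivative_fst[OF has_derivative_ident]
            holD(1)[OF lb_hol[OF s]]]) (use p in auto)
    have "((\<lambda>p. t j (snd p)) has_derivative (\<lambda>v. dird (t j) (snd v) (snd p))) (at p)" for j
      by (rule has_derivative_compose[OF has_derivative_snd[OF has_derivative_ident]
            holD(1)[OF lb_hol[OF t]]]) (use p in auto)
    then have 2: "((\<lambda>p. cnj (t j (snd p))) has_derivative (\<lambda>v. cnj (dird (t j) (snd v) (snd p)))) (at p)" for j
      by (rule has_derivative_cnj)
    show ?thesis unfolding A_def by (intro has_derivative_sum has_derivative_mult 1 2)
  qed
  have "dird (A J) v p = (\<Sum>j<J. s j (fst p) * cnj (dird (t j) (snd v) (snd p))
              + dird (s j) (fst v) (fst p) * cnj (t j (snd p)))" if "p \<in> S \<times> S" for J v p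
    by (rule dirdI[OF dA[OF that]])
  note dA' = this
  have holA: "P.hol (S \<times> S) (A J)" for J
  proof (rule P.holI[OF dA])
    fix p :: "'a \<times> 'a" and a v assume "p \<in> S \<times> S"
    then show "(\<Sum>j<J. s j (fst p) * cnj (dird (t j) (snd (sc2 a v)) (snd p))
              + dird (s j) (fst (sc2 a v)) (fst p) * cnj (t j (snd p))) =
          a * (\<Sum>j<J. s j (fst p) * cnj (dird (t j) (snd v) (snd p))
              + dird (s j) (fst v) (fst p) * cnj (t j (snd p)))"
      by (auto simp: sc2_def holD(2)[OF lb_hol[OF s]] holD(2)[OF lb_hol[OF t]] sum_distrib_left algebra_simps)
  qed
  have bdA: "\<exists>\<rho>>0. \<exists>M. \<forall>J. \<forall>y\<in>ball p \<rho>. cmod (A J y) \<le> M" if p: "p \<in> S \<times> S" for p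
  proof -
    obtain \<rho>1 M1 where 1: "\<rho>1 > 0" "M1 \<ge> 0" "\<And>y J. y \<in> ball (fst p) \<rho>1 \<Longrightarrow> (\<Sum>j<J. (cmod (s j y))\<^sup>2) \<le> M1"
      using lb_bound[OF s S, of "fst p"] p by (metis mem_Times_iff)
    obtain \<rho>2 M2 where 2: "\<rho>2 > 0" "M2 \<ge> 0" "\<And>y J. y \<in> ball (snd p) \<rho>2 \<Longrightarrow> (\<Sum>j<J. (cmod (t j y))\<^sup>2) \<le> M2"
      using lb_bound[OF t S, of "snd p"] p by (metis mem_Times_iff)
    have "cmod (A J y) \<le> sqrt M1 * sqrt M2" if y: "y \<in> ball p (min \<rho>1 \<rho>2)" for J y
    proof -
      have "fst y \<in> ball (fst p) \<rho>1" "snd y \<in> ball (snd p) \<rho>2"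
        using y dist_fst_le[of p y] dist_snd_le[of p y] by auto
      then have "(\<Sum>j<J. (cmod (s j (fst y)))\<^sup>2) \<le> M1" "(\<Sum>j<J. (cmod (cnj (t j (snd y))))\<^sup>2) \<le> M2"
        using 1(3) 2(3) by auto
      then have "sqrt (\<Sum>j<J. (cmod (s j (fst y)))\<^sup>2) * sqrt (\<Sum>j<J. (cmod (cnj (t j (snd y))))\<^sup>2) \<le> sqrt M1 * sqrt M2"
        using 1(2) by (intro mult_mono) (auto simp: sum_nonneg)
      from order_trans[OF cmod_sum_mult_le this] show ?thesis unfolding A_def .
    qed
    then show ?thesis using 1(1) 2(1) by (meson min_less_iff_conj)
  qed
  have limA: "(\<lambda>J. A J p) \<longlonglongrightarrow> B p" if "p \<in> S \<times> S" for p
    unfolding A_def B_def using that by (intro summable_LIMSEQ summable_pair2[OF s t]) auto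
  have "open (S \<times> S)" using S by (simp add: open_Times)
  note lim = P.hol_limit[OF this holA bdA limA]
  have px: "(x, x) \<in> S \<times> S" using xS by simp
  have D: "dird B v (x, x) = pair (\<lambda>j. dird (s j) (fst v)) t x + pair s (\<lambda>j. dird (t j) (snd v)) x" for v
  proof (rule LIMSEQ_unique[OF lim(2)[OF _ _ px]])
    have "(\<lambda>J. (\<Sum>j<J. dird (s j) (fst v) x * cnj (t j x)) + (\<Sum>j<J. s j x * cnj (dird (t j) (snd v) x)))
        \<longlonglongrightarrow> pair (\<lambda>j. dird (s j) (fst v)) t x + pair s (\<lambda>j. dird (t j) (snd v)) x"
      unfolding pair_def
      by (intro tendsto_add summable_LIMSEQ summable_pair2[OF lb_dird[OF s S] t] summable_pair2[OF s lb_dird[OF t S]] xS)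
    then show "(\<lambda>J. dird (A J) v (x, x)) \<longlonglongrightarrow> pair (\<lambda>j. dird (s j) (fst v)) t x + pair s (\<lambda>j. dird (t j) (snd v)) x"
      by (simp add: dA'[OF px] sum.distrib add.commute)
  qed
  have "(B has_derivative frechet_derivative B (at (x, x))) (at (x, x))"
    by (rule P.holD(1)[OF lim(1) px])
  moreover have "((\<lambda>y. (y, y)) has_derivative (\<lambda>v. (v, v))) (at x)"
    by (intro has_derivative_Pair has_derivative_ident)
  ultimately have "((\<lambda>y. B (y, y)) has_derivative (\<lambda>v. dird B (v, v) (x, x))) (at x)"
    using has_derivative_compose by fast
  then show ?thesis by (simp add: D B_def pair_def[abs_def])
qed

end

section \<open>Absolutely monotone functions\<close>

lemma Taylor_lagrange:
  fixes g :: "nat \<Rightarrow> real \<Rightarrow> real"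
  assumes "\<And>b x. \<alpha> < x \<Longrightarrow> x < \<beta> \<Longrightarrow> (g b has_real_derivative g (Suc b) x) (at x)"
    and "\<alpha> < u" "u < \<beta>" "\<alpha> < x" "x < \<beta>" "0 < m"
  shows "\<exists>t\<ge>min u x. t \<le> max u x \<and> g 0 x = (\<Sum>b<m. g b u / fact b * (x - u) ^ b) + g m t / fact m * (x - u) ^ m"
proof (cases "x = u")
  case True
  have "(\<Sum>b<m. g b u / fact b * 0 ^ b) = g 0 u"
    using \<open>0 < m\<close> by (subst sum.remove[of _ 0]) (auto simp: power_0_left)
  then show ?thesis using True \<open>0 < m\<close> by (intro exI[of _ u]) auto
next
  case False
  have "\<exists>t. (if x < u then x < t \<and> t < u else u < t \<and> t < x) \<and>
     g 0 x = (\<Sum>b<m. g b u / fact b * (x - u) ^ b) + g m t / fact m * (x - u) ^ m"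
    using assms False
    by (intro Taylor[where a="min u x" and b="max u x"]) (auto simp: min_def max_def)
  then obtain t where "if x < u then x < t \<and> t < u else u < t \<and> t < x"
     "g 0 x = (\<Sum>b<m. g b u / fact b * (x - u) ^ b) + g m t / fact m * (x - u) ^ m" by blast
  then show ?thesis by (intro exI[of _ t]) (auto split: if_splits simp del: times_divide_eq_left)
qed

locale abs_monotone =
  fixes g :: "nat \<Rightarrow> real \<Rightarrow> real" and \<alpha> \<beta> :: real
  assumes deriv: "\<alpha> < x \<Longrightarrow> x < \<beta> \<Longrightarrow> (g b has_real_derivative g (Suc b) x) (at x)"
    and nonneg: "\<alpha> < x \<Longrightarrow> x < \<beta> \<Longrightarrow> 0 \<le> g b x"
begin

lemma shift: "abs_monotone (\<lambda>b. g (k + b)) \<alpha> \<beta>"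
  by unfold_locales (use deriv nonneg in auto)

lemma mono:
  assumes "\<alpha> < x" "x \<le> y" "y < \<beta>"
  shows "g b x \<le> g b y"
  using assms(2)
proof (rule DERIV_nonneg_imp_nondecreasing)
  fix t assume "x \<le> t" "t \<le> y"
  then show "\<exists>d. (g b has_real_derivative d) (at t) \<and> 0 \<le> d"
    using deriv[of t b] nonneg[of t "Suc b"] assms by auto
qed

lemma partial_sum_le:
  assumes "\<alpha> < u" "u \<le> x" "x < \<beta>"
  shows "(\<Sum>b<m. g b u / fact b * (x - u) ^ b) \<le> g 0 x"
proof (cases "m = 0")
  case False
  then obtain t where "t \<ge> min u x" "t \<le> max u x"
      "g 0 x = (\<Sum>b<m. g b u / fact b * (x - u) ^ b) + g m t / fact m * (x - u) ^ m"
    using Taylor_lagrange[of \<alpha> \<beta> g u x m, OF deriv] assms by auto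
  moreover have "0 \<le> g m t" using calculation assms by (intro nonneg) auto
  ultimately show ?thesis using assms by simp
qed (use nonneg[of x 0] assms in simp)

lemma summable_series:
  assumes "\<alpha> < u" "u \<le> x" "x < \<beta>"
  shows "summable (\<lambda>b. g b u / fact b * (x - u) ^ b)"
  using assms partial_sum_le[OF assms] nonneg[of u]
  by (intro summableI_nonneg_bounded[where x="g 0 x"]) auto

text \<open>As \<open>g m\<close> increases, the Lagrange remainder is at most
  \<open>g m u / fact m * (u - x) ^ m\<close>, and the partial sums at \<open>u + \<eta>\<close>
  bound \<open>g m u / fact m * \<eta> ^ m\<close> by \<open>g 0 (u + \<eta>)\<close>. So
  convergence is geometric with ratio \<open>(u - x) / \<eta>\<close>: room to the right of
  \<open>u\<close> buys convergence to the left.\<close>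

lemma series_left:
  assumes "\<alpha> < x" "x \<le> u" "u + \<eta> < \<beta>" "u - x < \<eta>"
  shows "(\<lambda>b. g b u / fact b * (x - u) ^ b) sums g 0 x"
proof -
  have \<eta>: "\<eta> > 0" using assms by simp
  define q where "q = (u - x) / \<eta>"
  have q: "0 \<le> q" "q < 1" using assms \<eta> by (auto simp: q_def)
  have bound: "\<bar>g 0 x - (\<Sum>b<m. g b u / fact b * (x - u) ^ b)\<bar> \<le> g 0 (u + \<eta>) * q ^ m" if m0: "m > 0" for m
  proof -
    obtain t where t: "t \<ge> min u x" "t \<le> max u x"
      "g 0 x = (\<Sum>b<m. g b u / fact b * (x - u) ^ b) + g m t / fact m * (x - u) ^ m"
      using Taylor_lagrange[of \<alpha> \<beta> g u x m, OF deriv] assms m0 \<eta> by force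
    have tu: "\<alpha> < t" "t \<le> u" using t assms by auto
    have 1: "g m u / fact m * \<eta> ^ m \<le> g 0 (u + \<eta>)"
    proof -
      have "g m u / fact m * \<eta> ^ m \<le> (\<Sum>b<Suc m. g b u / fact b * (u + \<eta> - u) ^ b)"
        using nonneg[of u] assms \<eta> by (auto intro!: sum_nonneg)
      also have "\<dots> \<le> g 0 (u + \<eta>)" using assms \<eta> by (intro partial_sum_le) auto
      finally show ?thesis .
    qed
    have gm: "0 \<le> g m t" "g m t \<le> g m u" using nonneg[of t m] mono[of t u m] tu assms \<eta> by auto
    have "\<bar>g 0 x - (\<Sum>b<m. g b u / fact b * (x - u) ^ b)\<bar> = g m t / fact m * (u - x) ^ m"
      using t(3) gm assms by (simp add: abs_mult power_abs abs_minus_commute)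
    also have "\<dots> \<le> g m u / fact m * (u - x) ^ m"
      using gm assms by (intro mult_right_mono divide_right_mono) auto
    also have "\<dots> = (g m u / fact m * \<eta> ^ m) * q ^ m"
      using \<eta> by (simp add: q_def power_divide)
    also have "\<dots> \<le> g 0 (u + \<eta>) * q ^ m"
      using 1 q by (intro mult_right_mono) auto
    finally show ?thesis .
  qed
  have "(\<lambda>m. g 0 x - (\<Sum>b<m. g b u / fact b * (x - u) ^ b)) \<longlonglongrightarrow> 0"
  proof (rule Lim_null_comparison)
    show "\<forall>\<^sub>F m in sequentially. norm (g 0 x - (\<Sum>b<m. g b u / fact b * (x - u) ^ b)) \<le> g 0 (u + \<eta>) * q ^ m"
      using eventually_gt_at_top[of 0] by eventually_elim (use bound in simp)
    show "(\<lambda>m. g 0 (u + \<eta>) * q ^ m) \<longlonglongrightarrow> 0"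
      using LIMSEQ_realpow_zero[OF q] by (rule tendsto_mult_right_zero)
  qed
  then have "(\<lambda>m. g 0 x - (g 0 x - (\<Sum>b<m. g b u / fact b * (x - u) ^ b))) \<longlonglongrightarrow> g 0 x - 0"
    by (intro tendsto_intros)
  then show ?thesis by (simp add: sums_def)
qed

text \<open>To the right, the integral form of the remainder is compared with the one at a point \<open>w > x\<close>.\<close>

lemma series_right:
  assumes "\<alpha> < u" "u \<le> x" "x < \<beta>"
  shows "(\<lambda>b. g b u / fact b * (x - u) ^ b) sums g 0 x"
proof (cases "u = x")
  case True
  have "(\<lambda>b. g b u / fact b * 0 ^ b) sums (g 0 u / fact 0 * 0 ^ 0)"
    by (rule sums_finite[of "{0}", simplified]) auto
  then show ?thesis using True by simp
next
  case False
  obtain w where w: "x < w" "w < \<beta>" using assms dense by blast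
  \<comment> \<open>The quotient \<open>(x - t) / (w - t)\<close> is largest at
    \<open>t = u\<close>, so \<open>q\<close> compares the integrands of the two remainders on all
    of \<open>[u, x]\<close>.\<close>
  define q where "q = (x - u) / (w - u)"
  have q: "0 \<le> q" "q < 1" using assms w by (auto simp: q_def)
  define I where "I z m t = (z - t) ^ m / fact m * g (Suc m) t" for z m t
  have int: "(I z m has_integral g 0 z - (\<Sum>b<Suc m. g b u / fact b * (z - u) ^ b)) {u..z}"
    if "u \<le> z" "z < \<beta>" for z m
  proof -
    have "((\<lambda>t. ((z - t) ^ (Suc m - 1) / fact (Suc m - 1)) *\<^sub>R g (Suc m) t) has_integral
        g 0 z - (\<Sum>i<Suc m. ((z - u) ^ i / fact i) *\<^sub>R g i u)) {u..z}"
    proof (rule Taylor_has_integral)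
      fix b t assume "u \<le> t" "t \<le> z"
      then have "(g b has_real_derivative g (Suc b) t) (at t)" using that assms by (intro deriv) auto
      then show "(g b has_vector_derivative g (Suc b) t) (at t within {u..z})"
        by (meson has_real_derivative_iff_has_vector_derivative has_vector_derivative_at_within)
    qed (use that in auto)
    then show ?thesis by (simp add: I_def[abs_def] mult.commute)
  qed
  have bound: "g 0 x - (\<Sum>b<Suc m. g b u / fact b * (x - u) ^ b) \<le> q ^ m * g 0 w" for m
  proof -
    have Ipos: "0 \<le> I w m t" if "t \<in> {u..w}" for t
      using that w assms nonneg[of t] by (auto simp: I_def)
    have intw: "I w m integrable_on {u..w}" using int[of w m] w assms by (auto simp: integrable_on_def)
    have intwx: "I w m integrable_on {u..x}" using integrable_on_subinterval[OF intw] w by auto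
    have "g 0 x - (\<Sum>b<Suc m. g b u / fact b * (x - u) ^ b) = integral {u..x} (I x m)"
      using int[of x m] assms by (simp add: integral_unique)
    also have "\<dots> \<le> integral {u..x} (\<lambda>t. q ^ m * I w m t)"
    proof (rule integral_le)
      show "I x m integrable_on {u..x}" using int[of x m] assms by (auto simp: integrable_on_def)
      show "(\<lambda>t. q ^ m * I w m t) integrable_on {u..x}" using intwx by (rule integrable_on_mult_right)
      fix t assume t: "t \<in> {u..x}"
      have "x - t \<le> q * (w - t)"
      proof -
        have "(x - t) * (w - u) \<le> (x - u) * (w - t)"
          using mult_left_mono[of u t "w - x"] t w by (simp add: algebra_simps)
        then show ?thesis using assms w by (simp add: q_def field_simps)
      qed
      then have "(x - t) ^ m \<le> (q * (w - t)) ^ m" using t by (intro power_mono) auto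
      then have "(x - t) ^ m / fact m * g (Suc m) t \<le> (q * (w - t)) ^ m / fact m * g (Suc m) t"
        using nonneg[of t "Suc m"] t assms by (intro mult_right_mono divide_right_mono) auto
      then show "I x m t \<le> q ^ m * I w m t" by (simp add: I_def power_mult_distrib)
    qed
    also have "\<dots> = q ^ m * integral {u..x} (I w m)" by simp
    also have "\<dots> \<le> q ^ m * integral {u..w} (I w m)"
      using q w intw intwx Ipos by (intro mult_left_mono integral_subset_le) auto
    also have "integral {u..w} (I w m) = g 0 w - (\<Sum>b<Suc m. g b u / fact b * (w - u) ^ b)"
      using int[of w m] w assms by (simp add: integral_unique del: sum.lessThan_Suc)
    also have "q ^ m * \<dots> \<le> q ^ m * g 0 w"
    proof -
      have "0 \<le> (\<Sum>b<Suc m. g b u / fact b * (w - u) ^ b)"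
        using nonneg[of u] assms w by (intro sum_nonneg) auto
      then show ?thesis using q by (intro mult_left_mono) (auto simp del: sum.lessThan_Suc)
    qed
    finally show ?thesis .
  qed
  have "(\<lambda>m. g 0 x - (\<Sum>b<Suc m. g b u / fact b * (x - u) ^ b)) \<longlonglongrightarrow> 0"
  proof (rule Lim_null_comparison)
    show "\<forall>\<^sub>F m in sequentially. norm (g 0 x - (\<Sum>b<Suc m. g b u / fact b * (x - u) ^ b)) \<le> q ^ m * g 0 w"
      using bound partial_sum_le[OF assms] by (simp del: sum.lessThan_Suc)
    show "(\<lambda>m. q ^ m * g 0 w) \<longlonglongrightarrow> 0"
      using LIMSEQ_realpow_zero[OF q] by (rule tendsto_mult_left_zero)
  qed
  then have "(\<lambda>m. g 0 x - (g 0 x - (\<Sum>b<Suc m. g b u / fact b * (x - u) ^ b))) \<longlonglongrightarrow> g 0 x - 0"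
    by (intro tendsto_intros)
  then have "(\<lambda>m. \<Sum>b<Suc m. g b u / fact b * (x - u) ^ b) \<longlonglongrightarrow> g 0 x" by (simp del: sum.lessThan_Suc)
  then show ?thesis unfolding sums_def by (rule LIMSEQ_imp_Suc)
qed

end

text \<open>If \<open>g b = \<Sum> a\<^sub>k k\<^sup>b r\<^sup>k\<close>, the \<open>b\<close>-th derivative of a power series in \<open>r = exp X\<close>, then
  \<open>mom g p = \<Sum> a\<^sub>k p(k) r\<^sup>k\<close>. In particular, \<open>mom g (ffp m)\<close> is \<open>r\<^sup>m\<close> times the \<open>m\<close>-th derivative
  with respect to \<open>r\<close>.\<close>

definition mom :: "(nat \<Rightarrow> real) \<Rightarrow> real poly \<Rightarrow> real" where
  "mom g p = (\<Sum>i\<le>degree p. coeff p i * g i)"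

lemma mom_eq:
  assumes "degree p \<le> N"
  shows "mom g p = (\<Sum>i\<le>N. coeff p i * g i)"
  unfolding mom_def using assms
  by (intro sum.mono_neutral_left) (auto simp: coeff_eq_0)

lemma mom_add: "mom g (p + q) = mom g p + mom g q"
  by (subst (1 2 3) mom_eq[of _ "max (degree p) (degree q)"])
     (auto simp: degree_add_le algebra_simps sum.distrib)

lemma mom_smult: "mom g (smult c p) = c * mom g p"
  by (subst (1 2) mom_eq[of _ "degree p"]) (auto simp: degree_smult_le sum_distrib_left mult.assoc)

lemma mom_0 [simp]: "mom g 0 = 0"
  by (simp add: mom_def)

lemma mom_pCons: "mom g (pCons a p) = a * g 0 + mom (\<lambda>i. g (Suc i)) p"
  by (subst mom_eq[of _ "Suc (degree p)"], simp add: degree_pCons_le)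
     (simp add: sum.atMost_Suc_shift mom_def del: sum.atMost_Suc)

lemma mom_sum: "mom g (\<Sum>i\<in>I. p i) = (\<Sum>i\<in>I. mom g (p i))"
  by (induction I rule: infinite_finite_induct) (auto simp: mom_add)

lemma mom_monom_mult: "mom g (monom 1 c * p) = mom (\<lambda>i. g (c + i)) p"
proof (induction c arbitrary: g)
  case (Suc c)
  have "monom 1 (Suc c) * p = pCons 0 (monom 1 c * p)" by (simp add: monom_Suc)
  then show ?case using Suc[of "\<lambda>i. g (Suc i)"] by (simp add: mom_pCons)
qed simp

section \<open>Positivity on squares times falling factorials, and its propagation\<close>

definition ffp :: "nat \<Rightarrow> real poly" where
  "ffp m = (\<Prod>i<m. [:- real i, 1:])"

text \<open>The model is \<open>g b = \<Sum> a\<^sub>k k\<^sup>b r\<^sup>k\<close> with non-negative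
  \<open>a\<^sub>k\<close>: each \<open>R\<^sup>2 * ffp m\<close> is non-negative at every natural
  number, hence so is the moment. The case \<open>m = 0\<close> is positivity of the Hankel matrices
  of \<open>g\<close>.\<close>

definition pos_data :: "(nat \<Rightarrow> real) \<Rightarrow> bool" where
  "pos_data g \<longleftrightarrow> (\<forall>m R. 0 \<le> mom g (R\<^sup>2 * ffp m))"

lemma pos_data_nonneg:
  assumes "pos_data g"
  shows "0 \<le> g b"
proof -
  obtain k l where kl: "b = 2 * k + l" "l < 2" by (metis mod_less_divisor mult_div_mod_eq zero_less_numeral)
  have "(monom 1 k)\<^sup>2 * ffp l = (monom 1 b :: real poly)"
  proof (cases "l = 0")
    case True
    then show ?thesis by (simp add: ffp_def kl power2_eq_square mult_monom mult_2)
  next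
    case False
    then have l: "l = 1" using kl by simp
    have "[:0, 1:] = (monom 1 1 :: real poly)" by (simp add: monom_altdef)
    then show ?thesis by (simp add: ffp_def l kl power2_eq_square mult_monom mult_2)
  qed
  moreover have "mom g (monom 1 b) = g b"
    using mom_monom_mult[of g b 1] by (simp add: mom_def)
  ultimately show ?thesis using assms unfolding pos_data_def by metis
qed

lemma tendsto_binomial_over_power:
  "(\<lambda>M. real (M choose c) / real M ^ c) \<longlonglongrightarrow> 1 / fact c"
proof -
  have "(\<lambda>M. (\<Prod>i<c. 1 - real i / real M) / fact c) \<longlonglongrightarrow> (\<Prod>i<c. 1 - 0) / fact c"
    by (intro tendsto_intros lim_const_over_n) auto
  moreover have "\<forall>\<^sub>F M in sequentially. (\<Prod>i<c. 1 - real i / real M) / fact c = real (M choose c) / real M ^ c"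
    using eventually_gt_at_top[of 0]
  proof eventually_elim
    case (elim M)
    have "real (M choose c) = (\<Prod>i<c. real M - real i) / fact c"
      by (simp add: binomial_gbinomial gbinomial_prod_rev atLeast0LessThan)
    also have "(\<Prod>i<c. real M - real i) = (\<Prod>i<c. real M * (1 - real i / real M))"
      using elim by (intro prod.cong) (auto simp: field_simps)
    finally show ?case using elim by (simp add: prod.distrib)
  qed
  ultimately show ?thesis by (simp add: tendsto_cong)
qed

lemma binomial_over_power_le: "real (M choose c) / real M ^ c \<le> 1 / fact c"
proof (cases "M = 0")
  case False
  have "real ((M choose c) * fact c) \<le> real (M ^ c)"
    using binomial_fact_pow[of M c] by (simp only: of_nat_le_iff)
  then show ?thesis using False by (simp add: field_simps)
qed (cases c; simp)

text \<open>Positivity of the Taylor data propagates along the disc of convergence, since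
  \<open>(1 + y X / M)\<^sup>M\<close> is a square for even \<open>M\<close> and tends to \<open>exp (y X)\<close>.\<close>

lemma pos_data_propagate:
  assumes pos: "pos_data g" and sm: "\<And>b. summable (\<lambda>c. g (b + c) / fact c * \<bar>y\<bar> ^ c)"
  shows "pos_data (\<lambda>b. \<Sum>c. g (b + c) / fact c * y ^ c)"
  unfolding pos_data_def
proof (intro allI)
  fix m and R :: "real poly"
  define p where "p = R\<^sup>2 * ffp m"
  define w where "w c = mom g (monom 1 c * p)" for c
  have g0: "0 \<le> g b" for b using pos_data_nonneg[OF pos] .
  have sm': "summable (\<lambda>c. g (b + c) / fact c * y ^ c)" for b
    by (rule summable_norm_cancel) (use sm[of b] g0 in \<open>simp add: abs_mult power_abs\<close>)
  have w_alt: "w c = (\<Sum>b\<le>degree p. coeff p b * g (b + c))" for c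
    unfolding w_def mom_monom_mult by (simp add: mom_def add.commute)
  have "mom (\<lambda>b. \<Sum>c. g (b + c) / fact c * y ^ c) p
      = (\<Sum>b\<le>degree p. \<Sum>c. coeff p b * (g (b + c) / fact c * y ^ c))"
    unfolding mom_def by (intro sum.cong refl suminf_mult[symmetric] sm')
  also have "\<dots> = (\<Sum>c. \<Sum>b\<le>degree p. coeff p b * (g (b + c) / fact c * y ^ c))"
    by (intro suminf_sum[symmetric] summable_mult sm')
  also have "\<dots> = (\<Sum>c. w c / fact c * y ^ c)"
    by (simp add: w_alt sum_divide_distrib sum_distrib_right mult.assoc)
  finally have L: "mom (\<lambda>b. \<Sum>c. g (b + c) / fact c * y ^ c) p = (\<Sum>c. w c / fact c * y ^ c)" .
  \<comment> \<open>Even, so that a power with exponent \<open>M N\<close> is a square, and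
    positive, so that division by it makes sense.\<close>
  define M where "M N = 2 * Suc N" for N
  \<comment> \<open>The sum over \<open>c\<close> is the moment of \<open>p\<close> times the
    \<open>M N\<close>-th power of \<open>1 + y X / M N\<close>. The binomial factor is at most
    \<open>1 / fact c\<close>, which is the domination required by Tannery's theorem.\<close>
  define a where "a c N = real (M N choose c) / real (M N) ^ c * (w c * y ^ c)" for c N
  have M_lim: "filterlim M at_top sequentially"
    unfolding M_def by (rule filterlim_subseq) (auto simp: strict_mono_def)
  have smw: "summable (\<lambda>c. 1 / fact c * (\<bar>w c\<bar> * \<bar>y\<bar> ^ c))"
  proof (rule summable_comparison_test)
    show "summable (\<lambda>c. \<Sum>b\<le>degree p. \<bar>coeff p b\<bar> * (g (b + c) / fact c * \<bar>y\<bar> ^ c))"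
      by (intro summable_sum summable_mult sm)
    have "1 / fact c * (\<bar>w c\<bar> * \<bar>y\<bar> ^ c) \<le> (\<Sum>b\<le>degree p. \<bar>coeff p b\<bar> * (g (b + c) / fact c * \<bar>y\<bar> ^ c))" for c
    proof -
      have "\<bar>w c\<bar> \<le> (\<Sum>b\<le>degree p. \<bar>coeff p b\<bar> * g (b + c))"
        unfolding w_alt by (rule order_trans[OF sum_abs]) (use g0 in \<open>simp add: abs_mult\<close>)
      then have "1 / fact c * (\<bar>w c\<bar> * \<bar>y\<bar> ^ c) \<le> 1 / fact c * ((\<Sum>b\<le>degree p. \<bar>coeff p b\<bar> * g (b + c)) * \<bar>y\<bar> ^ c)"
        by (intro mult_left_mono mult_right_mono) auto
      also have "\<dots> = (\<Sum>b\<le>degree p. \<bar>coeff p b\<bar> * (g (b + c) / fact c * \<bar>y\<bar> ^ c))"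
        by (simp add: sum_distrib_left sum_distrib_right mult.assoc sum_divide_distrib)
      finally show ?thesis .
    qed
    then show "\<exists>N. \<forall>c\<ge>N. norm (1 / fact c * (\<bar>w c\<bar> * \<bar>y\<bar> ^ c))
        \<le> (\<Sum>b\<le>degree p. \<bar>coeff p b\<bar> * (g (b + c) / fact c * \<bar>y\<bar> ^ c))"
      by (simp add: abs_mult power_abs)
  qed
  have "(\<lambda>N. \<Sum>c. a c N) \<longlonglongrightarrow> (\<Sum>c. 1 / fact c * (w c * y ^ c))"
  proof (rule tannerys_theorem[THEN conjunct2, THEN conjunct2])
    show "(\<lambda>N. a c N) \<longlonglongrightarrow> 1 / fact c * (w c * y ^ c)" for c
      unfolding a_def
      by (intro tendsto_mult tendsto_const filterlim_compose[OF tendsto_binomial_over_power M_lim])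
    have "norm (a c N) \<le> 1 / fact c * (\<bar>w c\<bar> * \<bar>y\<bar> ^ c)" for c N
      using mult_right_mono[OF binomial_over_power_le[of "M N" c], of "\<bar>w c\<bar> * \<bar>y\<bar> ^ c"]
      by (simp add: a_def abs_mult power_abs)
    then show "\<forall>\<^sub>F (c, N) in sequentially \<times>\<^sub>F sequentially. norm (a c N) \<le> 1 / fact c * (\<bar>w c\<bar> * \<bar>y\<bar> ^ c)"
      by (intro always_eventually) auto
  qed (use smw in auto)
  moreover have "0 \<le> (\<Sum>c. a c N)" for N
  proof -
    define e where "e = [:1, y / real (M N):]"
    have "e ^ M N = ([:0, y / real (M N):] + 1) ^ M N"
      by (simp add: e_def one_pCons)
    also have "\<dots> = (\<Sum>c\<le>M N. of_nat (M N choose c) * [:0, y / real (M N):] ^ c)"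
      by (subst binomial_ring) simp
    also have "[:0, y / real (M N):] = monom (y / real (M N)) 1"
      by (simp add: monom_altdef)
    finally have e: "e ^ M N = (\<Sum>c\<le>M N. smult (real (M N choose c) * (y / real (M N)) ^ c) (monom 1 c))"
      by (simp add: monom_power smult_monom of_nat_poly flip: smult_smult)
    have "(\<Sum>c. a c N) = (\<Sum>c\<le>M N. a c N)"
      by (rule suminf_finite) (auto simp: a_def binomial_eq_0)
    also have "\<dots> = mom g (e ^ M N * p)"
      unfolding e sum_distrib_right mom_sum mult_smult_left mom_smult a_def w_def
      by (simp add: power_divide field_simps)
    also have "e ^ M N * p = (R * e ^ Suc N)\<^sup>2 * ffp m"
      by (simp only: M_def p_def power_mult_distrib power_mult[symmetric] mult.commute[of 2] mult.assoc mult.left_commute)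
    also have "0 \<le> mom g \<dots>" using pos unfolding pos_data_def by blast
    finally show ?thesis .
  qed
  ultimately have "0 \<le> (\<Sum>c. 1 / fact c * (w c * y ^ c))"
    by (intro tendsto_lowerbound) auto
  then show "0 \<le> mom (\<lambda>b. \<Sum>c. g (b + c) / fact c * y ^ c) (R\<^sup>2 * ffp m)"
    using L by (simp add: p_def)
qed

definition pos_family :: "(nat \<Rightarrow> real \<Rightarrow> real) \<Rightarrow> real \<Rightarrow> real \<Rightarrow> bool" where
  "pos_family g \<alpha> \<beta> \<longleftrightarrow> (\<forall>x b. \<alpha> < x \<longrightarrow> x < \<beta> \<longrightarrow> (g b has_real_derivative g (Suc b) x) (at x)) \<and>
     (\<forall>x. \<alpha> < x \<longrightarrow> x < \<beta> \<longrightarrow> pos_data (\<lambda>b. g b x))"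

lemma pos_family_imp_abs_monotone: "pos_family g \<alpha> \<beta> \<Longrightarrow> abs_monotone g \<alpha> \<beta>"
  unfolding pos_family_def by unfold_locales (auto dest: pos_data_nonneg)

text \<open>Absolute monotonicity to the right of \<open>u\<close> makes the Taylor series at
  \<open>u\<close> converge at distance \<open>\<eta>\<close> to the left as well, even past
  \<open>\<alpha>\<close>. There the series serves as continuation: \<open>series_left\<close>
  identifies it with \<open>g\<close> on the overlap, and \<open>pos_data_propagate\<close> carries
  the positivity over from \<open>u\<close>.\<close>

lemma pos_family_step:
  assumes g: "pos_family g \<alpha> \<beta>" and u: "\<alpha> < u" "u + \<eta> < \<beta>" and \<eta>: "\<eta> > 0"
  shows "\<exists>h. pos_family h (u - \<eta>) \<beta> \<and> (\<forall>b x. \<alpha> < x \<longrightarrow> x < \<beta> \<longrightarrow> h b x = g b x)"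
proof -
  interpret abs_monotone g \<alpha> \<beta> using g by (rule pos_family_imp_abs_monotone)
  define T where "T b x = (\<Sum>c. g (b + c) u / fact c * (x - u) ^ c)" for b x
  have ub: "u < \<beta>" using u \<eta> by simp
  have sm: "summable (\<lambda>c. g (b + c) u / fact c * \<eta> ^ c)" for b
    using abs_monotone.summable_series[OF shift[of b], of u "u + \<eta>"] u \<eta> by simp
  have sm': "summable (\<lambda>c. g (b + c) u / fact c * \<bar>y\<bar> ^ c)" if "\<bar>y\<bar> \<le> \<eta>" for b y
  proof (rule summable_comparison_test[OF _ sm])
    show "\<exists>N. \<forall>c\<ge>N. norm (g (b + c) u / fact c * \<bar>y\<bar> ^ c) \<le> g (b + c) u / fact c * \<eta> ^ c"
      using nonneg[OF u(1) ub] that by (auto simp: abs_mult intro!: mult_left_mono power_mono divide_right_mono)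
  qed
  have dT: "(T b has_real_derivative T (Suc b) x) (at x)" if "\<bar>x - u\<bar> < \<eta>" for b x
  proof -
    have dif: "diffs (\<lambda>c. g (b + c) u / fact c) = (\<lambda>c. g (Suc b + c) u / fact c)"
      by (auto simp: diffs_def fun_eq_iff simp del: of_nat_Suc)
    have "((\<lambda>y. \<Sum>c. g (b + c) u / fact c * y ^ c) has_real_derivative
            (\<Sum>c. g (Suc b + c) u / fact c * (x - u) ^ c)) (at (x - u))"
      using termdiffs_strong[OF sm[of b], of "x - u"] that \<eta> unfolding dif by simp
    then have "((\<lambda>x. \<Sum>c. g (b + c) u / fact c * (x - u) ^ c) has_real_derivative
            (\<Sum>c. g (Suc b + c) u / fact c * (x - u) ^ c) * 1) (at x)"
      by (rule DERIV_chain2) (auto intro!: derivative_eq_intros)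
    then show ?thesis by (simp add: T_def[abs_def])
  qed
  have gT: "g b x = T b x" if "\<alpha> < x" "x \<le> u" "u - x < \<eta>" for b x
    using sums_unique[OF abs_monotone.series_left[OF shift[of b] that(1,2) u(2) that(3)]] by (simp add: T_def)
  define h where "h b x = (if x > \<alpha> then g b x else T b x)" for b x
  have hT: "h b x = T b x" if "u - \<eta> < x" "x < u" for b x
    using gT[of x b] that by (auto simp: h_def)
  have "(h b has_real_derivative h (Suc b) x) (at x)" if x: "u - \<eta> < x" "x < \<beta>" for b x
  proof (cases "x > \<alpha>")
    case True
    have "(h b has_real_derivative g (Suc b) x) (at x)"
      by (rule has_field_derivative_transform_within_open[OF deriv[OF True x(2)], of "{\<alpha><..}"])
         (use True in \<open>auto simp: h_def\<close>)
    then show ?thesis using True by (simp add: h_def)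
  next
    case False
    with u have xu: "x < u" by simp
    have "(h b has_real_derivative T (Suc b) x) (at x)"
      by (rule has_field_derivative_transform_within_open[OF dT, of x "{u - \<eta><..<u}"])
         (use xu x hT in auto)
    then show ?thesis using hT[of x] xu x by simp
  qed
  moreover have "pos_data (\<lambda>b. h b x)" if x: "u - \<eta> < x" "x < \<beta>" for x
  proof (cases "x > \<alpha>")
    case True
    then show ?thesis using g x by (simp add: pos_family_def h_def)
  next
    case False
    with u have xu: "x < u" by simp
    have "pos_data (\<lambda>b. \<Sum>c. g (b + c) u / fact c * (x - u) ^ c)"
      using g u ub xu x by (intro pos_data_propagate[of "\<lambda>b. g b u"] sm') (auto simp: pos_family_def)
    then show ?thesis using hT[of x] xu x by (simp add: T_def)
  qed
  ultimately show ?thesis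
    by (intro exI[of _ h]) (auto simp: pos_family_def h_def)
qed

text \<open>The room to the right does not shrink when the left end point moves left, so every step
  gains the same length and finitely many reach any given point. Successive extensions agree where
  both are defined and are glued to \<open>G\<close>.\<close>

lemma pos_family_extend:
  assumes g: "pos_family g \<alpha> \<beta>" and "\<alpha> < \<beta>"
  obtains G where "\<And>\<alpha>'. pos_family G \<alpha>' \<beta>" "\<And>b x. \<alpha> < x \<Longrightarrow> x < \<beta> \<Longrightarrow> G b x = g b x"
proof -
  \<comment> \<open>Step \<open>N\<close> expands at \<open>u = t N + \<eta> / 2\<close>. The series
    reaches left to \<open>u - \<eta> = t (Suc N)\<close>, and \<open>u + \<eta> < \<beta>\<close>
    holds because \<open>t N \<le> \<alpha> = \<beta> - 4 * \<eta>\<close>.\<close>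
  define \<eta> where "\<eta> = (\<beta> - \<alpha>) / 4"
  have \<eta>: "\<eta> > 0" using assms by (simp add: \<eta>_def)
  define t where "t N = \<alpha> - real N * (\<eta> / 2)" for N
  have t\<alpha>: "t N \<le> \<alpha>" for N using \<eta> by (simp add: t_def)
  define P where "P N h \<longleftrightarrow> pos_family h (t N) \<beta> \<and> (\<forall>b x. \<alpha> < x \<longrightarrow> x < \<beta> \<longrightarrow> h b x = g b x)" for N h
  define Q where "Q N h h' \<longleftrightarrow> (\<forall>b x. t N < x \<longrightarrow> x < \<beta> \<longrightarrow> h' b x = h b x)"
    for N and h h' :: "nat \<Rightarrow> real \<Rightarrow> real"
  have "\<exists>H. \<forall>N. P N (H N) \<and> Q N (H N) (H (Suc N))"
  proof (rule dependent_nat_choice)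
    show "\<exists>h. P 0 h" using g by (intro exI[of _ g]) (simp add: P_def t_def)
    fix h N assume h: "P N h"
    have "\<exists>h'. pos_family h' (t N + \<eta>/2 - \<eta>) \<beta> \<and> (\<forall>b x. t N < x \<longrightarrow> x < \<beta> \<longrightarrow> h' b x = h b x)"
      using h t\<alpha>[of N] \<eta> by (intro pos_family_step) (auto simp: P_def \<eta>_def field_simps)
    moreover have "t N + \<eta>/2 - \<eta> = t (Suc N)" by (simp add: t_def field_simps)
    ultimately obtain h' where "pos_family h' (t (Suc N)) \<beta>" "\<forall>b x. t N < x \<longrightarrow> x < \<beta> \<longrightarrow> h' b x = h b x"
      by auto
    then show "\<exists>h'. P (Suc N) h' \<and> Q N h h'"
      using h t\<alpha>[of N] unfolding P_def Q_def by (intro exI[of _ h']) (auto dest: order_le_less_trans)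
  qed
  then obtain H where P: "\<And>N. P N (H N)" and Q: "\<And>N. Q N (H N) (H (Suc N))" by blast
  have tmono: "t M \<le> t N" if "N \<le> M" for N M using that \<eta> by (simp add: t_def)
  have coh: "H M b x = H N b x" if "N \<le> M" "t N < x" "x < \<beta>" for N M b x
    using that(1)
  proof (induction rule: dec_induct)
    case (step M)
    then show ?case using Q[of M] tmono[OF step(1)] that unfolding Q_def by auto
  qed simp
  have ex: "\<exists>N. t N < x" for x
  proof -
    obtain N where "(\<alpha> - x) / (\<eta>/2) < real N" using reals_Archimedean2 by blast
    then have "t N < x" using \<eta> by (simp add: t_def field_simps)
    then show ?thesis by blast
  qed
  define I where "I x = (SOME N. t N < x)" for x
  have I: "t (I x) < x" for x unfolding I_def using someI_ex[OF ex] .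
  define G where "G b x = H (I x) b x" for b x
  have GH: "G b x = H N b x" if "t N < x" "x < \<beta>" for N b x
    using coh[of N "max N (I x)" x b] coh[of "I x" "max N (I x)" x b] I[of x] that by (simp add: G_def)
  have "pos_family G \<alpha>' \<beta>" for \<alpha>'
    unfolding pos_family_def
  proof (intro conjI allI impI)
    fix x b assume x: "x < \<beta>"
    have "(H (I x) b has_real_derivative H (I x) (Suc b) x) (at x)"
      using P[of "I x"] I[of x] x by (simp add: P_def pos_family_def)
    then have "(G b has_real_derivative H (I x) (Suc b) x) (at x)"
      by (rule has_field_derivative_transform_within_open[of _ _ _ "{t (I x)<..<\<beta>}"])
         (use GH I x in auto)
    then show "(G b has_real_derivative G (Suc b) x) (at x)" by (simp add: G_def)
  next
    fix x assume x: "x < \<beta>"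
    show "pos_data (\<lambda>b. G b x)" using P[of "I x"] I[of x] x by (simp add: P_def pos_family_def G_def)
  qed
  moreover have "G b x = g b x" if "\<alpha> < x" "x < \<beta>" for b x
    using P[of "I x"] that by (simp add: P_def G_def)
  ultimately show ?thesis using that by blast
qed

lemma mom_has_derivative:
  assumes "\<And>i. (g i has_real_derivative g' i) (at x)"
  shows "((\<lambda>x. mom (\<lambda>i. g i x) p) has_real_derivative mom g' p) (at x)"
  unfolding mom_def by (auto intro!: derivative_eq_intros assms sum.cong)

text \<open>\<open>F m\<close> is the \<open>m\<close>-th derivative in \<open>r\<close> of
  \<open>G 0 (ln r)\<close>, so the case \<open>R = 1\<close> makes \<open>F\<close> absolutely
  monotone on \<open>(0, r1)\<close>. Bernstein's argument follows: the Taylor series at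
  \<open>u N\<close> represents \<open>F 0 r\<close>, its coefficients decrease to
  \<open>A b / fact b\<close>, and dominated convergence lets the expansion point tend to
  \<open>0\<close>.\<close>

lemma pos_family_power_series:
  assumes g: "pos_family g \<alpha> \<beta>" and "\<alpha> < \<beta>"
  obtains a :: "nat \<Rightarrow> real" where "\<And>k. 0 \<le> a k" "\<And>r. 0 < r \<Longrightarrow> r < exp \<beta> \<Longrightarrow> summable (\<lambda>k. a k * r ^ k)"
    "\<And>r. exp \<alpha> < r \<Longrightarrow> r < exp \<beta> \<Longrightarrow> (\<Sum>k. a k * r ^ k) = g 0 (ln r)"
proof -
  obtain G where G: "\<And>\<alpha>'. pos_family G \<alpha>' \<beta>" and Gg: "\<And>b x. \<alpha> < x \<Longrightarrow> x < \<beta> \<Longrightarrow> G b x = g b x"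
    using pos_family_extend[OF assms] by blast
  define r1 where "r1 = exp \<beta>"
  have lnr: "ln r < \<beta>" if "0 < r" "r < r1" for r
    using that ln_less_cancel_iff[of r r1] by (simp add: r1_def)
  define F where "F m r = mom (\<lambda>i. G i (ln r)) (ffp m) / r ^ m" for m r
  have F0: "F 0 r = G 0 (ln r)" for r by (simp add: F_def ffp_def mom_def)
  have am: "abs_monotone F 0 r1"
  proof
    fix r m assume r: "0 < r" "r < r1"
    have dG: "((\<lambda>r. G i (ln r)) has_real_derivative G (Suc i) (ln r) * (1 / r)) (at r)" for i
      using G[of "ln r - 1"] lnr[OF r] r unfolding pos_family_def
      by (intro DERIV_chain2[of "G i"] DERIV_ln_divide) auto
    have 1: "((\<lambda>r. mom (\<lambda>i. G i (ln r)) (ffp m)) has_real_derivative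
         mom (\<lambda>i. G (Suc i) (ln r) * (1 / r)) (ffp m)) (at r)"
      by (rule mom_has_derivative) (rule dG)
    have 2: "((\<lambda>r. inverse (r ^ m)) has_real_derivative (- (real m / r ^ Suc m))) (at r)"
    proof -
      have "((\<lambda>r. r ^ m) has_real_derivative real m * r ^ (m - 1)) (at r)"
        by (auto intro!: derivative_eq_intros)
      from DERIV_inverse_fun[OF this] r
      show ?thesis by (cases m) (auto elim!: DERIV_cong simp: field_simps)
    qed
    have X: "mom (\<lambda>i. G i (ln r)) (ffp (Suc m)) =
        mom (\<lambda>i. G (Suc i) (ln r)) (ffp m) - real m * mom (\<lambda>i. G i (ln r)) (ffp m)"
    proof -
      have "ffp (Suc m) = smult (- real m) (ffp m) + pCons 0 (ffp m)"
        by (simp add: ffp_def mult.commute[of _ "[:_, _:]"])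
      then show ?thesis by (simp only: mom_add mom_smult mom_pCons)
    qed
    have Y: "mom (\<lambda>i. G (Suc i) (ln r) / r) (ffp m) = mom (\<lambda>i. G (Suc i) (ln r)) (ffp m) / r"
      unfolding mom_def sum_divide_distrib by simp
    show "(F m has_real_derivative F (Suc m) r) (at r)"
      unfolding F_def[abs_def] divide_inverse[of _ "_ ^ m"]
      by (rule DERIV_cong[OF DERIV_mult[OF 1 2]]) (use r in \<open>simp add: X Y field_simps\<close>)
    have "pos_data (\<lambda>i. G i (ln r))"
      using G[of "ln r - 1"] lnr[OF r] unfolding pos_family_def by simp
    then have "0 \<le> mom (\<lambda>i. G i (ln r)) (1\<^sup>2 * ffp m)" unfolding pos_data_def by blast
    then show "0 \<le> F m r" using r by (simp add: F_def)
  qed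
  interpret F: abs_monotone F 0 r1 by (rule am)
  have r1: "r1 > 0" by (simp add: r1_def)
  define u where "u N = r1 / (real N + 2)" for N
  have u: "0 < u N" "u N < r1" for N using r1 by (auto simp: u_def field_simps intro: add_pos_nonneg)
  have u_dec: "u N \<le> u M" if "M \<le> N" for M N
    using that r1 unfolding u_def by (intro divide_left_mono) auto
  have u_lim: "u \<longlonglongrightarrow> 0"
    using LIMSEQ_ignore_initial_segment[OF lim_const_over_n[of r1], of 2] by (simp add: u_def[abs_def] add.commute)
  have conv: "convergent (\<lambda>N. F b (u N))" for b
  proof -
    have "decseq (\<lambda>N. F b (u N))"
      unfolding decseq_def using u u_dec by (auto intro!: F.mono)
    then obtain L where "(\<lambda>N. F b (u N)) \<longlonglongrightarrow> L"
      by (rule decseq_convergent[where B=0]) (use F.nonneg u in auto)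
    then show ?thesis by (rule convergentI)
  qed
  define A where "A b = lim (\<lambda>N. F b (u N))" for b
  have A: "(\<lambda>N. F b (u N)) \<longlonglongrightarrow> A b" for b
    unfolding A_def using conv convergent_LIMSEQ_iff by blast
  have A0: "0 \<le> A b" for b
    by (rule tendsto_lowerbound[OF A]) (use F.nonneg u in auto)
  have key: "summable (\<lambda>b. A b / fact b * r ^ b) \<and> (\<Sum>b. A b / fact b * r ^ b) = F 0 r" if r: "0 < r" "r < r1" for r
  proof -
    \<comment> \<open>\<open>u K < r\<close> puts the expansion points to the left of
      \<open>r\<close>; \<open>u K < r1 - r\<close> makes the series at \<open>u K\<close> converge
      at \<open>u K + r\<close>, which provides the majorant.\<close>
    obtain K where K: "u K < min r (r1 - r)"
      using order_tendstoD(2)[OF u_lim, of "min r (r1 - r)"] r by (auto simp: eventually_sequentially)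
    define a where "a b N = F b (u (N + K)) / fact b * (r - u (N + K)) ^ b" for b N
    have uNK: "u (N + K) \<le> u K" for N by (intro u_dec) simp
    have smb: "summable (\<lambda>b. F b (u K) / fact b * r ^ b)"
      using F.summable_series[of "u K" "u K + r"] u[of K] K r by simp
    have lim: "(\<lambda>N. a b N) \<longlonglongrightarrow> A b / fact b * (r - 0) ^ b" for b
      unfolding a_def by (intro tendsto_intros LIMSEQ_ignore_initial_segment A u_lim) simp
    have bd: "\<forall>\<^sub>F (b, N) in sequentially \<times>\<^sub>F sequentially. norm (a b N) \<le> F b (u K) / fact b * r ^ b"
    proof -
      have "norm (a b N) \<le> F b (u K) / fact b * r ^ b" for b N
      proof -
        have 0: "0 \<le> r - u (N + K)" using uNK[of N] K by simp
        have "norm (a b N) = F b (u (N + K)) / fact b * (r - u (N + K)) ^ b"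
          using F.nonneg[OF u(1,2), of b "N + K"] 0 by (simp add: a_def abs_mult)
        also have "\<dots> \<le> F b (u K) / fact b * r ^ b"
          using F.nonneg[OF u(1,2), of b "N + K"] F.nonneg[OF u(1,2), of b K] 0 F.mono[OF u(1) uNK u(2)] u(1)[of "N + K"]
          by (intro mult_mono divide_right_mono power_mono) auto
        finally show ?thesis .
      qed
      then show ?thesis by (intro always_eventually) auto
    qed
    note T = tannerys_theorem[OF lim bd smb trivial_limit_sequentially]
    have "(\<Sum>b. a b N) = F 0 r" for N
      unfolding a_def using F.series_right[of "u (N + K)" r] u uNK[of N] K r
      by (intro sums_unique[symmetric]) auto
    then have "(\<Sum>b. A b / fact b * (r - 0) ^ b) = F 0 r"
      using T by (simp add: LIMSEQ_const_iff)
    moreover have "summable (\<lambda>b. A b / fact b * (r - 0) ^ b)" by (rule summable_norm_cancel[OF conjunct1[OF conjunct2[OF T]]])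
    ultimately show ?thesis by simp
  qed
  show ?thesis
  proof (rule that[of "\<lambda>b. A b / fact b"])
    show "0 \<le> A k / fact k" for k using A0 by simp
    show "summable (\<lambda>k. A k / fact k * r ^ k)" if "0 < r" "r < exp \<beta>" for r
      using key[of r] that by (simp add: r1_def)
    show "(\<Sum>k. A k / fact k * r ^ k) = g 0 (ln r)" if "exp \<alpha> < r" "r < exp \<beta>" for r
    proof -
      have "0 < r" using that(1) exp_gt_zero[of \<alpha>] by linarith
      moreover have "\<alpha> < ln r" using that \<open>0 < r\<close> ln_less_cancel_iff[of "exp \<alpha>" r] by simp
      ultimately show ?thesis using key[of r] that lnr[of r] Gg[of "ln r" 0] by (simp add: r1_def F0)
    qed
  qed
qed

section \<open>Complex n-space as an instance of the abstract complex structure\<close>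

lemma norm_vector_scalar: "norm (a *s v) = cmod a * norm v" for v :: "complex^'n"
  unfolding norm_vec_def by (simp add: norm_mult L2_set_right_distrib)

interpretation V: complex_scaling "(*s) :: complex \<Rightarrow> complex^'n \<Rightarrow> complex^'n"
  by unfold_locales
    (auto simp: vec_eq_iff algebra_simps norm_vector_scalar scaleR_conv_of_real[where 'a=complex])

lemma hol_nth: "V.hol S (\<lambda>x. x $ i)"
  by (rule V.holI[OF has_derivative_vec_nth]) simp

lemma hol_herm: "V.hol S (\<lambda>x. herm x y)"
  unfolding herm_def by (intro V.hol_sum(1) V.hol_mult(1) hol_nth V.hol_const)

lemma vec_expand: "v = (\<Sum>i\<in>UNIV. v $ i *s axis i 1)" for v :: "complex^'n"
  by (rule basis_expansion[symmetric])

lemma dird_expand: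
  fixes v :: "complex^'n"
  assumes "V.hol S g" "x \<in> S"
  shows "dird g v x = (\<Sum>i\<in>UNIV. v $ i * dird g (axis i 1) x)"
proof -
  have "dird g v x = dird g (\<Sum>i\<in>UNIV. v $ i *s axis i 1) x" using vec_expand[of v] by simp
  also have "\<dots> = (\<Sum>i\<in>UNIV. dird g (v $ i *s axis i 1) x)"
    using V.dird_linear[OF assms] by (simp add: linear_sum)
  finally show ?thesis by (simp add: V.holD(2)[OF assms])
qed

text \<open>The second hypothesis is the vanishing of every \<open>d_z i\<close> of a function with
  differential \<open>D\<close>, so \<open>D\<close> has no complex linear part.\<close>

lemma conj_linearI:
  fixes D :: "complex^'n \<Rightarrow> complex"
  assumes "linear D" "\<And>i. D (axis i 1) = \<i> * D (axis i \<i>)"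
  shows "D (a *s v) = cnj a * D v"
proof -
  have *: "D v = (\<Sum>i\<in>UNIV. cnj (v $ i) * D (axis i 1))" for v
  proof -
    have 1: "v $ i *s axis i 1 = Re (v $ i) *\<^sub>R axis i 1 + Im (v $ i) *\<^sub>R (axis i \<i> :: complex^'n)" for i
      by (auto simp: vec_eq_iff axis_def complex_eq_iff)
    have "D v = (\<Sum>i\<in>UNIV. D (v $ i *s axis i 1))"
      by (subst vec_expand[of v]) (simp only: linear_sum[OF assms(1)])
    also have "\<dots> = (\<Sum>i\<in>UNIV. cnj (v $ i) * D (axis i 1))"
    proof (intro sum.cong refl)
      fix i
      show "D (v $ i *s axis i 1) = cnj (v $ i) * D (axis i 1)"
        unfolding 1 linear_add[OF assms(1)] linear_scale[OF assms(1)] assms(2)[of i]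
        by (auto simp: complex_eq_iff algebra_simps)
    qed
    finally show ?thesis .
  qed
  show ?thesis by (subst (1 2) *) (simp add: sum_distrib_left mult.assoc)
qed

section \<open>Square summable holomorphic maps\<close>

lemma ell2_comb:
  assumes "Z \<in> ell2" "W \<in> ell2"
  shows "(\<lambda>j. Z j + a * W j) \<in> ell2"
proof -
  have "(cmod (Z j + a * W j))\<^sup>2 \<le> 2 * (cmod (Z j))\<^sup>2 + 2 * (cmod a)\<^sup>2 * (cmod (W j))\<^sup>2" for j
  proof -
    have "(cmod (Z j + a * W j))\<^sup>2 \<le> (cmod (Z j) + cmod (a * W j))\<^sup>2"
      by (intro power_mono norm_triangle_ineq) auto
    also have "\<dots> \<le> 2 * (cmod (Z j))\<^sup>2 + 2 * (cmod (a * W j))\<^sup>2"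
      using sum_squares_bound[of "cmod (Z j)" "cmod (a * W j)"] by (simp add: power2_sum)
    finally show ?thesis by (simp add: norm_mult power_mult_distrib)
  qed
  note le = this
  have sm: "summable (\<lambda>j. 2 * (cmod (Z j))\<^sup>2 + 2 * (cmod a)\<^sup>2 * (cmod (W j))\<^sup>2)"
    using assms unfolding ell2_def by (intro summable_add summable_mult) auto
  have "summable (\<lambda>j. (cmod (Z j + a * W j))\<^sup>2)"
  proof (rule summable_comparison_test'[OF sm])
    show "norm ((cmod (Z n + a * W n))\<^sup>2) \<le> 2 * (cmod (Z n))\<^sup>2 + 2 * (cmod a)\<^sup>2 * (cmod (W n))\<^sup>2" for n
      using le[of n] by simp
  qed
  then show ?thesis by (simp add: ell2_def)
qed

lemma ell2_norm_ge:
  assumes "Z \<in> ell2"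
  shows "(\<Sum>j<J. (cmod (Z j))\<^sup>2) \<le> (ell2_norm Z)\<^sup>2" "cmod (Z j) \<le> ell2_norm Z"
proof -
  have s: "summable (\<lambda>j. (cmod (Z j))\<^sup>2)" using assms by (simp add: ell2_def)
  have n: "(ell2_norm Z)\<^sup>2 = (\<Sum>j. (cmod (Z j))\<^sup>2)" "0 \<le> ell2_norm Z"
    using s by (auto simp: ell2_norm_def suminf_nonneg)
  show 1: "(\<Sum>j<J. (cmod (Z j))\<^sup>2) \<le> (ell2_norm Z)\<^sup>2" for J
    unfolding n(1) by (intro sum_le_suminf s) auto
  have "(cmod (Z j))\<^sup>2 \<le> (\<Sum>j<Suc j. (cmod (Z j))\<^sup>2)" by (simp add: sum_nonneg)
  also have "\<dots> \<le> (ell2_norm Z)\<^sup>2" by (rule 1)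
  finally show "cmod (Z j) \<le> ell2_norm Z" using n(2) by (rule power2_le_imp_le)
qed

text \<open>Near \<open>x\<close> the value is \<open>s x + D h + r h\<close>. The remainder has
  norm at most 1 close to \<open>x\<close> by differentiability, and \<open>D h\<close> is bounded
  through the values of \<open>D\<close> on the finite basis. The factors 3 come from estimating the
  square of a sum of three terms.\<close>

lemma ell2_holomorphic_imp_lb:
  fixes S :: "(complex^'n) set"
  assumes S: "open S" and s: "ell2_holomorphic_on S s"
  shows "V.lb S (\<lambda>j x. s x j)"
proof -
  have sx: "s x \<in> ell2" if "x \<in> S" for x using s that by (simp add: ell2_holomorphic_on_def)
  have key: "(\<exists>D. \<forall>j. ((\<lambda>x. s x j) has_derivative (\<lambda>h. D h j)) (at x) \<and> (\<forall>a v. D (a *s v) j = a * D v j)) \<and>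
      (\<exists>\<rho>>0. \<exists>M. \<forall>y\<in>ball x \<rho>. \<forall>J. (\<Sum>j<J. (cmod (s y j))\<^sup>2) \<le> M)" if xS: "x \<in> S" for x
  proof -
    obtain D where D: "\<And>v. D v \<in> ell2" "\<And>v w. D (v + w) = (\<lambda>j. D v j + D w j)"
        "\<And>a v. D (a *s v) = (\<lambda>j. a * D v j)"
        "((\<lambda>h. ell2_norm (\<lambda>j. s (x + h) j - s x j - D h j) / norm h) \<longlongrightarrow> 0) (at 0)"
      using s xS unfolding ell2_holomorphic_on_def by blast
    obtain \<rho>0 where \<rho>0: "\<rho>0 > 0" "ball x \<rho>0 \<subseteq> S" using S xS by (meson open_contains_ball)
    define r where "r h = (\<lambda>j. s (x + h) j - s x j - D h j)" for h
    have r2: "r h \<in> ell2" if "norm h < \<rho>0" for h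
    proof -
      have "x + h \<in> S" using \<rho>0(2) that by (auto simp: dist_norm subset_iff)
      from ell2_comb[OF ell2_comb[OF sx[OF this] sx[OF xS], of "-1"] D(1)[of h], of "-1"]
      show ?thesis by (simp add: r_def)
    qed
    have lin: "linear (\<lambda>h. D h j)" for j
    proof (rule linearI)
      show "D (v + w) j = D v j + D w j" for v w by (simp add: D(2))
      show "D (t *\<^sub>R v) j = t *\<^sub>R D v j" for t v
        using D(3)[of "of_real t" v] V.sc_real[of t v] by (simp add: scaleR_conv_of_real)
    qed
    have der: "((\<lambda>x. s x j) has_derivative (\<lambda>h. D h j)) (at x)" for j
      unfolding has_derivative_at
    proof
      show "bounded_linear (\<lambda>h. D h j)" using lin by (simp add: linear_conv_bounded_linear)
      show "(\<lambda>h. norm (s (x + h) j - s x j - D h j) / norm h) \<midarrow>0\<rightarrow> 0"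
      proof (rule tendsto_sandwich[OF _ _ tendsto_const D(4)])
        have "\<forall>\<^sub>F h in at 0. norm h < \<rho>0"
          using \<rho>0(1) by (auto simp: eventually_at intro!: exI[of _ \<rho>0])
        then show "\<forall>\<^sub>F h in at 0. norm (s (x + h) j - s x j - D h j) / norm h
            \<le> ell2_norm (\<lambda>j. s (x + h) j - s x j - D h j) / norm h"
        proof eventually_elim
          case (elim h)
          show ?case using ell2_norm_ge(2)[OF r2[OF elim], of j] by (simp add: r_def divide_right_mono)
        qed
      qed simp
    qed
    define K where "K = (\<Sum>i\<in>UNIV. (ell2_norm (D (axis i 1)))\<^sup>2)"
    have DK: "(\<Sum>j<J. (cmod (D h j))\<^sup>2) \<le> (norm h)\<^sup>2 * K" for h J
    proof -
      have "(cmod (D h j))\<^sup>2 \<le> (norm h)\<^sup>2 * (\<Sum>i\<in>UNIV. (cmod (D (axis i 1) j))\<^sup>2)" for j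
      proof -
        have "D h j = (\<Sum>i\<in>UNIV. D (h $ i *s axis i 1) j)"
          by (subst vec_expand[of h]) (simp only: linear_sum[OF lin])
        also have "\<dots> = (\<Sum>i\<in>UNIV. h $ i * D (axis i 1) j)" by (simp add: D(3))
        finally have "cmod (D h j) \<le> sqrt (\<Sum>i\<in>UNIV. (cmod (h $ i))\<^sup>2) * sqrt (\<Sum>i\<in>UNIV. (cmod (D (axis i 1) j))\<^sup>2)"
          using V.cmod_sum_mult_le by metis
        also have "sqrt (\<Sum>i\<in>UNIV. (cmod (h $ i))\<^sup>2) = norm h" by (simp add: norm_vec_def L2_set_def)
        finally have "(cmod (D h j))\<^sup>2 \<le> (norm h * sqrt (\<Sum>i\<in>UNIV. (cmod (D (axis i 1) j))\<^sup>2))\<^sup>2"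
          by (intro power_mono) auto
        then show ?thesis by (simp add: power_mult_distrib sum_nonneg)
      qed
      then have "(\<Sum>j<J. (cmod (D h j))\<^sup>2) \<le> (\<Sum>j<J. (norm h)\<^sup>2 * (\<Sum>i\<in>UNIV. (cmod (D (axis i 1) j))\<^sup>2))"
        by (intro sum_mono) auto
      also have "\<dots> = (norm h)\<^sup>2 * (\<Sum>i\<in>UNIV. \<Sum>j<J. (cmod (D (axis i 1) j))\<^sup>2)"
        by (subst sum.swap) (simp add: sum_distrib_left)
      also have "\<dots> \<le> (norm h)\<^sup>2 * K"
        unfolding K_def by (intro mult_left_mono sum_mono ell2_norm_ge D(1)) auto
      finally show ?thesis .
    qed
    have "\<forall>\<^sub>F h in at 0. ell2_norm (r h) / norm h < 1"
      using order_tendstoD(2)[OF D(4), of 1] by (simp add: r_def)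
    then obtain d where d: "d > 0" "\<And>h. h \<noteq> 0 \<Longrightarrow> norm h < d \<Longrightarrow> ell2_norm (r h) / norm h < 1"
      unfolding eventually_at by (auto simp: dist_norm)
    define \<rho> where "\<rho> = min 1 (min d \<rho>0)"
    have \<rho>: "\<rho> > 0" "\<rho> \<le> 1" "\<rho> \<le> d" "\<rho> \<le> \<rho>0" using d \<rho>0 by (auto simp: \<rho>_def)
    have sq3: "(cmod (a + b + c))\<^sup>2 \<le> 3 * (cmod a)\<^sup>2 + 3 * (cmod b)\<^sup>2 + 3 * (cmod c)\<^sup>2" for a b c
    proof -
      have "cmod (a + b + c) \<le> cmod a + cmod b + cmod c"
        by (meson norm_triangle_ineq order_trans add_right_mono)
      then have "(cmod (a + b + c))\<^sup>2 \<le> (cmod a + cmod b + cmod c)\<^sup>2" by (intro power_mono) auto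
      also have "\<dots> \<le> 3 * (cmod a)\<^sup>2 + 3 * (cmod b)\<^sup>2 + 3 * (cmod c)\<^sup>2"
        using sum_squares_bound[of "cmod a" "cmod b"] sum_squares_bound[of "cmod a" "cmod c"]
          sum_squares_bound[of "cmod b" "cmod c"] by (simp add: power2_eq_square algebra_simps)
      finally show ?thesis .
    qed
    have "(\<Sum>j<J. (cmod (s y j))\<^sup>2) \<le> 3 * (ell2_norm (s x))\<^sup>2 + 3 * K + 3" if y: "y \<in> ball x \<rho>" for y J
    proof -
      define h where "h = y - x"
      have h: "norm h < \<rho>" using y by (simp add: h_def dist_norm norm_minus_commute)
      have rn: "ell2_norm (r h) \<le> 1" if "h \<noteq> 0"
      proof -
        have "ell2_norm (r h) < norm h" using d(2)[OF that] h \<rho> that by (simp add: field_simps)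
        then show ?thesis using h \<rho> by simp
      qed
      have r1: "(\<Sum>j<J. (cmod (r h j))\<^sup>2) \<le> 1"
      proof (cases "h = 0")
        case True
        have "D 0 j = 0" for j using linear_0[OF lin] .
        then show ?thesis using True by (simp add: r_def)
      next
        case False
        have n: "norm h < \<rho>0" using h \<rho> by simp
        have "(\<Sum>j<J. (cmod (r h j))\<^sup>2) \<le> (ell2_norm (r h))\<^sup>2" using ell2_norm_ge(1)[OF r2[OF n]] .
        also have "0 \<le> ell2_norm (r h)" using ell2_norm_ge(2)[OF r2[OF n], of 0] norm_ge_zero order_trans by blast
        then have "(ell2_norm (r h))\<^sup>2 \<le> 1" using rn[OF False] by (simp add: power_le_one)
        finally show ?thesis .
      qed
      have "K \<ge> 0" by (simp add: K_def sum_nonneg)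
      have D1: "(\<Sum>j<J. (cmod (D h j))\<^sup>2) \<le> K"
      proof -
        have "(norm h)\<^sup>2 * K \<le> 1 * K" using h \<rho> \<open>K \<ge> 0\<close> by (intro mult_right_mono) (auto simp: power_le_one)
        then show ?thesis using DK[where h=h and J=J] by simp
      qed
      have "(\<Sum>j<J. (cmod (s y j))\<^sup>2) = (\<Sum>j<J. (cmod (s x j + D h j + r h j))\<^sup>2)"
        by (simp add: r_def h_def)
      also have "\<dots> \<le> (\<Sum>j<J. 3 * (cmod (s x j))\<^sup>2 + 3 * (cmod (D h j))\<^sup>2 + 3 * (cmod (r h j))\<^sup>2)"
        by (intro sum_mono sq3)
      also have "\<dots> = 3 * (\<Sum>j<J. (cmod (s x j))\<^sup>2) + 3 * (\<Sum>j<J. (cmod (D h j))\<^sup>2) + 3 * (\<Sum>j<J. (cmod (r h j))\<^sup>2)"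
        by (simp add: sum.distrib sum_distrib_left)
      also have "\<dots> \<le> 3 * (ell2_norm (s x))\<^sup>2 + 3 * K + 3"
        using D1 r1 ell2_norm_ge(1)[OF sx[OF xS], of J] by linarith
      finally show ?thesis .
    qed
    then have "\<exists>\<rho>>0. \<exists>M. \<forall>y\<in>ball x \<rho>. \<forall>J. (\<Sum>j<J. (cmod (s y j))\<^sup>2) \<le> M"
      using \<rho>(1) by blast
    moreover have "\<forall>j. ((\<lambda>x. s x j) has_derivative (\<lambda>h. D h j)) (at x) \<and> (\<forall>a v. D (a *s v) j = a * D v j)"
      using der D(3) by simp
    ultimately show ?thesis by blast
  qed
  show ?thesis
    unfolding V.lb_def
  proof (intro conjI allI ballI)
    show "V.hol S (\<lambda>x. s x j)" for j
      unfolding V.hol_def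
    proof
      fix x assume "x \<in> S"
      from conjunct1[OF key[OF this]] obtain D where
        "\<forall>j. ((\<lambda>x. s x j) has_derivative (\<lambda>h. D h j)) (at x) \<and> (\<forall>a v. D (a *s v) j = a * D v j)" ..
      then show "\<exists>D. ((\<lambda>x. s x j) has_derivative D) (at x) \<and> (\<forall>a v. D (a *s v) = a * D v)"
        by (intro exI[of _ "\<lambda>h. D h j"]) blast
    qed
  qed (use key in blast)
qed

lemma pair_cnj:
  assumes "V.lb S q" "V.lb S t" "x \<in> S"
  shows "cnj (V.pair q t x) = V.pair t q x"
proof -
  have "cnj (\<Sum>j. q j x * cnj (t j x)) = (\<Sum>j. cnj (q j x * cnj (t j x)))"
    by (rule bounded_linear.suminf[OF bounded_linear_cnj V.summable_pair2[OF assms assms(3)]])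
  then show ?thesis by (simp add: V.pair_def mult.commute)
qed

lemma pair_self:
  assumes "V.lb S q" "x \<in> S"
  shows "V.pair q q x = of_real (\<Sum>j. (cmod (q j x))\<^sup>2)"
  using V.lb_summable[OF assms] unfolding V.pair_def
  by (simp only: suminf_of_real complex_norm_square)

lemma pair_sum:
  assumes "finite A" "\<And>a. a \<in> A \<Longrightarrow> V.lb S (q a)" "V.lb S t" "open S" "x \<in> S"
  shows "V.pair (\<lambda>j x. \<Sum>a\<in>A. c a * q a j x) t x = (\<Sum>a\<in>A. c a * V.pair (q a) t x)"
    and "V.pair t (\<lambda>j x. \<Sum>a\<in>A. c a * q a j x) x = (\<Sum>a\<in>A. cnj (c a) * V.pair t (q a) x)"
proof -
  have lbc: "V.lb S (\<lambda>j x. c a * q a j x)" if "a \<in> A" for a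
    by (intro V.lb_mult V.hol_const assms that)
  have lbs: "V.lb S (\<lambda>j x. \<Sum>a\<in>B. c a * q a j x)" if "B \<subseteq> A" for B
    by (intro V.lb_sum lbc assms finite_subset[OF that]) (use that in auto)
  show "V.pair (\<lambda>j x. \<Sum>a\<in>A. c a * q a j x) t x = (\<Sum>a\<in>A. c a * V.pair (q a) t x)"
    using assms(1) lbc lbs assms(2)
  proof (induction A rule: finite_induct)
    case (insert a A)
    have "V.pair (\<lambda>j x. c a * q a j x + (\<Sum>a\<in>A. c a * q a j x)) t x
        = c a * V.pair (q a) t x + V.pair (\<lambda>j x. \<Sum>a\<in>A. c a * q a j x) t x"
      using V.pair_linear(1)[of S "\<lambda>j x. c a * q a j x" "\<lambda>j x. \<Sum>a\<in>A. c a * q a j x" t x]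
        V.pair_linear(3)[of S "q a" "q a" t x "\<lambda>_. c a"] insert.prems insert.hyps assms by (auto simp: subset_insertI)
    then show ?case using insert by (simp add: subset_insertI2)
  qed (simp add: V.pair_def)
  show "V.pair t (\<lambda>j x. \<Sum>a\<in>A. c a * q a j x) x = (\<Sum>a\<in>A. cnj (c a) * V.pair t (q a) x)"
    using assms(1) lbc lbs assms(2)
  proof (induction A rule: finite_induct)
    case (insert a A)
    have "V.pair t (\<lambda>j x. c a * q a j x + (\<Sum>a\<in>A. c a * q a j x)) x
        = cnj (c a) * V.pair t (q a) x + V.pair t (\<lambda>j x. \<Sum>a\<in>A. c a * q a j x) x"
      using V.pair_linear(2)[of S "\<lambda>j x. c a * q a j x" "\<lambda>j x. \<Sum>a\<in>A. c a * q a j x" t x]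
        V.pair_linear(4)[of S "q a" "q a" t x "\<lambda>_. c a"] insert.prems insert.hyps assms by (auto simp: subset_insertI)
    then show ?case using insert by (simp add: subset_insertI2)
  qed (simp add: V.pair_def)
qed

section \<open>The weighted pairing and its Chern connection\<close>

locale local_potential =
  fixes S :: "(complex^'n) set" and s :: "nat \<Rightarrow> complex^'n \<Rightarrow> complex"
    and I :: "real set" and f :: "real \<Rightarrow> real" and c \<alpha> :: real
  assumes openS: "open S" and lbs: "V.lb S s" and nz: "\<And>x. x \<in> S \<Longrightarrow> \<exists>j. s j x \<noteq> 0"
    and openI: "open I" and smf: "smooth_on I f" and SI: "\<And>x. x \<in> S \<Longrightarrow> (norm x)\<^sup>2 \<in> I"
    and c: "c \<noteq> 0"
    and hess: "\<And>x. x \<in> S \<Longrightarrow>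
      complex_hessian (\<lambda>x. 1 / c * ln (\<Sum>j. (cmod (s j x))\<^sup>2)) x = \<alpha> *\<^sub>R radial_form f x"
begin

definition \<gamma> :: real where "\<gamma> = c * \<alpha>"

definition N :: "complex^'n \<Rightarrow> real" where "N x = (\<Sum>j. (cmod (s j x))\<^sup>2)"

lemma pair_ss: "x \<in> S \<Longrightarrow> V.pair s s x = of_real (N x)"
  using pair_self[OF lbs] by (simp add: N_def)

lemma N_pos: assumes "x \<in> S" shows "N x > 0"
proof -
  obtain j where "s j x \<noteq> 0" using nz[OF assms] by blast
  then show ?thesis unfolding N_def by (intro suminf_pos2[of _ j] V.lb_summable[OF lbs assms]) auto
qed

lemma N_has_derivative:
  assumes "x \<in> S"
  shows "(N has_derivative (\<lambda>v. 2 * Re (V.pair (\<lambda>j. dird (s j) v) s x))) (at x)"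
proof -
  have "((\<lambda>x. Re (V.pair s s x)) has_derivative
      (\<lambda>v. Re (V.pair (\<lambda>j. dird (s j) v) s x + V.pair s (\<lambda>j. dird (s j) v) x))) (at x)"
    by (rule has_derivative_Re[OF V.pair_has_derivative[OF lbs lbs openS assms]])
  then have "(N has_derivative
      (\<lambda>v. Re (V.pair (\<lambda>j. dird (s j) v) s x + V.pair s (\<lambda>j. dird (s j) v) x))) (at x)"
    by (rule has_derivative_transform_within_open[OF _ openS assms]) (simp add: pair_ss)
  moreover have "Re (V.pair (\<lambda>j. dird (s j) v) s x + V.pair s (\<lambda>j. dird (s j) v) x) = 2 * Re (V.pair (\<lambda>j. dird (s j) v) s x)" for v
    by (simp flip: pair_cnj[OF V.lb_dird[OF lbs openS] lbs assms])
  ultimately show ?thesis by simp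
qed

text \<open>\<open>A\<close> is the (holomorphic) differential \<open>\<partial> (log N - \<gamma> f)\<close>.\<close>

definition A :: "complex^'n \<Rightarrow> complex^'n \<Rightarrow> complex" where
  "A v x = V.pair (\<lambda>j. dird (s j) v) s x / of_real (N x) - of_real (\<gamma> * deriv f ((norm x)\<^sup>2)) * herm v x"

lemma f_deriv:
  assumes "r \<in> I"
  shows "(f has_real_derivative deriv f r) (at r)" "(deriv f has_real_derivative deriv (deriv f) r) (at r)"
  using F_deriv[OF openI smf assms] by simp_all

lemma d_zbar_log:
  assumes x: "x \<in> S"
  shows "d_zbar j (\<lambda>x. complex_of_real (1 / c * ln (N x))) x
     = V.pair s (\<lambda>k. dird (s k) (axis j 1)) x / of_real (c * N x)"
proof -
  have "((\<lambda>x. 1 / c * ln (N x)) has_derivative (\<lambda>v. 1 / c * (2 * Re (V.pair (\<lambda>j. dird (s j) v) s x) / N x))) (at x)"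
    using has_derivative_mult_right[OF has_derivative_ln[OF N_pos[OF x] N_has_derivative[OF x]], of "1 / c"]
    by (simp add: divide_inverse mult_ac)
  from d_zbar_eqI[OF has_derivative_of_real[OF this], of j]
  have "d_zbar j (\<lambda>x. complex_of_real (1 / c * ln (N x))) x =
     (complex_of_real (1 / c * (2 * Re (V.pair (\<lambda>k. dird (s k) (axis j 1)) s x) / N x))
      + \<i> * complex_of_real (1 / c * (2 * Re (V.pair (\<lambda>k. dird (s k) (axis j \<i>)) s x) / N x))) / 2" .
  also have "V.pair (\<lambda>k. dird (s k) (axis j \<i>)) s x = \<i> * V.pair (\<lambda>k. dird (s k) (axis j 1)) s x"
  proof -
    have ax: "axis j \<i> = \<i> *s (axis j 1 :: complex^'n)" by (simp add: vec_eq_iff axis_def)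
    have "V.pair (\<lambda>k. dird (s k) (axis j \<i>)) s x = V.pair (\<lambda>k x. \<i> * dird (s k) (axis j 1) x) s x"
      unfolding V.pair_def ax V.holD(2)[OF V.lb_hol[OF lbs] x] ..
    also have "\<dots> = \<i> * V.pair (\<lambda>k. dird (s k) (axis j 1)) s x"
      by (rule V.pair_linear(3)[OF V.lb_dird[OF lbs openS] lbs lbs x])
    finally show ?thesis .
  qed
  also have "V.pair (\<lambda>k. dird (s k) (axis j 1)) s x = cnj (V.pair s (\<lambda>k. dird (s k) (axis j 1)) x)"
    by (rule pair_cnj[OF lbs V.lb_dird[OF lbs openS] x, symmetric])
  finally show ?thesis using N_pos[OF x] c by (auto simp: complex_eq_iff field_simps Re_divide_of_real Im_divide_of_real)
qed

text \<open>By \<open>hess\<close>, the function \<open>log N - \<gamma> f\<close> has vanishing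
  complex Hessian. Its derivative \<open>b\<close> in the conjugate direction \<open>j\<close> is
  therefore killed by every \<open>d_z i\<close>, so its differential is conjugate linear by
  \<open>conj_linearI\<close>; and the conjugate of \<open>b\<close> is
  \<open>A (axis j 1)\<close>.\<close>

lemma hol_A_axis: "V.hol S (A (axis j 1))"
proof -
  define e where "e = (axis j 1 :: complex^'n)"
  define P where "P x = V.pair s (\<lambda>k. dird (s k) e) x / of_real (N x)" for x
  define G where "G x = complex_of_real (deriv f ((norm x)\<^sup>2)) * x $ j" for x :: "complex^'n"
  define b where "b x = P x - of_real \<gamma> * G x" for x
  have lbe: "V.lb S (\<lambda>k. dird (s k) e)" by (rule V.lb_dird[OF lbs openS])
  have bA: "cnj (b x) = A e x" if "x \<in> S" for x
  proof -
    have "herm e x = cnj (x $ j)"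
      unfolding herm_def e_def axis_def by (subst sum.remove[of _ j]) (auto intro!: sum.neutral)
    then show ?thesis
      unfolding b_def A_def P_def G_def by (simp add: pair_cnj[OF lbs lbe that] mult.assoc)
  qed
  have main: "\<exists>D. (b has_derivative D) (at x) \<and> linear D \<and> (\<forall>i. D (axis i 1) = \<i> * D (axis i \<i>))" if x: "x \<in> S" for x
  proof -
    have dN: "((\<lambda>x. complex_of_real (N x)) has_derivative (\<lambda>v. of_real (2 * Re (V.pair (\<lambda>j. dird (s j) v) s x)))) (at x)"
      by (rule has_derivative_of_real[OF N_has_derivative[OF x]])
    have N0: "complex_of_real (N x) \<noteq> 0" using N_pos[OF x] by simp
    obtain DP where DP: "(P has_derivative DP) (at x)"
      unfolding P_def[abs_def]
      using has_derivative_divide[OF V.pair_has_derivative[OF lbs lbe openS x] dN N0] by blast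
    obtain DG where DG: "(G has_derivative DG) (at x)"
      unfolding G_def[abs_def] using has_derivative_radial_mult[OF f_deriv(2)[OF SI[OF x]], of j] by blast
    have h1: "(DP (axis i 1) - \<i> * DP (axis i \<i>)) / 2 = of_real \<gamma> * radial_form f x $ i $ j" for i
    proof -
      have "((\<lambda>x. P x / of_real c) has_derivative (\<lambda>v. DP v / of_real c)) (at x)"
        using has_derivative_mult_left[OF DP, of "1 / of_real c"] by simp
      then have "((\<lambda>x. d_zbar j (\<lambda>x. complex_of_real (1 / c * ln (N x))) x) has_derivative (\<lambda>v. DP v / of_real c)) (at x)"
      proof (rule has_derivative_transform_within_open[OF _ openS x])
        show "P y / of_real c = d_zbar j (\<lambda>x. complex_of_real (1 / c * ln (N x))) y" if "y \<in> S" for y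
          by (subst d_zbar_log[OF that]) (simp add: P_def e_def mult.commute)
      qed
      from d_z_eqI[OF this, of i]
      have "complex_hessian (\<lambda>x. 1 / c * ln (N x)) x $ i $ j = (DP (axis i 1) - \<i> * DP (axis i \<i>)) / 2 / of_real c"
        by (simp add: complex_hessian_def diff_divide_distrib mult.commute)
      moreover have "complex_hessian (\<lambda>x. 1 / c * ln (N x)) x $ i $ j = of_real \<alpha> * radial_form f x $ i $ j"
        using hess[OF x] by (simp add: N_def scaleR_conv_of_real[where 'a=complex])
      ultimately show ?thesis using c by (simp add: \<gamma>_def field_simps)
    qed
    have h2: "(DG (axis i 1) - \<i> * DG (axis i \<i>)) / 2 = radial_form f x $ i $ j" for i
    proof -
      have "(d_zbar j (\<lambda>x. complex_of_real (f ((norm x)\<^sup>2))) has_derivative DG) (at x)"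
      proof (rule has_derivative_transform_within_open[OF DG openS x])
        show "G y = d_zbar j (\<lambda>x. complex_of_real (f ((norm x)\<^sup>2))) y" if "y \<in> S" for y
          using d_zbar_radial[OF f_deriv(1)[OF SI[OF that]], of j] by (simp add: G_def)
      qed
      from d_z_eqI[OF this, of i] show ?thesis
        by (simp add: radial_form_def complex_hessian_def)
    qed
    define D where "D v = DP v - of_real \<gamma> * DG v" for v
    have D: "(b has_derivative D) (at x)"
      unfolding b_def[abs_def] D_def[abs_def] by (intro has_derivative_diff has_derivative_mult_right DP DG)
    have "D (axis i 1) = \<i> * D (axis i \<i>)" for i
    proof -
      have "D (axis i 1) - \<i> * D (axis i \<i>) = 2 * ((DP (axis i 1) - \<i> * DP (axis i \<i>)) / 2 - of_real \<gamma> * ((DG (axis i 1) - \<i> * DG (axis i \<i>)) / 2))"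
        unfolding D_def by (simp add: field_simps)
      also have "\<dots> = 0" by (simp only: h1 h2 diff_self mult_zero_right)
      finally show ?thesis by simp
    qed
    then show ?thesis using D has_derivative_linear[OF D] by blast
  qed
  show ?thesis
    unfolding V.hol_def
  proof
    fix x assume x: "x \<in> S"
    obtain D where D: "(b has_derivative D) (at x)" "linear D" "\<And>i. D (axis i 1) = \<i> * D (axis i \<i>)"
      using main[OF x] by blast
    have "(A e has_derivative (\<lambda>v. cnj (D v))) (at x)"
      by (rule has_derivative_transform_within_open[OF has_derivative_cnj[OF D(1)] openS x]) (rule bA)
    moreover have "cnj (D (a *s v)) = a * cnj (D v)" for a v
      using conj_linearI[OF D(2,3)] by simp
    ultimately show "\<exists>D. (A (axis j 1) has_derivative D) (at x) \<and> (\<forall>a v. D (a *s v) = a * D v)"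
      unfolding e_def by blast
  qed
qed

lemma A_linear:
  assumes x: "x \<in> S"
  shows "A (a *s v) x = a * A v x" "A v x = (\<Sum>i\<in>UNIV. v $ i * A (axis i 1) x)"
proof -
  show 1: "A (a *s v) x = a * A v x" for a v
  proof -
    have "V.pair (\<lambda>k. dird (s k) (a *s v)) s x = V.pair (\<lambda>k x. a * dird (s k) v x) s x"
      unfolding V.pair_def V.holD(2)[OF V.lb_hol[OF lbs] x] ..
    also have "\<dots> = a * V.pair (\<lambda>k. dird (s k) v) s x"
      by (rule V.pair_linear(3)[OF V.lb_dird[OF lbs openS] lbs lbs x])
    finally show ?thesis by (simp add: A_def herm_scale_left algebra_simps)
  qed
  have "V.pair (\<lambda>k. dird (s k) v) s x = V.pair (\<lambda>k x. \<Sum>i\<in>UNIV. v $ i * dird (s k) (axis i 1) x) s x"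
    unfolding V.pair_def dird_expand[OF V.lb_hol[OF lbs] x, of _ v] ..
  also have "\<dots> = (\<Sum>i\<in>UNIV. v $ i * V.pair (\<lambda>k. dird (s k) (axis i 1)) s x)"
    by (rule pair_sum(1)[OF _ V.lb_dird[OF lbs openS] lbs openS x]) simp
  finally have p: "V.pair (\<lambda>k. dird (s k) v) s x = (\<Sum>i\<in>UNIV. v $ i * V.pair (\<lambda>k. dird (s k) (axis i 1)) s x)" .
  have h: "herm v x = (\<Sum>i\<in>UNIV. v $ i * herm (axis i 1) x)"
  proof -
    have "herm (axis i 1) x = cnj (x $ i)" for i
      unfolding herm_def axis_def by (subst sum.remove[of _ i]) (auto intro!: sum.neutral)
    then show ?thesis by (simp add: herm_def)
  qed
  show "A v x = (\<Sum>i\<in>UNIV. v $ i * A (axis i 1) x)"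
    unfolding A_def p h by (simp add: sum_divide_distrib sum_distrib_left sum_subtractf algebra_simps)
qed

lemma hol_A: "V.hol S (A v)"
proof -
  have "V.hol S (\<lambda>x. \<Sum>i\<in>UNIV. v $ i * A (axis i 1) x)"
    by (intro V.hol_sum(1) V.hol_mult(1) V.hol_const hol_A_axis)
  then show ?thesis
    unfolding V.hol_def using A_linear(2)
    by (metis (no_types, lifting) has_derivative_transform_within_open openS)
qed

text \<open>The Chern connection of the weight \<open>W\<close>.\<close>

definition nab :: "complex^'n \<Rightarrow> (nat \<Rightarrow> complex^'n \<Rightarrow> complex) \<Rightarrow> nat \<Rightarrow> complex^'n \<Rightarrow> complex" where
  "nab v q j x = dird (q j) v x + (- A v x) * q j x"

lemma hol_minus_A: "V.hol S (\<lambda>x. - A v x)"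
  using V.hol_mult(1)[OF V.hol_const[of S "-1"] hol_A[of v]] by simp

lemma lb_nab: assumes "V.lb S q" shows "V.lb S (nab v q)"
  unfolding nab_def[abs_def]
  by (rule V.lb_add[OF V.lb_dird[OF assms openS] V.lb_mult[OF hol_minus_A assms openS] openS])

definition W :: "complex^'n \<Rightarrow> real" where "W x = exp (\<gamma> * f ((norm x)\<^sup>2)) / N x"

definition wp :: "(nat \<Rightarrow> complex^'n \<Rightarrow> complex) \<Rightarrow> (nat \<Rightarrow> complex^'n \<Rightarrow> complex) \<Rightarrow> complex^'n \<Rightarrow> complex" where
  "wp q t x = of_real (W x) * V.pair q t x"

lemma W_pos: "x \<in> S \<Longrightarrow> W x > 0"
  by (simp add: W_def N_pos)

lemma wp_ss: "x \<in> S \<Longrightarrow> wp s s x = of_real (exp (\<gamma> * f ((norm x)\<^sup>2)))"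
  using N_pos[of x] by (simp add: wp_def pair_ss W_def)

text \<open>The logarithm of \<open>W\<close> is \<open>\<gamma> f - log N\<close>, which is real
  and whose complex linear differential is \<open>- A\<close>; the conjugate term is the other
  half.\<close>

lemma W_has_derivative:
  assumes x: "x \<in> S"
  shows "((\<lambda>x. complex_of_real (W x)) has_derivative (\<lambda>v. - of_real (W x) * (A v x + cnj (A v x)))) (at x)"
proof -
  have f: "((\<lambda>x. f ((norm x)\<^sup>2)) has_derivative (\<lambda>v. deriv f ((norm x)\<^sup>2) * (2 * (x \<bullet> v)))) (at x)"
    using has_derivative_compose[OF has_derivative_norm_sq f_deriv(1)[OF SI[OF x], unfolded has_field_derivative_def]] by simp
  have "((\<lambda>x. exp (\<gamma> * f ((norm x)\<^sup>2))) has_derivative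
      (\<lambda>v. exp (\<gamma> * f ((norm x)\<^sup>2)) * (\<gamma> * (deriv f ((norm x)\<^sup>2) * (2 * (x \<bullet> v)))))) (at x)"
    using has_derivative_exp[OF has_derivative_mult_right[OF f, of \<gamma>]] by (simp add: mult_ac)
  from has_derivative_divide[OF this N_has_derivative[OF x]] N_pos[OF x]
  have "(W has_derivative (\<lambda>v. - exp (\<gamma> * f ((norm x)\<^sup>2)) * (inverse (N x) * (2 * Re (V.pair (\<lambda>j. dird (s j) v) s x)) * inverse (N x))
      + exp (\<gamma> * f ((norm x)\<^sup>2)) * (\<gamma> * (deriv f ((norm x)\<^sup>2) * (2 * (x \<bullet> v)))) / N x)) (at x)"
    unfolding W_def[abs_def] by simp
  from has_derivative_of_real[OF this]
  show ?thesis
  proof (rule has_derivative_eq_rhs, intro ext)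
    fix v
    have "A v x + cnj (A v x) = of_real (2 * Re (A v x))" by (simp add: complex_add_cnj)
    moreover have "Re (A v x) = Re (V.pair (\<lambda>j. dird (s j) v) s x) / N x - \<gamma> * deriv f ((norm x)\<^sup>2) * (x \<bullet> v)"
      using inner_herm[of v x] by (simp add: A_def inner_commute Re_divide_of_real)
    ultimately have e: "- of_real (W x) * (A v x + cnj (A v x)) =
      complex_of_real (- W x * (2 * (Re (V.pair (\<lambda>j. dird (s j) v) s x) / N x - \<gamma> * deriv f ((norm x)\<^sup>2) * (x \<bullet> v))))"
      by simp
    show "complex_of_real (- exp (\<gamma> * f ((norm x)\<^sup>2)) * (inverse (N x) * (2 * Re (V.pair (\<lambda>j. dird (s j) v) s x)) * inverse (N x))
      + exp (\<gamma> * f ((norm x)\<^sup>2)) * (\<gamma> * (deriv f ((norm x)\<^sup>2) * (2 * (x \<bullet> v)))) / N x)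
      = - of_real (W x) * (A v x + cnj (A v x))"
      unfolding e of_real_eq_iff using N_pos[OF x] by (simp add: W_def field_simps)
  qed
qed

text \<open>The terms \<open>- A v\<close> in the two arguments absorb the derivative of
  \<open>W\<close>, so the connection is compatible with the weighted pairing. As \<open>A\<close>
  is holomorphic, \<open>nab v\<close> preserves locally bounded holomorphic families
  (\<open>lb_nab\<close>), and the rule can be iterated without curvature terms.\<close>

lemma wp_has_derivative:
  assumes q: "V.lb S q" and t: "V.lb S t" and x: "x \<in> S"
  shows "(wp q t has_derivative (\<lambda>v. wp (nab v q) t x + wp q (nab v t) x)) (at x)"
proof -
  have 1: "V.pair (nab v q) t x = V.pair (\<lambda>j. dird (q j) v) t x + (- A v x) * V.pair q t x" for v
    unfolding nab_def[abs_def]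
    using V.pair_linear(1)[OF V.lb_dird[OF q openS] V.lb_mult[OF hol_minus_A q openS] t x, of v v]
      V.pair_linear(3)[OF q q t x, of "\<lambda>x. - A v x"] by simp
  have 2: "V.pair q (nab v t) x = V.pair q (\<lambda>j. dird (t j) v) x + cnj (- A v x) * V.pair q t x" for v
    unfolding nab_def[abs_def]
    using V.pair_linear(2)[OF V.lb_dird[OF t openS] V.lb_mult[OF hol_minus_A t openS] q x, of v v]
      V.pair_linear(4)[OF t t q x, of "\<lambda>x. - A v x"] by simp
  have "(wp q t has_derivative (\<lambda>v. of_real (W x) * (V.pair (\<lambda>j. dird (q j) v) t x + V.pair q (\<lambda>j. dird (t j) v) x)
       + (- of_real (W x) * (A v x + cnj (A v x))) * V.pair q t x)) (at x)"
    unfolding wp_def[abs_def] by (intro has_derivative_mult W_has_derivative V.pair_has_derivative[OF q t openS] x)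
  then show ?thesis
    by (rule has_derivative_eq_rhs) (simp add: wp_def 1 2 fun_eq_iff algebra_simps)
qed

lemma wp_scale_left:
  assumes "V.lb S q" "V.lb S t" "x \<in> S" "\<And>j. r j x = a * q j x"
  shows "wp r t x = a * wp q t x"
  using V.pair_linear(3)[OF assms(1,1,2,3), of "\<lambda>_. a"] assms(4) by (simp add: wp_def V.pair_def)

lemma wp_scale_right:
  assumes "V.lb S q" "V.lb S t" "x \<in> S" "\<And>j. r j x = a * q j x"
  shows "wp t r x = cnj a * wp t q x"
  using V.pair_linear(4)[OF assms(1,1,2,3), of "\<lambda>_. a"] assms(4) by (simp add: wp_def V.pair_def)

lemma nab_scale: "x \<in> S \<Longrightarrow> V.lb S q \<Longrightarrow> nab (a *s v) q j x = a * nab v q j x"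
  by (simp add: nab_def A_linear(1) V.holD(2)[OF V.lb_hol] algebra_simps)

lemma lb_nab_pow: "V.lb S ((nab v ^^ m) s)"
  by (induction m) (auto simp: lbs intro: lb_nab)

end

section \<open>Covariant derivatives in a direction orthogonal to the radius\<close>

text \<open>Used to read off both Wirtinger derivatives of a function from a formula for its real
  differential; the values at \<open>1\<close> and \<open>\<i>\<close> separate them.\<close>

lemma has_derivative_complex_unique:
  fixes u :: "complex \<Rightarrow> complex"
  assumes "(u has_derivative (\<lambda>h. h * a + cnj h * b)) (at z)" "(u has_derivative (\<lambda>h. h * a' + cnj h * b')) (at z)"
  shows "a = a'" "b = b'"
proof -
  have eq: "(\<lambda>h. h * a + cnj h * b) = (\<lambda>h. h * a' + cnj h * b')"
    using has_derivative_unique[OF assms] .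
  have "a + b = a' + b'" "\<i> * a - \<i> * b = \<i> * a' - \<i> * b'"
    using fun_cong[OF eq, of 1] fun_cong[OF eq, of \<i>] by auto
  then have "a + b = a' + b'" "a - b = a' - b'"
    by (simp, metis complex_i_not_zero mult_left_cancel right_diff_distrib)
  then show "a = a'" "b = b'" by (auto simp: complex_eq_iff)
qed

lemma has_derivative_power_radial:
  assumes "(\<phi> has_real_derivative \<phi>') (at ((cmod z)\<^sup>2))"
  shows "((\<lambda>z. z ^ k * complex_of_real (\<phi> ((cmod z)\<^sup>2))) has_derivative
     (\<lambda>h. h * (of_nat k * z ^ (k - 1) * of_real (\<phi> ((cmod z)\<^sup>2)) + z ^ k * cnj z * of_real \<phi>')
        + cnj h * (z ^ Suc k * of_real \<phi>'))) (at z)"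
proof -
  have "((\<lambda>z. z ^ k) has_derivative (\<lambda>h. h * (of_nat k * z ^ (k - 1)))) (at z)"
  proof -
    have "((\<lambda>z. z ^ k) has_field_derivative of_nat k * z ^ (k - 1)) (at z)"
      by (auto intro!: derivative_eq_intros)
    then show ?thesis
      unfolding has_field_derivative_def by (rule has_derivative_eq_rhs) (simp add: fun_eq_iff)
  qed
  from has_derivative_mult[OF this has_derivative_radial[OF assms]]
  have "((\<lambda>z. z ^ k * complex_of_real (\<phi> ((cmod z)\<^sup>2))) has_derivative
     (\<lambda>h. z ^ k * of_real (\<phi>' * (2 * (z \<bullet> h))) + h * (of_nat k * z ^ (k - 1)) * of_real (\<phi> ((cmod z)\<^sup>2)))) (at z)" .
  moreover have "complex_of_real (2 * (z \<bullet> h)) = h * cnj z + cnj h * z" for h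
    by (simp add: inner_complex_def complex_eq_iff algebra_simps)
  ultimately show ?thesis
    by (simp only: of_real_mult[of \<phi>'] power_Suc) (rule has_derivative_eq_rhs, assumption, simp add: fun_eq_iff algebra_simps)
qed

text \<open>\<open>radial_coeff F k l i x\<close> is the \<open>i\<close>-th derivative at \<open>x = |\<xi>|\<^sup>2\<close> of the coefficient of \<open>\<xi> ^ (k - l)\<close>
  in the \<open>l\<close>-th \<open>\<xi>\<close>-derivative of \<open>\<xi> ^ k * F 0 (|\<xi>|\<^sup>2)\<close>.\<close>

primrec radial_coeff :: "(nat \<Rightarrow> real \<Rightarrow> real) \<Rightarrow> nat \<Rightarrow> nat \<Rightarrow> nat \<Rightarrow> real \<Rightarrow> real" where
  "radial_coeff F k 0 i x = F i x"
| "radial_coeff F k (Suc l) i x = real (k - l + i) * radial_coeff F k l i x + x * radial_coeff F k l (Suc i) x"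

lemma radial_coeff_deriv:
  assumes "\<And>i. (F i has_real_derivative F (Suc i) x) (at x)"
  shows "(radial_coeff F k l i has_real_derivative radial_coeff F k l (Suc i) x) (at x)"
proof (induction l arbitrary: i)
  case (Suc l)
  show ?case
    unfolding radial_coeff.simps(2)[abs_def]
    by (auto intro!: derivative_eq_intros Suc.IH simp: algebra_simps)
qed (use assms in \<open>simp add: radial_coeff.simps(1)[abs_def]\<close>)

text \<open>At \<open>x = 0\<close> only the first term of the recursion survives, so its factors
  multiply up to a falling factorial; \<open>fact (k - l)\<close> on the left avoids a
  quotient.\<close>

lemma radial_coeff_0: "l \<le> k \<Longrightarrow> radial_coeff F k l 0 0 * fact (k - l) = fact k * F 0 0"
proof (induction l)
  case (Suc l)
  then have "fact (k - l) = real (k - l) * fact (k - Suc l)"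
    by (metis Suc_diff_le diff_Suc_Suc fact_Suc of_nat_fact of_nat_mult Suc_diff_Suc Suc_le_lessD)
  then show ?case using Suc by (simp add: mult_ac)
qed simp

lemma radial_coeff_full: "radial_coeff F k k 0 0 = fact k * F 0 0"
  using radial_coeff_0[of k k F] by simp

context local_potential
begin

lemma slice_has_derivative:
  assumes q: "V.lb S q" and t: "V.lb S t" and x: "x0 + z *s e \<in> S"
  shows "((\<lambda>z. wp q t (x0 + z *s e)) has_derivative
     (\<lambda>h. h * wp (nab e q) t (x0 + z *s e) + cnj h * wp q (nab e t) (x0 + z *s e))) (at z)"
proof -
  have "((\<lambda>z. x0 + z *s e) has_derivative (\<lambda>h. h *s e)) (at z)"
    using bounded_linear_imp_has_derivative[OF V.bounded_linear_sc_left, of e "at z"]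
    by (auto intro!: derivative_eq_intros)
  from has_derivative_compose[OF this wp_has_derivative[OF q t x]]
  have "((\<lambda>z. wp q t (x0 + z *s e)) has_derivative
     (\<lambda>h. wp (nab (h *s e) q) t (x0 + z *s e) + wp q (nab (h *s e) t) (x0 + z *s e))) (at z)" .
  moreover have "wp (nab (h *s e) q) t (x0 + z *s e) = h * wp (nab e q) t (x0 + z *s e)"
      "wp q (nab (h *s e) t) (x0 + z *s e) = cnj h * wp q (nab e t) (x0 + z *s e)" for h
    using wp_scale_left[where r="nab (h *s e) q", OF lb_nab[OF q, of e] t x nab_scale[OF x q]]
      wp_scale_right[where r="nab (h *s e) t", OF lb_nab[OF t, of e] q x nab_scale[OF x t]] by blast+
  ultimately show ?thesis by simp
qed

text \<open>Orthogonality makes the squared norm of \<open>x0 + z *s e\<close> equal to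
  \<open>\<rho> + |z|^2\<close>, so on this slice the pairing of \<open>s\<close> with itself is
  \<open>F 0 (\<rho> + |z|^2)\<close>. Derivatives in \<open>z\<close> act on the left argument as
  \<open>nab e\<close>, those in \<open>cnj z\<close> on the right one; \<open>m\<close> of each are
  evaluated at \<open>z = 0\<close>.\<close>

lemma nab_pow_norm:
  assumes x0: "x0 \<in> S" and e: "norm e = 1" "herm e x0 = 0"
    and F0: "\<And>r. r \<in> I \<Longrightarrow> F 0 r = exp (\<gamma> * f r)"
    and F: "\<And>k r. r \<in> I \<Longrightarrow> (F k has_real_derivative F (Suc k) r) (at r)"
  shows "wp ((nab e ^^ m) s) ((nab e ^^ m) s) x0 = of_real (fact m * F m ((norm x0)\<^sup>2))"
proof -
  define \<Omega> where "\<Omega> = {z. x0 + z *s e \<in> S}"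
  define \<rho> where "\<rho> = (norm x0)\<^sup>2"
  define u where "u l m z = wp ((nab e ^^ l) s) ((nab e ^^ m) s) (x0 + z *s e)" for l m z
  have cont: "continuous_on UNIV (\<lambda>z. x0 + z *s e)"
    by (intro continuous_intros linear_continuous_on V.bounded_linear_sc_left)
  have op: "open \<Omega>" unfolding \<Omega>_def using open_vimage[OF openS cont] by (simp add: vimage_def)
  have nsq: "(norm (x0 + z *s e))\<^sup>2 = \<rho> + (cmod z)\<^sup>2" for z
  proof -
    have "herm x0 e = 0" using herm_commute[of e x0] e(2) by simp
    then have "complex_of_real ((norm (x0 + z *s e))\<^sup>2) = of_real (\<rho> + (cmod z)\<^sup>2)"
      unfolding herm_self[symmetric] herm_add_left herm_add_right herm_scale_left herm_scale_right
      using e herm_self[of e] herm_self[of x0] complex_norm_square[of z] by (simp add: \<rho>_def)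
    then show ?thesis by (simp only: of_real_eq_iff)
  qed
  have inI: "\<rho> + (cmod z)\<^sup>2 \<in> I" if "z \<in> \<Omega>" for z using SI[of "x0 + z *s e"] that by (simp add: \<Omega>_def nsq)
  have du: "(u l m has_derivative (\<lambda>h. h * u (Suc l) m z + cnj h * u l (Suc m) z)) (at z)" if "z \<in> \<Omega>" for l m z
    unfolding u_def[abs_def] using slice_has_derivative[OF lb_nab_pow lb_nab_pow, of x0 z e] that by (simp add: \<Omega>_def)
  have dF: "((\<lambda>x. F k (\<rho> + x)) has_real_derivative F (Suc k) (\<rho> + (cmod z)\<^sup>2)) (at ((cmod z)\<^sup>2))" if "z \<in> \<Omega>" for k z
    using DERIV_shift[of "F k" "F (Suc k) (\<rho> + (cmod z)\<^sup>2)" "(cmod z)\<^sup>2" \<rho>] F[OF inI[OF that]]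
    by (simp add: add.commute)
  have step: "u (Suc l) m z = a" "u l (Suc m) z = b"
    if eq: "\<And>z. z \<in> \<Omega> \<Longrightarrow> u l m z = w z" and d: "(w has_derivative (\<lambda>h. h * a + cnj h * b)) (at z)" and z: "z \<in> \<Omega>"
    for l m w a b z
  proof -
    have "(u l m has_derivative (\<lambda>h. h * a + cnj h * b)) (at z)"
      by (rule has_derivative_transform_within_open[OF d op z]) (simp add: eq)
    from has_derivative_complex_unique[OF du[OF z] this]
    show "u (Suc l) m z = a" "u l (Suc m) z = b" .
  qed
  \<comment> \<open>The conjugate derivatives come first: each raises the index of \<open>F\<close>
    and contributes a factor \<open>z\<close>, since the power of \<open>z\<close> is not affected
    by them.\<close>
  have Acl: "u 0 m z = z ^ m * of_real (F m (\<rho> + (cmod z)\<^sup>2))" if "z \<in> \<Omega>" for m z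
    using that
  proof (induction m arbitrary: z)
    case 0
    then show ?case using wp_ss[of "x0 + z *s e"] F0[OF inI[OF 0]] by (simp add: u_def \<Omega>_def nsq)
  next
    case (Suc m)
    from step(2)[OF Suc.IH has_derivative_power_radial[OF dF[OF Suc.prems]] Suc.prems]
    show ?case .
  qed
  \<comment> \<open>The holomorphic derivatives lower the power of \<open>z\<close>; after
    \<open>m\<close> of them it is gone, and the value at \<open>0\<close> is given by
    \<open>radial_coeff_full\<close>.\<close>
  have Bcl: "u l m z = z ^ (m - l) * of_real (radial_coeff (\<lambda>i x. F (m + i) (\<rho> + x)) m l 0 ((cmod z)\<^sup>2))"
    if "l \<le> m" "z \<in> \<Omega>" for l z
    using that
  proof (induction l arbitrary: z)
    case 0
    then show ?case using Acl by simp
  next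
    case (Suc l)
    let ?R = "radial_coeff (\<lambda>i x. F (m + i) (\<rho> + x)) m"
    have d: "(?R l 0 has_real_derivative ?R l (Suc 0) ((cmod z)\<^sup>2)) (at ((cmod z)\<^sup>2))"
      by (rule radial_coeff_deriv) (use dF[OF Suc.prems(2)] in simp)
    have IH: "\<And>z. z \<in> \<Omega> \<Longrightarrow> u l m z = z ^ (m - l) * of_real (?R l 0 ((cmod z)\<^sup>2))"
      using Suc.IH Suc.prems(1) by simp
    from step(1)[OF IH has_derivative_power_radial[OF d] Suc.prems(2)]
    have "u (Suc l) m z = of_nat (m - l) * z ^ (m - l - 1) * of_real (?R l 0 ((cmod z)\<^sup>2))
         + z ^ (m - l) * cnj z * of_real (?R l (Suc 0) ((cmod z)\<^sup>2))" .
    also have "z ^ (m - l) = z ^ (m - l - 1) * z"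
      using Suc.prems(1) by (metis Suc_diff_Suc Suc_le_lessD diff_Suc_1 power_Suc2)
    also have "of_nat (m - l) * z ^ (m - l - 1) * of_real (?R l 0 ((cmod z)\<^sup>2))
         + z ^ (m - l - 1) * z * cnj z * of_real (?R l (Suc 0) ((cmod z)\<^sup>2))
       = z ^ (m - Suc l) * of_real (?R (Suc l) 0 ((cmod z)\<^sup>2))"
      using complex_norm_square[of z] by (simp add: algebra_simps)
    finally show ?case .
  qed
  have "0 \<in> \<Omega>" using x0 by (simp add: \<Omega>_def)
  from Bcl[OF order_refl this] show ?thesis
    by (simp add: u_def radial_coeff_full \<rho>_def)
qed

end

section \<open>Derivatives in the logarithmic variable\<close>

lemma ffp_Suc: "ffp (Suc m) = smult (- real m) (ffp m) + pCons 0 (ffp m)"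
  by (simp add: ffp_def mult.commute[of _ "[:_, _:]"])

text \<open>A moment is a polynomial in the derivation applied to the function with data
  \<open>g\<close>, so moments taken in succession multiply the polynomials.\<close>

lemma mom_mult: "mom (\<lambda>j. mom (\<lambda>i. g (j + i)) q) p = mom g (p * q)"
proof (induction p arbitrary: g)
  case (pCons a p)
  have "mom (\<lambda>j. mom (\<lambda>i. g (Suc j + i)) q) p = mom (\<lambda>i. g (Suc i)) (p * q)"
    using pCons.IH[of "\<lambda>i. g (Suc i)"] by simp
  then show ?case by (simp add: mom_pCons mom_add mom_smult)
qed simp

text \<open>\<open>log_deriv F i m\<close> is the \<open>i\<close>-th derivative of \<open>X \<mapsto> exp (m X) F\<^sub>m(exp X)\<close>, where \<open>F\<^sub>m\<close> is the
  \<open>m\<close>-th derivative of \<open>F\<^sub>0\<close>.\<close>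

primrec log_deriv :: "(nat \<Rightarrow> real \<Rightarrow> real) \<Rightarrow> nat \<Rightarrow> nat \<Rightarrow> real \<Rightarrow> real" where
  "log_deriv F 0 m X = exp (real m * X) * F m (exp X)"
| "log_deriv F (Suc i) m X = real m * log_deriv F i m X + log_deriv F i (Suc m) X"

lemma log_deriv_has_derivative:
  assumes "\<And>k. (F k has_real_derivative F (Suc k) (exp X)) (at (exp X))"
  shows "(log_deriv F i m has_real_derivative log_deriv F (Suc i) m X) (at X)"
proof (induction i arbitrary: m)
  case 0
  have "((\<lambda>X. F m (exp X)) has_real_derivative F (Suc m) (exp X) * exp X) (at X)"
    by (rule DERIV_chain2[where f="F m" and g=exp, OF assms DERIV_exp])
  then show ?case
    unfolding log_deriv.simps[abs_def]
    by (auto intro!: derivative_eq_intros simp: algebra_simps exp_add)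
next
  case (Suc i)
  show ?case
    unfolding log_deriv.simps(2)[of F i, abs_def] log_deriv.simps(2)[of F "Suc i"]
    using Suc.IH[of m] Suc.IH[of "Suc m"] by (intro DERIV_add DERIV_cmult) simp_all
qed

text \<open>This is the operator identity \<open>r^m (d/dr)^m = D (D - 1) ... (D - m + 1)\<close>
  for \<open>D = r d/dr\<close>. The shift \<open>j\<close> is there for the induction, where
  \<open>ffp_Suc\<close> raises it by one.\<close>

lemma mom_log_deriv: "mom (\<lambda>i. log_deriv F (j + i) 0 X) (ffp m) = log_deriv F j m X"
proof (induction m arbitrary: j)
  case 0
  then show ?case by (simp add: ffp_def mom_def)
next
  case (Suc m)
  have "mom (\<lambda>i. log_deriv F (j + i) 0 X) (ffp (Suc m)) =
     - real m * mom (\<lambda>i. log_deriv F (j + i) 0 X) (ffp m) + mom (\<lambda>i. log_deriv F (Suc j + i) 0 X) (ffp m)"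
    unfolding ffp_Suc mom_add mom_smult mom_pCons by simp
  then show ?case by (simp only: Suc.IH) simp
qed

inductive exp_class :: "(real \<Rightarrow> real) \<Rightarrow> real \<Rightarrow> (real \<Rightarrow> real) \<Rightarrow> bool" for f \<gamma> where
  const: "exp_class f \<gamma> (\<lambda>x. c)"
| deriv: "exp_class f \<gamma> (\<lambda>x. (deriv ^^ k) f x)"
| exp: "exp_class f \<gamma> (\<lambda>x. exp (\<gamma> * f x))"
| add: "exp_class f \<gamma> u \<Longrightarrow> exp_class f \<gamma> v \<Longrightarrow> exp_class f \<gamma> (\<lambda>x. u x + v x)"
| mult: "exp_class f \<gamma> u \<Longrightarrow> exp_class f \<gamma> v \<Longrightarrow> exp_class f \<gamma> (\<lambda>x. u x * v x)"

lemma exp_class_derivative: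
  assumes "exp_class f \<gamma> u" "open I" "smooth_on I f"
  shows "\<exists>d. exp_class f \<gamma> d \<and> (\<forall>x\<in>I. (u has_real_derivative d x) (at x))"
  using assms(1)
proof induction
  case (const c)
  show ?case by (rule exI[of _ "\<lambda>x. 0"]) (auto intro: exp_class.const)
next
  case (deriv k)
  show ?case by (rule exI[of _ "\<lambda>x. (deriv ^^ Suc k) f x"])
     (use smooth_on_higher_deriv(2)[OF assms(2,3)] exp_class.deriv in blast)
next
  case exp
  have d: "(f has_real_derivative (deriv ^^ 1) f x) (at x)" if "x \<in> I" for x
    using smooth_on_deriv(2)[OF assms(2,3) that] by simp
  have "exp_class f \<gamma> (\<lambda>x. exp (\<gamma> * f x) * (\<gamma> * (deriv ^^ 1) f x))"
    by (intro exp_class.intros)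
  moreover have "((\<lambda>x. exp (\<gamma> * f x)) has_real_derivative exp (\<gamma> * f x) * (\<gamma> * (deriv ^^ 1) f x)) (at x)" if "x \<in> I" for x
    by (auto intro!: derivative_eq_intros d[OF that] simp del: funpow.simps)
  ultimately show ?case by blast
next
  case (add u v)
  then obtain d d' where "exp_class f \<gamma> d" "\<forall>x\<in>I. (u has_real_derivative d x) (at x)"
    "exp_class f \<gamma> d'" "\<forall>x\<in>I. (v has_real_derivative d' x) (at x)" by blast
  then show ?case
    by (intro exI[of _ "\<lambda>x. d x + d' x"]) (auto intro: exp_class.add DERIV_add)
next
  case (mult u v)
  then obtain d d' where *: "exp_class f \<gamma> d" "\<forall>x\<in>I. (u has_real_derivative d x) (at x)"
    "exp_class f \<gamma> d'" "\<forall>x\<in>I. (v has_real_derivative d' x) (at x)" by blast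
  have "exp_class f \<gamma> (\<lambda>x. d x * v x + d' x * u x)"
    using * mult.hyps by (intro exp_class.add exp_class.mult)
  then show ?case
    using * by (intro exI[of _ "\<lambda>x. d x * v x + d' x * u x"]) (auto intro: DERIV_mult)
qed

lemma exp_class_smooth:
  assumes "exp_class f \<gamma> u" "open I" "smooth_on I f"
  shows "smooth_on I u"
proof (rule smooth_on_closed_class[OF assms(2), where K="Collect (exp_class f \<gamma>)"])
  show "u \<in> Collect (exp_class f \<gamma>)" using assms by simp
  fix w assume "w \<in> Collect (exp_class f \<gamma>)"
  then obtain d where d: "exp_class f \<gamma> d" "\<forall>x\<in>I. (w has_real_derivative d x) (at x)"
    using exp_class_derivative[OF _ assms(2,3)] by blast
  have "exp_class f \<gamma> (\<lambda>x. d x * h)" for h by (rule exp_class.mult[OF d(1) exp_class.const])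
  then show "\<exists>D. (\<forall>x\<in>I. (w has_derivative D x) (at x)) \<and>
      (\<forall>h. \<exists>w\<in>Collect (exp_class f \<gamma>). \<forall>x\<in>I. D x h = w x)"
    using d(2) unfolding has_field_derivative_def
    by (intro exI[of _ "\<lambda>x. (*) (d x)"]) auto
qed

section \<open>Covariant derivatives along the Euler field\<close>

context local_potential
begin

text \<open>The covariant derivative along the Euler field, see \<open>E_eq\<close>. Expressed
  through constant directions with the holomorphic coefficients \<open>x $ i\<close>, it clearly
  preserves locally bounded families.\<close>

definition E :: "(nat \<Rightarrow> complex^'n \<Rightarrow> complex) \<Rightarrow> nat \<Rightarrow> complex^'n \<Rightarrow> complex" where
  "E q j x = (\<Sum>i\<in>UNIV. x $ i * nab (axis i 1) q j x)"

lemma lb_E: assumes "V.lb S q" shows "V.lb S (E q)"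
  unfolding E_def[abs_def]
  by (intro V.lb_sum V.lb_mult hol_nth lb_nab assms openS) simp

lemma lb_E_pow: "V.lb S q \<Longrightarrow> V.lb S ((E ^^ a) q)"
  by (induction a) (auto intro: lb_E)

lemma E_eq:
  assumes x: "x \<in> S" and q: "V.lb S q"
  shows "E q j x = nab x q j x"
proof -
  have "nab x q j x = dird (q j) x x - A x x * q j x" by (simp add: nab_def)
  also have "dird (q j) x x = (\<Sum>i\<in>UNIV. x $ i * dird (q j) (axis i 1) x)"
    by (rule dird_expand[OF V.lb_hol[OF q] x])
  also have "A x x = (\<Sum>i\<in>UNIV. x $ i * A (axis i 1) x)" by (rule A_linear(2)[OF x])
  finally show ?thesis
    by (simp add: E_def nab_def algebra_simps sum.distrib sum_subtractf sum_distrib_left)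
qed

lemma curve_has_derivative:
  assumes q: "V.lb S q" and t: "V.lb S t" and x: "exp z *s x0 \<in> S"
  shows "((\<lambda>z. wp q t (exp z *s x0)) has_derivative
     (\<lambda>h. h * wp (E q) t (exp z *s x0) + cnj h * wp q (E t) (exp z *s x0))) (at z)"
proof -
  have "(exp has_derivative (\<lambda>h. h * exp z)) (at z)"
    by (rule has_derivative_eq_rhs[OF DERIV_exp[of z, unfolded has_field_derivative_def]]) (simp add: fun_eq_iff)
  from bounded_linear.has_derivative[OF V.bounded_linear_sc_left this]
  have "((\<lambda>z. exp z *s x0) has_derivative (\<lambda>h. h *s (exp z *s x0))) (at z)"
    by (simp add: vector_smult_assoc)
  from has_derivative_compose[OF this wp_has_derivative[OF q t x]]
  have "((\<lambda>z. wp q t (exp z *s x0)) has_derivative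
     (\<lambda>h. wp (nab (h *s (exp z *s x0)) q) t (exp z *s x0) + wp q (nab (h *s (exp z *s x0)) t) (exp z *s x0))) (at z)" .
  moreover have nabE: "nab (h *s (exp z *s x0)) r j (exp z *s x0) = h * E r j (exp z *s x0)" if "V.lb S r" for r h j
    using E_eq[OF x that] nab_scale[OF x that] by simp
  have "wp (nab (h *s (exp z *s x0)) q) t (exp z *s x0) = h * wp (E q) t (exp z *s x0)" for h
    by (rule wp_scale_left[where r="nab (h *s (exp z *s x0)) q" and a=h, OF lb_E[OF q] t x nabE[OF q]])
  moreover have "wp q (nab (h *s (exp z *s x0)) t) (exp z *s x0) = cnj h * wp q (E t) (exp z *s x0)" for h
    by (rule wp_scale_right[where r="nab (h *s (exp z *s x0)) t" and a=h, OF lb_E[OF t] q x nabE[OF t]])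
  ultimately show ?thesis by simp
qed

text \<open>Along the curve \<open>exp z *s x0\<close> the vector \<open>e\<close> stays orthogonal
  to the point, so \<open>nab_pow_norm\<close> applies everywhere on it and \<open>Q\<close> has
  squared weighted norm \<open>K r^m F\<^sub>m(r)\<close>. Since \<open>E\<close> differentiates
  along the curve, pairing \<open>E^a Q\<close> with \<open>E^b Q\<close> gives \<open>K\<close>
  times the derivative of order \<open>a + b\<close> in \<open>X = ln r\<close>. The norm of
  \<open>R(E) Q\<close>, which is \<open>Z\<close> below, thus turns into the moment of
  \<open>R\<^sup>2 * ffp m\<close>, up to the positive factor \<open>K\<close>.\<close>

lemma pos_data_at:
  assumes x0: "x0 \<in> S" "x0 \<noteq> 0" and e: "norm e = 1" "herm e x0 = 0"
    and F0: "\<And>r. r \<in> I \<Longrightarrow> F 0 r = exp (\<gamma> * f r)"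
    and F: "\<And>k r. r \<in> I \<Longrightarrow> (F k has_real_derivative F (Suc k) r) (at r)"
  shows "pos_data (\<lambda>i. log_deriv F i 0 (ln ((norm x0)\<^sup>2)))"
  unfolding pos_data_def
proof (intro allI)
  fix m and R :: "real poly"
  define r0 where "r0 = (norm x0)\<^sup>2"
  have r0: "r0 > 0" using x0 by (simp add: r0_def)
  define X0 where "X0 = ln r0"
  define \<Omega> where "\<Omega> = {z. exp z *s x0 \<in> S}"
  \<comment> \<open>A linear function with value \<open>exp z\<close> on the curve. Its
    \<open>m\<close>-th power supplies the factor \<open>r^m / r0^m\<close> in the norm, which turns
    the \<open>m\<close>-th derivative of \<open>F\<close> into a polynomial in the Euler operator;
    being holomorphic, it keeps \<open>Q\<close> locally bounded holomorphic.\<close>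
  define ch where "ch x = herm x x0 * of_real (1 / r0)" for x
  have ch: "V.hol S ch" unfolding ch_def[abs_def] by (intro V.hol_mult(1) hol_herm V.hol_const)
  have chm: "V.hol S (\<lambda>x. ch x ^ m)" by (induction m) (auto intro: V.hol_mult(1) ch V.hol_const)
  have chC: "ch (exp z *s x0) = exp z" for z
    using r0 by (simp add: ch_def herm_scale_left herm_self r0_def)
  define Q where "Q j x = ch x ^ m * (nab e ^^ m) s j x" for j x
  have lbQ: "V.lb S Q" unfolding Q_def[abs_def] by (rule V.lb_mult[OF chm lb_nab_pow openS])
  define K where "K = fact m / r0 ^ m"
  have K: "K > 0" using r0 by (simp add: K_def)
  have cont: "continuous_on UNIV (\<lambda>z. exp z *s x0)"
    by (intro continuous_on_compose2[OF linear_continuous_on[OF V.bounded_linear_sc_left] continuous_on_exp] continuous_intros) auto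
  have op: "open \<Omega>" unfolding \<Omega>_def using open_vimage[OF openS cont] by (simp add: vimage_def)
  have e2: "exp (2 * Re z + X0) = (exp (Re z))\<^sup>2 * r0" for z
    using r0 by (simp add: exp_add X0_def exp_double)
  have nsq: "(norm (exp z *s x0))\<^sup>2 = exp (2 * Re z + X0)" for z
    unfolding e2 norm_vector_scalar norm_exp_eq_Re power_mult_distrib r0_def ..
  have inI: "exp (2 * Re z + X0) \<in> I" if "z \<in> \<Omega>" for z using SI[of "exp z *s x0"] that by (simp add: \<Omega>_def nsq)
  define u where "u a b z = wp ((E ^^ a) Q) ((E ^^ b) Q) (exp z *s x0)" for a b z
  have u0: "u 0 0 z = of_real (K * log_deriv F 0 m (2 * Re z + X0))" if "z \<in> \<Omega>" for z
  proof -
    have xS: "exp z *s x0 \<in> S" using that by (simp add: \<Omega>_def)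
    define t where "t = (nab e ^^ m) s"
    have lbt: "V.lb S t" unfolding t_def by (rule lb_nab_pow)
    have Qt: "Q j (exp z *s x0) = exp z ^ m * t j (exp z *s x0)" for j
      by (simp add: Q_def t_def chC)
    have "wp Q Q (exp z *s x0) = (exp z ^ m * cnj (exp z ^ m)) * wp t t (exp z *s x0)"
      using wp_scale_left[where r=Q and q=t, OF lbt lbQ xS Qt] wp_scale_right[where r=Q and q=t, OF lbt lbt xS Qt] by simp
    also have "exp z ^ m * cnj (exp z ^ m) = of_real ((cmod (exp z ^ m))\<^sup>2)" by (simp only: complex_norm_square)
    also have "(cmod (exp z ^ m))\<^sup>2 = exp (real m * (2 * Re z + X0)) / r0 ^ m"
      using r0 unfolding exp_of_nat_mult e2
      by (simp add: norm_power power_mult_distrib mult.commute flip: power_mult)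
    also have "wp t t (exp z *s x0) = of_real (fact m * F m (exp (2 * Re z + X0)))"
      unfolding t_def using nab_pow_norm[OF xS e(1) _ F0 F, of m] e(2) by (simp add: herm_scale_right nsq)
    finally show ?thesis by (simp add: u_def K_def)
  qed
  have du: "(u a b has_derivative (\<lambda>h. h * u (Suc a) b z + cnj h * u a (Suc b) z)) (at z)" if "z \<in> \<Omega>" for a b z
    unfolding u_def[abs_def] using curve_has_derivative[OF lb_E_pow[OF lbQ] lb_E_pow[OF lbQ]] that by (simp add: \<Omega>_def)
  \<comment> \<open>\<open>2 * Re z\<close> is \<open>z + cnj z\<close>, so both Wirtinger
    derivatives of a function of \<open>X = 2 * Re z + X0\<close> are its derivative in
    \<open>X\<close>, without a factor.\<close>
  have step: "u (Suc a) b z = of_real (K * log_deriv F (Suc i) m (2 * Re z + X0))"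
     "u a (Suc b) z = of_real (K * log_deriv F (Suc i) m (2 * Re z + X0))"
    if eq: "\<And>z. z \<in> \<Omega> \<Longrightarrow> u a b z = of_real (K * log_deriv F i m (2 * Re z + X0))" and z: "z \<in> \<Omega>" for a b i z
  proof -
    let ?d = "of_real (K * log_deriv F (Suc i) m (2 * Re z + X0))"
    have "((\<lambda>z. log_deriv F i m (2 * Re z + X0)) has_derivative (\<lambda>h. log_deriv F (Suc i) m (2 * Re z + X0) * (2 * Re h))) (at z)"
    proof -
      have 1: "((\<lambda>z. 2 * Re z + X0) has_derivative (\<lambda>h. 2 * Re h)) (at z)"
        by (auto intro!: derivative_eq_intros)
      have 2: "(log_deriv F i m has_derivative (*) (log_deriv F (Suc i) m (2 * Re z + X0))) (at (2 * Re z + X0))"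
        using log_deriv_has_derivative[of F, OF F[OF inI[OF z]]] by (simp add: has_field_derivative_def del: log_deriv.simps)
      from has_derivative_compose[OF 1 2] show ?thesis .
    qed
    from has_derivative_of_real[OF has_derivative_mult_right[OF this, of K]]
    have "((\<lambda>z. complex_of_real (K * log_deriv F i m (2 * Re z + X0))) has_derivative (\<lambda>h. h * ?d + cnj h * ?d)) (at z)"
      by (rule has_derivative_eq_rhs)
         (auto simp: fun_eq_iff complex_eq_iff algebra_simps simp del: log_deriv.simps)
    then have "(u a b has_derivative (\<lambda>h. h * ?d + cnj h * ?d)) (at z)"
      by (rule has_derivative_transform_within_open[OF _ op z]) (simp add: eq del: log_deriv.simps)
    from has_derivative_complex_unique[OF du[OF z] this]
    show "u (Suc a) b z = ?d" "u a (Suc b) z = ?d" .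
  qed
  have ua: "u a 0 z = of_real (K * log_deriv F a m (2 * Re z + X0))" if "z \<in> \<Omega>" for a z
    using that
  proof (induction a arbitrary: z)
    case (Suc a)
    show ?case by (rule step(1)[OF Suc.IH Suc.prems])
  qed (rule u0)
  have uab: "u a b z = of_real (K * log_deriv F (a + b) m (2 * Re z + X0))" if "z \<in> \<Omega>" for a b z
    using that
  proof (induction b arbitrary: z)
    case (Suc b)
    show ?case using step(2)[OF Suc.IH Suc.prems] by (simp del: log_deriv.simps)
  qed (use ua in simp)
  have "0 \<in> \<Omega>" using x0 by (simp add: \<Omega>_def)
  note uab0 = uab[OF this, simplified, folded of_real_mult]
  define d where "d = degree R"
  define Z where "Z j x = (\<Sum>a\<le>d. of_real (coeff R a) * (E ^^ a) Q j x)" for j x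
  have lbZ: "V.lb S Z" unfolding Z_def[abs_def]
    by (intro V.lb_sum V.lb_mult V.hol_const lb_E_pow lbQ openS) simp
  have Zeq: "(\<lambda>j x. \<Sum>a\<le>d. of_real (coeff R a) * (E ^^ a) Q j x) = Z"
    by (simp add: Z_def[abs_def])
  have "V.pair Z Z x0 = (\<Sum>a\<le>d. of_real (coeff R a) * V.pair ((E ^^ a) Q) Z x0)"
    using pair_sum(1)[where A="{..d}" and q="\<lambda>a. (E ^^ a) Q" and c="\<lambda>a. of_real (coeff R a)",
        OF _ lb_E_pow[OF lbQ] lbZ openS x0(1)]
    by (simp only: Zeq finite_atMost)
  also have "\<dots> = (\<Sum>a\<le>d. of_real (coeff R a) * (\<Sum>b\<le>d. of_real (coeff R b) * V.pair ((E ^^ a) Q) ((E ^^ b) Q) x0))"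
  proof (intro sum.cong refl arg_cong2[where f="(*)"])
    fix a
    show "V.pair ((E ^^ a) Q) Z x0 = (\<Sum>b\<le>d. of_real (coeff R b) * V.pair ((E ^^ a) Q) ((E ^^ b) Q) x0)"
      using pair_sum(2)[where A="{..d}" and q="\<lambda>a. (E ^^ a) Q" and c="\<lambda>a. of_real (coeff R a)"
          and t="(E ^^ a) Q", OF _ lb_E_pow[OF lbQ] lb_E_pow[OF lbQ] openS x0(1)]
      by (simp only: Zeq finite_atMost complex_cnj_complex_of_real)
  qed
  finally have "of_real (W x0) * V.pair Z Z x0 =
     (\<Sum>a\<le>d. of_real (coeff R a) * (\<Sum>b\<le>d. of_real (coeff R b) * wp ((E ^^ a) Q) ((E ^^ b) Q) x0))"
    by (simp add: wp_def sum_distrib_left mult_ac)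
  also have "\<dots> = of_real (\<Sum>a\<le>d. coeff R a * (\<Sum>b\<le>d. coeff R b * (K * log_deriv F (a + b) m X0)))"
  proof -
    have "wp ((E ^^ a) Q) ((E ^^ b) Q) x0 = of_real (K * log_deriv F (a + b) m X0)" for a b
      using uab[OF \<open>0 \<in> \<Omega>\<close>, of a b] by (simp add: u_def)
    then show ?thesis by simp
  qed
  also have "(\<Sum>a\<le>d. coeff R a * (\<Sum>b\<le>d. coeff R b * (K * log_deriv F (a + b) m X0)))
      = K * mom (\<lambda>a. mom (\<lambda>b. log_deriv F (a + b) m X0) R) R"
    by (simp add: mom_def d_def sum_distrib_left mult_ac)
  also have "mom (\<lambda>a. mom (\<lambda>b. log_deriv F (a + b) m X0) R) R = mom (\<lambda>a. log_deriv F a m X0) (R\<^sup>2)"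
    by (simp add: mom_mult[of "\<lambda>a. log_deriv F a m X0"] power2_eq_square)
  also have "(\<lambda>a. log_deriv F a m X0) = (\<lambda>a. mom (\<lambda>i. log_deriv F (a + i) 0 X0) (ffp m))"
    by (simp only: mom_log_deriv)
  also have "mom \<dots> (R\<^sup>2) = mom (\<lambda>i. log_deriv F i 0 X0) (R\<^sup>2 * ffp m)"
    by (rule mom_mult)
  finally have "complex_of_real (W x0 * (\<Sum>j. (cmod (Z j x0))\<^sup>2)) = of_real (K * mom (\<lambda>i. log_deriv F i 0 X0) (R\<^sup>2 * ffp m))"
    by (simp add: pair_self[OF lbZ x0(1)])
  then have "W x0 * (\<Sum>j. (cmod (Z j x0))\<^sup>2) = K * mom (\<lambda>i. log_deriv F i 0 X0) (R\<^sup>2 * ffp m)"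
    by (simp only: of_real_eq_iff)
  moreover have "0 \<le> W x0 * (\<Sum>j. (cmod (Z j x0))\<^sup>2)"
    using W_pos[OF x0(1)] V.lb_summable[OF lbZ x0(1)] by (intro mult_nonneg_nonneg suminf_nonneg) auto
  ultimately have "0 \<le> K * mom (\<lambda>i. log_deriv F i 0 X0) (R\<^sup>2 * ffp m)" by simp
  then show "0 \<le> mom (\<lambda>i. log_deriv F i 0 (ln ((norm x0)\<^sup>2))) (R\<^sup>2 * ffp m)"
    using K by (simp add: zero_le_mult_iff X0_def r0_def)
qed

text \<open>\<open>pos_data_at\<close> needs a point of \<open>S\<close> over each value of
  \<open>r\<close>; multiples of \<open>x0\<close> provide them on an interval around
  \<open>|x0|^2\<close>. Over this interval the data form a \<open>pos_family\<close>, to which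
  \<open>pos_family_power_series\<close> applies.\<close>

lemma local_power_series:
  assumes x0: "x0 \<in> S" and I0: "I \<subseteq> {0<..}"
    and e: "\<And>x. x \<in> S \<Longrightarrow> \<exists>e :: complex^'n. norm e = 1 \<and> herm e x = 0"
  obtains a r1 \<delta> where "\<And>k. 0 \<le> a k" "(norm x0)\<^sup>2 < r1" "\<delta> > 0"
    "\<And>r. 0 < r \<Longrightarrow> r < r1 \<Longrightarrow> summable (\<lambda>k. a k * r ^ k)"
    "\<And>r. \<bar>r - (norm x0)\<^sup>2\<bar> < \<delta> \<Longrightarrow> r \<in> I \<and> (\<Sum>k. a k * r ^ k) = exp (\<gamma> * f r)"
proof -
  define F where "F k = (deriv ^^ k) (\<lambda>r. exp (\<gamma> * f r))" for k
  have F0: "F 0 r = exp (\<gamma> * f r)" for r by (simp add: F_def)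
  have smF: "smooth_on I (\<lambda>r. exp (\<gamma> * f r))" by (rule exp_class_smooth[OF exp_class.exp openI smf])
  have F: "(F k has_real_derivative F (Suc k) r) (at r)" if "r \<in> I" for k r
    unfolding F_def by (rule smooth_on_higher_deriv(2)[OF openI smF that])
  define r0 where "r0 = (norm x0)\<^sup>2"
  have r0: "r0 > 0" using SI[OF x0] I0 by (auto simp: r0_def)
  then have x00: "x0 \<noteq> 0" by (auto simp: r0_def)
  have cont: "continuous_on {0<..} (\<lambda>r. sqrt (r / r0) *\<^sub>R x0)"
    using r0 by (intro continuous_intros) auto
  have "open ((\<lambda>r. sqrt (r / r0) *\<^sub>R x0) -` S \<inter> {0<..})"
    using continuous_open_preimage[OF cont _ openS] by (simp add: Int_commute)
  moreover have "r0 \<in> (\<lambda>r. sqrt (r / r0) *\<^sub>R x0) -` S \<inter> {0<..}" using r0 x0 by simp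
  ultimately obtain d where d: "d > 0" "ball r0 d \<subseteq> (\<lambda>r. sqrt (r / r0) *\<^sub>R x0) -` S \<inter> {0<..}"
    by (meson open_contains_ball)
  define \<delta> where "\<delta> = d / 2"
  have near: "r > 0 \<and> (\<exists>x\<in>S. (norm x)\<^sup>2 = r)" if "\<bar>r - r0\<bar> < d" for r
  proof -
    have "r \<in> ball r0 d" using that by (simp add: dist_real_def abs_minus_commute)
    then have r: "sqrt (r / r0) *\<^sub>R x0 \<in> S" "r > 0" using d(2) by auto
    moreover have "(norm (sqrt (r / r0) *\<^sub>R x0))\<^sup>2 = r"
      using r(2) r0 by (simp add: power_mult_distrib r0_def[symmetric])
    ultimately show ?thesis by blast
  qed
  have \<delta>: "\<delta> > 0" "r0 - \<delta> > 0" using d(1) near[of "r0 - \<delta>"] by (auto simp: \<delta>_def)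
  define \<alpha> \<beta> where "\<alpha> = ln (r0 - \<delta>)" and "\<beta> = ln (r0 + \<delta>)"
  have e\<alpha>: "exp \<alpha> = r0 - \<delta>" "exp \<beta> = r0 + \<delta>" using \<delta> r0 by (auto simp: \<alpha>_def \<beta>_def)
  have eX: "\<bar>exp X - r0\<bar> < d" if "\<alpha> < X" "X < \<beta>" for X
  proof -
    have "exp \<alpha> < exp X" "exp X < exp \<beta>" using that by auto
    then show ?thesis unfolding e\<alpha> using d(1) by (auto simp: \<delta>_def abs_if)
  qed
  have "pos_family (\<lambda>i. log_deriv F i 0) \<alpha> \<beta>"
    unfolding pos_family_def
  proof (intro conjI allI impI)
    fix X i assume X: "\<alpha> < X" "X < \<beta>"
    obtain x where x: "x \<in> S" "(norm x)\<^sup>2 = exp X" using near[OF eX[OF X]] by blast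
    have "exp X \<in> I" using SI[OF x(1)] x(2) by simp
    then show "(log_deriv F i 0 has_real_derivative log_deriv F (Suc i) 0 X) (at X)"
      by (intro log_deriv_has_derivative F)
  next
    fix X assume X: "\<alpha> < X" "X < \<beta>"
    obtain x where x: "x \<in> S" "(norm x)\<^sup>2 = exp X" using near[OF eX[OF X]] by blast
    obtain e :: "complex^'n" where e: "norm e = 1" "herm e x = 0" using e[OF x(1)] by blast
    have "x \<noteq> 0" using x(2) by auto
    from pos_data_at[OF x(1) this e F0 F] show "pos_data (\<lambda>b. log_deriv F b 0 X)" by (simp add: x(2))
  qed
  moreover have "\<alpha> < \<beta>" using \<delta> by (simp add: \<alpha>_def \<beta>_def)
  ultimately obtain a where a: "\<And>k. 0 \<le> a k" "\<And>r. 0 < r \<Longrightarrow> r < exp \<beta> \<Longrightarrow> summable (\<lambda>k. a k * r ^ k)"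
    "\<And>r. exp \<alpha> < r \<Longrightarrow> r < exp \<beta> \<Longrightarrow> (\<Sum>k. a k * r ^ k) = log_deriv F 0 0 (ln r)"
    using pos_family_power_series[of "\<lambda>i. log_deriv F i 0" \<alpha> \<beta>] by blast
  show ?thesis
  proof (rule that[of a "r0 + \<delta>" \<delta>])
    fix r assume "\<bar>r - (norm x0)\<^sup>2\<bar> < \<delta>"
    then have r: "\<bar>r - r0\<bar> < \<delta>" by (simp add: r0_def)
    then have "\<bar>r - r0\<bar> < d" using d by (simp add: \<delta>_def)
    from near[OF this] have "r > 0" "r \<in> I" using SI by auto
    moreover have "(\<Sum>k. a k * r ^ k) = exp (\<gamma> * f r)"
      using a(3)[of r] r \<open>r > 0\<close> by (simp add: e\<alpha> F0 abs_if split: if_splits)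
    ultimately show "r \<in> I \<and> (\<Sum>k. a k * r ^ k) = exp (\<gamma> * f r)" by blast
  qed (use a \<delta> in \<open>auto simp: e\<alpha> r0_def\<close>)
qed

end

text \<open>The remainder is estimated by duality, as in the bound for the derivatives.\<close>

lemma lb_imp_ell2_holomorphic:
  fixes S :: "(complex^'n) set"
  assumes S: "open S" and lb: "V.lb S s"
  shows "ell2_holomorphic_on S (\<lambda>x j. s j x)"
  unfolding ell2_holomorphic_on_def
proof (intro conjI ballI)
  show "(\<lambda>j. s j x) \<in> ell2" if "x \<in> S" for x
    using V.lb_summable[OF lb that] by (simp add: ell2_def)
  fix x assume x: "x \<in> S"
  obtain \<rho> M where \<rho>: "\<rho> > 0" "M \<ge> 0" "ball x \<rho> \<subseteq> S"
    "\<And>y J. y \<in> ball x \<rho> \<Longrightarrow> (\<Sum>j<J. (cmod (s j y))\<^sup>2) \<le> M"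
    using V.lb_bound[OF lb S x] by metis
  define C where "C = 8 * sqrt M / \<rho>\<^sup>2"
  have C: "C \<ge> 0" using \<rho> by (simp add: C_def)
  define r where "r h j = s j (x + h) - s j x - dird (s j) h x" for h j
  have fin: "(\<Sum>j<J. (cmod (r h j))\<^sup>2) \<le> (C * (norm h)\<^sup>2)\<^sup>2" if h: "norm h \<le> \<rho> / 4" for h J
  proof -
    define T where "T = (\<Sum>j<J. (cmod (r h j))\<^sup>2)"
    have T0: "T \<ge> 0" by (simp add: T_def sum_nonneg)
    define G where "G = (\<lambda>y. \<Sum>j<J. cnj (r h j) * s j y)"
    have holG: "V.hol S G" unfolding G_def by (intro V.hol_sum(1) V.hol_mult(1) V.hol_const V.lb_hol lb)
    have "dird G h x = (\<Sum>j<J. dird (\<lambda>y. cnj (r h j) * s j y) h x)"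
      unfolding G_def by (rule V.hol_sum(2)[OF _ x]) (intro V.hol_mult(1) V.hol_const V.lb_hol lb)
    also have "\<dots> = (\<Sum>j<J. cnj (r h j) * dird (s j) h x)"
      by (simp add: V.hol_mult(2)[OF V.hol_const V.lb_hol[OF lb] x])
    finally have dG: "dird G h x = (\<Sum>j<J. cnj (r h j) * dird (s j) h x)" .
    have "G (x + h) - G x - dird G h x = (\<Sum>j<J. cnj (r h j) * r h j)"
      unfolding dG by (simp add: G_def r_def algebra_simps flip: sum_subtractf)
    also have "\<dots> = of_real T"
      unfolding T_def of_real_sum by (intro sum.cong refl) (simp only: complex_norm_square mult.commute)
    finally have eq: "G (x + h) - G x - dird G h x = of_real T" .
    have "cmod (G (x + h) - G x - dird G h x) \<le> 8 * (sqrt T * sqrt M) / \<rho>\<^sup>2 * (norm h)\<^sup>2"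
    proof (rule V.cauchy_second[OF holG \<rho>(3,1) _ h])
      fix y assume y: "y \<in> ball x \<rho>"
      have "cmod (G y) \<le> sqrt (\<Sum>j<J. (cmod (cnj (r h j)))\<^sup>2) * sqrt (\<Sum>j<J. (cmod (s j y))\<^sup>2)"
        unfolding G_def by (rule V.cmod_sum_mult_le)
      also have "\<dots> \<le> sqrt T * sqrt M"
        using \<rho>(4)[OF y, of J] by (intro mult_mono) (auto simp: T_def sum_nonneg)
      finally show "cmod (G y) \<le> sqrt T * sqrt M" .
    qed
    then have le: "sqrt T * sqrt T \<le> sqrt T * (C * (norm h)\<^sup>2)"
      using T0 by (simp add: eq C_def mult_ac)
    have "sqrt T \<le> C * (norm h)\<^sup>2"
    proof (cases "T = 0")
      case False
      with T0 have "0 < sqrt T" by simp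
      then show ?thesis using le by (simp only: mult_le_cancel_left_pos)
    qed (use C in simp)
    then have "(sqrt T)\<^sup>2 \<le> (C * (norm h)\<^sup>2)\<^sup>2" using T0 by (intro power_mono) auto
    then show ?thesis using T0 by (simp add: T_def)
  qed
  have nrm: "ell2_norm (r h) \<le> C * (norm h)\<^sup>2" "0 \<le> ell2_norm (r h)" if h: "norm h \<le> \<rho> / 4" for h
  proof -
    have s: "summable (\<lambda>j. (cmod (r h j))\<^sup>2)"
      using fin[OF h] by (intro summableI_nonneg_bounded) auto
    have "(\<Sum>j. (cmod (r h j))\<^sup>2) \<le> (C * (norm h)\<^sup>2)\<^sup>2"
      using fin[OF h] by (intro suminf_le_const s) auto
    then have "sqrt (\<Sum>j. (cmod (r h j))\<^sup>2) \<le> sqrt ((C * (norm h)\<^sup>2)\<^sup>2)" by (rule real_sqrt_le_mono)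
    then show "ell2_norm (r h) \<le> C * (norm h)\<^sup>2" using C by (simp add: ell2_norm_def)
    show "0 \<le> ell2_norm (r h)" using s by (simp add: ell2_norm_def suminf_nonneg)
  qed
  show "\<exists>D. (\<forall>v. D v \<in> ell2) \<and> (\<forall>v w. D (v + w) = (\<lambda>j. D v j + D w j)) \<and>
        (\<forall>a v. D (a *s v) = (\<lambda>j. a * D v j)) \<and>
        ((\<lambda>h. ell2_norm (\<lambda>j. s j (x + h) - s j x - D h j) / norm h) \<longlongrightarrow> 0) (at 0)"
  proof (intro exI[of _ "\<lambda>v j. dird (s j) v x"] conjI allI)
    show "(\<lambda>j. dird (s j) v x) \<in> ell2" for v
      using V.lb_summable[OF V.lb_dird[OF lb S] x] by (simp add: ell2_def)
    show "(\<lambda>j. dird (s j) (v + w) x) = (\<lambda>j. dird (s j) v x + dird (s j) w x)" for v w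
      using V.dird_linear[OF V.lb_hol[OF lb] x] by (simp add: linear_add)
    show "(\<lambda>j. dird (s j) (a *s v) x) = (\<lambda>j. a * dird (s j) v x)" for a v
      using V.holD(2)[OF V.lb_hol[OF lb] x] by simp
    have ev: "\<forall>\<^sub>F h in at 0. h \<noteq> (0::complex^'n) \<and> norm h \<le> \<rho> / 4"
      using \<rho>(1) by (auto simp: eventually_at intro!: exI[of _ "\<rho>/4"])
    have "((\<lambda>h. ell2_norm (r h) / norm h) \<longlongrightarrow> 0) (at 0)"
    proof (rule tendsto_sandwich)
      show "\<forall>\<^sub>F h in at 0. 0 \<le> ell2_norm (r h) / norm h"
        using ev by eventually_elim (use nrm in simp)
      show "\<forall>\<^sub>F h in at 0. ell2_norm (r h) / norm h \<le> C * norm h"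
        using ev by eventually_elim (use nrm in \<open>simp add: field_simps power2_eq_square\<close>)
      show "((\<lambda>h::complex^'n. C * norm h) \<longlongrightarrow> 0) (at 0)"
        by (rule tendsto_eq_intros refl | simp)+
    qed simp
    then show "((\<lambda>h. ell2_norm (\<lambda>j. s j (x + h) - s j x - dird (s j) h x) / norm h) \<longlongrightarrow> 0) (at 0)"
      by (simp add: r_def[abs_def])
  qed
qed

lemma lb_compose:
  fixes \<tau> :: "complex^'n \<Rightarrow> complex^'n"
  assumes t: "V.lb T t" and T: "open T" and \<tau>: "holomorphic_map_on S \<tau>" "\<tau> ` S \<subseteq> T"
  shows "V.lb S (\<lambda>j x. t j (\<tau> x))"
  unfolding V.lb_def
proof (intro conjI allI ballI)
  show "V.hol S (\<lambda>x. t j (\<tau> x))" for j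
    unfolding V.hol_def
  proof
    fix x assume x: "x \<in> S"
    obtain D where D: "(\<tau> has_derivative D) (at x)" "\<And>a v. D (a *s v) = a *s D v"
      using \<tau>(1) x unfolding holomorphic_map_on_def by blast
    have \<tau>x: "\<tau> x \<in> T" using \<tau>(2) x by blast
    have "((\<lambda>x. t j (\<tau> x)) has_derivative (\<lambda>v. dird (t j) (D v) (\<tau> x))) (at x)"
      by (rule has_derivative_compose[OF D(1) V.holD(1)[OF V.lb_hol[OF t] \<tau>x]])
    moreover have "dird (t j) (D (a *s v)) (\<tau> x) = a * dird (t j) (D v) (\<tau> x)" for a v
      unfolding D(2) by (rule V.holD(2)[OF V.lb_hol[OF t] \<tau>x])
    ultimately show "\<exists>D. ((\<lambda>x. t j (\<tau> x)) has_derivative D) (at x) \<and> (\<forall>a v. D (a *s v) = a * D v)" by blast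
  qed
  fix x assume x: "x \<in> S"
  have \<tau>x: "\<tau> x \<in> T" using \<tau>(2) x by blast
  obtain \<rho> M where \<rho>: "\<rho> > 0" "\<And>y J. y \<in> ball (\<tau> x) \<rho> \<Longrightarrow> (\<Sum>j<J. (cmod (t j y))\<^sup>2) \<le> M"
    using V.lb_bound[OF t T \<tau>x] by metis
  have "isCont \<tau> x" using \<tau>(1) x unfolding holomorphic_map_on_def by (meson has_derivative_continuous)
  then obtain d where "d > 0" "\<And>y. dist y x < d \<Longrightarrow> dist (\<tau> y) (\<tau> x) < \<rho>"
    unfolding continuous_at_eps_delta using \<rho>(1) by blast
  then show "\<exists>\<rho>>0. \<exists>M. \<forall>y\<in>ball x \<rho>. \<forall>J. (\<Sum>j<J. (cmod (t j (\<tau> y)))\<^sup>2) \<le> M"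
    using \<rho>(2) by (intro exI[of _ d] conjI exI[of _ M]) (auto simp: dist_commute)
qed

section \<open>Restriction of charts\<close>

context
  fixes U :: "'m::{t2_space,second_countable_topology} set" and z :: "'m \<Rightarrow> complex^'n"
  assumes ch: "is_chart (U, z)"
begin

lemma chart_open: "open U" "open (z ` U)"
  and chart_inj: "inj_on z U"
  and chart_homeo: "homeomorphism U (z ` U) z (inv_into U z)"
proof -
  show "open U" "open (z ` U)" and h: "homeomorphism U (z ` U) z (inv_into U z)"
    using ch by (auto simp: is_chart_def)
  show "inj_on z U" using h unfolding homeomorphism_def by (metis inj_onI)
qed

lemma chart_image_open: assumes "open W" "W \<subseteq> U" shows "open (z ` W)"
proof -
  have "openin (top_of_set U) W" using assms by (simp add: open_subset)
  then have "openin (top_of_set (z ` U)) (z ` W)" by (rule homeomorphism_imp_open_map[OF chart_homeo])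
  then show ?thesis using chart_open(2) openin_open_trans by blast
qed

lemma inv_into_restrict:
  assumes "W \<subseteq> U" "y \<in> z ` W"
  shows "inv_into W z y = inv_into U z y"
proof -
  obtain p where p: "p \<in> W" "y = z p" using assms by blast
  have "inj_on z W" using chart_inj assms(1) by (rule inj_on_subset)
  then show ?thesis using p assms(1) chart_inj by (simp add: inv_into_f_f subset_iff)
qed

lemma is_chart_restrict:
  assumes "open W" "W \<subseteq> U"
  shows "is_chart (W, z)"
proof -
  have "homeomorphism W (z ` W) z (inv_into U z)"
    by (rule homeomorphism_of_subsets[OF chart_homeo]) (use assms in auto)
  then have "homeomorphism W (z ` W) z (inv_into W z)"
    by (rule homeomorphism_cong) (auto simp: inv_into_restrict[OF assms(2)])
  then show ?thesis using assms(1) chart_image_open[OF assms] by (simp add: is_chart_def)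
qed

end

lemma complex_manifoldD:
  assumes "complex_manifold A"
  shows "C \<in> A \<Longrightarrow> is_chart C" "C \<in> A \<Longrightarrow> D \<in> A \<Longrightarrow> compatible C D"
    "is_chart C \<Longrightarrow> (\<And>D. D \<in> A \<Longrightarrow> compatible C D) \<Longrightarrow> C \<in> A"
  using assms unfolding complex_manifold_def by blast+

text \<open>Homogeneous lifts exist only locally, while \<open>induced_by_CP_infinity\<close>
  compares metrics on whole chart domains. So charts have to be shrunk, which maximality of the
  atlas allows.\<close>

lemma chart_restrict_in_atlas:
  fixes A :: "('m::{t2_space,second_countable_topology}, 'n::finite) chart set"
  assumes A: "complex_manifold A" and UA: "(U, z) \<in> A" and W: "open W" "W \<subseteq> U"
  shows "(W, z) \<in> A"
proof -
  have ch: "is_chart (U, z)" by (rule complex_manifoldD(1)[OF A UA])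
  note chW = is_chart_restrict[OF ch W]
  have "compatible (W, z) D" if D: "D \<in> A" for D
  proof -
    have comp: "compatible (U, z) D" by (rule complex_manifoldD(2)[OF A UA D])
    have chD: "is_chart D" by (rule complex_manifoldD(1)[OF A D])
    have sub: "overlap (W, z) D \<subseteq> overlap (U, z) D" "overlap D (W, z) \<subseteq> overlap D (U, z)"
      using W by (auto simp: overlap_def)
    have op: "open (overlap (W, z) D)"
      unfolding overlap_def fst_conv snd_conv
      using W chD by (intro chart_image_open[OF ch]) (auto simp: is_chart_def split: prod.splits)
    have "transition D (W, z) = transition D (U, z)" by (simp add: transition_def)
    then have 2: "holomorphic_map_on (overlap D (W, z)) (transition D (W, z))"
      using comp sub(2) by (auto simp: compatible_def holomorphic_map_on_def)
    have eq: "transition (U, z) D y = transition (W, z) D y" if "y \<in> overlap (W, z) D" for y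
      using that inv_into_restrict[OF ch W(2), of y] by (auto simp: transition_def overlap_def)
    have "holomorphic_map_on (overlap (W, z) D) (transition (W, z) D)"
      unfolding holomorphic_map_on_def
    proof
      fix x assume x: "x \<in> overlap (W, z) D"
      then obtain E where E: "(transition (U, z) D has_derivative E) (at x)" "\<forall>a v. E (a *s v) = a *s E v"
        using comp sub(1) unfolding compatible_def holomorphic_map_on_def by blast
      have "(transition (W, z) D has_derivative E) (at x)"
        by (rule has_derivative_transform_within_open[OF E(1) op x eq])
      then show "\<exists>E. (transition (W, z) D has_derivative E) (at x) \<and> (\<forall>a v. E (a *s v) = a *s E v)"
        using E(2) by blast
    qed
    then show ?thesis using 2 by (simp add: compatible_def)
  qed
  then show ?thesis by (rule complex_manifoldD(3)[OF A chW])
qed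

lemma form11_restrict:
  fixes A :: "('m::{t2_space,second_countable_topology}, 'n::finite) chart set"
  assumes g: "is_form11 A g" and UA: "(U, z) \<in> A" and WA: "(W, z) \<in> A" and W: "W \<subseteq> U"
    and ch: "is_chart (U, z)" "open (z ` W)" and x: "x \<in> z ` W"
  shows "g (W, z) x = g (U, z) x"
proof -
  have id: "transition (W, z) (U, z) y = y" if y: "y \<in> z ` W" for y
    using that inv_into_restrict[OF ch(1) W y] f_inv_into_f[of y z U] W by (auto simp: transition_def)
  have d: "d_z i (\<lambda>y. transition (W, z) (U, z) y $ k) x = kd i k" for i k
  proof -
    have "((\<lambda>y. transition (W, z) (U, z) y $ k) has_derivative (\<lambda>h. h $ k)) (at x)"
      by (rule has_derivative_transform_within_open[OF has_derivative_vec_nth ch(2) x]) (simp add: id)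
    note D = this
    show ?thesis unfolding d_z_eqI[OF D] by (simp add: axis_def)
  qed
  have "x \<in> overlap (W, z) (U, z)" using x W by (auto simp: overlap_def)
  then have "g (W, z) x $ i $ j = (\<Sum>k\<in>UNIV. \<Sum>l\<in>UNIV. kd i k * cnj (kd j l) * g (U, z) x $ k $ l)" for i j
    using g WA UA unfolding is_form11_def by (simp add: d id[OF x])
  also have "(\<Sum>k\<in>UNIV. \<Sum>l\<in>UNIV. kd i k * cnj (kd j l) * g (U, z) x $ k $ l) = g (U, z) x $ i $ j" for i j
  proof -
    have 1: "(\<Sum>l\<in>UNIV. kd i k * cnj (kd j l) * g (U, z) x $ k $ l) = kd i k * g (U, z) x $ k $ j" for k
    proof -
      have "(\<Sum>l\<in>UNIV. kd i k * cnj (kd j l) * g (U, z) x $ k $ l)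
          = (\<Sum>l\<in>UNIV. if j = l then kd i k * g (U, z) x $ k $ l else 0)"
        by (rule sum.cong) simp_all
      then show ?thesis by simp
    qed
    have "(\<Sum>k\<in>UNIV. kd i k * g (U, z) x $ k $ j) = (\<Sum>k\<in>UNIV. if i = k then g (U, z) x $ k $ j else 0)"
      by (rule sum.cong) simp_all
    then show ?thesis by (simp add: 1 del: mult_cancel_right1)
  qed
  finally show ?thesis by (simp add: vec_eq_iff)
qed

section \<open>From an induced metric to a power series\<close>

text \<open>The lift near \<open>p\<close> lives in some chart \<open>D\<close>, the radial
  coordinates in \<open>(U, z)\<close>. On \<open>W = U \<inter> fst D\<close> the lift is moved to
  the coordinates \<open>z\<close> by the transition map; the moved map is recognised as holomorphic
  into the sequence space through its local bounds, by \<open>lb_compose\<close> and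
  \<open>lb_imp_ell2_holomorphic\<close>.\<close>

lemma induced_power_series:
  fixes A :: "('m::{t2_space,second_countable_topology}, 'n::finite) chart set"
  assumes A: "complex_manifold A" and UA: "(U, z) \<in> A" and g: "is_form11 A g"
    and rad: "\<And>x. x \<in> z ` U \<Longrightarrow> g (U, z) x = radial_form f x \<and> (norm x)\<^sup>2 \<in> I"
    and I: "open I" "I \<subseteq> {0<..}" "smooth_on I f" and c: "c > 0"
    and ind: "induced_by_CP_infinity A c (\<lambda>C x. \<alpha> *\<^sub>R g C x)"
    and p: "p \<in> U" and e: "\<And>x. x \<in> z ` U \<Longrightarrow> \<exists>e :: complex^'n. norm e = 1 \<and> herm e x = 0"
  obtains a r1 \<delta> where "\<And>k. 0 \<le> a k" "(norm (z p))\<^sup>2 < r1" "\<delta> > 0"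
    "\<And>r. 0 < r \<Longrightarrow> r < r1 \<Longrightarrow> summable (\<lambda>k. a k * r ^ k)"
    "\<And>r. \<bar>r - (norm (z p))\<^sup>2\<bar> < \<delta> \<Longrightarrow> r \<in> I \<and> (\<Sum>k. a k * r ^ k) = exp (c * \<alpha> * f r)"
proof -
  obtain \<phi> where \<phi>: "holomorphic_to_CP_infinity A \<phi>"
    "\<And>C s x. C \<in> A \<Longrightarrow> homogeneous_lift \<phi> C s \<Longrightarrow> x \<in> snd C ` fst C \<Longrightarrow> \<alpha> *\<^sub>R g C x = fubini_study_pullback c s x"
    using ind unfolding induced_by_CP_infinity_def by blast
  obtain D t where D: "D \<in> A" "p \<in> fst D" and t: "homogeneous_lift \<phi> D t"
    using \<phi>(1) unfolding holomorphic_to_CP_infinity_def by blast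
  have chD: "is_chart D" and ch: "is_chart (U, z)" and comp: "compatible (U, z) D"
    using complex_manifoldD(1,2)[OF A] UA D(1) by blast+
  have opD: "open (fst D)" "open (snd D ` fst D)" using chD by (auto simp: is_chart_def split: prod.splits)
  define W where "W = U \<inter> fst D"
  have W: "open W" "W \<subseteq> U" "p \<in> W" using chart_open(1)[OF ch] opD p D by (auto simp: W_def)
  have WA: "(W, z) \<in> A" by (rule chart_restrict_in_atlas[OF A UA W(1,2)])
  define S where "S = z ` W"
  have opS: "open S" unfolding S_def by (rule chart_image_open[OF ch W(1,2)])
  define \<tau> where "\<tau> = transition (U, z) D"
  have ov: "overlap (U, z) D = S" by (simp add: overlap_def S_def W_def)
  have \<tau>z: "\<tau> (z q) = snd D q" if "q \<in> W" for q
    using that W(2) chart_inj[OF ch] by (auto simp: \<tau>_def transition_def inv_into_f_f)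
  have \<tau>S: "\<tau> ` S \<subseteq> snd D ` fst D" using \<tau>z by (auto simp: S_def W_def)
  have hol\<tau>: "holomorphic_map_on S \<tau>" using comp by (simp add: compatible_def ov \<tau>_def)
  have "V.lb (snd D ` fst D) (\<lambda>j x. t x j)"
    using t opD(2) by (intro ell2_holomorphic_imp_lb) (auto simp: homogeneous_lift_def)
  from lb_compose[OF this opD(2) hol\<tau> \<tau>S] have lb: "V.lb S (\<lambda>j x. t (\<tau> x) j)" .
  have lift: "homogeneous_lift \<phi> (W, z) (\<lambda>x. t (\<tau> x))"
    unfolding homogeneous_lift_def fst_conv snd_conv
  proof (intro conjI ballI)
    show "ell2_holomorphic_on (z ` W) (\<lambda>x. t (\<tau> x))"
      using lb_imp_ell2_holomorphic[OF opS lb] by (simp add: S_def)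
    show "t (\<tau> x) \<noteq> (\<lambda>j. 0)" if "x \<in> z ` W" for x
    proof -
      have "\<tau> x \<in> snd D ` fst D" using \<tau>S that by (auto simp: S_def)
      then show ?thesis using t unfolding homogeneous_lift_def by blast
    qed
    show "\<phi> q = proj_point (t (\<tau> (z q)))" if "q \<in> W" for q
      using t \<tau>z[OF that] that by (auto simp: homogeneous_lift_def W_def)
  qed
  interpret local_potential S "\<lambda>j x. t (\<tau> x) j" I f c \<alpha>
  proof
    show "\<exists>j. t (\<tau> x) j \<noteq> 0" if "x \<in> S" for x
      using lift that by (auto simp: homogeneous_lift_def S_def fun_eq_iff)
    show "(norm x)\<^sup>2 \<in> I" if "x \<in> S" for x using rad that W by (auto simp: S_def)
    fix x assume x: "x \<in> S"
    have "\<alpha> *\<^sub>R g (W, z) x = fubini_study_pullback c (\<lambda>x. t (\<tau> x)) x"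
      using \<phi>(2)[OF WA lift, of x] x by (simp add: S_def)
    moreover have "g (W, z) x = g (U, z) x"
      using form11_restrict[OF g UA WA W(2) ch, of x] opS x by (simp add: S_def)
    moreover have "g (U, z) x = radial_form f x" using rad x W by (auto simp: S_def)
    ultimately show "complex_hessian (\<lambda>x. 1 / c * ln (\<Sum>j. (cmod (t (\<tau> x) j))\<^sup>2)) x = \<alpha> *\<^sub>R radial_form f x"
      by (simp add: fubini_study_pullback_def)
  qed (use opS lb I c in auto)
  have zp: "z p \<in> S" using W by (simp add: S_def)
  have "\<exists>e :: complex^'n. norm e = 1 \<and> herm e x = 0" if "x \<in> S" for x
    using e that W by (auto simp: S_def)
  from local_power_series[OF zp I(2) this] that show ?thesis
    unfolding \<gamma>_def by blast
qed

section \<open>The soliton equation for radial metrics\<close>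

definition contr :: "complex^'n^'n \<Rightarrow> complex^'n \<Rightarrow> complex^'n \<Rightarrow> complex" where
  "contr M v w = (\<Sum>i\<in>UNIV. \<Sum>j\<in>UNIV. M $ i $ j * v $ i * cnj (w $ j))"

lemma contr_add: "contr (M + M') v w = contr M v w + contr M' v w"
  by (simp add: contr_def algebra_simps sum.distrib)

lemma contr_scaleR: "contr (a *\<^sub>R M) v w = of_real a * contr M v w"
  by (simp add: contr_def scaleR_conv_of_real[where 'a=complex] sum_distrib_left mult_ac)

lemma contr_radial:
  fixes M :: "complex^'n^'n"
  assumes "\<And>i j. M $ i $ j = a * kd i j + b * cnj (x $ i) * x $ j"
  shows "contr M v w = a * herm v w + b * herm v x * herm x w"
proof -
  have "contr M v w = (\<Sum>i\<in>UNIV. \<Sum>j\<in>UNIV. (if i = j then a * (v $ i * cnj (w $ i)) else 0)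
      + b * ((v $ i * cnj (x $ i)) * (x $ j * cnj (w $ j))))"
    unfolding contr_def by (intro sum.cong refl) (simp add: assms algebra_simps)
  also have "\<dots> = a * herm v w + b * (herm v x * herm x w)"
    unfolding herm_def sum_product by (simp add: sum.distrib sum_distrib_left)
  finally show ?thesis by (simp add: mult.assoc)
qed

lemma holomorphic_map_component:
  fixes G :: "complex^'n \<Rightarrow> complex^'n"
  assumes "holomorphic_map_on S G"
  shows "V.hol S (\<lambda>x. G x $ m)"
  unfolding V.hol_def
proof
  fix x assume "x \<in> S"
  then obtain D where D: "(G has_derivative D) (at x)" "\<forall>a v. D (a *s v) = a *s D v"
    using assms unfolding holomorphic_map_on_def by blast
  have "((\<lambda>x. G x $ m) has_derivative (\<lambda>v. D v $ m)) (at x)"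
    using has_derivative_compose[OF D(1) has_derivative_vec_nth] by simp
  then show "\<exists>D. ((\<lambda>x. G x $ m) has_derivative D) (at x) \<and> (\<forall>a v. D (a *s v) = a * D v)"
    using D(2) by (intro exI[of _ "\<lambda>v. D v $ m"]) simp
qed

lemma d_z_hol:
  assumes "V.hol S g" "x \<in> S"
  shows "d_z i g x = dird g (axis i 1) x"
proof -
  have "axis i \<i> = \<i> *s (axis i 1 :: complex^'a)" by (simp add: vec_eq_iff axis_def)
  then show ?thesis
    using V.holD(2)[OF assms, of \<i> "axis i 1"] by (simp add: d_z_def)
qed

definition vderiv :: "(complex^'n \<Rightarrow> complex^'m) \<Rightarrow> complex^'n \<Rightarrow> complex^'n \<Rightarrow> complex^'m" where
  "vderiv G v x = (\<chi> m. dird (\<lambda>y. G y $ m) v x)"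

text \<open>Contracting twice with one vector turns the matrix equation into a scalar one. The two
  terms with derivatives of \<open>X\<close> are conjugate to each other because the form is
  Hermitian, which leaves a real part.\<close>

lemma contr_lie_derivative:
  fixes x v :: "complex^'n" and X :: "complex^'n \<Rightarrow> complex^'n"
  assumes I: "open I" and F: "smooth_on I F" and x: "(norm x)\<^sup>2 \<in> I"
    and V: "\<And>m. V.hol S (\<lambda>y. X y $ m)" and xS: "x \<in> S"
  defines "q \<equiv> (norm x)\<^sup>2"
  defines "F1 \<equiv> deriv F q" and "F2 \<equiv> deriv (deriv F) q" and "F3 \<equiv> deriv (deriv (deriv F)) q"
  shows "contr (lie_derivative X (radial_form F) x) v v =
     of_real (F2 * (2 * (x \<bullet> X x))) * herm v v + of_real (F3 * (2 * (x \<bullet> X x))) * herm v x * herm x v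
     + of_real F2 * (herm v (X x) * herm x v + herm v x * herm (X x) v)
     + of_real (2 * Re (of_real F1 * herm (vderiv X v x) v + of_real F2 * herm (vderiv X v x) x * herm x v))"
proof -
  define G where "G = radial_form F x"
  define h where "h = X x"
  have fd: "frechet_derivative (\<lambda>y. radial_form F y $ i $ j) (at x) h =
      of_real (F2 * (2 * (x \<bullet> h))) * kd i j + of_real (F3 * (2 * (x \<bullet> h))) * cnj (x $ i) * x $ j
        + of_real F2 * (cnj (h $ i) * x $ j + cnj (x $ i) * h $ j)" for i j
    unfolding F1_def F2_def F3_def q_def
    by (simp add: frechet_derivative_at[OF radial_form_has_derivative[OF I F x], symmetric])
  define M1 :: "complex^'n^'n" where "M1 = (\<chi> i j. frechet_derivative (\<lambda>y. radial_form F y $ i $ j) (at x) h)"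
  define M2 :: "complex^'n^'n" where "M2 = (\<chi> i j. \<Sum>m\<in>UNIV. G $ m $ j * d_z i (\<lambda>y. X y $ m) x)"
  define M3 :: "complex^'n^'n" where "M3 = (\<chi> i j. \<Sum>m\<in>UNIV. G $ i $ m * cnj (d_z j (\<lambda>y. X y $ m) x))"
  have split: "lie_derivative X (radial_form F) x = M1 + M2 + M3"
    by (simp add: lie_derivative_def M1_def M2_def M3_def vec_eq_iff h_def G_def)
  have Gp: "contr G u w = of_real F1 * herm u w + of_real F2 * herm u x * herm x w" for u w
    unfolding G_def by (rule contr_radial) (simp add: radial_form_eq[OF I F x] F1_def F2_def q_def)
  have c1: "contr M1 v v = of_real (F2 * (2 * (x \<bullet> h))) * herm v v + of_real (F3 * (2 * (x \<bullet> h))) * herm v x * herm x v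
     + of_real F2 * (herm v h * herm x v + herm v x * herm h v)"
  proof -
    have "M1 = (\<chi> i j. of_real (F2 * (2 * (x \<bullet> h))) * kd i j + of_real (F3 * (2 * (x \<bullet> h))) * cnj (x $ i) * x $ j)
       + (\<chi> i j. of_real F2 * (cnj (h $ i) * x $ j + cnj (x $ i) * h $ j))"
      by (simp add: M1_def fd vec_eq_iff)
    moreover have "contr (\<chi> i j. of_real F2 * (cnj (h $ i) * x $ j + cnj (x $ i) * h $ j)) v v
        = of_real F2 * (herm v h * herm x v + herm v x * herm h v)"
      unfolding contr_def herm_def sum_product
      by (simp add: sum_distrib_left sum.distrib[symmetric] algebra_simps)
    ultimately show ?thesis
      by (simp only: contr_add contr_radial[where a="of_real (F2 * (2 * (x \<bullet> h)))" and b="of_real (F3 * (2 * (x \<bullet> h)))" and x=x] vec_lambda_beta)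
  qed
  have dv: "(\<Sum>i\<in>UNIV. d_z i (\<lambda>y. X y $ m) x * v $ i) = vderiv X v x $ m" for m
    unfolding vderiv_def vec_lambda_beta dird_expand[OF V xS, of m v] d_z_hol[OF V xS]
    by (simp add: mult.commute)
  have "contr M2 v v = (\<Sum>i\<in>UNIV. \<Sum>j\<in>UNIV. \<Sum>m\<in>UNIV. G $ m $ j * (d_z i (\<lambda>y. X y $ m) x * v $ i) * cnj (v $ j))"
    by (simp add: contr_def M2_def sum_distrib_right mult.assoc)
  also have "\<dots> = (\<Sum>m\<in>UNIV. \<Sum>j\<in>UNIV. \<Sum>i\<in>UNIV. G $ m $ j * (d_z i (\<lambda>y. X y $ m) x * v $ i) * cnj (v $ j))"
    by (subst sum.swap, subst (2) sum.swap, subst sum.swap) simp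
  also have "\<dots> = contr G (vderiv X v x) v"
    by (simp add: contr_def dv[symmetric] sum_distrib_left sum_distrib_right)
  finally have c2: "contr M2 v v = contr G (vderiv X v x) v" .
  have "contr M3 v v = (\<Sum>i\<in>UNIV. \<Sum>j\<in>UNIV. \<Sum>m\<in>UNIV. G $ i $ m * v $ i * cnj (d_z j (\<lambda>y. X y $ m) x * v $ j))"
    by (simp add: contr_def M3_def sum_distrib_right sum_distrib_left mult_ac)
  also have "\<dots> = (\<Sum>i\<in>UNIV. \<Sum>m\<in>UNIV. \<Sum>j\<in>UNIV. G $ i $ m * v $ i * cnj (d_z j (\<lambda>y. X y $ m) x * v $ j))"
    by (intro sum.cong refl sum.swap)
  also have "\<dots> = contr G v (vderiv X v x)"
    by (simp only: contr_def dv[symmetric] sum_distrib_left cnj_sum)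
  finally have c3: "contr M3 v v = contr G v (vderiv X v x)" .
  have "contr G v (vderiv X v x) = cnj (contr G (vderiv X v x) v)"
    unfolding Gp by (simp add: herm_commute)
  then have "contr M2 v v + contr M3 v v = of_real (2 * Re (contr G (vderiv X v x) v))"
    unfolding c2 c3 by (simp add: complex_add_cnj)
  then show ?thesis unfolding split contr_add c1 Gp h_def by (simp add: add.assoc)
qed

lemma hol_exp_line:
  assumes g: "V.hol S g" and s: "exp s *s p \<in> S"
  shows "((\<lambda>s. g (exp s *s p)) has_field_derivative dird g (exp s *s p) (exp s *s p)) (at s)"
proof -
  have "(exp has_derivative (\<lambda>h. h * exp s)) (at s)"
    by (rule has_derivative_eq_rhs[OF DERIV_exp[of s, unfolded has_field_derivative_def]]) (simp add: fun_eq_iff)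
  from bounded_linear.has_derivative[OF V.bounded_linear_sc_left this]
  have "((\<lambda>z. exp z *s p) has_derivative (\<lambda>h. h *s (exp s *s p))) (at s)"
    by (simp add: vector_smult_assoc)
  from has_derivative_compose[OF this V.holD(1)[OF g s]]
  show ?thesis
    unfolding has_field_derivative_def V.holD(2)[OF g s]
    by (rule has_derivative_eq_rhs) (simp add: fun_eq_iff)
qed

text \<open>The period of a primitive of a \<open>2\<pi>\<i>\<close>-periodic holomorphic function is the same on all
  vertical lines, which replaces averaging over circles.\<close>

lemma periodic_primitive:
  fixes D :: "complex set" and w :: "complex \<Rightarrow> complex"
  assumes D: "open D" "convex D" and per: "\<And>s. s \<in> D \<Longrightarrow> s + 2 * of_real pi * \<i> \<in> D"
    and w: "w holomorphic_on D" "\<And>s. s \<in> D \<Longrightarrow> w (s + 2 * of_real pi * \<i>) = w s"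
  obtains P c where "\<And>s. s \<in> D \<Longrightarrow> (P has_field_derivative w s) (at s)"
    "\<And>s. s \<in> D \<Longrightarrow> P (s + 2 * of_real pi * \<i>) - P s = 2 * of_real pi * \<i> * c"
proof -
  obtain P where P: "\<And>s. s \<in> D \<Longrightarrow> (P has_field_derivative w s) (at s within D)"
    using holomorphic_convex_primitive'[OF D(2,1) w(1)] by blast
  have P': "(P has_field_derivative w s) (at s)" if "s \<in> D" for s
    using P[OF that] at_within_open[OF that D(1)] by simp
  have "\<exists>k. \<forall>s\<in>D. P (s + 2 * of_real pi * \<i>) - P s = k"
  proof (rule has_field_derivative_zero_constant[OF D(2)])
    fix s assume s: "s \<in> D"
    have "((\<lambda>s. P (s + 2 * of_real pi * \<i>)) has_field_derivative w (s + 2 * of_real pi * \<i>)) (at s)"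
      using P'[OF per[OF s]] by (simp add: DERIV_shift)
    from DERIV_diff[OF this P'[OF s]]
    show "((\<lambda>s. P (s + 2 * of_real pi * \<i>) - P s) has_field_derivative 0) (at s within D)"
      by (simp add: w(2)[OF s] has_field_derivative_at_within)
  qed
  then obtain k where "\<forall>s\<in>D. P (s + 2 * of_real pi * \<i>) - P s = k" ..
  then show ?thesis using P' by (intro that[of P "k / (2 * of_real pi * \<i>)"]) auto
qed

text \<open>On a complex line, the soliton equation contracted with \<open>e\<close> and with
  \<open>x\<close> involves \<open>X\<close> only through the real parts of \<open>w\<close>,
  \<open>w'\<close> and \<open>v\<close>. Averaging over circles replaces \<open>w\<close> and
  \<open>v\<close> by constants \<open>k0\<close> and \<open>k2\<close> and removes
  \<open>w'\<close>; comparing the two averaged equations gives \<open>k0 = k2\<close>, and then the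
  first one says that the expression in the conclusion has derivative zero.\<close>

lemma krs_imp_ode:
  fixes X :: "complex^'n \<Rightarrow> complex^'n"
  assumes n: "CARD('n) \<ge> 2" and I: "open I" "is_interval I" "I \<subseteq> {0<..}" "I \<noteq> {}" and F: "smooth_on I F"
    and krs: "krs_on {x. (norm x)\<^sup>2 \<in> I} (radial_form F) X lam"
  obtains \<kappa> B where
    "\<And>r. r \<in> I \<Longrightarrow> ln (deriv F r ^ (CARD('n) - 1) * (deriv F r + r * deriv (deriv F) r)) + lam * F r + 2 * \<kappa> * r * deriv F r = B"
    "\<And>r. r \<in> I \<Longrightarrow> 0 < deriv F r" "\<And>r. r \<in> I \<Longrightarrow> 0 < deriv F r + r * deriv (deriv F) r"
    "\<And>x :: complex^'n. (norm x)\<^sup>2 \<in> I \<Longrightarrow> \<exists>e :: complex^'n. norm e = 1 \<and> herm e x = 0"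
proof -
  define S :: "(complex^'n) set" where "S = {x. (norm x)\<^sup>2 \<in> I}"
  define F1 F2 F3 where "F1 = deriv F" and "F2 = deriv (deriv F)" and "F3 = deriv (deriv (deriv F))"
  have opS: "open S" unfolding S_def by (rule open_shell_preimage[OF I(1)])
  have K: "kaehler_on S (radial_form F)" and hX: "holomorphic_map_on S X"
    and eq: "\<And>x. x \<in> S \<Longrightarrow> ricci_form (radial_form F) x = lam *\<^sub>R radial_form F x + lie_derivative X (radial_form F) x"
    using krs unfolding krs_on_def S_def by blast+
  have f21: "deriv F1 = F2" and f32: "deriv F2 = F3" by (simp_all add: F1_def F2_def F3_def)
  note Fd = F_deriv[OF I(1) F, folded F1_def F2_def F3_def, unfolded f21 f32]
  obtain k l :: 'n where kl: "k \<noteq> l"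
  proof -
    have "\<not> (\<forall>k l :: 'n. k = l)"
    proof
      assume "\<forall>k l :: 'n. k = l"
      then have "UNIV = {undefined :: 'n}" by auto
      then have "CARD('n) = 1" by (metis is_singletonI is_singleton_altdef)
      then show False using n by simp
    qed
    then show ?thesis using that by blast
  qed
  define p e where "p = (axis k 1 :: complex^'n)" and "e = (axis l 1 :: complex^'n)"
  have pe: "norm p = 1" "norm e = 1" by (simp_all add: p_def e_def)
  have pe0: "herm e p = 0"
    unfolding herm_def p_def e_def axis_def using kl by (auto intro!: sum.neutral)
  have nz: "(norm (exp s *s p))\<^sup>2 = exp (2 * Re s)" for s
    by (simp add: norm_vector_scalar pe norm_exp_eq_Re exp_double)
  \<comment> \<open>The logarithmic coordinate \<open>s\<close> unrolls the annulus in the line into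
    a convex strip, where primitives exist; circles become vertical segments of length
    \<open>2 * pi\<close>.\<close>
  define D where "D = {s. exp (2 * Re s) \<in> I}"
  have zS: "exp s *s p \<in> S" if "s \<in> D" for s using that by (simp add: S_def D_def nz)
  have opD: "open D" unfolding D_def
    using open_vimage[OF I(1), of "\<lambda>s::complex. exp (2 * Re s)"] by (simp add: vimage_def continuous_intros)
  have cD: "convex D"
  proof -
    have "is_interval {x::real. exp (2 * x) \<in> I}"
      unfolding is_interval_1
    proof (intro ballI allI impI)
      fix a b x :: real
      assume "a \<in> {x. exp (2 * x) \<in> I}" "b \<in> {x. exp (2 * x) \<in> I}" "a \<le> x \<and> x \<le> b"
      then have *: "exp (2 * a) \<in> I" "exp (2 * b) \<in> I" "exp (2 * a) \<le> exp (2 * x)" "exp (2 * x) \<le> exp (2 * b)"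
        by simp_all
      have "exp (2 * x) \<in> I"
        using I(2) * unfolding is_interval_1 by blast
      then show "x \<in> {x. exp (2 * x) \<in> I}" by simp
    qed
    then have "convex {x::real. exp (2 * x) \<in> I}" by (simp add: is_interval_convex_1)
    from convex_linear_vimage[OF _ this, of Re] show ?thesis
      unfolding D_def vimage_def by (simp add: bounded_linear.linear[OF bounded_linear_Re])
  qed
  have per: "s + 2 * of_real pi * \<i> \<in> D" if "s \<in> D" for s using that by (simp add: D_def)
  have expper: "exp (s + 2 * of_real pi * \<i>) = exp s" for s
    unfolding exp_add by simp
  have hol_m: "V.hol S (\<lambda>x. X x $ m)" for m by (rule holomorphic_map_component[OF hX])
  have hol_h: "V.hol S (\<lambda>x. herm (X x) p)" unfolding herm_def
    by (intro V.hol_sum(1) V.hol_mult(1) hol_m V.hol_const)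
  have dh: "dird (\<lambda>x. herm (X x) p) v x = herm (vderiv X v x) p" if "x \<in> S" for v x
    unfolding herm_def vderiv_def
    by (subst V.hol_sum(2)[OF _ that], intro V.hol_mult(1) hol_m V.hol_const)
       (simp add: V.hol_mult(2)[OF hol_m V.hol_const that])
  have hol_e: "V.hol S (\<lambda>x. herm (vderiv X e x) e)" unfolding herm_def vderiv_def vec_lambda_beta
    by (intro V.hol_sum(1) V.hol_mult(1) V.hol_dird[OF hol_m opS] V.hol_const)
  \<comment> \<open>Normalised so that \<open>herm (X x) x = r * w s\<close> at
    \<open>x = exp s *s p\<close>. For \<open>X\<close> equal to \<open>\<kappa>\<close> times the
    Euler field, both \<open>w\<close> and \<open>v\<close> are the constant
    \<open>\<kappa>\<close>.\<close>
  define w where "w s = herm (X (exp s *s p)) p * exp (- s)" for s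
  define w' where "w' s = herm (vderiv X (exp s *s p) (exp s *s p)) p * exp (- s) - w s" for s
  define v where "v s = herm (vderiv X e (exp s *s p)) e" for s
  have dw: "(w has_field_derivative w' s) (at s)" if "s \<in> D" for s
  proof -
    have "((\<lambda>s. herm (X (exp s *s p)) p) has_field_derivative herm (vderiv X (exp s *s p) (exp s *s p)) p) (at s)"
      using hol_exp_line[OF hol_h zS[OF that]] dh[OF zS[OF that]] by simp
    then show ?thesis
      unfolding w_def[abs_def] w'_def by (auto intro!: derivative_eq_intros simp: algebra_simps)
  qed
  have holw: "w holomorphic_on D" using dw opD by (meson holomorphic_on_open)
  have holv: "v holomorphic_on D"
    using hol_exp_line[OF hol_e zS] opD unfolding v_def[abs_def] by (meson holomorphic_on_open)
  have wper: "w (s + 2 * of_real pi * \<i>) = w s" for s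
    unfolding w_def expper using expper[of "- (s + 2 * of_real pi * \<i>)"] by simp
  have vper: "v (s + 2 * of_real pi * \<i>) = v s" for s unfolding v_def expper ..
  obtain P c0 where P: "\<And>s. s \<in> D \<Longrightarrow> (P has_field_derivative w s) (at s)"
    "\<And>s. s \<in> D \<Longrightarrow> P (s + 2 * of_real pi * \<i>) - P s = 2 * of_real pi * \<i> * c0"
    using periodic_primitive[OF opD cD per holw wper] by blast
  obtain Q c2 where Q: "\<And>s. s \<in> D \<Longrightarrow> (Q has_field_derivative v s) (at s)"
    "\<And>s. s \<in> D \<Longrightarrow> Q (s + 2 * of_real pi * \<i>) - Q s = 2 * of_real pi * \<i> * c2"
    using periodic_primitive[OF opD cD per holv vper] by blast
  have pos: "0 < F1 r" "0 < F1 r + r * F2 r" if r: "r \<in> I" for r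
  proof -
    have r0: "r > 0" using r I(3) by auto
    have x: "(norm (exp (of_real (ln r / 2)) *s p))\<^sup>2 = r" using r0 by (simp add: nz)
    then have "exp (of_real (ln r / 2)) *s p \<noteq> 0" using r0 by auto
    from radial_kaehler_imp_pos[OF I(1) F K _ _ this n] x r
    show "0 < F1 r" "0 < F1 r + r * F2 r" by (simp_all add: S_def F1_def F2_def)
  qed
  define H where "H r = ln (F1 r ^ (CARD('n) - 1) * (F1 r + r * F2 r))" for r
  define H1 where "H1 r = real (CARD('n) - 1) * (F2 r / F1 r) + (2 * F2 r + r * F3 r) / (F1 r + r * F2 r)" for r
  have dH: "(H has_real_derivative H1 r) (at r)" if r: "r \<in> I" for r
  proof -
    have a: "((\<lambda>r. ln (F1 r)) has_real_derivative F2 r / F1 r) (at r)"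
      using DERIV_chain2[OF DERIV_ln_divide[OF pos(1)[OF r]] Fd(2)[OF r]] by simp
    have b: "((\<lambda>r. F1 r + r * F2 r) has_real_derivative 2 * F2 r + r * F3 r) (at r)"
      by (auto intro!: derivative_eq_intros Fd[OF r])
    have c: "((\<lambda>r. ln (F1 r + r * F2 r)) has_real_derivative (2 * F2 r + r * F3 r) / (F1 r + r * F2 r)) (at r)"
      using DERIV_chain2[OF DERIV_ln_divide[OF pos(2)[OF r]] b] by simp
    have "((\<lambda>r. real (CARD('n) - 1) * ln (F1 r) + ln (F1 r + r * F2 r)) has_real_derivative H1 r) (at r)"
      unfolding H1_def by (rule DERIV_add[OF DERIV_cmult[OF a] c])
    then show ?thesis
      by (rule has_field_derivative_transform_within_open[OF _ I(1) r])
         (simp add: H_def ln_mult_pos ln_realpow pos)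
  qed
  have F3d: "(F3 has_real_derivative deriv F3 r) (at r)" if "r \<in> I" for r
    using smooth_on_higher_deriv(2)[OF I(1) F that, of 3] by (simp add: F3_def numeral_3_eq_3)
  have "\<exists>d. (H1 has_real_derivative d) (at r)" if r: "r \<in> I" for r
  proof -
    have dF: "F1 differentiable at r" "F2 differentiable at r" "F3 differentiable at r"
      using Fd[OF r] F3d[OF r] by (auto simp: real_differentiable_def)
    have "H1 differentiable at r"
      unfolding H1_def[abs_def] using pos[OF r]
      by (intro differentiable_add differentiable_mult differentiable_divide differentiable_const differentiable_ident dF) auto
    then show ?thesis by (simp add: real_differentiable_def)
  qed
  then obtain H2 where dH1: "\<And>r. r \<in> I \<Longrightarrow> (H1 has_real_derivative H2 r) (at r)" by metis
  define E1 E2 where "E1 r = H1 r + lam * F1 r" and "E2 r = H2 r + lam * F2 r" for r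
  have contr_eq: "of_real (E1 ((norm x)\<^sup>2)) * herm u u + of_real (E2 ((norm x)\<^sup>2)) * herm u x * herm x u
      + contr (lie_derivative X (radial_form F) x) u u = 0" if x: "x \<in> S" for x u
  proof -
    have xI: "(norm x)\<^sup>2 \<in> I" using x by (simp add: S_def)
    have a: "contr (ricci_form (radial_form F) x) u u
       = of_real (- H1 ((norm x)\<^sup>2)) * herm u u + of_real (- H2 ((norm x)\<^sup>2)) * herm u x * herm x u"
      by (rule contr_radial, subst ricci_form_radial[OF I(1) F xI, of H H1 "H2 ((norm x)\<^sup>2)"])
         (use dH dH1 xI in \<open>auto simp: H_def F1_def F2_def algebra_simps\<close>)
    have b: "contr (radial_form F x) u u = of_real (F1 ((norm x)\<^sup>2)) * herm u u + of_real (F2 ((norm x)\<^sup>2)) * herm u x * herm x u"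
      by (rule contr_radial) (simp add: radial_form_eq[OF I(1) F xI] F1_def F2_def)
    have "contr (lie_derivative X (radial_form F) x) u u
        = contr (ricci_form (radial_form F) x) u u - of_real lam * contr (radial_form F x) u u"
      unfolding eq[OF x] contr_add contr_scaleR by simp
    note L = this
    show ?thesis unfolding L a b E1_def E2_def by (simp add: algebra_simps)
  qed
  have eqs: "E1 r + 2 * F2 r * r * Re (w s) + 2 * F1 r * Re (v s) = 0"
     "E1 r + r * E2 r + 2 * Re (w s) * (2 * r * F2 r + r\<^sup>2 * F3 r) + 2 * (F1 r + r * F2 r) * Re (w s + w' s) = 0"
    if s: "s \<in> D" and r: "r = exp (2 * Re s)" for s r
  proof -
    define x where "x = exp s *s p"
    have x: "x \<in> S" using zS[OF s] by (simp add: x_def)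
    have xr: "(norm x)\<^sup>2 = r" by (simp add: x_def nz r)
    have xI: "(norm x)\<^sup>2 \<in> I" using x by (simp add: S_def)
    have r0: "r > 0" by (simp add: r)
    have ss: "cnj (exp s) * exp s = of_real r"
    proof -
      have "(cmod (exp s))\<^sup>2 = r" by (simp add: r exp_double norm_exp_eq_Re)
      then show ?thesis using complex_norm_square[of "exp s"] by (simp only: mult.commute)
    qed
    have hx: "herm u x = cnj (exp s) * herm u p" for u by (simp add: x_def herm_scale_right)
    have hXx: "herm (X x) x = of_real r * w s"
      unfolding hx w_def using ss by (simp add: x_def exp_minus field_simps)
    have inn: "x \<bullet> X x = r * Re (w s)"
      using hXx inner_herm[of "X x" x] by (simp add: inner_commute)
    have hDx: "herm (vderiv X x x) x = of_real r * (w s + w' s)"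
      unfolding hx w'_def using ss by (simp add: x_def exp_minus field_simps)
    have hee: "herm e e = 1" "herm e x = 0" "herm x e = 0"
      using herm_self[of e] pe pe0 herm_commute[of e x] hx by auto
    have hxx: "herm x x = of_real r" using herm_self[of x] xr by simp
    have "of_real (E1 r) + (of_real (F2 r * (2 * (r * Re (w s)))) + of_real (2 * Re (of_real (F1 r) * v s))) = (0::complex)"
      using contr_eq[OF x, of e]
      unfolding contr_lie_derivative[OF I(1) F xI hol_m x] xr F1_def F2_def F3_def inn hee
      by (simp add: v_def x_def)
    then have "complex_of_real (E1 r + (F2 r * (2 * (r * Re (w s))) + 2 * Re (of_real (F1 r) * v s))) = of_real 0"
      by simp
    then have "E1 r + (F2 r * (2 * (r * Re (w s))) + 2 * Re (of_real (F1 r) * v s)) = 0"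
      by (simp only: of_real_eq_iff)
    then show "E1 r + 2 * F2 r * r * Re (w s) + 2 * F1 r * Re (v s) = 0" by simp
    have hxX: "herm x (X x) + herm (X x) x = of_real (2 * (r * Re (w s)))"
      using hXx herm_commute[of "X x" x] by (simp add: complex_eq_iff)
    have "of_real (E1 r) * of_real r + of_real (E2 r) * of_real r * of_real r +
       (of_real (F2 r * (2 * (r * Re (w s)))) * of_real r + of_real (F3 r * (2 * (r * Re (w s)))) * of_real r * of_real r
        + of_real (F2 r) * ((herm x (X x) + herm (X x) x) * of_real r)
        + of_real (2 * Re (of_real (F1 r) * (of_real r * (w s + w' s)) + of_real (F2 r) * (of_real r * (w s + w' s)) * of_real r))) = (0::complex)"
      using contr_eq[OF x, of x]
      unfolding contr_lie_derivative[OF I(1) F xI hol_m x] xr F1_def[symmetric] f21 f32 inn hDx hxx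
      by (simp add: algebra_simps)
    then have "complex_of_real (E1 r * r + E2 r * r * r + (F2 r * (2 * (r * Re (w s))) * r + F3 r * (2 * (r * Re (w s))) * r * r
        + F2 r * (2 * (r * Re (w s)) * r) + 2 * Re (of_real (F1 r) * (of_real r * (w s + w' s)) + of_real (F2 r) * (of_real r * (w s + w' s)) * of_real r))) = of_real 0"
      unfolding hxX by simp
    then have "E1 r * r + E2 r * r * r + (F2 r * (2 * (r * Re (w s))) * r + F3 r * (2 * (r * Re (w s))) * r * r
        + F2 r * (2 * (r * Re (w s)) * r) + 2 * Re (of_real (F1 r) * (of_real r * (w s + w' s)) + of_real (F2 r) * (of_real r * (w s + w' s)) * of_real r)) = 0"
      by (simp only: of_real_eq_iff)
    then have "r * (E1 r + r * E2 r + 2 * Re (w s) * (2 * r * F2 r + r\<^sup>2 * F3 r) + 2 * (F1 r + r * F2 r) * Re (w s + w' s)) = 0"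
      by (simp add: algebra_simps power2_eq_square)
    then show "E1 r + r * E2 r + 2 * Re (w s) * (2 * r * F2 r + r\<^sup>2 * F3 r) + 2 * (F1 r + r * F2 r) * Re (w s + w' s) = 0"
      using r0 by simp
  qed
  define k0 k2 where "k0 = Re c0" and "k2 = Re c2"
  \<comment> \<open>The identity is integrated over one vertical period. The primitives
    \<open>P\<close> and \<open>Q\<close> grow by amounts that are the same on every circle, and
    \<open>w\<close> is periodic, so the term with \<open>w'\<close> averages to zero.\<close>
  have avg: "a + b * k0 + d * k2 = 0"
    if r: "r \<in> I" and ab: "\<And>s. exp (2 * Re s) = r \<Longrightarrow> a + b * Re (w s) + b' * Re (w' s) + d * Re (v s) = 0" for a b b' d r
  proof -
    have r0: "r > 0" using r I(3) by auto
    define s where "s t = complex_of_real (ln r / 2) + of_real t * \<i>" for t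
    have sr: "exp (2 * Re (s t)) = r" for t using r0 by (simp add: s_def)
    have sD: "s t \<in> D" for t using r by (simp add: D_def sr)
    have ds: "(s has_vector_derivative \<i>) (at t)" for t
      unfolding s_def[abs_def] by (auto intro!: derivative_eq_intros simp: has_vector_derivative_def scaleR_conv_of_real)
    define f where "f t = a * t + b * Im (P (s t)) + b' * Im (w (s t)) + d * Im (Q (s t))" for t
    have chain: "((\<lambda>t. Im (g (s t))) has_real_derivative Re g') (at t)"
      if "(g has_field_derivative g') (at (s t))" for g g' t
    proof -
      have "((g \<circ> s) has_vector_derivative \<i> * g') (at t)"
        by (rule field_vector_diff_chain_at[OF ds that])
      then have "((\<lambda>t. g (s t)) has_derivative (\<lambda>h. h *\<^sub>R (\<i> * g'))) (at t)"
        by (simp add: has_vector_derivative_def o_def)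
      from has_derivative_Im[OF this] show ?thesis
        by (simp add: has_field_derivative_def mult.commute[of _ "Re g'"])
    qed
    have "(f has_real_derivative 0) (at t)" for t
    proof -
      have "(f has_real_derivative a * 1 + b * Re (w (s t)) + b' * Re (w' (s t)) + d * Re (v (s t))) (at t)"
        unfolding f_def by (intro DERIV_add DERIV_cmult chain P(1) Q(1) dw sD DERIV_ident)
      then show ?thesis using ab[OF sr] by simp
    qed
    then have "f (2 * pi) = f 0" by (intro DERIV_isconst_all) auto
    moreover have "s (2 * pi) = s 0 + 2 * of_real pi * \<i>" by (simp add: s_def)
    then have "Im (P (s (2 * pi))) = Im (P (s 0)) + 2 * pi * k0" "Im (Q (s (2 * pi))) = Im (Q (s 0)) + 2 * pi * k2"
      "w (s (2 * pi)) = w (s 0)"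
      using arg_cong[OF P(2)[OF sD[of 0]], of Im] arg_cong[OF Q(2)[OF sD[of 0]], of Im] wper
      by (auto simp: k0_def k2_def)
    ultimately have "2 * pi * (a + b * k0 + d * k2) = 0"
      by (simp add: f_def algebra_simps)
    then show ?thesis by simp
  qed
  have a1: "E1 r + 2 * r * F2 r * k0 + 2 * F1 r * k2 = 0" if r: "r \<in> I" for r
  proof (rule avg[OF r, of _ _ 0])
    fix s assume s: "exp (2 * Re s) = r"
    then have "s \<in> D" using r by (simp add: D_def)
    from eqs(1)[OF this s[symmetric]]
    show "E1 r + 2 * r * F2 r * Re (w s) + 0 * Re (w' s) + 2 * F1 r * Re (v s) = 0" by (simp add: mult_ac)
  qed
  have a2: "(E1 r + r * E2 r) + (2 * (2 * r * F2 r + r\<^sup>2 * F3 r) + 2 * (F1 r + r * F2 r)) * k0 + 0 * k2 = 0" if r: "r \<in> I" for r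
  proof (rule avg[OF r, of _ _ "2 * (F1 r + r * F2 r)"])
    fix s assume s: "exp (2 * Re s) = r"
    then have "s \<in> D" using r by (simp add: D_def)
    from eqs(2)[OF this s[symmetric]]
    show "(E1 r + r * E2 r) + (2 * (2 * r * F2 r + r\<^sup>2 * F3 r) + 2 * (F1 r + r * F2 r)) * Re (w s)
       + 2 * (F1 r + r * F2 r) * Re (w' s) + 0 * Re (v s) = 0" by (simp add: algebra_simps)
  qed
  have dE1: "(E1 has_real_derivative E2 r) (at r)" if "r \<in> I" for r
    unfolding E1_def E2_def by (intro DERIV_add DERIV_cmult dH1 Fd(2) that)
  \<comment> \<open>\<open>A\<close> has derivative zero by the second averaged equation. By the
    first it equals \<open>2 * (k0 - k2) * (r * F1 r)\<close>, whose derivative is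
    \<open>2 * (k0 - k2)\<close> times a positive number.\<close>
  have "k0 = k2"
  proof -
    obtain r where r: "r \<in> I" using I(4) by blast
    define A where "A r = r * E1 r + 2 * k0 * (r * (F1 r + r * F2 r))" for r
    have "(A has_real_derivative E1 r + r * E2 r + 2 * k0 * (F1 r + r * F2 r + r * (F2 r + F2 r + r * F3 r))) (at r)"
      unfolding A_def by (auto intro!: derivative_eq_intros dE1[OF r] Fd[OF r] simp: algebra_simps)
    then have 1: "(A has_real_derivative 0) (at r)"
      using a2[OF r] by (elim DERIV_cong) (simp add: algebra_simps power2_eq_square)
    have "((\<lambda>r. 2 * (k0 - k2) * (r * F1 r)) has_real_derivative 2 * (k0 - k2) * (F1 r + r * F2 r)) (at r)"
      by (auto intro!: derivative_eq_intros Fd[OF r] simp: algebra_simps)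
    then have "(A has_real_derivative 2 * (k0 - k2) * (F1 r + r * F2 r)) (at r)"
    proof (rule has_field_derivative_transform_within_open[OF _ I(1) r])
      fix t assume "t \<in> I"
      have "A t - 2 * (k0 - k2) * (t * F1 t) = t * (E1 t + 2 * t * F2 t * k0 + 2 * F1 t * k2)"
        by (simp add: A_def algebra_simps)
      then show "2 * (k0 - k2) * (t * F1 t) = A t" using a1[OF \<open>t \<in> I\<close>] by simp
    qed
    from DERIV_unique[OF this 1] pos(2)[OF r] show ?thesis by simp
  qed
  have "\<exists>B. \<forall>r\<in>I. H r + lam * F r + 2 * k0 * (r * F1 r) = B"
  proof (rule has_field_derivative_zero_constant)
    show "convex I" using I(2) by (simp add: is_interval_convex_1)
    fix r assume r: "r \<in> I"
    have "((\<lambda>r. H r + lam * F r + 2 * k0 * (r * F1 r)) has_real_derivative H1 r + lam * F1 r + 2 * k0 * (F1 r + r * F2 r)) (at r)"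
      by (auto intro!: derivative_eq_intros dH[OF r] Fd[OF r] simp: algebra_simps)
    moreover have "H1 r + lam * F1 r + 2 * k0 * (F1 r + r * F2 r) = 0"
      using a1[OF r] \<open>k0 = k2\<close> by (simp add: E1_def algebra_simps)
    ultimately show "((\<lambda>r. H r + lam * F r + 2 * k0 * (r * F1 r)) has_real_derivative 0) (at r within I)"
      by (metis has_field_derivative_at_within)
  qed
  then obtain B where B: "\<And>r. r \<in> I \<Longrightarrow> H r + lam * F r + 2 * k0 * (r * F1 r) = B" by blast
  show ?thesis
  proof (rule that[of k0 B])
    fix x :: "complex^'n" assume x: "(norm x)\<^sup>2 \<in> I"
    then have "x \<noteq> 0" using I(3) by auto
    from radial_kaehler_imp_pos(3)[OF I(1) F K _ x this n] x
    show "\<exists>e :: complex^'n. norm e = 1 \<and> herm e x = 0" by (simp add: S_def)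
  next
    show "ln (deriv F r ^ (CARD('n) - 1) * (deriv F r + r * deriv (deriv F) r)) + lam * F r + 2 * k0 * r * deriv F r = B"
      if "r \<in> I" for r
      using B[OF that] by (simp add: H_def F1_def F2_def mult.assoc)
    show "0 < deriv F r" "0 < deriv F r + r * deriv (deriv F) r" if "r \<in> I" for r
      using pos[OF that] by (simp_all add: F1_def F2_def)
  qed
qed

section \<open>Power series with non-negative coefficients\<close>

text \<open>The \<open>i\<close>-th derivative of the series, for real and complex arguments at
  once: identities known on a real interval are continued over the complex disc and read back on the
  real axis.\<close>

definition ps :: "(nat \<Rightarrow> real) \<Rightarrow> nat \<Rightarrow> 'a::{real_normed_field,banach} \<Rightarrow> 'a" where
  "ps a i x = (\<Sum>n. of_real ((diffs ^^ i) a n) * x ^ n)"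

lemma diffs_of_real: "diffs (\<lambda>n. of_real (b n) :: 'a::real_normed_field) = (\<lambda>n. of_real (diffs b n))"
  by (simp add: diffs_def fun_eq_iff)

locale nonneg_series =
  fixes a :: "nat \<Rightarrow> real" and r1 :: real
  assumes a: "0 \<le> a k" and sm: "0 < r \<Longrightarrow> r < r1 \<Longrightarrow> summable (\<lambda>k. a k * r ^ k)" and r1: "r1 > 0"
begin

lemma diffs_nonneg: "0 \<le> (diffs ^^ i) a k"
  by (induction i arbitrary: k) (auto simp: a diffs_def)

lemma ps_summable:
  assumes "norm (x::'a::{real_normed_field,banach}) < r1"
  shows "summable (\<lambda>n. of_real ((diffs ^^ i) a n) * x ^ n)"
  using assms
proof (induction i arbitrary: x)
  case 0
  obtain r where r: "norm x < r" "r < r1" using 0 dense by blast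
  then have "0 < r" using norm_ge_zero[of x] by linarith
  show ?case
  proof (rule summable_comparison_test'[OF sm[OF \<open>0 < r\<close> r(2)]])
    show "norm (of_real ((diffs ^^ 0) a n) * x ^ n) \<le> a n * r ^ n" for n
      using a[of n] r by (auto simp: norm_mult norm_power intro!: mult_left_mono power_mono)
  qed
next
  case (Suc i)
  have "summable (\<lambda>n. diffs (\<lambda>n. of_real ((diffs ^^ i) a n) :: 'a) n * x ^ n)"
    using Suc by (intro termdiff_converges[of x r1]) auto
  then show ?case by (simp add: diffs_of_real)
qed

lemma ps_deriv:
  assumes "norm (x::'a::{real_normed_field,banach}) < r1"
  shows "(ps a i has_field_derivative ps a (Suc i) x) (at x)"
proof -
  obtain r where r: "norm x < r" "r < r1" using assms dense by blast
  have rr: "norm (of_real r :: 'a) = r" using r norm_ge_zero[of x] by (simp only: norm_of_real)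
  have "((\<lambda>x. \<Sum>n. of_real ((diffs ^^ i) a n) * x ^ n) has_field_derivative
      (\<Sum>n. diffs (\<lambda>n. of_real ((diffs ^^ i) a n) :: 'a) n * x ^ n)) (at x)"
    by (rule termdiffs_strong[OF ps_summable, of "of_real r"]) (use r rr in auto)
  then show ?thesis by (simp add: ps_def[abs_def] diffs_of_real)
qed

lemma ps_of_real:
  assumes "\<bar>r\<bar> < r1"
  shows "ps a i (of_real r :: complex) = of_real (ps a i r)"
proof -
  have "ps a i r = (\<Sum>n. (diffs ^^ i) a n * r ^ n)" by (simp add: ps_def)
  also have "of_real \<dots> = (\<Sum>n. complex_of_real ((diffs ^^ i) a n * r ^ n))"
    using ps_summable[of r i] assms by (intro suminf_of_real) auto
  finally show ?thesis by (simp add: ps_def)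
qed

lemma ps_nonneg: "0 \<le> r \<Longrightarrow> r < r1 \<Longrightarrow> 0 \<le> ps a i (r::real)"
  using ps_summable[of r i] diffs_nonneg by (auto simp: ps_def intro!: suminf_nonneg)

lemma ps_holomorphic: "ps a i holomorphic_on ball 0 r1"
  unfolding holomorphic_on_open[OF open_ball] using ps_deriv by fastforce

lemma ps_0: "ps a 0 (0::real) = a 0"
  unfolding ps_def by (subst suminf_finite[of "{0}"]) auto

lemma ps_pos: "a 0 > 0 \<Longrightarrow> 0 \<le> r \<Longrightarrow> r < r1 \<Longrightarrow> 0 < ps a 0 (r::real)"
proof -
  assume *: "a 0 > 0" "0 \<le> r" "r < r1"
  have "0 < (\<Sum>n. of_real ((diffs ^^ 0) a n) * r ^ n)"
    by (rule suminf_pos2[of _ 0]) (use * a ps_summable[of r 0] in auto)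
  then show "0 < ps a 0 r" by (simp add: ps_def)
qed

lemma shift_series: "nonneg_series (\<lambda>k. a (k + m)) r1"
proof
  fix r :: real assume r: "0 < r" "r < r1"
  have "summable (\<lambda>k. a (k + m) * r ^ (k + m))" using sm[OF r] by (subst summable_iff_shift)
  then have "summable (\<lambda>k. (a (k + m) * r ^ (k + m)) * (1 / r ^ m))" by (rule summable_mult2)
  then show "summable (\<lambda>k. a (k + m) * r ^ k)" using r by (simp add: power_add)
qed (use a r1 in auto)

text \<open>Factor out the leading power: if the series is \<open>r^m\<close> times
  \<open>b\<close>, its logarithmic derivative times \<open>r\<close> is
  \<open>m + r b' / b\<close>, and \<open>b\<close> does not vanish at \<open>0\<close>.\<close>

lemma log_derivative_limit:
  assumes "\<And>k. k < m \<Longrightarrow> a k = 0" "a m > 0"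
  shows "((\<lambda>r. r * ps a 1 r / ps a 0 r) \<longlongrightarrow> real m) (at_right 0)"
proof -
  define b where "b = (\<lambda>k. a (k + m))"
  interpret b: nonneg_series b r1 unfolding b_def by (rule shift_series)
  have S: "ps a 0 r = r ^ m * ps b 0 r" if "\<bar>r\<bar> < r1" for r :: real
  proof -
    have s: "summable (\<lambda>n. a n * r ^ n)" using ps_summable[of r 0] that by simp
    have "(\<Sum>n. a n * r ^ n) = (\<Sum>n. a (n + m) * r ^ (n + m)) + (\<Sum>i<m. a i * r ^ i)"
      by (rule suminf_split_initial_segment[OF s])
    also have "(\<Sum>i<m. a i * r ^ i) = 0" using assms(1) by simp
    also have "(\<Sum>n. a (n + m) * r ^ (n + m)) = (\<Sum>n. r ^ m * (b n * r ^ n))"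
      by (simp add: b_def power_add mult_ac)
    also have "\<dots> = r ^ m * (\<Sum>n. b n * r ^ n)"
      using b.ps_summable[of r 0] that by (intro suminf_mult) auto
    finally show ?thesis by (simp add: ps_def)
  qed
  have S1: "r * ps a 1 r = real m * r ^ m * ps b 0 r + r ^ m * (r * ps b 1 r)" if "\<bar>r\<bar> < r1" for r :: real
  proof -
    have "((\<lambda>r. r ^ m * ps b 0 r) has_real_derivative real m * r ^ (m - 1) * ps b 0 r + ps b (Suc 0) r * r ^ m) (at r)"
      using that by (auto intro!: derivative_eq_intros b.ps_deriv)
    then have "(ps a 0 has_real_derivative real m * r ^ (m - 1) * ps b 0 r + ps b (Suc 0) r * r ^ m) (at r)"
      by (rule has_field_derivative_transform_within_open[of _ _ _ "{-r1<..<r1}"]) (use that S in auto)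
    moreover have "(ps a 0 has_real_derivative ps a (Suc 0) r) (at r)" using that by (intro ps_deriv) auto
    ultimately have "ps a (Suc 0) r = real m * r ^ (m - 1) * ps b 0 r + ps b (Suc 0) r * r ^ m"
      by (rule DERIV_unique[symmetric])
    then show ?thesis by (cases m) (auto simp: algebra_simps)
  qed
  have b0: "b 0 > 0" using assms(2) by (simp add: b_def)
  have ev: "\<forall>\<^sub>F r in at_right 0. 0 < r \<and> r < r1"
    using r1 by (auto simp: eventually_at_right_field)
  have cont: "(ps b i \<longlongrightarrow> ps b i 0) (at_right (0::real))" for i
    using DERIV_isCont[OF b.ps_deriv[of "0::real" i]] r1 by (auto simp: isCont_def intro: tendsto_within_subset)
  have "((\<lambda>r. real m + r * ps b 1 r / ps b 0 r) \<longlongrightarrow> real m + 0 * ps b 1 0 / ps b 0 0) (at_right 0)"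
    by (intro tendsto_intros cont) (use b0 b.ps_0 in auto)
  moreover have "\<forall>\<^sub>F r in at_right 0. real m + r * ps b 1 r / ps b 0 r = r * ps a 1 r / ps a 0 r"
    using ev
  proof eventually_elim
    case (elim r)
    have "ps b 0 r > 0" using b.ps_pos[OF b0, of r] elim by simp
    then show ?case using elim S[of r] S1[of r] by (simp add: field_simps)
  qed
  ultimately show ?thesis by (simp add: tendsto_cong)
qed

end

lemma islimpt_real_interval:
  assumes "u < (v::real)"
  shows "complex_of_real ((u + v) / 2) islimpt complex_of_real ` {u<..<v}"
proof -
  have "(u + v) / 2 islimpt {u<..<v}"
    using assms by (intro interior_limit_point) (auto simp: interior_open field_simps)
  then show ?thesis
    unfolding islimpt_approachable
    by (metis (no_types, lifting) dist_of_real image_eqI of_real_eq_iff)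
qed

text \<open>The logarithmic derivative \<open>r b' / b\<close> tends to the leading exponent as \<open>r\<close> tends to \<open>0\<close>; the
  identity theorem gives \<open>r b' / b = t r a' / a\<close> on all of the common disc.\<close>

lemma leading_exponent_ratio:
  assumes A: "nonneg_series a r1" and B: "nonneg_series b r2"
    and uv: "0 < u" "u < v" "v < r1" "v < r2"
    and eq: "\<And>r. u < r \<Longrightarrow> r < v \<Longrightarrow> ps b 0 r = ps a 0 r powr t \<and> 0 < ps a 0 r"
    and k: "\<And>k. k < m \<Longrightarrow> a k = 0" "a m > 0" and l: "\<And>k. k < l \<Longrightarrow> b k = 0" "b l > 0"
  shows "real l = t * real m"
proof -
  interpret A: nonneg_series a r1 by (rule A)
  interpret B: nonneg_series b r2 by (rule B)
  define R where "R = min r1 r2"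
  have R: "R > 0" "R \<le> r1" "R \<le> r2" "v < R" using uv A.r1 B.r1 by (auto simp: R_def)
  \<comment> \<open>The relation between the logarithmic derivatives without its denominators, so
    that zeros of the series in the disc do no harm.\<close>
  define h where "h z = ps b 1 z * ps a 0 z - of_real t * ps a 1 z * ps b 0 z" for z :: complex
  have sub: "ball 0 R \<subseteq> ball (0::complex) r1" "ball 0 R \<subseteq> ball (0::complex) r2" using R by auto
  have hol: "h holomorphic_on ball 0 R"
    unfolding h_def[abs_def]
    by (intro holomorphic_intros holomorphic_on_subset[OF A.ps_holomorphic sub(1)] holomorphic_on_subset[OF B.ps_holomorphic sub(2)])
  have z: "h (of_real r) = 0" if r: "u < r" "r < v" for r
  proof -
    have ar: "\<bar>r\<bar> < r1" "\<bar>r\<bar> < r2" using r uv by auto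
    have "((\<lambda>r. ps a 0 r powr t) has_real_derivative t * ps a 0 r powr (t - 1) * ps a (Suc 0) r) (at r)"
      using eq[OF r] ar by (auto intro!: derivative_eq_intros A.ps_deriv)
    then have "(ps b 0 has_real_derivative t * ps a 0 r powr (t - 1) * ps a (Suc 0) r) (at r)"
      by (rule has_field_derivative_transform_within_open[of _ _ _ "{u<..<v}"]) (use r eq in auto)
    moreover have "(ps b 0 has_real_derivative ps b (Suc 0) r) (at r)" using ar by (intro B.ps_deriv) auto
    ultimately have "ps b (Suc 0) r = t * ps a 0 r powr (t - 1) * ps a (Suc 0) r" using DERIV_unique by blast
    then have "ps b 1 r * ps a 0 r - t * ps a 1 r * ps b 0 r = 0"
      using eq[OF r] by (simp add: powr_diff)
    then have "complex_of_real (ps b 1 r * ps a 0 r - t * ps a 1 r * ps b 0 r) = 0" by (simp only: of_real_0)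
    then show ?thesis unfolding h_def A.ps_of_real[OF ar(1)] B.ps_of_real[OF ar(2)] by simp
  qed
  have h0: "h w = 0" if "w \<in> ball 0 R" for w
  proof (rule analytic_continuation[OF hol open_ball connected_ball _ _ islimpt_real_interval[OF uv(2)] _ that])
    show "complex_of_real ` {u<..<v} \<subseteq> ball 0 R" using uv R by auto
    show "complex_of_real ((u + v) / 2) \<in> ball 0 R" using uv R by (auto simp del: of_real_divide of_real_add)
    show "h x = 0" if "x \<in> complex_of_real ` {u<..<v}" for x using that z by auto
  qed
  obtain \<epsilon> where \<epsilon>: "\<epsilon> > 0" "\<epsilon> < R" using R dense by blast
  have pos: "0 < ps a 0 r" "0 < ps b 0 r" if r: "0 < r" "r < R" for r :: real
  proof -
    have "0 < (\<Sum>n. of_real ((diffs ^^ 0) a n) * r ^ n)"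
      by (rule suminf_pos2[of _ m]) (use r R k A.a A.ps_summable[of r 0] in auto)
    then show "0 < ps a 0 r" by (simp add: ps_def)
    have "0 < (\<Sum>n. of_real ((diffs ^^ 0) b n) * r ^ n)"
      by (rule suminf_pos2[of _ l]) (use r R l B.a B.ps_summable[of r 0] in auto)
    then show "0 < ps b 0 r" by (simp add: ps_def)
  qed
  have "\<forall>\<^sub>F r in at_right 0. r * ps b 1 r / ps b 0 r = t * (r * ps a 1 r / ps a 0 r)"
    unfolding eventually_at_right_field
  proof (intro exI[of _ R] conjI R(1) allI impI)
    fix r :: real assume r: "0 < r" "r < R"
    have ar: "\<bar>r\<bar> < r1" "\<bar>r\<bar> < r2" using r R by auto
    have "h (of_real r) = 0" using h0[of "of_real r"] r by simp
    then have "complex_of_real (ps b 1 r * ps a 0 r - t * ps a 1 r * ps b 0 r) = of_real 0"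
      unfolding h_def A.ps_of_real[OF ar(1)] B.ps_of_real[OF ar(2)] by simp
    then have "ps b 1 r * ps a 0 r = t * ps a 1 r * ps b 0 r" by (simp only: of_real_eq_iff)
    then show "r * ps b 1 r / ps b 0 r = t * (r * ps a 1 r / ps a 0 r)"
      using pos[OF r] by (simp add: field_simps)
  qed
  moreover have "((\<lambda>r. t * (r * ps a 1 r / ps a 0 r)) \<longlongrightarrow> t * real m) (at_right 0)"
    by (intro tendsto_intros A.log_derivative_limit k)
  ultimately have "((\<lambda>r. r * ps b 1 r / ps b 0 r) \<longlongrightarrow> t * real m) (at_right 0)"
    by (simp add: tendsto_cong)
  then show ?thesis using B.log_derivative_limit[OF l] tendsto_unique[OF trivial_limit_at_right_real] by blast
qed

section \<open>The ordinary differential equation\<close>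

lemma ln_diff_le_abs:
  assumes "0 < m" "m \<le> x" "m \<le> (y::real)"
  shows "\<bar>ln x - ln y\<bar> \<le> \<bar>x - y\<bar> / m"
proof -
  have *: "ln x - ln y \<le> \<bar>x - y\<bar> / m" if "m \<le> x" "m \<le> y" for x y
  proof -
    have "ln x - ln y \<le> (x - y) / y" using assms(1) that by (intro ln_diff_le) auto
    also have "\<dots> \<le> \<bar>x - y\<bar> / y" using assms(1) that by (intro divide_right_mono) auto
    also have "\<dots> \<le> \<bar>x - y\<bar> / m" using assms(1) that by (intro divide_left_mono) auto
    finally show ?thesis .
  qed
  show ?thesis using *[OF assms(2,3)] *[OF assms(3,2)] by (simp add: abs_le_iff abs_minus_commute)
qed

lemma exp_diff_le_abs:
  assumes "exp x \<le> M" "exp y \<le> (M::real)"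
  shows "\<bar>exp x - exp y\<bar> \<le> M * \<bar>x - y\<bar>"
proof -
  have *: "exp x - exp y \<le> M * \<bar>x - y\<bar>" if "exp x \<le> M" for x y :: real
  proof -
    have "exp x - exp y = exp x * (1 - exp (y - x))" by (simp add: exp_diff field_simps)
    also have "\<dots> \<le> exp x * (x - y)" using exp_ge_add_one_self[of "y - x"] by (intro mult_left_mono) (linarith, simp)
    also have "\<dots> \<le> exp x * \<bar>x - y\<bar>" by (intro mult_left_mono) auto
    also have "\<dots> \<le> M * \<bar>x - y\<bar>" using that by (intro mult_right_mono) auto
    finally show ?thesis .
  qed
  show ?thesis using *[OF assms(1), of y] *[OF assms(2), of x] by (simp add: abs_le_iff abs_minus_commute)
qed

text \<open>The factor \<open>exp (- M * r)\<close> to the right of \<open>r0\<close>, and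
  \<open>exp (M * r)\<close> to the left, turns the bound on \<open>w'\<close> into monotonicity,
  which squeezes \<open>w\<close> between \<open>0\<close> and its value at
  \<open>r0\<close>.\<close>

lemma gronwall_zero:
  fixes w w' :: "real \<Rightarrow> real"
  assumes w: "\<And>r. r \<in> {u..v} \<Longrightarrow> (w has_real_derivative w' r) (at r)" "\<And>r. r \<in> {u..v} \<Longrightarrow> 0 \<le> w r"
    and le: "\<And>r. r \<in> {u..v} \<Longrightarrow> \<bar>w' r\<bar> \<le> M * w r" and r0: "r0 \<in> {u..v}" "w r0 = 0" and r: "r \<in> {u..v}"
  shows "w r = 0"
proof (cases "r0 \<le> r")
  case True
  have "(\<lambda>r. w r * exp (- M * r)) r \<le> (\<lambda>r. w r * exp (- M * r)) r0"
  proof (rule DERIV_nonpos_imp_nonincreasing[OF True])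
    fix x assume x: "r0 \<le> x" "x \<le> r"
    then have xx: "x \<in> {u..v}" using r r0 by auto
    have "((\<lambda>r. w r * exp (- M * r)) has_real_derivative (w' x - M * w x) * exp (- M * x)) (at x)"
      by (auto intro!: derivative_eq_intros w(1)[OF xx] simp: algebra_simps)
    moreover have "(w' x - M * w x) * exp (- M * x) \<le> 0" using le[OF xx] by (intro mult_nonpos_nonneg) auto
    ultimately show "\<exists>y. ((\<lambda>r. w r * exp (- M * r)) has_real_derivative y) (at x) \<and> y \<le> 0" by blast
  qed
  then have "w r * exp (- M * r) \<le> 0" using r0 by simp
  then show ?thesis using w(2)[OF r] by (simp add: mult_le_0_iff)
next
  case False
  then have "r \<le> r0" by simp
  have "(\<lambda>r. w r * exp (M * r)) r \<le> (\<lambda>r. w r * exp (M * r)) r0"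
  proof (rule DERIV_nonneg_imp_nondecreasing[OF \<open>r \<le> r0\<close>])
    fix x assume x: "r \<le> x" "x \<le> r0"
    then have xx: "x \<in> {u..v}" using r r0 by auto
    have "((\<lambda>r. w r * exp (M * r)) has_real_derivative (w' x + M * w x) * exp (M * x)) (at x)"
      by (auto intro!: derivative_eq_intros w(1)[OF xx] simp: algebra_simps)
    moreover have "0 \<le> (w' x + M * w x) * exp (M * x)" using le[OF xx] by (intro mult_nonneg_nonneg) auto
    ultimately show "\<exists>y. ((\<lambda>r. w r * exp (M * r)) has_real_derivative y) (at x) \<and> 0 \<le> y" by blast
  qed
  then have "w r * exp (M * r) \<le> 0" using r0 by simp
  then show ?thesis using w(2)[OF r] by (simp add: mult_le_0_iff)
qed

text \<open>The derivatives are parameters, so that the statement applies alike to \<open>f\<close>,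
  to the function obtained from the series and to the one glued from both.\<close>

definition soliton_ode ::
    "nat \<Rightarrow> real \<Rightarrow> real \<Rightarrow> real \<Rightarrow> (real \<Rightarrow> real) \<Rightarrow> (real \<Rightarrow> real) \<Rightarrow> (real \<Rightarrow> real) \<Rightarrow> real \<Rightarrow> bool" where
  "soliton_ode n lam \<kappa> B F F1 F2 r \<longleftrightarrow>
     (F has_real_derivative F1 r) (at r) \<and> (F1 has_real_derivative F2 r) (at r) \<and>
     0 < F1 r \<and> 0 < F1 r + r * F2 r \<and>
     ln (F1 r ^ (n - 1) * (F1 r + r * F2 r)) + lam * F r + 2 * \<kappa> * r * F1 r = B"

lemma soliton_ode_exp:
  assumes "soliton_ode n lam \<kappa> B F F1 F2 r"
  shows "F1 r + r * F2 r = exp (B - lam * F r - 2 * \<kappa> * r * F1 r - real (n - 1) * ln (F1 r))"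
proof -
  have p: "0 < F1 r" "0 < F1 r + r * F2 r" using assms by (auto simp: soliton_ode_def)
  have "ln (F1 r ^ (n - 1) * (F1 r + r * F2 r)) = real (n - 1) * ln (F1 r) + ln (F1 r + r * F2 r)"
    using p by (simp add: ln_mult_pos ln_realpow)
  then have "ln (F1 r + r * F2 r) = B - lam * F r - 2 * \<kappa> * r * F1 r - real (n - 1) * ln (F1 r)"
    using assms by (simp add: soliton_ode_def)
  then show ?thesis using p(2) exp_ln by metis
qed

text \<open>Solved for the second derivative by \<open>soliton_ode_exp\<close>, the equation
  satisfies a Lipschitz estimate in \<open>(F, F1)\<close> for the two solutions on a compact
  interval, which stays away from the singular point \<open>r = 0\<close>. Gronwall's inequality is
  applied to their squared distance in the phase plane.\<close>

lemma soliton_ode_unique: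
  assumes F: "\<And>r. r \<in> {u..v} \<Longrightarrow> soliton_ode n lam \<kappa> B F F1 F2 r"
    and G: "\<And>r. r \<in> {u..v} \<Longrightarrow> soliton_ode n lam \<kappa> B G G1 G2 r"
    and u: "0 < u" and r0: "r0 \<in> {u..v}" "F r0 = G r0" "F1 r0 = G1 r0" and r: "r \<in> {u..v}"
  shows "F r = G r"
proof -
  have Fd: "(F has_real_derivative F1 r) (at r)" "(F1 has_real_derivative F2 r) (at r)" "0 < F1 r" if "r \<in> {u..v}" for r
    using F[OF that] by (auto simp: soliton_ode_def)
  have Gd: "(G has_real_derivative G1 r) (at r)" "(G1 has_real_derivative G2 r) (at r)" "0 < G1 r" if "r \<in> {u..v}" for r
    using G[OF that] by (auto simp: soliton_ode_def)
  have cont: "continuous_on {u..v} F" "continuous_on {u..v} F1" "continuous_on {u..v} G" "continuous_on {u..v} G1"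
    by (rule DERIV_continuous_on[OF has_field_derivative_at_within[OF Fd(1)]], assumption,
        rule DERIV_continuous_on[OF has_field_derivative_at_within[OF Fd(2)]], assumption,
        rule DERIV_continuous_on[OF has_field_derivative_at_within[OF Gd(1)]], assumption,
        rule DERIV_continuous_on[OF has_field_derivative_at_within[OF Gd(2)]], assumption)
  define e where "e H H1 r = B - lam * H r - 2 * \<kappa> * r * H1 r - real (n - 1) * ln (H1 r)" for H H1 and r :: real
  have ne: "{u..v} \<noteq> {}" using r by auto
  obtain m1 where m1: "m1 \<in> {u..v}" "\<And>r. r \<in> {u..v} \<Longrightarrow> F1 m1 \<le> F1 r"
    using continuous_attains_inf[OF compact_Icc ne cont(2)] by blast
  obtain m2 where m2: "m2 \<in> {u..v}" "\<And>r. r \<in> {u..v} \<Longrightarrow> G1 m2 \<le> G1 r"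
    using continuous_attains_inf[OF compact_Icc ne cont(4)] by blast
  define m where "m = min (F1 m1) (G1 m2)"
  have m: "m > 0" "\<And>r. r \<in> {u..v} \<Longrightarrow> m \<le> F1 r \<and> m \<le> G1 r"
    using m1(2) m2(2) Fd(3)[OF m1(1)] Gd(3)[OF m2(1)] by (fastforce simp: m_def min_le_iff_disj)+
  have conte: "continuous_on {u..v} (\<lambda>r. exp (e F F1 r))" "continuous_on {u..v} (\<lambda>r. exp (e G G1 r))"
  proof -
    have "F1 r \<noteq> 0" "G1 r \<noteq> 0" if "r \<in> {u..v}" for r using Fd(3)[OF that] Gd(3)[OF that] by auto
    then show "continuous_on {u..v} (\<lambda>r. exp (e F F1 r))" "continuous_on {u..v} (\<lambda>r. exp (e G G1 r))"
      unfolding e_def by (auto intro!: continuous_intros cont)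
  qed
  obtain M1 where M1: "\<And>r. r \<in> {u..v} \<Longrightarrow> exp (e F F1 r) \<le> M1"
    using continuous_attains_sup[OF compact_Icc ne conte(1)] by blast
  obtain M2 where M2: "\<And>r. r \<in> {u..v} \<Longrightarrow> exp (e G G1 r) \<le> M2"
    using continuous_attains_sup[OF compact_Icc ne conte(2)] by blast
  define M where "M = max M1 M2"
  have M: "\<And>r. r \<in> {u..v} \<Longrightarrow> exp (e F F1 r) \<le> M \<and> exp (e G G1 r) \<le> M"
    using M1 M2 by (auto simp: M_def le_max_iff_disj)
  have M0: "M \<ge> 0" using M[OF r] exp_gt_zero[of "e F F1 r"] by linarith
  \<comment> \<open>The bracket bounds the difference of the exponents, with \<open>1 / m\<close>
    from the logarithm; \<open>M\<close> bounds the slope of \<open>exp\<close>, the added 1 comes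
    from the term \<open>F1\<close> in \<open>F1 + r * F2\<close>, and the division by
    \<open>u\<close> from solving for \<open>F2\<close>.\<close>
  define L where "L = (M * (\<bar>lam\<bar> + 2 * \<bar>\<kappa>\<bar> * v + real (n - 1) / m) + 1) / u"
  have uv: "u \<le> v" using r by simp
  have L0: "L \<ge> 0" using M0 m u uv by (auto simp: L_def intro!: divide_nonneg_pos add_nonneg_nonneg mult_nonneg_nonneg)
  have lip: "\<bar>F2 r - G2 r\<bar> \<le> L * (\<bar>F r - G r\<bar> + \<bar>F1 r - G1 r\<bar>)" if r: "r \<in> {u..v}" for r
  proof -
    have r': "u \<le> r" "r \<le> v" "0 < r" using r u by auto
    define d where "d = \<bar>F r - G r\<bar> + \<bar>F1 r - G1 r\<bar>"
    have d: "\<bar>F r - G r\<bar> \<le> d" "\<bar>F1 r - G1 r\<bar> \<le> d" "0 \<le> d" by (auto simp: d_def)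
    have "e F F1 r - e G G1 r = - lam * (F r - G r) - 2 * \<kappa> * r * (F1 r - G1 r) - real (n - 1) * (ln (F1 r) - ln (G1 r))"
      by (simp add: e_def algebra_simps)
    also have "\<bar>\<dots>\<bar> \<le> \<bar>lam * (F r - G r)\<bar> + \<bar>2 * \<kappa> * r * (F1 r - G1 r)\<bar> + \<bar>real (n - 1) * (ln (F1 r) - ln (G1 r))\<bar>"
      by linarith
    also have "\<dots> \<le> \<bar>lam\<bar> * d + 2 * \<bar>\<kappa>\<bar> * v * d + real (n - 1) * (d / m)"
    proof (intro add_mono)
      show "\<bar>lam * (F r - G r)\<bar> \<le> \<bar>lam\<bar> * d" using d by (simp add: abs_mult mult_left_mono)
      show "\<bar>2 * \<kappa> * r * (F1 r - G1 r)\<bar> \<le> 2 * \<bar>\<kappa>\<bar> * v * d" using d r' by (auto simp: abs_mult intro!: mult_mono)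
      have "\<bar>ln (F1 r) - ln (G1 r)\<bar> \<le> \<bar>F1 r - G1 r\<bar> / m" using m r by (intro ln_diff_le_abs) auto
      also have "\<dots> \<le> d / m" using d m by (intro divide_right_mono) auto
      finally show "\<bar>real (n - 1) * (ln (F1 r) - ln (G1 r))\<bar> \<le> real (n - 1) * (d / m)"
        using mult_left_mono[of "\<bar>ln (F1 r) - ln (G1 r)\<bar>" "d / m" "real (n - 1)"] by (simp add: abs_mult)
    qed
    also have "\<dots> = (\<bar>lam\<bar> + 2 * \<bar>\<kappa>\<bar> * v + real (n - 1) / m) * d" by (simp add: algebra_simps)
    finally have ediff: "\<bar>e F F1 r - e G G1 r\<bar> \<le> (\<bar>lam\<bar> + 2 * \<bar>\<kappa>\<bar> * v + real (n - 1) / m) * d" .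
    have "\<bar>exp (e F F1 r) - exp (e G G1 r)\<bar> \<le> M * \<bar>e F F1 r - e G G1 r\<bar>"
      using M[OF r] by (intro exp_diff_le_abs) auto
    also have "\<dots> \<le> M * ((\<bar>lam\<bar> + 2 * \<bar>\<kappa>\<bar> * v + real (n - 1) / m) * d)"
      using M0 ediff by (rule mult_left_mono[rotated])
    finally have xd: "\<bar>exp (e F F1 r) - exp (e G G1 r)\<bar> \<le> M * ((\<bar>lam\<bar> + 2 * \<bar>\<kappa>\<bar> * v + real (n - 1) / m) * d)" .
    have "r * (F2 r - G2 r) = (exp (e F F1 r) - exp (e G G1 r)) - (F1 r - G1 r)"
      using soliton_ode_exp[OF F[OF r]] soliton_ode_exp[OF G[OF r]] by (simp add: e_def algebra_simps)
    moreover have "r * \<bar>F2 r - G2 r\<bar> = \<bar>r * (F2 r - G2 r)\<bar>" using r' by (simp add: abs_mult)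
    moreover have "\<bar>(exp (e F F1 r) - exp (e G G1 r)) - (F1 r - G1 r)\<bar>
        \<le> \<bar>exp (e F F1 r) - exp (e G G1 r)\<bar> + \<bar>F1 r - G1 r\<bar>"
      by (rule abs_triangle_ineq4)
    ultimately have "r * \<bar>F2 r - G2 r\<bar> \<le> M * ((\<bar>lam\<bar> + 2 * \<bar>\<kappa>\<bar> * v + real (n - 1) / m) * d) + d"
      using xd d(2) by linarith
    also have "\<dots> = (u * L) * d" using u unfolding L_def by (simp add: distrib_right mult.assoc)
    also have "\<dots> = u * (L * d)" by (rule mult.assoc)
    finally have "r * \<bar>F2 r - G2 r\<bar> \<le> u * (L * d)" .
    moreover have "u * \<bar>F2 r - G2 r\<bar> \<le> r * \<bar>F2 r - G2 r\<bar>" using r' by (intro mult_right_mono) auto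
    ultimately have "u * \<bar>F2 r - G2 r\<bar> \<le> u * (L * d)" by linarith
    then show ?thesis using u by (simp add: d_def)
  qed
  define w where "w r = (F r - G r)\<^sup>2 + (F1 r - G1 r)\<^sup>2" for r
  define w' where "w' r = 2 * (F r - G r) * (F1 r - G1 r) + 2 * (F1 r - G1 r) * (F2 r - G2 r)" for r
  have "w r = 0"
  proof (rule gronwall_zero[where w=w and r=r and M="1 + 3 * L" and w'=w' and u=u and v=v and ?r0.0=r0])
    fix r assume r: "r \<in> {u..v}"
    show "(w has_real_derivative w' r) (at r)"
      unfolding w_def w'_def by (auto intro!: derivative_eq_intros Fd[OF r] Gd[OF r] simp: algebra_simps)
    show "0 \<le> w r" by (simp add: w_def)
    define a b where "a = \<bar>F r - G r\<bar>" and "b = \<bar>F1 r - G1 r\<bar>"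
    have ab: "0 \<le> a" "0 \<le> b" "2 * a * b \<le> a\<^sup>2 + b\<^sup>2" using sum_squares_bound[of a b] by (auto simp: a_def b_def)
    have "\<bar>w' r\<bar> \<le> 2 * a * b + 2 * b * \<bar>F2 r - G2 r\<bar>"
      unfolding w'_def a_def b_def by (rule order_trans[OF abs_triangle_ineq]) (simp only: abs_mult abs_numeral order_refl)
    also have "\<dots> \<le> 2 * a * b + 2 * b * (L * (a + b))"
      using lip[OF r] ab by (intro add_left_mono mult_left_mono) (auto simp: a_def b_def)
    also have "\<dots> = 2 * a * b + L * (2 * a * b) + 2 * L * b\<^sup>2" by (simp add: algebra_simps power2_eq_square)
    also have "\<dots> \<le> (a\<^sup>2 + b\<^sup>2) + L * (a\<^sup>2 + b\<^sup>2) + 2 * L * (a\<^sup>2 + b\<^sup>2)"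
      using ab L0 by (intro add_mono mult_left_mono) auto
    also have "\<dots> = (1 + 3 * L) * w r" by (simp add: w_def a_def b_def algebra_simps)
    finally show "\<bar>w' r\<bar> \<le> (1 + 3 * L) * w r" .
  qed (use r0 r in \<open>auto simp: w_def\<close>)
  then show ?thesis by (simp add: w_def sum_power2_eq_zero_iff)
qed

section \<open>Analytic solutions of the equation\<close>

inductive ln_class :: "(nat \<Rightarrow> real) \<Rightarrow> (real \<Rightarrow> real) \<Rightarrow> bool" for a where
  const: "ln_class a (\<lambda>x. c)"
| series: "ln_class a (ps a i)"
| inv: "ln_class a (\<lambda>x. inverse (ps a 0 x))"
| ln: "ln_class a (\<lambda>x. ln (ps a 0 x))"
| add: "ln_class a u \<Longrightarrow> ln_class a v \<Longrightarrow> ln_class a (\<lambda>x. u x + v x)"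
| mult: "ln_class a u \<Longrightarrow> ln_class a v \<Longrightarrow> ln_class a (\<lambda>x. u x * v x)"

context nonneg_series
begin

lemma ln_class_derivative:
  assumes "ln_class a u" and J: "\<And>x. x \<in> J \<Longrightarrow> \<bar>x\<bar> < r1 \<and> 0 < ps a 0 x"
  shows "\<exists>d. ln_class a d \<and> (\<forall>x\<in>J. (u has_real_derivative d x) (at x))"
  using assms(1)
proof induction
  case (const c)
  show ?case by (rule exI[of _ "\<lambda>x. 0"]) (auto intro: ln_class.const)
next
  case (series i)
  show ?case by (rule exI[of _ "ps a (Suc i)"]) (use J in \<open>auto intro!: ln_class.series ps_deriv\<close>)
next
  case inv
  have "ln_class a (\<lambda>x. (-1) * (ps a (Suc 0) x * (inverse (ps a 0 x) * inverse (ps a 0 x))))"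
    by (intro ln_class.intros)
  moreover have "((\<lambda>x. inverse (ps a 0 x)) has_real_derivative (-1) * (ps a (Suc 0) x * (inverse (ps a 0 x) * inverse (ps a 0 x)))) (at x)"
    if "x \<in> J" for x
    using DERIV_inverse_fun[OF ps_deriv[of x 0]] J[OF that] by (simp add: mult_ac)
  ultimately show ?case by blast
next
  case ln
  have "ln_class a (\<lambda>x. ps a (Suc 0) x * inverse (ps a 0 x))"
    by (intro ln_class.intros)
  moreover have "((\<lambda>x. ln (ps a 0 x)) has_real_derivative ps a (Suc 0) x * inverse (ps a 0 x)) (at x)"
    if "x \<in> J" for x
    using DERIV_chain2[OF DERIV_ln ps_deriv[of x 0]] J[OF that] by (simp add: mult_ac)
  ultimately show ?case by blast
next
  case (add u v)
  then obtain d d' where "ln_class a d" "\<forall>x\<in>J. (u has_real_derivative d x) (at x)"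
    "ln_class a d'" "\<forall>x\<in>J. (v has_real_derivative d' x) (at x)" by blast
  then show ?case
    by (intro exI[of _ "\<lambda>x. d x + d' x"]) (auto intro: ln_class.add DERIV_add)
next
  case (mult u v)
  then obtain d d' where *: "ln_class a d" "\<forall>x\<in>J. (u has_real_derivative d x) (at x)"
    "ln_class a d'" "\<forall>x\<in>J. (v has_real_derivative d' x) (at x)" by blast
  have "ln_class a (\<lambda>x. d x * v x + d' x * u x)"
    using * mult.hyps by (intro ln_class.add ln_class.mult)
  then show ?case
    using * by (intro exI[of _ "\<lambda>x. d x * v x + d' x * u x"]) (auto intro: DERIV_mult)
qed

lemma ln_class_smooth:
  assumes "ln_class a u" "open J" and J: "\<And>x. x \<in> J \<Longrightarrow> \<bar>x\<bar> < r1 \<and> 0 < ps a 0 x"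
  shows "smooth_on J u"
proof (rule smooth_on_closed_class[OF assms(2), where K="Collect (ln_class a)"])
  show "u \<in> Collect (ln_class a)" using assms by simp
  fix w assume "w \<in> Collect (ln_class a)"
  then obtain d where d: "ln_class a d" "\<forall>x\<in>J. (w has_real_derivative d x) (at x)"
    using ln_class_derivative[OF _ J] by blast
  have "ln_class a (\<lambda>x. d x * h)" for h by (rule ln_class.mult[OF d(1) ln_class.const])
  then show "\<exists>D. (\<forall>x\<in>J. (w has_derivative D x) (at x)) \<and>
      (\<forall>h. \<exists>w\<in>Collect (ln_class a). \<forall>x\<in>J. D x h = w x)"
    using d(2) unfolding has_field_derivative_def
    by (intro exI[of _ "\<lambda>x. (*) (d x)"]) auto
qed

text \<open>The differential equation, cleared of denominators, is an identity between power series, so it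
  holds on the whole disc of convergence.\<close>

lemma series_soliton_ode:
  fixes f :: "real \<Rightarrow> real"
  assumes a0: "a 0 > 0" and c: "c > 0" and n: "n \<ge> 2" and uv: "0 < u" "u < v" "v < r1"
    and fa: "\<And>r. u < r \<Longrightarrow> r < v \<Longrightarrow> ps a 0 r = exp (c * f r)"
    and ode: "\<And>r. u < r \<Longrightarrow> r < v \<Longrightarrow> soliton_ode n lam \<kappa> B f f1 f2 r"
  obtains h h1 h2 \<delta> where "\<delta> > 0" "smooth_on {-\<delta><..<r1} h" "\<And>r. u < r \<Longrightarrow> r < v \<Longrightarrow> h r = f r"
    "\<And>r. -\<delta> < r \<Longrightarrow> r < r1 \<Longrightarrow> (h has_real_derivative h1 r) (at r) \<and> (h1 has_real_derivative h2 r) (at r)"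
    "\<And>r. 0 \<le> r \<Longrightarrow> r < r1 \<Longrightarrow> 0 < h1 r \<and> 0 < h1 r + r * h2 r"
    "\<And>r. 0 < r \<Longrightarrow> r < r1 \<Longrightarrow> soliton_ode n lam \<kappa> B h h1 h2 r"
proof -
  define S where "S i = (ps a i :: real \<Rightarrow> real)" for i
  have "isCont (S 0) 0" unfolding S_def using ps_deriv[of "0::real" 0] r1 by (intro DERIV_isCont) auto
  then have "\<forall>\<^sub>F r in at 0. 0 < S 0 r"
    using a0 ps_0 by (auto simp: isCont_def S_def intro: order_tendstoD(1))
  then obtain d where d: "d > 0" "\<And>r. r \<noteq> 0 \<Longrightarrow> \<bar>r\<bar> < d \<Longrightarrow> 0 < S 0 r"
    unfolding eventually_at by (auto simp: dist_real_def)
  \<comment> \<open>To the left of \<open>0\<close> the coefficients give no sign, so positivity of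
    the series is taken from continuity at \<open>0\<close>.\<close>
  define \<delta> where "\<delta> = min d r1"
  have \<delta>: "\<delta> > 0" using d r1 by (simp add: \<delta>_def)
  define J where "J = {-\<delta><..<r1}"
  have J: "\<bar>r\<bar> < r1 \<and> 0 < S 0 r" if "r \<in> J" for r
  proof (cases "r \<ge> 0")
    case True
    then show ?thesis using that ps_pos[OF a0, of r] by (auto simp: J_def S_def)
  next
    case False
    then show ?thesis using that d(2)[of r] by (auto simp: J_def \<delta>_def)
  qed
  have uJ: "r \<in> J" if "u < r" "r < v" for r using that uv \<delta> by (auto simp: J_def)
  have opJ: "open J" by (simp add: J_def)
  have dS: "(S i has_real_derivative S (Suc i) r) (at r)" if "r \<in> J" for i r
    unfolding S_def using J[OF that] by (intro ps_deriv) auto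
  define h where "h r = inverse c * ln (S 0 r)" for r
  define h1 where "h1 r = S 1 r / (c * S 0 r)" for r
  define P2 where "P2 r = S 2 r * S 0 r - (S 1 r)\<^sup>2" for r
  define P3 where "P3 r = S 3 r * (S 0 r)\<^sup>2 - 3 * S 1 r * S 2 r * S 0 r + 2 * (S 1 r)^3" for r
  define h2 where "h2 r = P2 r / (c * (S 0 r)\<^sup>2)" for r
  define h3 where "h3 r = P3 r / (c * (S 0 r)^3)" for r
  have smh: "smooth_on J h"
    unfolding h_def[abs_def] S_def
    by (rule ln_class_smooth[OF ln_class.mult[OF ln_class.const ln_class.ln] opJ]) (use J in \<open>auto simp: S_def\<close>)
  have dh: "(h has_real_derivative h1 r) (at r)" if "r \<in> J" for r
    unfolding h_def h1_def using J[OF that] c dS[OF that, of 0]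
    by (auto intro!: derivative_eq_intros simp: field_simps)
  have S2: "(S 1 has_real_derivative S 2 r) (at r)" "(S 2 has_real_derivative S 3 r) (at r)" if "r \<in> J" for r
    using dS[OF that, of 1] dS[OF that, of 2] by (simp_all add: numeral_2_eq_2 numeral_3_eq_3)
  have S0': "(S 0 has_real_derivative S 1 r) (at r)" if "r \<in> J" for r using dS[OF that, of 0] by simp
  have dh1: "(h1 has_real_derivative h2 r) (at r)" if "r \<in> J" for r
  proof -
    have "(h1 has_real_derivative (S 2 r * (c * S 0 r) - S 1 r * (c * S 1 r)) / ((c * S 0 r) * (c * S 0 r))) (at r)"
      unfolding h1_def using J[OF that] c by (intro DERIV_divide DERIV_cmult S0' S2 that) auto
    then show ?thesis
      by (rule DERIV_cong) (use J[OF that] c in \<open>simp add: h2_def P2_def field_simps power2_eq_square\<close>)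
  qed
  have dP2: "(P2 has_real_derivative S 3 r * S 0 r - S 1 r * S 2 r) (at r)" if "r \<in> J" for r
  proof -
    have "(P2 has_real_derivative (S 3 r * S 0 r + S 1 r * S 2 r) - of_nat 2 * (S 2 r * S 1 r ^ (2 - Suc 0))) (at r)"
      unfolding P2_def[abs_def] by (intro DERIV_diff DERIV_mult DERIV_power S0' S2 that)
    then show ?thesis by (rule DERIV_cong) (simp add: algebra_simps)
  qed
  have dh2: "(h2 has_real_derivative h3 r) (at r)" if "r \<in> J" for r
  proof -
    have dd: "((\<lambda>r. c * (S 0 r)\<^sup>2) has_real_derivative c * (2 * S 0 r * S 1 r)) (at r)"
      by (auto intro!: derivative_eq_intros S0' that)
    have "(h2 has_real_derivative ((S 3 r * S 0 r - S 1 r * S 2 r) * (c * (S 0 r)\<^sup>2) - P2 r * (c * (2 * S 0 r * S 1 r)))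
        / ((c * (S 0 r)\<^sup>2) * (c * (S 0 r)\<^sup>2))) (at r)"
      unfolding h2_def using J[OF that] c by (intro DERIV_divide dd dP2 that) auto
    then show ?thesis
    proof (rule DERIV_cong)
      have s: "S 0 r \<noteq> 0" using J[OF that] by simp
      show "((S 3 r * S 0 r - S 1 r * S 2 r) * (c * (S 0 r)\<^sup>2) - P2 r * (c * (2 * S 0 r * S 1 r)))
        / ((c * (S 0 r)\<^sup>2) * (c * (S 0 r)\<^sup>2)) = h3 r"
        using s c by (simp add: h3_def P2_def P3_def divide_simps) (simp add: algebra_simps power2_eq_square power3_eq_cube)
    qed
  qed
  \<comment> \<open>The exponential of the left-hand side of the equation, which makes sense
    wherever \<open>h\<close> is defined. Its derivative splits into a factor containing
    \<open>exp\<close> and the factor \<open>Res\<close>, which is rational in the series and so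
    becomes accessible to the identity theorem.\<close>
  define T where "T r = h1 r ^ (n - 1) * (h1 r + r * h2 r) * exp (lam * h r + 2 * \<kappa> * (r * h1 r))" for r
  define Res where "Res r = real (n - 1) * h2 r * (h1 r + r * h2 r) + h1 r * (2 * h2 r + r * h3 r)
      + h1 r * (h1 r + r * h2 r) * (lam * h1 r + 2 * \<kappa> * (h1 r + r * h2 r))" for r
  obtain n' where n': "n = Suc (Suc n')" using n by (metis Suc_diff_Suc add_2_eq_Suc le_Suc_ex)
  have dT: "(T has_real_derivative h1 r ^ n' * exp (lam * h r + 2 * \<kappa> * (r * h1 r)) * Res r) (at r)" if r: "r \<in> J" for r
  proof -
    have 1: "((\<lambda>r. h1 r ^ (n - 1)) has_real_derivative real (Suc n') * (h2 r * h1 r ^ n')) (at r)"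
      using DERIV_power[OF dh1[OF r], of "n - 1"] by (simp add: n' del: power_Suc of_nat_Suc)
    have 2: "((\<lambda>r. h1 r + r * h2 r) has_real_derivative 2 * h2 r + r * h3 r) (at r)"
      by (auto intro!: derivative_eq_intros dh1 dh2 r)
    have 3: "((\<lambda>r. exp (lam * h r + 2 * \<kappa> * (r * h1 r))) has_real_derivative
        exp (lam * h r + 2 * \<kappa> * (r * h1 r)) * (lam * h1 r + 2 * \<kappa> * (h1 r + r * h2 r))) (at r)"
      by (auto intro!: derivative_eq_intros dh dh1 r simp: algebra_simps)
    show ?thesis
      unfolding T_def[abs_def]
      by (rule DERIV_cong[OF DERIV_mult[OF DERIV_mult[OF 1 2] 3]]) (simp add: Res_def n' algebra_simps)
  qed
  have hf: "h r = f r" if "u < r" "r < v" for r using fa[OF that] c by (simp add: h_def S_def)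
  have hode: "soliton_ode n lam \<kappa> B h h1 h2 r" if r: "u < r" "r < v" for r
  proof -
    have 0: "h1 t = f1 t" if t: "u < t" "t < v" for t
    proof -
      have "(f has_real_derivative h1 t) (at t)"
        by (rule has_field_derivative_transform_within_open[OF dh[OF uJ[OF t]], of "{u<..<v}"]) (use t hf in auto)
      then show ?thesis using ode[OF t] DERIV_unique unfolding soliton_ode_def by blast
    qed
    have 1: "h2 r = f2 r"
    proof -
      have "(f1 has_real_derivative h2 r) (at r)"
        by (rule has_field_derivative_transform_within_open[OF dh1[OF uJ[OF r]], of "{u<..<v}"]) (use r 0 in auto)
      then show ?thesis using ode[OF r] DERIV_unique unfolding soliton_ode_def by blast
    qed
    show ?thesis using ode[OF r] dh[OF uJ[OF r]] dh1[OF uJ[OF r]] 0[OF r] 1 hf[OF r] by (simp add: soliton_ode_def)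
  qed
  have TB: "T r = exp B" if r: "u < r" "r < v" for r
  proof -
    have "ln (h1 r ^ (n - 1) * (h1 r + r * h2 r)) = B - (lam * h r + 2 * \<kappa> * (r * h1 r))"
      "0 < h1 r ^ (n - 1) * (h1 r + r * h2 r)"
      using hode[OF r] by (auto simp: soliton_ode_def)
    then have "h1 r ^ (n - 1) * (h1 r + r * h2 r) = exp (B - (lam * h r + 2 * \<kappa> * (r * h1 r)))"
      by (metis exp_ln)
    then show ?thesis by (simp add: T_def flip: exp_add)
  qed
  \<comment> \<open>This is \<open>Res\<close> times \<open>c^3 * (S 0 r)^5\<close>, which clears
    all denominators, as a polynomial in the series; it is written over the complex numbers for the
    identity theorem and, as \<open>Y\<close>, over the reals.\<close>
  define Z where "Z x0 x1 x2 x3 r = (let p2 = x2 * x0 - x1\<^sup>2; p3 = x3 * x0\<^sup>2 - 3 * x1 * x2 * x0 + 2 * x1^3; q = x1 * x0 + r * p2 in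
     of_real (c * real (n - 1)) * p2 * q * x0 + of_real c * (2 * p2 * x0 + r * p3) * x1 * x0 + of_real lam * x1\<^sup>2 * q * x0
      + of_real (2 * \<kappa>) * x1 * q\<^sup>2)" for x0 x1 x2 x3 r :: "complex"
  define Y where "Y x0 x1 x2 x3 r = (let p2 = x2 * x0 - x1\<^sup>2; p3 = x3 * x0\<^sup>2 - 3 * x1 * x2 * x0 + 2 * x1^3; q = x1 * x0 + r * p2 in
     (c * real (n - 1)) * p2 * q * x0 + c * (2 * p2 * x0 + r * p3) * x1 * x0 + lam * x1\<^sup>2 * q * x0
      + (2 * \<kappa>) * x1 * q\<^sup>2)" for x0 x1 x2 x3 r :: "real"
  have YZ: "Z (of_real x0) (of_real x1) (of_real x2) (of_real x3) (of_real r) = of_real (Y x0 x1 x2 x3 r)" for x0 x1 x2 x3 r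
    by (simp add: Y_def Z_def Let_def)
  have YRes: "Y (S 0 r) (S 1 r) (S 2 r) (S 3 r) r = c^3 * (S 0 r)^5 * Res r" if "r \<in> J" for r
  proof -
    have s: "S 0 r \<noteq> 0" using J[OF that] by simp
    define q where "q = S 1 r * S 0 r + r * P2 r"
    have hq: "h1 r + r * h2 r = q / (c * (S 0 r)\<^sup>2)"
      using s c by (simp add: h1_def h2_def q_def field_simps power2_eq_square)
    have 1: "c^3 * (S 0 r)^5 * (real (n - 1) * h2 r * (h1 r + r * h2 r)) = (c * real (n - 1)) * P2 r * q * S 0 r"
      unfolding hq unfolding h2_def using s c by (simp add: field_simps eval_nat_numeral)
    have 2: "c^3 * (S 0 r)^5 * (h1 r * (2 * h2 r + r * h3 r)) = c * (2 * P2 r * S 0 r + r * P3 r) * S 1 r * S 0 r"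
      unfolding h1_def h2_def h3_def using s c by (simp add: field_simps eval_nat_numeral)
    have 3: "c^3 * (S 0 r)^5 * (h1 r * (h1 r + r * h2 r) * (lam * h1 r)) = lam * (S 1 r)\<^sup>2 * q * S 0 r"
      unfolding hq unfolding h1_def using s c by (simp add: field_simps eval_nat_numeral)
    have 4: "c^3 * (S 0 r)^5 * (h1 r * (h1 r + r * h2 r) * (2 * \<kappa> * (h1 r + r * h2 r))) = (2 * \<kappa>) * S 1 r * q\<^sup>2"
      unfolding hq unfolding h1_def using s c by (simp add: field_simps eval_nat_numeral)
    have "c^3 * (S 0 r)^5 * Res r = c^3 * (S 0 r)^5 * (real (n - 1) * h2 r * (h1 r + r * h2 r))
       + c^3 * (S 0 r)^5 * (h1 r * (2 * h2 r + r * h3 r))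
       + c^3 * (S 0 r)^5 * (h1 r * (h1 r + r * h2 r) * (lam * h1 r))
       + c^3 * (S 0 r)^5 * (h1 r * (h1 r + r * h2 r) * (2 * \<kappa> * (h1 r + r * h2 r)))"
      unfolding Res_def by (simp only: distrib_left distrib_right add.assoc)
    then show ?thesis unfolding 1 2 3 4 by (simp add: Y_def Let_def q_def P2_def P3_def)
  qed
  have Y0: "Y (S 0 r) (S 1 r) (S 2 r) (S 3 r) r = 0" if r: "u < r" "r < v" for r
  proof -
    have "(T has_real_derivative 0) (at r)"
      by (rule has_field_derivative_transform_within_open[of "\<lambda>_. exp B" _ _ "{u<..<v}"]) (use r TB in auto)
    then have "h1 r ^ n' * exp (lam * h r + 2 * \<kappa> * (r * h1 r)) * Res r = 0"
      using DERIV_unique[OF dT[OF uJ[OF r]]] by blast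
    moreover have "0 < h1 r" using hode[OF r] by (simp add: soliton_ode_def)
    ultimately have "Res r = 0" by simp
    then show ?thesis using YRes[OF uJ[OF r]] by simp
  qed
  define W where "W z = Z (ps a 0 z) (ps a 1 z) (ps a 2 z) (ps a 3 z) z" for z
  have WY: "W (of_real r) = of_real (Y (S 0 r) (S 1 r) (S 2 r) (S 3 r) r)" if "\<bar>r\<bar> < r1" for r
    unfolding W_def ps_of_real[OF that] S_def YZ ..
  have holW: "W holomorphic_on ball 0 r1"
    unfolding W_def[abs_def] Z_def Let_def by (intro holomorphic_intros ps_holomorphic)
  have W0: "W z = 0" if "z \<in> ball 0 r1" for z
  proof (rule analytic_continuation[OF holW open_ball connected_ball _ _ islimpt_real_interval[OF uv(2)] _ that])
    show "complex_of_real ` {u<..<v} \<subseteq> ball 0 r1" using uv by auto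
    show "complex_of_real ((u + v) / 2) \<in> ball 0 r1" using uv by (auto simp del: of_real_divide of_real_add)
    show "W x = 0" if "x \<in> complex_of_real ` {u<..<v}" for x
      using that WY Y0 uv by auto
  qed
  have Res0: "Res r = 0" if "r \<in> J" for r
  proof -
    have "of_real (Y (S 0 r) (S 1 r) (S 2 r) (S 3 r) r) = (0::complex)"
      using W0[of "of_real r"] WY[of r] J[OF that] by simp
    then have "Y (S 0 r) (S 1 r) (S 2 r) (S 3 r) r = 0" by (simp only: of_real_eq_0_iff)
    then show ?thesis using YRes[OF that] J[OF that] c by simp
  qed
  have "\<exists>k. \<forall>r\<in>J. T r = k"
  proof (rule has_field_derivative_zero_constant)
    show "convex J" by (simp add: J_def)
    show "(T has_real_derivative 0) (at r within J)" if "r \<in> J" for r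
      using has_field_derivative_at_within[OF dT[OF that]] by (simp add: Res0[OF that])
  qed
  then obtain k where k: "\<And>r. r \<in> J \<Longrightarrow> T r = k" by blast
  have m: "u < (u + v) / 2" "(u + v) / 2 < v" using uv by auto
  have "k = exp B" using k[OF uJ[OF m]] TB[OF m] by simp
  with k have T: "T r = exp B" if "r \<in> J" for r using that by simp
  \<comment> \<open>\<open>T\<close> is a non-zero constant and contains \<open>h1\<close> as a
    factor because \<open>n \<ge> 2\<close>. So \<open>h1\<close>, non-negative by the signs of the
    coefficients, cannot vanish; this includes \<open>r = 0\<close>.\<close>
  have pos: "0 < h1 r \<and> 0 < h1 r + r * h2 r" if r: "0 \<le> r" "r < r1" for r
  proof -
    have rJ: "r \<in> J" using r \<delta> by (simp add: J_def)
    have Tp: "0 < T r" using T[OF rJ] by simp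
    have "0 \<le> h1 r" using ps_nonneg[OF r, of 1] J[OF rJ] c by (simp add: h1_def S_def)
    moreover have "h1 r \<noteq> 0" using Tp n by (auto simp: T_def power_0_left)
    ultimately have "0 < h1 r" by simp
    moreover have "0 < h1 r + r * h2 r" using Tp \<open>0 < h1 r\<close> by (simp add: T_def zero_less_mult_iff)
    ultimately show ?thesis by simp
  qed
  have "soliton_ode n lam \<kappa> B h h1 h2 r" if r: "0 < r" "r < r1" for r
  proof -
    have rJ: "r \<in> J" using r \<delta> by (simp add: J_def)
    have p: "0 < h1 r" "0 < h1 r + r * h2 r" using pos r by auto
    have "ln (T r) = ln (h1 r ^ (n - 1) * (h1 r + r * h2 r)) + (lam * h r + 2 * \<kappa> * (r * h1 r))"
      unfolding T_def using p by (subst ln_mult_pos) (auto intro: mult_pos_pos)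
    then have "ln (h1 r ^ (n - 1) * (h1 r + r * h2 r)) + lam * h r + 2 * \<kappa> * r * h1 r = B"
      by (simp add: T[OF rJ] mult.assoc)
    then show ?thesis using p dh[OF rJ] dh1[OF rJ] by (simp add: soliton_ode_def)
  qed
  then show ?thesis
    using that[OF \<delta>, of h h1 h2] smh hf dh dh1 pos by (simp add: J_def)
qed

end

section \<open>Stability and continuation to the origin\<close>

lemma stable_radial_power_series:
  fixes A :: "('m::{t2_space,second_countable_topology}, 'n::finite) chart set"
  assumes A: "complex_manifold A" and UA: "(U, z) \<in> A" and g: "is_form11 A g"
    and rad: "\<And>x. x \<in> z ` U \<Longrightarrow> g (U, z) x = radial_form f x \<and> (norm x)\<^sup>2 \<in> I"
    and I: "open I" "I \<subseteq> {0<..}" "smooth_on I f" and c: "c > 0"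
    and stab: "c_stable_projectively_induced A c g"
    and p: "p \<in> U" and e: "\<And>x. x \<in> z ` U \<Longrightarrow> \<exists>e :: complex^'n. norm e = 1 \<and> herm e x = 0"
  obtains a r1 \<delta> where "nonneg_series a r1" "a 0 > 0" "(norm (z p))\<^sup>2 < r1" "\<delta> > 0"
    "\<And>r. \<bar>r - (norm (z p))\<^sup>2\<bar> < \<delta> \<Longrightarrow> r \<in> I \<and> ps a 0 r = exp (c * f r)"
proof -
  define r0 where "r0 = (norm (z p))\<^sup>2"
  have r0I: "r0 \<in> I" and r0: "r0 > 0" using rad[of "z p"] p I(2) by (auto simp: r0_def)
  have series: thesis' if H: "induced_by_CP_infinity A c (\<lambda>C x. \<alpha> *\<^sub>R g C x)"
    and K: "\<And>a r1 \<delta> m. nonneg_series a r1 \<Longrightarrow> r0 < r1 \<Longrightarrow> \<delta> > 0 \<Longrightarrow>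
      (\<And>r. \<bar>r - r0\<bar> < \<delta> \<Longrightarrow> r \<in> I \<and> ps a 0 r = exp (c * \<alpha> * f r)) \<Longrightarrow>
      (\<And>k. k < m \<Longrightarrow> a k = 0) \<Longrightarrow> a m > 0 \<Longrightarrow> thesis'" for \<alpha> thesis'
  proof -
    obtain a r1 \<delta> where a: "\<And>k. 0 \<le> a k" "(norm (z p))\<^sup>2 < r1" "\<delta> > 0"
      "\<And>r. 0 < r \<Longrightarrow> r < r1 \<Longrightarrow> summable (\<lambda>k. a k * r ^ k)"
      "\<And>r. \<bar>r - (norm (z p))\<^sup>2\<bar> < \<delta> \<Longrightarrow> r \<in> I \<and> (\<Sum>k. a k * r ^ k) = exp (c * \<alpha> * f r)"
      by (rule induced_power_series[OF A UA g _ I(1) I(2) I(3) c H p])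
         (erule rad, erule e, blast)
    note a = a[folded r0_def]
    have "\<exists>k. a k > 0"
    proof (rule ccontr)
      assume "\<not> ?thesis"
      then have "a k = 0" for k using a(1)[of k] by (metis order_le_less)
      then show False using a(5)[of r0] a(3) by simp
    qed
    then have L: "a (LEAST k. a k > 0) > 0" by (rule LeastI_ex)
    have L': "a k = 0" if "k < (LEAST k. a k > 0)" for k
      using not_less_Least[OF that] a(1)[of k] by simp
    have "nonneg_series a r1" using a(1,2,4) r0 by unfold_locales auto
    then show thesis'
    proof (rule K[where ?r1.0=r1 and m="LEAST k. a k > 0", OF _ a(2,3)])
      show "r \<in> I \<and> ps a 0 r = exp (c * \<alpha> * f r)" if "\<bar>r - r0\<bar> < \<delta>" for r
        using a(5)[OF that] by (simp add: ps_def)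
      show "0 < a (LEAST k. 0 < a k)" by (rule L)
      show "a k = 0" if "k < (LEAST k. 0 < a k)" for k by (rule L'[OF that])
    qed
  qed
  obtain \<epsilon> where \<epsilon>: "\<epsilon> > 0"
    and ind: "\<And>\<alpha>. \<alpha> \<in> {1 - \<epsilon><..<1 + \<epsilon>} \<Longrightarrow> induced_by_CP_infinity A c (\<lambda>C x. \<alpha> *\<^sub>R g C x)"
    using stab unfolding c_stable_projectively_induced_def by blast
  obtain a r1 \<delta> m where a: "nonneg_series a r1" "r0 < r1" "\<delta> > 0"
    "\<And>r. \<bar>r - r0\<bar> < \<delta> \<Longrightarrow> r \<in> I \<and> ps a 0 r = exp (c * 1 * f r)"
    "\<And>k. k < m \<Longrightarrow> a k = 0" "a m > 0"
    by (rule series[OF ind[of 1]]) (use \<epsilon> in auto)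
  \<comment> \<open>Small enough for stability and for \<open>\<eta> * m < 1\<close>. Then
    \<open>l - m = \<eta> * m\<close> is an integer in \<open>[0, 1)\<close>, hence
    \<open>0\<close>, which forces \<open>m = 0\<close>.\<close>
  define \<eta> where "\<eta> = min (\<epsilon> / 2) (1 / (2 * (real m + 1)))"
  have \<eta>: "0 < \<eta>" "\<eta> < \<epsilon>" "\<eta> * (real m + 1) \<le> 1 / 2"
  proof -
    show "0 < \<eta>" "\<eta> < \<epsilon>" using \<epsilon> by (auto simp: \<eta>_def)
    have "\<eta> * (real m + 1) \<le> 1 / (2 * (real m + 1)) * (real m + 1)"
      by (intro mult_right_mono) (auto simp: \<eta>_def)
    also have "\<dots> = 1 / 2" using of_nat_0_le_iff[of m, where 'a=real] by (simp add: divide_simps)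
    finally show "\<eta> * (real m + 1) \<le> 1 / 2" .
  qed
  obtain b r2 \<delta>2 l where b: "nonneg_series b r2" "r0 < r2" "\<delta>2 > 0"
    "\<And>r. \<bar>r - r0\<bar> < \<delta>2 \<Longrightarrow> r \<in> I \<and> ps b 0 r = exp (c * (1 + \<eta>) * f r)"
    "\<And>k. k < l \<Longrightarrow> b k = 0" "b l > 0"
    by (rule series[OF ind[of "1 + \<eta>"]]) (use \<epsilon> \<eta> in auto)
  define D where "D = min (min \<delta> \<delta>2) (min (r1 - r0) (r2 - r0))"
  have D: "D > 0" "D \<le> \<delta>" "D \<le> \<delta>2" "D \<le> r1 - r0" "D \<le> r2 - r0" using a(2,3) b(2,3) by (auto simp: D_def)
  have "real l = (1 + \<eta>) * real m"
  proof (rule leading_exponent_ratio[OF a(1) b(1), of r0 "r0 + D / 2"])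
    show "0 < r0" "r0 < r0 + D / 2" "r0 + D / 2 < r1" "r0 + D / 2 < r2" using r0 D by auto
    fix r assume "r0 < r" "r < r0 + D / 2"
    then have "\<bar>r - r0\<bar> < \<delta>" "\<bar>r - r0\<bar> < \<delta>2" using D by auto
    then show "ps b 0 r = ps a 0 r powr (1 + \<eta>) \<and> 0 < ps a 0 r"
      using a(4)[of r] b(4)[of r] by (simp add: powr_def mult_ac)
  qed (use a(5,6) b(5,6) in auto)
  then have lm: "real l - real m = \<eta> * real m" by (simp add: algebra_simps)
  have "0 \<le> \<eta> * real m" "\<eta> * real m < 1" using \<eta> by (auto simp: algebra_simps)
  with lm have "l = m" by linarith
  with lm \<eta>(1) have "m = 0" by simp
  then show thesis using that[of a r1 \<delta>] a by (simp add: r0_def)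
qed

lemma derivatives_eq_on_open:
  fixes F h h1 h2 :: "real \<Rightarrow> real"
  assumes J: "open J" and eq: "\<And>r. r \<in> J \<Longrightarrow> F r = h r"
    and h: "\<And>r. r \<in> J \<Longrightarrow> (h has_real_derivative h1 r) (at r)" "\<And>r. r \<in> J \<Longrightarrow> (h1 has_real_derivative h2 r) (at r)"
    and r: "r \<in> J"
  shows "deriv F r = h1 r" "deriv (deriv F) r = h2 r"
proof -
  have 1: "deriv F r = h1 r" if "r \<in> J" for r
    by (rule DERIV_imp_deriv, rule has_field_derivative_transform_within_open[OF h(1)[OF that] J that])
       (simp add: eq)
  show "deriv F r = h1 r" by (rule 1[OF r])
  show "deriv (deriv F) r = h2 r"
    by (rule DERIV_imp_deriv, rule has_field_derivative_transform_within_open[OF h(2)[OF r] J r]) (simp add: 1)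
qed

lemma einterval_pos: "0 \<le> a \<Longrightarrow> einterval a b \<subseteq> {0<..}"
  by (auto simp: einterval_def dest: order_le_less_trans[of 0 a])

lemma is_interval_einterval: "is_interval (einterval a b)"
  unfolding is_interval_1 einterval_def
  by auto (meson ereal_less_eq(3) order_le_less_trans order_less_le_trans)+

lemma radial_soliton_extends:
  fixes lam :: real
  assumes n: "CARD('n::finite) \<ge> 2" and max: "maximal_krs_potential TYPE('n) lam f rinf rsup"
    and ns: "nonneg_series a r1" and a0: "a 0 > 0" and c: "c > 0" and r0: "r0 < r1" and \<delta>: "\<delta> > 0"
    and ser: "\<And>r. \<bar>r - r0\<bar> < \<delta> \<Longrightarrow> r \<in> einterval rinf rsup \<and> ps a 0 r = exp (c * f r)"
  obtains F d where "rinf = 0" "d > 0" "smooth_on (einterval (ereal (-d)) rsup) F"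
    "\<And>r. r \<in> einterval rinf rsup \<Longrightarrow> F r = f r"
    "\<And>r. r \<in> einterval (ereal (-d)) rsup \<Longrightarrow> 0 \<le> r \<Longrightarrow> 0 < deriv F r \<and> 0 < deriv F r + r * deriv (deriv F) r"
proof -
  interpret nonneg_series a r1 by (rule ns)
  define I where "I = einterval rinf rsup"
  define n where "n = CARD('n)"
  have "krs_potential TYPE('n) lam f rinf rsup" using max by (simp add: maximal_krs_potential_def)
  then obtain V :: "complex^'n \<Rightarrow> complex^'n" where rinf: "0 \<le> rinf" and sm: "smooth_on I f"
    and V: "krs_on (shell rinf rsup) (radial_form f) V lam"
    by (auto simp: krs_potential_def I_def)
  have rsup: "0 < rsup" using ser[of r0] \<delta> rinf by (auto simp: einterval_def intro: order_le_less_trans less_trans)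
  have opI: "open I" by (simp add: I_def open_einterval)
  have intI: "is_interval I" by (simp add: I_def is_interval_einterval)
  have posI: "I \<subseteq> {0<..}" unfolding I_def by (rule einterval_pos[OF rinf])
  have rI: "r \<in> I" if "\<bar>r - r0\<bar> < \<delta>" for r using ser[OF that] by (simp add: I_def)
  have r0I: "r0 \<in> I" using rI[of r0] \<delta> by simp
  have r00: "0 < r0" using r0I posI by auto
  have ne: "I \<noteq> {}" using r0I by auto
  have VI: "krs_on {x. (norm x)\<^sup>2 \<in> I} (radial_form f) V lam" using V by (simp add: shell_def I_def)
  obtain \<kappa> B where kB:
    "\<And>r. r \<in> I \<Longrightarrow> ln (deriv f r ^ (CARD('n) - 1) * (deriv f r + r * deriv (deriv f) r)) + lam * f r + 2 * \<kappa> * r * deriv f r = B"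
    "\<And>r. r \<in> I \<Longrightarrow> 0 < deriv f r" "\<And>r. r \<in> I \<Longrightarrow> 0 < deriv f r + r * deriv (deriv f) r"
    "\<And>x :: complex^'n. (norm x)\<^sup>2 \<in> I \<Longrightarrow> \<exists>e :: complex^'n. norm e = 1 \<and> herm e x = 0"
  proof (rule krs_imp_ode[OF n opI intI posI ne sm VI], goal_cases)
    case (1 \<kappa> B)
    show thesis by (rule that[of \<kappa> B]; fact 1)
  qed
  have fd: "(f has_real_derivative deriv f r) (at r)" "(deriv f has_real_derivative deriv (deriv f) r) (at r)" if "r \<in> I" for r
    using F_deriv(1,2)[OF opI sm that] by auto
  have odef: "soliton_ode n lam \<kappa> B f (deriv f) (deriv (deriv f)) r" if "r \<in> I" for r
    using kB(1-3)[OF that] fd[OF that] by (simp add: soliton_ode_def n_def)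
  define D where "D = min \<delta> (r1 - r0)"
  have D: "0 < D" "D \<le> \<delta>" "D \<le> r1 - r0" using \<delta> r0 by (auto simp: D_def)
  define v where "v = r0 + D / 2"
  have v: "r0 < v" "v < r1" using D by (auto simp: v_def)
  have rv: "\<bar>r - r0\<bar> < \<delta>" if "r0 < r" "r < v" for r using that D by (auto simp: v_def)
  obtain h h1 h2 d where d: "d > 0" and smh: "smooth_on {-d<..<r1} h"
    and hf: "\<And>r. r0 < r \<Longrightarrow> r < v \<Longrightarrow> h r = f r"
    and hd: "\<And>r. -d < r \<Longrightarrow> r < r1 \<Longrightarrow> (h has_real_derivative h1 r) (at r) \<and> (h1 has_real_derivative h2 r) (at r)"
    and hpos: "\<And>r. 0 \<le> r \<Longrightarrow> r < r1 \<Longrightarrow> 0 < h1 r \<and> 0 < h1 r + r * h2 r"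
    and hode: "\<And>r. 0 < r \<Longrightarrow> r < r1 \<Longrightarrow> soliton_ode n lam \<kappa> B h h1 h2 r"
  proof -
    have n2: "2 \<le> n" using n by (simp add: n_def)
    have fa: "ps a 0 r = exp (c * f r)" if "r0 < r" "r < v" for r using ser[OF rv[OF that]] by simp
    have fo: "soliton_ode n lam \<kappa> B f (deriv f) (deriv (deriv f)) r" if "r0 < r" "r < v" for r
      by (rule odef[OF rI[OF rv[OF that]]])
    show thesis
      by (rule series_soliton_ode[OF a0 c n2 r00 v, where f=f and ?f1.0="deriv f" and ?f2.0="deriv (deriv f)"
            and lam=lam and \<kappa>=\<kappa> and B=B]) (erule (1) fa, erule (1) fo, rule that)
  qed
  define J where "J = {-d<..<r1}"
  have opJ: "open J" by (simp add: J_def)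
  define m where "m = (r0 + v) / 2"
  have m: "r0 < m" "m < v" using v by (auto simp: m_def)
  have mI: "m \<in> I" by (rule rI[OF rv[OF m]])
  have mem: "x \<in> I" if "s \<in> I" "t \<in> I" "s \<le> x" "x \<le> t" for s t x
    using intI that unfolding is_interval_1 by blast
  \<comment> \<open>By construction \<open>h\<close> equals \<open>f\<close> only between
    \<open>r0\<close> and \<open>v\<close>. Uniqueness for the differential equation, started at
    \<open>m\<close>, carries this over all of \<open>I\<close> below \<open>r1\<close>, in
    particular to the left of \<open>r0\<close>.\<close>
  have hI: "h r = f r" if r: "r \<in> I" "r < r1" for r
  proof -
    have sub: "s \<in> I \<and> 0 < s \<and> s < r1" if "s \<in> {min r m..max r m}" for s
    proof -
      have "min r m \<in> I" "max r m \<in> I" using r mI by (auto simp: min_def max_def)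
      then have "s \<in> I" by (rule mem) (use that in auto)
      moreover have "s < r1" using that r m v by (auto simp: max_def split: if_splits)
      ultimately show ?thesis using posI by auto
    qed
    have "h1 m = deriv f m"
    proof -
      have "deriv f m = h1 m"
        by (rule derivatives_eq_on_open(1)[of "{r0<..<v}" _ h _ h2]) (use hd hf m r00 v d in auto)
      then show ?thesis ..
    qed
    show ?thesis
    proof (rule soliton_ode_unique[where F=h and G=f and r=r and u="min r m" and v="max r m" and ?r0.0=m and n=n and lam=lam and \<kappa>=\<kappa> and B=B
          and ?F1.0=h1 and ?F2.0=h2 and ?G1.0="deriv f" and ?G2.0="deriv (deriv f)"])
      show "soliton_ode n lam \<kappa> B h h1 h2 s" if "s \<in> {min r m..max r m}" for s using hode sub[OF that] by blast
      show "soliton_ode n lam \<kappa> B f (deriv f) (deriv (deriv f)) s" if "s \<in> {min r m..max r m}" for s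
        using odef sub[OF that] by blast
      show "0 < min r m" using r m r00 posI by auto
      show "h m = f m" by (rule hf[OF m])
      show "h1 m = deriv f m" by fact
    qed auto
  qed
  define F where "F r = (if r < r1 then h r else f r)" for r
  have FJ: "F r = h r" if "r \<in> J" for r using that by (simp add: F_def J_def)
  have FI: "F r = f r" if "r \<in> I" for r using hI[OF that] by (simp add: F_def)
  have smF: "smooth_on (J \<union> I) F"
  proof (rule smooth_on_Un[OF opJ opI])
    show "smooth_on J F" using smooth_on_cong[OF opJ FJ] smh by (simp add: J_def)
    show "smooth_on I F" using smooth_on_cong[OF opI FI] sm by simp
  qed
  have dJ: "deriv F r = h1 r" "deriv (deriv F) r = h2 r" if "r \<in> J" for r
    by (rule derivatives_eq_on_open[of J F h h1 h2 r]; use FJ hd that in \<open>simp add: J_def\<close>)+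
  have dI: "deriv F r = deriv f r" "deriv (deriv F) r = deriv (deriv f) r" if "r \<in> I" for r
    by (rule derivatives_eq_on_open[of I F f "deriv f" "deriv (deriv f)" r]; use opI FI fd that in simp)+
  have JI: "einterval (ereal (-d)) rsup \<subseteq> J \<union> I"
  proof
    fix r assume r: "r \<in> einterval (ereal (-d)) rsup"
    show "r \<in> J \<union> I"
    proof (cases "r < r1")
      case True
      then show ?thesis using r by (simp add: J_def einterval_def)
    next
      case False
      then have "rinf < ereal r" using r0I r0 by (auto simp: I_def einterval_def intro: less_trans)
      then show ?thesis using r by (auto simp: I_def einterval_def)
    qed
  qed
  have I0: "einterval 0 rsup \<subseteq> einterval (ereal (-d)) rsup"
    using d order_less_trans[of "ereal (-d)" 0] by (auto simp: einterval_def zero_ereal_def simp del: ereal_less)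
  have odeF: "soliton_ode n lam \<kappa> B F (deriv F) (deriv (deriv F)) r" if r: "r \<in> J \<union> I" "r > 0" for r
  proof -
    have "(F has_real_derivative deriv F r) (at r)" "(deriv F has_real_derivative deriv (deriv F) r) (at r)"
      using F_deriv(1,2)[OF open_Un[OF opJ opI] smF r(1)] by auto
    moreover have "soliton_ode n lam \<kappa> B h h1 h2 r" if "r \<in> J" using hode[of r] that r by (simp add: J_def)
    ultimately show ?thesis
      using r odef[of r] FJ[of r] FI[of r] dJ[of r] dI[of r] by (auto simp: soliton_ode_def)
  qed
  \<comment> \<open>The field \<open>V\<close> is given only over \<open>I\<close>. On the larger
    shell the multiple \<open>\<kappa>\<close> of the Euler field takes its place, since a potential
    only asks for some field.\<close>
  have "krs_potential TYPE('n) lam F 0 rsup"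
    unfolding krs_potential_def
  proof (intro conjI exI)
    show sm0: "smooth_on (einterval 0 rsup) F"
      by (rule smooth_on_subset[OF smF open_Un[OF opJ opI] open_einterval]) (use I0 JI in blast)
    show "krs_on (shell 0 rsup :: (complex^'n) set) (radial_form F) (\<lambda>x. of_real \<kappa> *s x) lam"
    proof (rule krs_on_radial[OF open_einterval sm0])
      show "shell 0 rsup = {x :: complex^'n. (norm x)\<^sup>2 \<in> einterval 0 rsup}" by (simp add: shell_def)
      show sub: "einterval 0 rsup \<subseteq> {0<..}" by (rule einterval_pos) simp
      fix r assume r: "r \<in> einterval 0 rsup"
      then have "soliton_ode n lam \<kappa> B F (deriv F) (deriv (deriv F)) r" using I0 JI sub by (intro odeF) auto
      then show "0 < deriv F r \<and> 0 < deriv F r + r * deriv (deriv F) r"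
        "ln (deriv F r ^ (CARD('n) - 1) * (deriv F r + r * deriv (deriv F) r)) + lam * F r + 2 * \<kappa> * r * deriv F r = B"
        by (simp_all add: soliton_ode_def n_def)
    qed
  qed (use rsup in auto)
  with max rinf FI have "0 = rinf" unfolding maximal_krs_potential_def I_def by blast
  show thesis
  proof (rule that)
    show "rinf = 0" "d > 0" using \<open>0 = rinf\<close> d by simp_all
    show "smooth_on (einterval (ereal (-d)) rsup) F"
      by (rule smooth_on_subset[OF smF open_Un[OF opJ opI] open_einterval JI])
    show "F r = f r" if "r \<in> einterval rinf rsup" for r using FI that by (simp add: I_def)
    show "0 < deriv F r \<and> 0 < deriv F r + r * deriv (deriv F) r"
      if r: "r \<in> einterval (ereal (-d)) rsup" "0 \<le> r" for r
    proof (cases "r \<in> J")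
      case True
      then show ?thesis using hpos[of r] r dJ[of r] by (simp add: J_def)
    next
      case False
      then have "r \<in> I" using JI r by blast
      then show ?thesis using kB(2,3)[of r] dI[of r] by simp
    qed
  qed
qed

text \<open>Multiplied by \<open>y ^ (n - 1)\<close>, the formula for \<open>\<psi>\<close> is continuous up to \<open>y = 0\<close>, and \<open>y\<close> and \<open>\<psi>\<close>
  tend to \<open>0\<close> at the origin.\<close>

lemma soliton_parameter_at_origin:
  assumes n: "n \<ge> 2" and J: "open J" "0 \<in> J" and F: "smooth_on J F"
    and I: "open I" "I \<subseteq> {0<..}" "is_interval I" "I = J \<inter> {0<..}"
    and Ff: "\<And>r. r \<in> I \<Longrightarrow> F r = f r"
    and pos: "\<And>r. r \<in> I \<Longrightarrow> 0 < deriv F r \<and> 0 < deriv F r + r * deriv (deriv F) r"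
    and par: "soliton_parameters n lam f I \<mu> \<nu>"
  shows "\<nu> = fact n * (\<mu> - lam) / \<mu> ^ (n + 1)"
proof -
  have Fd: "(F has_real_derivative deriv F r) (at r)" "(deriv F has_real_derivative deriv (deriv F) r) (at r)"
    "(deriv (deriv F) has_real_derivative deriv (deriv (deriv F)) r) (at r)" if "r \<in> J" for r
    using F_deriv[OF J(1) F that] by auto
  have IJ: "r \<in> J" if "r \<in> I" for r using that I(4) by blast
  have fd: "deriv f r = deriv F r" if "r \<in> I" for r
    by (rule derivatives_eq_on_open(1)[of I f F "deriv F" "deriv (deriv F)" r]) (use I(1) Ff Fd(1,2) IJ that in auto)
  define Y where "Y r = r * deriv F r" for r
  define P where "P r = r * (deriv F r + r * deriv (deriv F) r)" for r
  have dY: "(Y has_real_derivative deriv F r + r * deriv (deriv F) r) (at r)" if "r \<in> J" for r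
    unfolding Y_def[abs_def] by (auto intro!: derivative_eq_intros Fd that)
  have yY: "y_of f r = Y r" if "r \<in> I" for r using fd[OF that] by (simp add: y_of_def Y_def)
  have psiP: "psi_of f r = P r" if r: "r \<in> I" for r
  proof -
    have "deriv (y_of f) r = deriv F r + r * deriv (deriv F) r"
      by (rule DERIV_imp_deriv, rule has_field_derivative_transform_within_open[OF dY[OF IJ[OF r]] I(1) r])
         (simp add: yY)
    then show ?thesis by (simp add: psi_of_def P_def)
  qed
  have mono: "Y r < Y s" if "r \<in> I" "s \<in> I" "r < s" for r s
  proof (rule DERIV_pos_imp_increasing[OF that(3)])
    fix x assume "r \<le> x" "x \<le> s"
    then have "x \<in> I" using I(3) that unfolding is_interval_1 by blast
    then show "\<exists>y. (Y has_real_derivative y) (at x) \<and> 0 < y" using dY[OF IJ] pos by blast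
  qed
  have inj: "inj_on (y_of f) I"
  proof (rule inj_onI)
    fix r s assume rs: "r \<in> I" "s \<in> I" "y_of f r = y_of f s"
    then show "r = s" using mono[of r s] mono[of s r] yY by (cases r s rule: linorder_cases) auto
  qed
  have psi: "psi_of_y f I (Y r) = P r" if "r \<in> I" for r
    using the_inv_into_f_f[OF inj that] by (simp add: psi_of_y_def psiP[OF that] yY[OF that])
  define K where "K = (lam - \<mu>) / \<mu> ^ (n + 1)"
  define G where "G r = P r * Y r ^ (n - 1) - (\<nu> * exp (\<mu> * Y r) + lam / \<mu> * Y r ^ n
      + K * (\<Sum>j<n. fact n / fact j * \<mu> ^ j * Y r ^ j))" for r
  have G0: "G r = 0" if r: "r \<in> I" for r
  proof -
    have y0: "Y r > 0" using pos[OF r] r I(2) by (auto simp: Y_def)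
    have pw: "Y r powi (int j + 1 - int n) * Y r ^ (n - 1) = Y r ^ j" for j
    proof -
      have "Y r powi (int j + 1 - int n) * Y r ^ (n - 1) = Y r powi (int j + 1 - int n) * Y r powi int (n - 1)"
        by simp
      also have "\<dots> = Y r powi (int j + 1 - int n + int (n - 1))" using y0 by (simp add: power_int_add)
      also have "int j + 1 - int n + int (n - 1) = int j" using n by simp
      finally show ?thesis by simp
    qed
    have "Y r \<in> y_of f ` I" using yY[OF r] r by (metis imageI)
    then have "psi_of_y f I (Y r) = \<nu> * exp (\<mu> * Y r) / Y r ^ (n - 1) + lam / \<mu> * Y r
        + K * (\<Sum>j<n. fact n / fact j * \<mu> ^ j * Y r powi (int j + 1 - int n))"
      using par unfolding soliton_parameters_def K_def by blast
    then have "P r = \<nu> * exp (\<mu> * Y r) / Y r ^ (n - 1) + lam / \<mu> * Y r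
        + K * (\<Sum>j<n. fact n / fact j * \<mu> ^ j * Y r powi (int j + 1 - int n))"
      by (simp only: psi[OF r])
    then have "P r * Y r ^ (n - 1) = \<nu> * exp (\<mu> * Y r) + lam / \<mu> * (Y r * Y r ^ (n - 1))
        + K * (\<Sum>j<n. fact n / fact j * \<mu> ^ j * (Y r powi (int j + 1 - int n) * Y r ^ (n - 1)))"
      using y0 by (simp add: distrib_right sum_distrib_right mult.assoc)
    also have "\<dots> = \<nu> * exp (\<mu> * Y r) + lam / \<mu> * (Y r * Y r ^ (n - 1))
        + K * (\<Sum>j<n. fact n / fact j * \<mu> ^ j * Y r ^ j)" by (simp only: pw)
    also have "Y r * Y r ^ (n - 1) = Y r ^ n" using n by (simp flip: power_Suc)
    finally show ?thesis by (simp add: G_def)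
  qed
  have cF: "isCont (deriv F) 0" "isCont (deriv (deriv F)) 0"
    using DERIV_isCont[OF Fd(2)[OF J(2)]] DERIV_isCont[OF Fd(3)[OF J(2)]] by auto
  have "isCont G 0" unfolding G_def[abs_def] P_def Y_def by (intro continuous_intros cF)
  then have lim: "(G \<longlongrightarrow> G 0) (at_right 0)" by (auto simp: isCont_def intro: filterlim_at_split[THEN iffD1, THEN conjunct2])
  have "\<forall>\<^sub>F r in at_right 0. r \<in> J" using eventually_nhds_in_open[OF J] by (auto simp: eventually_at_filter elim: eventually_mono)
  then have "\<forall>\<^sub>F r in at_right 0. G r = 0"
    using eventually_at_right_less[of "0::real"] by eventually_elim (use G0 I(4) in auto)
  then have "(G \<longlongrightarrow> 0) (at_right 0)" by (simp add: tendsto_eventually)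
  then have "G 0 = 0" using tendsto_unique[OF _ lim] by simp
  \<comment> \<open>Only \<open>j = 0\<close> survives, because \<open>0 ^ 0 = 1\<close>; as
    \<open>P 0 = 0\<close> and \<open>Y 0 = 0\<close>, the equation \<open>G 0 = 0\<close> reads
    \<open>\<nu> + K * fact n = 0\<close>.\<close>
  moreover have "(\<Sum>j<n. fact n / fact j * \<mu> ^ j * (0::real) ^ j) = (\<Sum>j<n. if j = 0 then fact n else 0)"
    by (intro sum.cong) auto
  ultimately have "\<nu> = - K * fact n" using n by (simp add: G_def P_def Y_def power_0_left)
  then show ?thesis by (simp add: K_def minus_divide_left)
qed

theorem theorem1p3:
  fixes A :: "('m::{t2_space,second_countable_topology}, 'n::finite) chart set"
    and g :: "('m, 'n) form11"
    and X :: "('m, 'n) vector_field"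
    and lam c :: real
    and f :: "real \<Rightarrow> real"
    and rinf rsup :: ereal
  assumes "CARD('n) \<ge> 2"
    and "complex_manifold A"
    and "connected (UNIV :: 'm set)"
    and "radial_krs A g X lam f rinf rsup"
    and "c > 0"
    and "c_stable_projectively_induced A c g"
  shows "defined_at_origin TYPE('n) f rinf rsup \<and>
    (\<forall>\<mu> \<nu>. soliton_parameters CARD('n) lam f (einterval rinf rsup) \<mu> \<nu> \<longrightarrow>
       \<nu> = fact CARD('n) * (\<mu> - lam) / \<mu> ^ (CARD('n) + 1))"
proof -
  define I where "I = einterval rinf rsup"
  have max: "maximal_krs_potential TYPE('n) lam f rinf rsup" and g: "is_form11 A g"
    using assms(4) by (auto simp: radial_krs_def kaehler_ricci_soliton_def)
  obtain U z where Uz: "(U, z) \<in> A" "U \<noteq> {}" "z ` U \<subseteq> shell rinf rsup"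
    "\<And>x. x \<in> z ` U \<Longrightarrow> g (U, z) x = radial_form f x"
    using assms(4) unfolding radial_krs_def by blast
  then obtain p where p: "p \<in> U" by blast
  have rad: "g (U, z) x = radial_form f x \<and> (norm x)\<^sup>2 \<in> I" if "x \<in> z ` U" for x
    using Uz(3) Uz(4)[OF that] that by (auto simp: shell_def I_def)
  obtain V :: "complex^'n \<Rightarrow> complex^'n" where rinf: "0 \<le> rinf" and sm: "smooth_on I f"
    and V: "krs_on (shell rinf rsup) (radial_form f) V lam"
    using max by (auto simp: maximal_krs_potential_def krs_potential_def I_def)
  have opI: "open I" by (simp add: I_def open_einterval)
  have intI: "is_interval I" by (simp add: I_def is_interval_einterval)
  have posI: "I \<subseteq> {0<..}" unfolding I_def by (rule einterval_pos[OF rinf])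
  have e: "\<exists>e :: complex^'n. norm e = 1 \<and> herm e x = 0" if "x \<in> z ` U" for x
  proof -
    have ne: "I \<noteq> {}" and x: "(norm x)\<^sup>2 \<in> I" using rad[OF that] by auto
    have "krs_on {x. (norm x)\<^sup>2 \<in> I} (radial_form f) V lam" using V by (simp add: shell_def I_def)
    from krs_imp_ode[OF assms(1) opI intI posI ne sm this] show ?thesis using x by metis
  qed
  obtain a r1 \<delta> where a: "nonneg_series a r1" "a 0 > 0" "(norm (z p))\<^sup>2 < r1" "\<delta> > 0"
    "\<And>r. \<bar>r - (norm (z p))\<^sup>2\<bar> < \<delta> \<Longrightarrow> r \<in> einterval rinf rsup \<and> ps a 0 r = exp (c * f r)"
    unfolding I_def[symmetric]
    by (rule stable_radial_power_series[OF assms(2) Uz(1) g _ opI posI sm assms(5,6) p])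
       (erule rad, erule e, blast)
  obtain F d where F: "rinf = 0" "d > 0" "smooth_on (einterval (ereal (-d)) rsup) F"
    "\<And>r. r \<in> einterval rinf rsup \<Longrightarrow> F r = f r"
    "\<And>r. r \<in> einterval (ereal (-d)) rsup \<Longrightarrow> 0 \<le> r \<Longrightarrow> 0 < deriv F r \<and> 0 < deriv F r + r * deriv (deriv F) r"
  proof (rule radial_soliton_extends[OF assms(1) max a(1,2) assms(5) a(3,4,5)], goal_cases)
    case (2 F d)
    show thesis by (rule that[of d F]; fact 2)
  qed
  \<comment> \<open>\<open>J\<close> reaches below \<open>0\<close>, so that \<open>F\<close> has
    two-sided derivatives at the origin and \<open>kaehler_on_radial_form\<close> applies
    there.\<close>
  define J where "J = einterval (ereal (-d)) rsup"
  have J: "r \<in> J \<longleftrightarrow> ereal r < rsup" if "0 \<le> r" for r using that F(2) by (auto simp: J_def einterval_def)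
  have opJ: "open J" by (simp add: J_def open_einterval)
  have "rinf < rsup" using a(4) a(5)[of "(norm (z p))\<^sup>2"] by (auto simp: einterval_def dest: less_trans)
  then have rsup: "0 < rsup" by (simp add: F(1))
  have IJ: "I = J \<inter> {0<..}" using J by (auto simp: I_def F(1) einterval_def)
  have "defined_at_origin TYPE('n) f rinf rsup"
    unfolding defined_at_origin_def
  proof (intro conjI exI)
    show "kaehler_on {x :: complex^'n. ereal ((norm x)\<^sup>2) < rsup} (radial_form F)"
    proof (rule kaehler_on_radial_form[OF opJ])
      show "smooth_on J F" using F(3) by (simp add: J_def)
      show "{x :: complex^'n. ereal ((norm x)\<^sup>2) < rsup} = {x. (norm x)\<^sup>2 \<in> J}" by (simp add: J)
      show "0 < deriv F ((norm x)\<^sup>2) \<and> 0 < deriv F ((norm x)\<^sup>2) + (norm x)\<^sup>2 * deriv (deriv F) ((norm x)\<^sup>2)"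
        if "x \<in> {x :: complex^'n. ereal ((norm x)\<^sup>2) < rsup}" for x
        using that by (intro F(5)) (simp_all add: J flip: J_def)
    qed
  qed (use F in auto)
  moreover have "\<nu> = fact CARD('n) * (\<mu> - lam) / \<mu> ^ (CARD('n) + 1)"
    if "soliton_parameters CARD('n) lam f (einterval rinf rsup) \<mu> \<nu>" for \<mu> \<nu>
  proof (rule soliton_parameter_at_origin[where J=J and I=I and F=F and f=f, OF assms(1) opJ _ _ opI posI intI IJ])
    show "0 \<in> J" using J[of 0] rsup by (simp add: zero_ereal_def)
    show "smooth_on J F" using F(3) by (simp add: J_def)
    show "F r = f r" if "r \<in> I" for r using F(4) that by (simp add: I_def)
    show "0 < deriv F r \<and> 0 < deriv F r + r * deriv (deriv F) r" if "r \<in> I" for r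
      using that IJ by (intro F(5)) (auto simp: J_def)
    show "soliton_parameters CARD('n) lam f I \<mu> \<nu>" using that by (simp add: I_def)
  qed
  ultimately show ?thesis by blast
qed

end
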